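(* Let $\mu_0=e^{-V_0}\mathcal L^n=\varrho_0\mathcal L^n$, $\mu_1=e^{-V_1}\mathcal L^n=\varrho_1\mathcal L^n$ be probability measures on $\mathbb R^n$ with finite second moment, where $V_0,V_1\in C^2(\mathbb R^n)$ and there is $C>0$ such that $C^{-1}|\xi|^2\le \xi\cdot D^2V_i(x)\xi\le C|\xi|^2$ for all $x,\xi\in\mathbb R^n$, $i=0,1$. Then for every $\varepsilon>0$, $$\varepsilon\min_{\gamma\in\Gamma(\mu_0,\mu_1)}H(\gamma\mid\mathsf R_\varepsilon)=\varepsilon H(\mu_0\mid\mathcal L^n)+\min\Big\{\int_0^1\!\!\int\frac{|v_t|^2}{2}\eta_t\,d\mathcal L^n\,dt:\ (\eta_t\mathcal L^n,v_t)\text{ Fokker--Planck pair},\ \eta_0=\varrho_0,\ \eta_1=\varrho_1\Big\}.$$ Moreover, the minimizer on the right-hand side is unique and is given by $(\mu^\varepsilon_t,\nabla\psi^\varepsilon_t)$.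
   Context: $\mathsf r_s(x,y)=(2\pi s)^{-n/2}e^{-|x-y|^2/(2s)}$, $\mathsf R_\varepsilon=\mathsf r_\varepsilon\mathcal L^n\otimes\mathcal L^n$; $H(Q\mid P)=\int\log\frac{dQ}{dP}dQ$ if $Q\ll P$, $+\infty$ otherwise; $\Gamma(\mu_0,\mu_1)$ is the set of couplings of $\mu_0,\mu_1$. The Schrödinger problem has a unique minimizer $\gamma^\varepsilon=(f^\varepsilon\otimes g^\varepsilon)\mathsf R_\varepsilon$ with Borel $f^\varepsilon,g^\varepsilon\ge0$ solving $f^\varepsilon(x)\int g^\varepsilon(y)\mathsf r_\varepsilon(x,y)dy=\varrho_0(x)$ and $g^\varepsilon(y)\int f^\varepsilon(x)\mathsf r_\varepsilon(x,y)dx=\varrho_1(y)$ a.e. Define $f^\varepsilon_0=f^\varepsilon$, $f^\varepsilon_t(x)=\int f^\varepsilon(y)\mathsf r_{\varepsilon t}(x,y)dy$ for $t\in]0,1]$; $g^\varepsilon_1=g^\varepsilon$, $g^\varepsilon_t(x)=\int g^\varepsilon(y)\mathsf r_{\varepsilon(1-t)}(x,y)dy$ for $t\in[0,1[$; $\varrho^\varepsilon_t=f^\varepsilon_tg^\varepsilon_t$, $\mu^\varepsilon_t=\varrho^\varepsilon_t\mathcal L^n$, $\psi^\varepsilon_t=\varepsilon\log g^\varepsilon_t$ (with $\psi^\varepsilon_1=\varepsilon\log g^\varepsilon$). Fokker--Planck pair: given a Borel map $v:[0,1]\times\mathbb R^n\to\mathbb R^n$, a curve $\nu\in C([0,1];\mathcal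 P(\mathbb R^n))$ solves $\partial_t\nu-\frac{\varepsilon}{2}\Delta\nu+\mathrm{div}(v\nu)=0$ distributionally if $|v_t|\in L^1(\nu_t)$ for every $t$, $t\mapsto\|v_t\|_{L^1(\nu_t)}$ is in $L^1(0,1)$, and for every $f\in C^1([0,1])\cap C^\infty_c(\mathbb R^n)$ (i.e. $C^1$ in time, smooth compactly supported in space), $\int_0^1\int(\partial_tf_t+\frac{\varepsilon}{2}\Delta f_t+v_t\cdot\nabla f_t)\,d\nu_t\,dt=\int f_1d\nu_1-\int f_0d\nu_0$; then $(\nu_t,v_t)$ is called a Fokker--Planck pair. *)

theory Defs
  imports "HOL-Probability.Probability"
begin

definition heat_kernel :: "real \<Rightarrow> real^'n \<Rightarrow> real^'n \<Rightarrow> real" where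
  "heat_kernel s x y =
     (2 * pi * s) powr (- real CARD('n) / 2) * exp (- (norm (x - y))\<^sup>2 / (2 * s))"

definition ref_meas :: "real \<Rightarrow> ((real^'n) \<times> (real^'n)) measure" where
  "ref_meas eps = density lborel (\<lambda>(x, y). ennreal (heat_kernel eps x y))"

definition rel_entropy :: "'a measure \<Rightarrow> 'a measure \<Rightarrow> ereal" where
  "rel_entropy Q P =
     (if sets Q = sets P \<and> absolutely_continuous P Q then
        enn2ereal (\<integral>\<^sup>+ x. ennreal (max 0 (ln (enn2real (RN_deriv P Q x)))) \<partial>Q)
        - enn2ereal (\<integral>\<^sup>+ x. ennreal (max 0 (- ln (enn2real (RN_deriv P Q x)))) \<partial>Q)
      else \<infinity>)"

definition couplings :: "'a::topological_space measure \<Rightarrow> 'b::topological_space measure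
    \<Rightarrow> ('a \<times> 'b) measure set" where
  "couplings \<mu>0 \<mu>1 = {\<gamma>. prob_space \<gamma> \<and> sets \<gamma> = sets borel \<and>
      distr \<gamma> borel fst = \<mu>0 \<and> distr \<gamma> borel snd = \<mu>1}"

definition grad :: "(real^'n \<Rightarrow> real) \<Rightarrow> real^'n \<Rightarrow> real^'n" where
  "grad h x = (\<chi> i. frechet_derivative h (at x) (axis i 1))"

definition partial_deriv :: "'n \<Rightarrow> (real^'n \<Rightarrow> real) \<Rightarrow> real^'n \<Rightarrow> real" where
  "partial_deriv i h x = frechet_derivative h (at x) (axis i 1)"

definition laplacian :: "(real^'n::finite \<Rightarrow> real) \<Rightarrow> real^'n \<Rightarrow> real" where
  "laplacian h x = (\<Sum>i\<in>UNIV. partial_deriv i (partial_deriv i h) x)"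

coinductive smooth_fun :: "(real^'n::finite \<Rightarrow> real) \<Rightarrow> bool" where
  "continuous_on UNIV h \<Longrightarrow> (\<forall>x. h differentiable (at x)) \<Longrightarrow>
   (\<forall>i. smooth_fun (partial_deriv i h)) \<Longrightarrow> smooth_fun h"

definition C2_hessian :: "(real^'n::finite \<Rightarrow> real) \<Rightarrow> (real^'n \<Rightarrow> real^'n^'n) \<Rightarrow> bool" where
  "C2_hessian V H \<longleftrightarrow> (\<exists>DV. (\<forall>x. (V has_derivative (\<lambda>h. DV x \<bullet> h)) (at x)) \<and>
      (\<forall>x. (DV has_derivative (\<lambda>h. H x *v h)) (at x)) \<and> continuous_on UNIV H)"

definition test_fun :: "(real \<Rightarrow> real^'n::finite \<Rightarrow> real) \<Rightarrow> (real \<Rightarrow> real^'n \<Rightarrow> real) \<Rightarrow> bool" where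
  "test_fun \<phi> \<phi>t \<longleftrightarrow>
     (\<exists>K. compact K \<and> (\<forall>t\<in>{0..1}. \<forall>x. x \<notin> K \<longrightarrow> \<phi> t x = 0)) \<and>
     (\<forall>t\<in>{0..1}. smooth_fun (\<phi> t)) \<and>
     (\<forall>t\<in>{0..1}. \<forall>x. ((\<lambda>s. \<phi> s x) has_real_derivative \<phi>t t x) (at t within {0..1})) \<and>
     continuous_on ({0..1} \<times> UNIV) (\<lambda>(t, x). \<phi> t x) \<and>
     continuous_on ({0..1} \<times> UNIV) (\<lambda>(t, x). \<phi>t t x) \<and>
     continuous_on ({0..1} \<times> UNIV) (\<lambda>(t, x). grad (\<phi> t) x) \<and>
     continuous_on ({0..1} \<times> UNIV) (\<lambda>(t, x). laplacian (\<phi> t) x)"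

definition prob_curve :: "(real \<Rightarrow> 'a::topological_space measure) \<Rightarrow> bool" where
  "prob_curve \<nu> \<longleftrightarrow>
     (\<forall>t\<in>{0..1}. prob_space (\<nu> t) \<and> sets (\<nu> t) = sets borel) \<and>
     (\<forall>h::'a \<Rightarrow> real. continuous_on UNIV h \<and> bounded (range h) \<longrightarrow>
        continuous_on {0..1} (\<lambda>t. \<integral>x. h x \<partial>\<nu> t))"

definition fp_pair :: "real \<Rightarrow> (real \<Rightarrow> (real^'n::finite) measure) \<Rightarrow> (real \<Rightarrow> real^'n \<Rightarrow> real^'n) \<Rightarrow> bool" where
  "fp_pair eps \<nu> v \<longleftrightarrow>
     prob_curve \<nu> \<and>
     (\<lambda>(t, x). v t x) \<in> borel_measurable borel \<and>
     (\<forall>t\<in>{0..1}. integrable (\<nu> t) (\<lambda>x. norm (v t x))) \<and>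
     set_integrable lborel {0..1} (\<lambda>t. \<integral>x. norm (v t x) \<partial>\<nu> t) \<and>
     (\<forall>\<phi> \<phi>t. test_fun \<phi> \<phi>t \<longrightarrow>
        (LINT t:{0..1}|lborel. (\<integral>x. \<phi>t t x + eps / 2 * laplacian (\<phi> t) x + v t x \<bullet> grad (\<phi> t) x \<partial>\<nu> t))
        = (\<integral>x. \<phi> 1 x \<partial>\<nu> 1) - (\<integral>x. \<phi> 0 x \<partial>\<nu> 0))"

definition fp_admissible :: "real \<Rightarrow> (real^'n::finite \<Rightarrow> real) \<Rightarrow> (real^'n \<Rightarrow> real)
    \<Rightarrow> ((real \<Rightarrow> real^'n \<Rightarrow> real) \<times> (real \<Rightarrow> real^'n \<Rightarrow> real^'n)) set" where
  "fp_admissible eps \<rho>0 \<rho>1 = {(\<eta>, v).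
     (\<forall>t\<in>{0..1}. \<eta> t \<in> borel_measurable borel \<and> (\<forall>x. 0 \<le> \<eta> t x)) \<and>
     fp_pair eps (\<lambda>t. density lborel (\<lambda>x. ennreal (\<eta> t x))) v \<and>
     density lborel (\<lambda>x. ennreal (\<eta> 0 x)) = density lborel (\<lambda>x. ennreal (\<rho>0 x)) \<and>
     density lborel (\<lambda>x. ennreal (\<eta> 1 x)) = density lborel (\<lambda>x. ennreal (\<rho>1 x))}"

definition kin_cost :: "((real \<Rightarrow> real^'n::finite \<Rightarrow> real) \<times> (real \<Rightarrow> real^'n \<Rightarrow> real^'n)) \<Rightarrow> ennreal" where
  "kin_cost p = (\<integral>\<^sup>+ t\<in>{0..1}. (\<integral>\<^sup>+ x. ennreal ((norm (snd p t x))\<^sup>2 / 2 * fst p t x) \<partial>lborel) \<partial>lborel)"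

definition fpot :: "real \<Rightarrow> (real^'n::finite \<Rightarrow> real) \<Rightarrow> real \<Rightarrow> real^'n \<Rightarrow> real" where
  "fpot eps f t x = (if t = 0 then f x
      else enn2real (\<integral>\<^sup>+ y. ennreal (f y * heat_kernel (eps * t) x y) \<partial>lborel))"

definition gpot :: "real \<Rightarrow> (real^'n::finite \<Rightarrow> real) \<Rightarrow> real \<Rightarrow> real^'n \<Rightarrow> real" where
  "gpot eps g t x = (if t = 1 then g x
      else enn2real (\<integral>\<^sup>+ y. ennreal (g y * heat_kernel (eps * (1 - t)) x y) \<partial>lborel))"

definition ent_density :: "real \<Rightarrow> (real^'n::finite \<Rightarrow> real) \<Rightarrow> (real^'n \<Rightarrow> real) \<Rightarrow> real \<Rightarrow> real^'n \<Rightarrow> real" where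
  "ent_density eps f g t x = fpot eps f t x * gpot eps g t x"

definition ent_psi :: "real \<Rightarrow> (real^'n::finite \<Rightarrow> real) \<Rightarrow> real \<Rightarrow> real^'n \<Rightarrow> real" where
  "ent_psi eps g t x = eps * ln (gpot eps g t x)"

end

(* The potentials have regular representatives: continuous, positive, with |log| growing quadratically and
   a Gaussian upper bound exp(kappa |x|^2 / 2), kappa * eps < 1, by strong convexity of V0 and V1.
   Upper bound: along the entropic interpolation the entropy t |-> integral of psi_t d mu_t increases at least at the
   rate of the kinetic energy, by a Gaussian Gibbs inequality over each small time step.
   Lower bound: for any Fokker-Planck pair, testing with eps * log (P_{eps (b - t)} h), which solves the
   Hamilton-Jacobi-Bellman equation, bounds the kinetic cost from below; truncations h of g give the sharp value.
   Uniqueness: tilting g_T by exp(lambda chi) at an intermediate time T and differentiating at lambda = 0 fixes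
   the marginals; the parallelogram identity fixes the velocity. *)
theory Submission
  imports Defs "HOL-Computational_Algebra.Polynomial"
begin

text \<open>Competitors are tested only with compactly supported functions, while \<open>g\<close>
  is unbounded and known only up to null sets. Hence continuous representatives, cutoffs
  \<open>bump R\<close>, and truncations between two positive constants, whose heat flows have
  bounded logarithms. The entropy is never differentiated: Gibbs' inequality yields one inequality
  for difference quotients, and the dual bound turns it into an equality. The rate
  \<open>kap\<close> arises on dividing \<open>exp (- V)\<close> by a heat integral bounded below by
  a multiple of \<open>exp (- (norm x + 1)^2 / (2 * eps))\<close>. This leaves the rate
  \<open>1 / eps - 1 / C\<close> plus linear terms; half of the convexity gain absorbs those, so
  \<open>1 / eps - 1 / (2 * C)\<close> remains. A formal obstacle shapes the second half: the
  velocity of a Fokker--Planck pair must be Borel on all of space-time. Before time 0 the heat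
  integral may diverge, after time 1 the kernel has negative variance and grows; there
  \<open>enn2real\<close> and \<open>ln\<close> return 0, and gradients at nondifferentiable points
  are one unspecified vector. At time 1 the given Borel version of \<open>g\<close> itself is
  differentiated.\<close>

abbreviation (input) "hk \<equiv> heat_kernel"
abbreviation (input) "pd \<equiv> partial_deriv"
abbreviation (input) seq_limit (infix "---->" 60) where "seq_limit X L \<equiv> X \<longlonglongrightarrow> L"
abbreviation (input) "contU \<equiv> continuous_on UNIV"
abbreviation (input) "strip_cont a b \<equiv> continuous_on ({a..b} \<times> UNIV)"
abbreviation (input) "borel_fun f \<equiv> f \<in> borel_measurable borel"

lemmas borel_contI = borel_measurable_continuous_onI
  and integrable_boundI = Bochner_Integration.integrable_bound
  and LINT_cong = Bochner_Integration.integral_cong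

section \<open>Smooth functions\<close>

text \<open>A counted order of differentiability replaces the coinductive \<open>smooth_fun\<close>:
  derivatives of products and compositions are sums of products, which ordinary induction on the
  order handles with the function generalised.\<close>

primrec smooth_k :: "nat => (real^'n::finite => real) => bool" where
 "smooth_k 0 h = contU h"
| "smooth_k (Suc k) h = (contU h & (\<forall>x. h differentiable (at x)) & (\<forall>i. smooth_k k (pd i h)))"

lemma partial_deriv_eqI:
 assumes "(h has_derivative D) (at x)"
 shows "pd i h x = D (axis i 1)"
 using frechet_derivative_at[OF assms] by (simp add: partial_deriv_def)

lemma smooth_k_continuous: "smooth_k k h ==> contU h"
 by (cases k) auto

lemma smooth_k_SucD: "smooth_k (Suc k) h ==> smooth_k k h"
 by (induction k arbitrary: h) auto

lemma smooth_fun_iff_smooth_k: "smooth_fun h \<longleftrightarrow> (\<forall>k. smooth_k k h)"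
proof
 assume "smooth_fun h"
 then have "smooth_k k h" for k
 proof (induction k arbitrary: h)
  case 0 then show ?case by (auto elim: smooth_fun.cases)
 next
  case (Suc k)
  from Suc.prems show ?case by (rule smooth_fun.cases) (auto intro: Suc.IH)
 qed
 then show "\<forall>k. smooth_k k h" by auto
next
 assume "\<forall>k. smooth_k k h"
 then show "smooth_fun h"
 proof (coinduction arbitrary: h rule: smooth_fun.coinduct)
  case (smooth_fun h)
  have "smooth_k (Suc k) h" for k using smooth_fun by blast
  then show ?case by auto
 qed
qed

lemma partial_deriv_const: "pd i (%x. c) = (%x. 0)"
 by (rule ext) (simp add: partial_deriv_eqI[OF has_derivative_const])

lemma smooth_k_const: "smooth_k k (%x. c)"
 by (induction k arbitrary: c) (auto simp: partial_deriv_const)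

lemma partial_deriv_nth: "pd i (%x::real^'n::finite. x $ j) = (%x. if i = j then 1 else 0)"
proof (rule ext)
 fix x :: "real^'n"
 have "((%x::real^'n. x $ j) has_derivative (%x. x $ j)) (at x)"
  by (intro bounded_linear.has_derivative[OF bounded_linear_vec_nth] has_derivative_ident)
 from partial_deriv_eqI[OF this, of i]
 show "pd i (%x::real^'n. x $ j) x = (if i = j then 1 else 0)" by (simp add: axis_def)
qed

lemma smooth_k_nth: "smooth_k k (%x::real^'n::finite. x $ j)"
proof (cases k)
 case 0 then show ?thesis by (simp add: continuous_on_component)
next
 case (Suc l)
 have "(%x::real^'n. x $ j) differentiable (at x)" for x
  by (intro bounded_linear_imp_differentiable bounded_linear_vec_nth)
 then show ?thesis using Suc
  by (auto simp: partial_deriv_nth smooth_k_const continuous_on_component)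
qed

lemma partial_deriv_add:
 assumes "h differentiable (at x)" "g differentiable (at x)"
 shows "pd i (%x. h x + g x) x = pd i h x + pd i g x"
 using partial_deriv_eqI[OF has_derivative_add[OF assms[unfolded frechet_derivative_works]]]
 by (simp add: partial_deriv_def)

lemma partial_deriv_mult:
 assumes "h differentiable (at x)" "g differentiable (at x)"
 shows "pd i (%x. h x * g x) x = h x * pd i g x + g x * pd i h x"
 using partial_deriv_eqI[OF has_derivative_mult[OF assms[unfolded frechet_derivative_works]]]
 by (simp add: partial_deriv_def mult.commute)

lemma partial_deriv_comp:
 assumes "h differentiable (at x)" "(\<tau> has_real_derivative \<tau>') (at (h x))"
 shows "pd i (%x. \<tau> (h x)) x = \<tau>' * pd i h x"
proof -
 have "((%x. \<tau> (h x)) has_derivative (%d. \<tau>' * frechet_derivative h (at x) d)) (at x)"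
  using assms has_derivative_compose[of h "frechet_derivative h (at x)" x UNIV \<tau> "(*) \<tau>'"]
  by (auto simp: has_field_derivative_def frechet_derivative_works[symmetric])
 from partial_deriv_eqI[OF this] show ?thesis by (simp add: partial_deriv_def)
qed

lemma smooth_k_add: "smooth_k k h ==> smooth_k k g ==> smooth_k k (%x. h x + g x)"
proof (induction k arbitrary: h g)
 case 0 then show ?case by (auto intro: continuous_on_add continuous_on_mult)
next
 case (Suc k)
 have "pd i (%x. h x + g x) = (%x. pd i h x + pd i g x)" for i
  using Suc.prems by (auto intro!: partial_deriv_add)
 then show ?case using Suc by (auto intro: continuous_on_add differentiable_add)
qed

lemma smooth_k_mult: "smooth_k k h ==> smooth_k k g ==> smooth_k k (%x. h x * g x)"
proof (induction k arbitrary: h g)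
 case 0 then show ?case by (auto intro: continuous_on_add continuous_on_mult)
next
 case (Suc k)
 have "pd i (%x. h x * g x) = (%x. h x * pd i g x + g x * pd i h x)" for i
  using Suc.prems by (auto intro!: partial_deriv_mult)
 moreover have "smooth_k k (%x. h x * pd i g x + g x * pd i h x)" for i
  using Suc.prems smooth_k_SucD[of k h] smooth_k_SucD[of k g] by (intro smooth_k_add Suc.IH) auto
 ultimately show ?case using Suc.prems by (auto intro: continuous_on_mult differentiable_mult)
qed

lemma smooth_k_cmult: "smooth_k k h ==> smooth_k k (%x. c * h x)"
 by (intro smooth_k_mult smooth_k_const)

lemma smooth_k_diff: "smooth_k k h ==> smooth_k k g ==> smooth_k k (%x. h x - g x)"
 using smooth_k_add[OF _ smooth_k_cmult[of k g "-1"], of h] by simp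

lemma smooth_k_sum: "finite I ==> (!!j. j \<in> I ==> smooth_k k (h j)) ==> smooth_k k (%x. \<Sum>j\<in>I. h j x)"
 by (induction I rule: finite_induct) (auto intro: smooth_k_const smooth_k_add)

text \<open>The outer function comes with its whole tower of derivatives \<open>D m\<close>. Keeping
  \<open>m\<close> general lets the chain rule, which raises \<open>m\<close> by one and multiplies
  by a partial derivative, feed the induction on the order.\<close>

lemma smooth_k_comp:
 assumes D: "!!m z. z \<in> S ==> (D m has_real_derivative D (Suc m) z) (at z)"
  and S: "!!x. h x \<in> S"
 shows "smooth_k k h ==> smooth_k k (%x. D m (h x))"
proof (induction k arbitrary: m)
 case 0
 have "isCont (D m) (h x)" for x using D[OF S] by (rule DERIV_isCont)
 with 0 show ?case
  by (auto simp: continuous_on_eq_continuous_at intro: isCont_o2)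
next
 case (Suc k)
 have diff: "h differentiable (at x)" for x using Suc.prems by simp
 have "pd i (%x. D m (h x)) = (%x. D (Suc m) (h x) * pd i h x)" for i
  by (intro ext partial_deriv_comp diff D S)
 moreover have "(%x. D m (h x)) differentiable (at x)" for x
  using differentiable_chain_at[OF diff, of "D m" x] D[OF S, of m x]
  by (auto simp: o_def real_differentiable_def)
 then have "(%x. D m (h x)) differentiable (at x)" for x by simp
 moreover from this have "contU (%x. D m (h x))"
  by (auto intro: differentiable_imp_continuous_on simp: differentiable_on_def)
 moreover have "smooth_k k (%x. D (Suc m) (h x) * pd i h x)" for i
  by (rule smooth_k_mult[OF Suc.IH[OF smooth_k_SucD[OF Suc.prems]]]) (use Suc.prems in simp)
 ultimately show ?case by simp
qed

lemma smooth_k_ln: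
 assumes "smooth_k k h" "!!x. 0 < h x"
 shows "smooth_k k (%x. ln (h x))"
proof -
 define D :: "nat => real => real"
  where "D = (%m z. case m of 0 => ln z | Suc j => (-1)^j * fact j * inverse z ^ Suc j)"
 have "(D m has_real_derivative D (Suc m) z) (at z)" if "z \<in> {0<..}" for m z
 proof (cases m)
  case 0 with that show ?thesis
   unfolding D_def by (auto intro!: derivative_eq_intros simp: inverse_eq_divide)
 next
  case (Suc j)
  have "((%z. (-1)^j * fact j * inverse z ^ Suc j) has_real_derivative
    (-1)^j * fact j * ((1 + real j) * (- (inverse z ^ Suc (Suc 0)) * inverse z ^ j))) (at z)"
   using that by (intro DERIV_cmult DERIV_power_Suc DERIV_inverse) auto
  then show ?thesis unfolding D_def Suc by (simp add: algebra_simps)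
 qed
 from smooth_k_comp[where S="{0<..}" and D=D and h=h and k=k and m=0, OF this] assms show ?thesis by (simp add: D_def)
qed

lemma partial_deriv_scale:
 assumes "!!x. h differentiable (at x)"
 shows "pd i (%x. h (c *\<^sub>R x)) x = c * pd i h (c *\<^sub>R x)"
proof -
 have "((%x. h (c *\<^sub>R x)) has_derivative (%d. frechet_derivative h (at (c *\<^sub>R x)) (c *\<^sub>R d))) (at x)"
 proof -
  have 1: "((%x. c *\<^sub>R x) has_derivative (%d. c *\<^sub>R d)) (at x)" by (auto intro!: derivative_eq_intros)
  have 2: "(h has_derivative frechet_derivative h (at (c *\<^sub>R x))) (at (c *\<^sub>R x))"
   using assms by (simp add: frechet_derivative_works[symmetric])
  from has_derivative_compose[OF 1 2] show ?thesis .
 qed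
 from partial_deriv_eqI[OF this, of i]
 have "pd i (%x. h (c *\<^sub>R x)) x = frechet_derivative h (at (c *\<^sub>R x)) (c *\<^sub>R axis i 1)" .
 also have "... = c * pd i h (c *\<^sub>R x)"
  using linear_frechet_derivative[OF assms, of "c *\<^sub>R x"]
  by (simp add: partial_deriv_def linear_cmul)
 finally show ?thesis .
qed

lemma smooth_k_scale: "smooth_k k h ==> smooth_k k (%x. h (c *\<^sub>R x))"
proof (induction k arbitrary: h)
 case 0 then show ?case
  by (auto intro!: continuous_on_compose2[of UNIV h UNIV "%x. c *\<^sub>R x"] continuous_intros)
next
 case (Suc k)
 have "pd i (%x. h (c *\<^sub>R x)) = (%x. c * pd i h (c *\<^sub>R x))" for i
  using Suc.prems by (auto intro!: partial_deriv_scale)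
 moreover have "(%x. h (c *\<^sub>R x)) differentiable (at x)" for x
  using Suc.prems differentiable_chain_at[of "%x. c *\<^sub>R x" x h] by (auto simp: o_def)
 moreover have "contU (%x. h (c *\<^sub>R x))" using smooth_k_continuous[OF Suc.prems]
  by (auto intro!: continuous_on_compose2[of UNIV h UNIV "%x. c *\<^sub>R x"] continuous_intros)
 ultimately show ?case using Suc by (auto intro!: smooth_k_cmult)
qed

lemma grad_nth: "grad h x $ i = pd i h x"
 by (simp add: grad_def partial_deriv_def)

lemma grad_eqI:
 assumes "(h has_derivative (%d. G \<bullet> d)) (at x)"
 shows "grad h x = G"
 by (simp add: vec_eq_iff grad_nth partial_deriv_eqI[OF assms] inner_axis)

lemma has_derivative_grad:
 assumes "h differentiable (at x)"
 shows "(h has_derivative (%d. grad h x \<bullet> d)) (at x)"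
proof -
 have lin: "linear (frechet_derivative h (at x))" by (rule linear_frechet_derivative[OF assms])
 have "frechet_derivative h (at x) d = grad h x \<bullet> d" for d
 proof -
  have "frechet_derivative h (at x) d = frechet_derivative h (at x) (\<Sum>i\<in>UNIV. d $ i *\<^sub>R axis i 1)"
   by (simp add: basis_expansion flip: scalar_mult_eq_scaleR)
  also have "... = (\<Sum>i\<in>UNIV. d $ i * pd i h x)"
   by (simp add: linear_sum[OF lin] linear_cmul[OF lin] partial_deriv_def)
  also have "... = grad h x \<bullet> d" by (simp add: inner_vec_def grad_nth mult.commute)
  finally show ?thesis .
 qed
 then have "frechet_derivative h (at x) = (%d. grad h x \<bullet> d)" by auto
 with assms show ?thesis by (metis frechet_derivative_works)
qed

lemma grad_mult:
 assumes "h differentiable (at x)" "g differentiable (at x)"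
 shows "grad (%x. h x * g x) x = h x *\<^sub>R grad g x + g x *\<^sub>R grad h x"
 by (simp add: vec_eq_iff grad_nth partial_deriv_mult[OF assms])

lemma grad_comp:
 assumes "h differentiable (at x)" "(\<tau> has_real_derivative \<tau>') (at (h x))"
 shows "grad (%x. \<tau> (h x)) x = \<tau>' *\<^sub>R grad h x"
 by (simp add: vec_eq_iff grad_nth partial_deriv_comp[OF assms])

lemma laplacian_mult:
 assumes "smooth_k 2 h" "smooth_k 2 g"
 shows "laplacian (%x. h x * g x) x = h x * laplacian g x + 2 * (grad h x \<bullet> grad g x) + g x * laplacian h x"
proof -
 have h: "h differentiable (at x)" "(%x. pd i h x) differentiable (at x)"
  and g: "g differentiable (at x)" "(%x. pd i g x) differentiable (at x)" for i x
  using assms by (auto simp: numeral_2_eq_2)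
 have "pd i (pd i (%x. h x * g x)) x
   = h x * pd i (pd i g) x + 2 * (pd i h x * pd i g x)
    + g x * pd i (pd i h) x" for i
 proof -
  have "pd i (%x. h x * g x) = (%x. h x * pd i g x + g x * pd i h x)"
   by (intro ext partial_deriv_mult h g)
  then show ?thesis
   by (simp add: partial_deriv_add partial_deriv_mult h g)
 qed
 then show ?thesis
  by (simp add: laplacian_def sum.distrib sum_distrib_left inner_vec_def grad_nth)
qed

lemma laplacian_ln:
 assumes "smooth_k 2 h" "!!x. 0 < h x"
 shows "laplacian (%x. ln (h x)) x = laplacian h x / h x - (norm (grad h x))\<^sup>2 / (h x)\<^sup>2"
proof -
 have h: "h differentiable (at x)" "(%x. pd i h x) differentiable (at x)" for i x
  using assms by (auto simp: numeral_2_eq_2)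
 have inv: "(%x. inverse (h x)) differentiable (at x)" for x
  using h assms(2)[of x] by (auto intro!: derivative_intros)
 have "pd i (pd i (%x. ln (h x))) x
   = pd i (pd i h) x / h x - (pd i h x)\<^sup>2 / (h x)\<^sup>2" for i
 proof -
  have "pd i (%x. ln (h x)) = (%x. inverse (h x) * pd i h x)"
   using assms(2) by (intro ext partial_deriv_comp h) (auto intro!: derivative_eq_intros simp: inverse_eq_divide)
  moreover have "pd i (%x. inverse (h x)) x = - (inverse (h x))\<^sup>2 * pd i h x"
   using assms(2)[of x] by (intro partial_deriv_comp h) (auto intro!: derivative_eq_intros simp: power2_eq_square)
  moreover have "pd i (%x. inverse (h x) * pd i h x) x
    = inverse (h x) * pd i (pd i h) x + pd i h x * pd i (%x. inverse (h x)) x"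
   by (rule partial_deriv_mult[OF inv h(2)])
  ultimately show ?thesis
   using assms(2)[of x] by (simp only:) (simp add: power2_eq_square field_simps)
 qed
 moreover have "(norm (grad h x))^2 = (\<Sum>i\<in>UNIV. (pd i h x)\<^sup>2)"
  by (subst power2_norm_eq_inner) (simp add: inner_vec_def grad_nth power2_eq_square)
 ultimately show ?thesis
  by (simp add: laplacian_def sum_subtractf sum_divide_distrib[symmetric])
qed

lemma laplacian_cmult:
 assumes "smooth_k 2 h"
 shows "laplacian (%x. c * h x) x = c * laplacian h x"
 using laplacian_mult[OF smooth_k_const assms, of c x]
 by (simp add: laplacian_def partial_deriv_const grad_nth inner_vec_def)

lemma grad_cmult: "h differentiable (at x) ==> grad (%x. c * h x) x = c *\<^sub>R grad h x"
 using grad_mult[of "%_. c" x h] by (simp add: vec_eq_iff grad_nth partial_deriv_const)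

lemma smooth_k_differentiable: "smooth_k (Suc k) h ==> h differentiable (at x)"
 by simp

lemma continuous_on_grad: "smooth_k (Suc 0) h ==> contU (grad h)"
 unfolding grad_def[abs_def] by (subst continuous_on_vec_lambda) (auto simp: partial_deriv_def[abs_def])

lemma continuous_on_laplacian: "smooth_k 2 h ==> contU (laplacian h)"
 unfolding laplacian_def[abs_def] by (intro continuous_intros) (auto simp: numeral_2_eq_2)

subsection \<open>Cutoff functions\<close>

text \<open>The \<open>m\<close>-th derivative of exp(-1/z) is p(1/z) exp(-1/z) for a polynomial p.
  One more differentiation multiplies by 1/z^2 and replaces p by p - p', which is this
  recursion.\<close>

primrec flat_poly :: "nat => real poly" where
 "flat_poly 0 = 1"
| "flat_poly (Suc m) = [:0, 0, 1:] * (flat_poly m - pderiv (flat_poly m))"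

definition flat :: "nat => real => real" where
 "flat m z = (if 0 < z then poly (flat_poly m) (1 / z) * exp (- (1 / z)) else 0)"

lemma poly_times_exp_minus_tendsto_0: "((%z. poly p (1 / z) * exp (- (1 / z))) \<longlongrightarrow> 0) (at_right (0::real))"
proof -
 have "((%w. poly p w * exp (- w)) \<longlongrightarrow> 0) at_top"
 proof -
  have "((%w. \<Sum>i\<le>degree p. coeff p i * (w ^ i / exp w)) \<longlongrightarrow> (\<Sum>i\<le>degree p. coeff p i * (0::real))) at_top"
   by (intro tendsto_intros tendsto_power_div_exp_0)
  then show ?thesis
   by (simp add: poly_altdef sum_distrib_right exp_minus divide_inverse mult.assoc)
 qed
 from filterlim_compose[OF this filterlim_inverse_at_top_right]
 show ?thesis by (simp add: divide_inverse)
qed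

lemma flat_DERIV: "(flat m has_real_derivative flat (Suc m) z) (at z)"
proof -
 consider "z < 0" | "z = 0" | "z > 0" by linarith
 then show ?thesis
 proof cases
  case 1
  have "((%_. 0) has_real_derivative flat (Suc m) z) (at z)" using 1 by (simp add: flat_def)
  then show ?thesis
   by (rule has_field_derivative_transform_within_open[where S="{..<0}"]) (use 1 in \<open>auto simp: flat_def\<close>)
 next
  case 3
  have "((%z. poly (flat_poly m) (1 / z) * exp (- (1 / z))) has_real_derivative flat (Suc m) z) (at z)"
   using 3 unfolding flat_def
   by (auto intro!: derivative_eq_intros DERIV_chain2[OF poly_DERIV] simp: field_simps power2_eq_square)
  then show ?thesis
   by (rule has_field_derivative_transform_within_open[where S="{0<..}"]) (use 3 in \<open>auto simp: flat_def\<close>)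
 next
  case 2
  \<comment> \<open>Dividing by the increment multiplies the polynomial in its reciprocal by X, so
    the right difference quotient at 0 has the form already known to vanish.\<close>
  have "((%z. poly ([:0,1:] * flat_poly m) (1 / z) * exp (- (1 / z))) \<longlongrightarrow> 0) (at_right (0::real))"
   by (rule poly_times_exp_minus_tendsto_0)
  then have "((%h. flat m h / h) \<longlongrightarrow> 0) (at_right 0)"
   by (rule Lim_transform_eventually)
    (auto simp: eventually_at_right_less flat_def intro!: eventually_mono[OF eventually_at_right_less])
  moreover have "((%h. flat m h / h) \<longlongrightarrow> 0) (at_left 0)"
   by (rule tendsto_eventually) (auto simp: flat_def eventually_at_left_field intro!: exI[of _ "-1"])
  ultimately have "((%h. flat m h / h) \<longlongrightarrow> 0) (at 0)"
   by (simp add: filterlim_split_at)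
  then show ?thesis using 2 by (simp add: DERIV_def flat_def)
 qed
qed

text \<open>The factor \<open>exp 1\<close> normalises the value at the origin to 1, since
  \<open>flat 0 1 = exp (- 1)\<close>.\<close>

definition bump :: "real => real^'n::finite => real" where
 "bump R x = exp 1 * flat 0 (1 - (norm ((1/R) *\<^sub>R x))\<^sup>2)"

lemma smooth_k_bump1: "smooth_k k (%x::real^'n::finite. exp 1 * flat 0 (1 - (norm x)\<^sup>2))"
proof -
 have "smooth_k k (%x::real^'n. 1 - (\<Sum>i\<in>UNIV. x $ i * x $ i))"
  by (intro smooth_k_diff smooth_k_const smooth_k_sum smooth_k_mult smooth_k_nth) auto
 then have "smooth_k k (%x::real^'n. flat 0 (1 - (\<Sum>i\<in>UNIV. x $ i * x $ i)))"
  by (intro smooth_k_comp[where S=UNIV and D=flat and m=0] flat_DERIV) auto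
 then show ?thesis
  by (auto intro!: smooth_k_cmult simp: power2_norm_eq_inner inner_vec_def)
qed

lemma smooth_k_bump: "smooth_k k (bump R)"
 unfolding bump_def[abs_def] by (rule smooth_k_scale[OF smooth_k_bump1])

lemma bump_range: "0 <= bump R x" "bump R x <= 1"
proof -
 show "0 <= bump R x" by (simp add: bump_def flat_def)
 show "bump R x <= 1"
 proof (cases "norm ((1/R) *\<^sub>R x) < 1")
  case True
  then have "0 < 1 - (norm ((1/R) *\<^sub>R x))\<^sup>2" by (simp add: abs_square_less_1)
  moreover have "1 <= 1 / (1 - (norm ((1/R) *\<^sub>R x))\<^sup>2)"
   using calculation by (simp add: field_simps)
  ultimately show ?thesis by (simp add: bump_def flat_def mult_exp_exp)
 next
  case False
  then show ?thesis by (simp add: bump_def flat_def abs_square_less_1 not_less)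
 qed
qed

lemma bump_eq_0: "0 < R ==> R <= norm x ==> bump R x = 0"
 by (simp add: bump_def flat_def not_less field_simps power_mono)

lemma bump_tendsto_1: "(%k. bump (real (Suc k)) x) ----> 1"
proof -
 have "(%k. norm ((1 / real (Suc k)) *\<^sub>R x)) ----> 0"
  using LIMSEQ_Suc[OF lim_const_over_n, of "norm x"] by (simp add: field_simps)
 then have "(%k. 1 - (norm ((1 / real (Suc k)) *\<^sub>R x))\<^sup>2) ----> 1 - 0\<^sup>2"
  by (intro tendsto_intros)
 moreover have "isCont (flat 0) (1 - 0\<^sup>2)" by (rule DERIV_isCont[OF flat_DERIV])
 ultimately have "(%k. flat 0 (1 - (norm ((1 / real (Suc k)) *\<^sub>R x))\<^sup>2)) ----> flat 0 (1 - 0\<^sup>2)"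
  by (rule isCont_tendsto_compose[rotated])
 then have "(%k. exp 1 * flat 0 (1 - (norm ((1 / real (Suc k)) *\<^sub>R x))\<^sup>2)) ----> exp 1 * flat 0 (1 - 0\<^sup>2)"
  by (intro tendsto_intros)
 then show ?thesis by (simp add: bump_def flat_def mult_exp_exp)
qed

text \<open>All bumps are rescalings of one profile whose derivatives are continuous and vanish
  outside the unit ball. Scaling produces the factors 1/R and 1/R^2 with one constant for every
  radius, which makes cutoff errors disappear as the radius grows.\<close>

lemma bump_bounds:
 obtains B where "0 <= B" "!!R (x::real^'n::finite). 0 < R ==> norm (grad (bump R) x) <= B / R"
  "!!R (x::real^'n::finite). 0 < R ==> \<bar>laplacian (bump R) x\<bar> <= B / R\<^sup>2"
proof -
 define b :: "real^'n => real" where "b = (%x. exp 1 * flat 0 (1 - (norm x)\<^sup>2))"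
 have sb: "smooth_k k b" for k unfolding b_def by (rule smooth_k_bump1)
 have b1: "bump R = (%x::real^'n. b ((1/R) *\<^sub>R x))" for R by (simp add: b_def bump_def[abs_def])
 have db: "b differentiable (at x)" "pd i b differentiable (at x)" for x i
  using sb[of 2] by (auto simp: numeral_2_eq_2)
 have p: "pd i (bump R) = (%x. (1/R) * pd i b ((1/R) *\<^sub>R x))" for i R
  unfolding b1 by (intro ext partial_deriv_scale db)
 have pp: "pd i (pd i (bump R)) x = (1/R)^2 * pd i (pd i b) ((1/R) *\<^sub>R x)" for i R x
 proof -
  have "pd i (%x. (1/R) * pd i b ((1/R) *\<^sub>R x)) x
    = (1/R) * pd i (%x. pd i b ((1/R) *\<^sub>R x)) x"
   using differentiable_chain_at[of "%x. (1/R) *\<^sub>R x" x "pd i b"] db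
   by (subst partial_deriv_mult) (auto simp: partial_deriv_const o_def)
  also have "pd i (%x. pd i b ((1/R) *\<^sub>R x)) x = (1/R) * pd i (pd i b) ((1/R) *\<^sub>R x)"
   by (intro partial_deriv_scale db)
  finally show ?thesis unfolding p by (simp add: power2_eq_square)
 qed
 have g: "grad (bump R) x = (1/R) *\<^sub>R grad b ((1/R) *\<^sub>R x)" for R x
  by (simp add: vec_eq_iff grad_nth p)
 have l: "laplacian (bump R) x = (1/R)^2 * laplacian b ((1/R) *\<^sub>R x)" for R x
  by (simp add: laplacian_def pp sum_distrib_left)
 have cg: "continuous_on (cball 0 1) (%x. norm (grad b x))"
  by (intro continuous_on_norm continuous_on_subset[OF continuous_on_grad[OF sb]]) auto
 have cl: "continuous_on (cball 0 1) (%x. \<bar>laplacian b x\<bar>)"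
  by (intro continuous_on_rabs continuous_on_subset[OF continuous_on_laplacian[OF sb]]) auto
 have "bounded ((%x. norm (grad b x)) ` cball 0 1)"
  by (intro compact_imp_bounded compact_continuous_image cg) auto
 then obtain B1 where "\<forall>x\<in>cball 0 1. norm (norm (grad b x)) <= B1" by (auto simp: bounded_iff)
 then have B1: "!!x. norm x <= 1 ==> norm (grad b x) <= B1" by auto
 have "bounded ((%x. \<bar>laplacian b x\<bar>) ` cball 0 1)"
  by (intro compact_imp_bounded compact_continuous_image cl) auto
 then obtain B2 where "\<forall>x\<in>cball 0 1. norm \<bar>laplacian b x\<bar> <= B2" by (auto simp: bounded_iff)
 then have B2: "!!x. norm x <= 1 ==> \<bar>laplacian b x\<bar> <= B2" by auto
 have op: "open {y::real^'n. norm y > 1}" by (intro open_Collect_less continuous_intros)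
 have b0: "b y = 0" if "norm y > 1" for y
  using that by (auto simp: b_def flat_def not_less)
 have p0: "pd i b x = 0" if "norm x > 1" for x i
 proof -
  have "((%_. 0) has_derivative (%_. 0)) (at x)" by simp
  then have "(b has_derivative (%_. 0)) (at x)"
   by (rule has_derivative_transform_within_open[OF _ op]) (use that in \<open>auto simp: b0\<close>)
  from partial_deriv_eqI[OF this] show ?thesis .
 qed
 have pp0: "pd i (pd i b) x = 0" if "norm x > 1" for x i
 proof -
  have "((%_. 0) has_derivative (%_. 0)) (at x)" by simp
  then have "(pd i b has_derivative (%_. 0)) (at x)"
   by (rule has_derivative_transform_within_open[OF _ op]) (use that in \<open>auto simp: p0\<close>)
  from partial_deriv_eqI[OF this] show ?thesis .
 qed
 define B where "B = max 0 (max B1 B2)"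
 have Bg: "norm (grad b x) <= B" for x
 proof (cases "norm x <= 1")
  case True then show ?thesis using B1 by (fastforce simp: B_def)
 next
  case False then have "grad b x = 0" by (simp add: vec_eq_iff grad_nth p0)
  then show ?thesis by (simp add: B_def)
 qed
 have Bl: "\<bar>laplacian b x\<bar> <= B" for x
 proof (cases "norm x <= 1")
  case True then show ?thesis using B2 by (fastforce simp: B_def)
 next
  case False then have "laplacian b x = 0" by (simp add: laplacian_def pp0)
  then show ?thesis by (simp add: B_def)
 qed
 show ?thesis
 proof (rule that[of B])
  show "0 <= B" by (simp add: B_def)
  show "norm (grad (bump R) x) <= B / R" if "0 < R" for R and x :: "real^'n"
   using that Bg[of "(1/R) *\<^sub>R x"] by (simp add: g divide_right_mono)
  show "\<bar>laplacian (bump R) x\<bar> <= B / R\<^sup>2" if "0 < R" for R and x :: "real^'n"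
   using that Bl[of "(1/R) *\<^sub>R x"] by (simp add: l abs_mult power_divide divide_right_mono)
 qed
qed

section \<open>The heat semigroup on functions of Gaussian growth\<close>

lemma exp_remainder_bound: "\<bar>exp z - 1 - z\<bar> <= z\<^sup>2 * exp \<bar>z\<bar>" for z :: real
proof -
 have lo: "0 <= exp z - 1 - z" using exp_ge_add_one_self[of z] by linarith
 have "exp z * (1 - z) <= exp z * exp (- z)"
  using exp_ge_add_one_self[of "-z"] by (intro mult_left_mono) auto
 then have 1: "exp z - 1 <= z * exp z" by (simp add: algebra_simps mult_exp_exp)
 have "exp z - 1 - z <= z\<^sup>2 * exp \<bar>z\<bar>"
 proof (cases "z \<ge> 0")
  case True
  have "exp z - 1 - z <= z * (exp z - 1)" using 1 by (simp add: algebra_simps)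
  also have "... <= z * (z * exp z)" using 1 True by (intro mult_left_mono) auto
  finally show ?thesis using True by (simp add: power2_eq_square)
 next
  case False
  have "exp z - 1 - z <= (- z) * (1 - exp z)" using 1 by (simp add: algebra_simps)
  also have "... <= (- z) * (- z)" by (intro mult_left_mono; use False exp_ge_add_one_self[of z] in linarith)
  also have "... <= z\<^sup>2 * exp \<bar>z\<bar>" by (simp add: power2_eq_square[symmetric] mult_le_cancel_left1)
  finally show ?thesis .
 qed
 with lo show ?thesis by simp
qed

lemma integral_abs_le:
 fixes f g :: "'b => real"
 assumes "integrable M f" "integrable M g" "!!x. x \<in> space M ==> \<bar>f x\<bar> <= g x"
 shows "\<bar>\<integral>x. f x \<partial>M\<bar> <= (LINT x|M. g x)"
proof -
 have "\<bar>\<integral>x. f x \<partial>M\<bar> <= (LINT x|M. \<bar>f x\<bar>)" by (rule integral_abs_bound)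
 also have "... <= (LINT x|M. g x)" using assms by (intro integral_mono) auto
 finally show ?thesis .
qed

lemma sq_le_exp: "0 <= x ==> x\<^sup>2 <= 2 * exp x" for x :: real
 using exp_lower_Taylor_quadratic[of x] by simp

text \<open>The second-order remainder of the exponential is at most |h|^2 |T|^2 exp(|h| |T|). The
  slack \<open>r\<close> is split in two halves: one pays for |T|^2 through z^2 <= 2 exp z at z = r
  |T| / 2, which gives the constant 8 / r^2, the other for exp(|h| |T|) when |h| <= r / 2. The error
  is then quadratic in \<open>h\<close>.\<close>

lemma has_derivative_exp_family:
 fixes T :: "'b => 'a::euclidean_space" and w :: "'b => real"
 assumes [measurable]: "T \<in> borel_measurable M" "w \<in> borel_measurable M"
  and r: "0 < r" and int: "integrable M (%y. exp (\<theta> \<bullet> T y + r * norm (T y)) * w y)"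
 shows "((%\<theta>. \<integral>y. exp (\<theta> \<bullet> T y) * w y \<partial>M) has_derivative
     (%h. (LINT y|M. (exp (\<theta> \<bullet> T y) * w y) *\<^sub>R T y) \<bullet> h)) (at \<theta>)"
  and "integrable M (%y. (exp (\<theta> \<bullet> T y) * w y) *\<^sub>R T y)"
proof -
 let ?E = "%y. exp (\<theta> \<bullet> T y + r * norm (T y)) * \<bar>w y\<bar>"
 have intE: "integrable M ?E" using integrable_abs[OF int] by (simp add: abs_mult)
 have i0: "integrable M (%y. exp ((\<theta> + h) \<bullet> T y) * w y)" if "norm h <= r" for h
 proof (rule integrable_boundI[OF intE])
  have "h \<bullet> T y <= r * norm (T y)" for y
   using norm_cauchy_schwarz[of h "T y"] that by (meson mult_right_mono norm_ge_zero order_trans)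
  then show "AE y in M. norm (exp ((\<theta> + h) \<bullet> T y) * w y) <= norm (?E y)"
   by (intro AE_I2) (simp add: abs_mult inner_add_left mult_right_mono)
 qed measurable
 have sq: "(norm (T y))^2 <= 8 / r\<^sup>2 * exp (r / 2 * norm (T y))" for y
  using sq_le_exp[of "r / 2 * norm (T y)"] r by (simp add: power_mult_distrib field_simps)
 have i1: "integrable M (%y. (exp (\<theta> \<bullet> T y) * w y) *\<^sub>R T y)"
 proof (rule integrable_boundI[OF integrable_mult_right[OF intE, of "1/r"]])
  have "r * norm (T y) <= exp (r * norm (T y))" for y
   using exp_ge_add_one_self[of "r * norm (T y)"] by linarith
  then have "norm (T y) <= 1/r * exp (r * norm (T y))" for y
   using r by (simp add: field_simps)
  then have "(exp (\<theta> \<bullet> T y) * \<bar>w y\<bar>) * norm (T y) <= (exp (\<theta> \<bullet> T y) * \<bar>w y\<bar>) * (1/r * exp (r * norm (T y)))" for y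
   by (intro mult_left_mono) auto
  then show "AE y in M. norm ((exp (\<theta> \<bullet> T y) * w y) *\<^sub>R T y) <= norm (1/r * ?E y)"
   using r by (intro AE_I2) (simp add: exp_add abs_mult ac_simps)
 qed measurable
 then show "integrable M (%y. (exp (\<theta> \<bullet> T y) * w y) *\<^sub>R T y)" .
 define L where "L = (LINT y|M. (exp (\<theta> \<bullet> T y) * w y) *\<^sub>R T y)"
 define K where "K = 8 / r\<^sup>2 * (LINT y|M. ?E y)"
 have K0: "0 <= K" unfolding K_def by (intro mult_nonneg_nonneg integral_nonneg) auto
 have bd: "norm ((LINT y|M. exp ((\<theta> + h) \<bullet> T y) * w y) - (LINT y|M. exp (\<theta> \<bullet> T y) * w y) - L \<bullet> h) <= K * (norm h)^2"
  if h: "norm h <= r / 2" for h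
 proof -
  have h': "norm h <= r" using h r by simp
  have iL: "integrable M (%y. ((exp (\<theta> \<bullet> T y) * w y) *\<^sub>R T y) \<bullet> h)"
   using i1 by (rule integrable_inner_left)
  have "(LINT y|M. exp ((\<theta> + h) \<bullet> T y) * w y) - (LINT y|M. exp (\<theta> \<bullet> T y) * w y) - L \<bullet> h
    = (LINT y|M. exp ((\<theta> + h) \<bullet> T y) * w y - exp (\<theta> \<bullet> T y) * w y - ((exp (\<theta> \<bullet> T y) * w y) *\<^sub>R T y) \<bullet> h)"
  proof -
   have "(LINT y|M. ((exp (\<theta> \<bullet> T y) * w y) *\<^sub>R T y) \<bullet> h) = L \<bullet> h"
    unfolding L_def using i1 by (intro integral_inner_left) auto
   moreover have "integrable M (%y. exp (\<theta> \<bullet> T y) * w y)" using i0[of 0] r by simp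
   ultimately show ?thesis using i0[OF h'] iL
    by (simp only: Bochner_Integration.integral_diff Bochner_Integration.integrable_diff)
  qed
  also have "norm ... <= (LINT y|M. (8 / r\<^sup>2 * (norm h)^2) * ?E y)"
   unfolding real_norm_def
  proof (rule integral_abs_le)
   show "integrable M (%y. exp ((\<theta> + h) \<bullet> T y) * w y - exp (\<theta> \<bullet> T y) * w y - ((exp (\<theta> \<bullet> T y) * w y) *\<^sub>R T y) \<bullet> h)"
    using i0[OF h'] i0[of 0] iL r by (intro Bochner_Integration.integrable_diff) auto
   show "integrable M (%y. (8 / r\<^sup>2 * (norm h)^2) * ?E y)" using intE by simp
   fix y
   have z: "\<bar>h \<bullet> T y\<bar> <= norm h * norm (T y)" by (rule Cauchy_Schwarz_ineq2)
   have "exp ((\<theta> + h) \<bullet> T y) * w y - exp (\<theta> \<bullet> T y) * w y - ((exp (\<theta> \<bullet> T y) * w y) *\<^sub>R T y) \<bullet> h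
     = (exp (\<theta> \<bullet> T y) * w y) * (exp (h \<bullet> T y) - 1 - h \<bullet> T y)"
    by (simp add: inner_add_left exp_add algebra_simps inner_commute)
   then have "norm (exp ((\<theta> + h) \<bullet> T y) * w y - exp (\<theta> \<bullet> T y) * w y - ((exp (\<theta> \<bullet> T y) * w y) *\<^sub>R T y) \<bullet> h)
     = (exp (\<theta> \<bullet> T y) * \<bar>w y\<bar>) * \<bar>exp (h \<bullet> T y) - 1 - h \<bullet> T y\<bar>"
    by (simp add: abs_mult)
   also have "... <= (exp (\<theta> \<bullet> T y) * \<bar>w y\<bar>) * ((h \<bullet> T y)\<^sup>2 * exp \<bar>h \<bullet> T y\<bar>)"
    by (intro mult_left_mono exp_remainder_bound) auto
   also have "... <= (exp (\<theta> \<bullet> T y) * \<bar>w y\<bar>) * (((norm h)^2 * (norm (T y))^2) * exp (r / 2 * norm (T y)))"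
   proof (intro mult_left_mono mult_mono)
    show "(h \<bullet> T y)\<^sup>2 <= (norm h)^2 * (norm (T y))^2"
     using power_mono[OF z, of 2] by (simp add: power_mult_distrib)
    show "exp \<bar>h \<bullet> T y\<bar> <= exp (r / 2 * norm (T y))"
     using order_trans[OF z mult_right_mono[OF h norm_ge_zero]] by simp
   qed auto
   also have "... <= (exp (\<theta> \<bullet> T y) * \<bar>w y\<bar>) * (((norm h)^2 * (8 / r\<^sup>2 * exp (r / 2 * norm (T y)))) * exp (r / 2 * norm (T y)))"
    by (intro mult_left_mono mult_right_mono sq) auto
   also have "... = (8 / r\<^sup>2 * (norm h)^2) * ?E y"
   proof -
    have "exp (r * norm (T y)) = exp (r / 2 * norm (T y)) * exp (r / 2 * norm (T y))"
     by (simp add: mult_exp_exp)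
    then show ?thesis by (simp add: exp_add)
   qed
   finally show "\<bar>exp ((\<theta> + h) \<bullet> T y) * w y - exp (\<theta> \<bullet> T y) * w y - ((exp (\<theta> \<bullet> T y) * w y) *\<^sub>R T y) \<bullet> h\<bar>
    <= (8 / r\<^sup>2 * (norm h)^2) * ?E y" unfolding real_norm_def .
  qed
  also have "... = K * (norm h)^2" by (simp add: K_def)
  finally show ?thesis .
 qed
 have "((%h. norm ((LINT y|M. exp ((\<theta> + h) \<bullet> T y) * w y) - (LINT y|M. exp (\<theta> \<bullet> T y) * w y) - L \<bullet> h) / norm h) \<longlongrightarrow> 0) (at 0)"
 proof (rule Lim_null_comparison)
  show "((%h. K * norm h) \<longlongrightarrow> 0) (at 0)" by (auto intro!: tendsto_eq_intros)
  have "\<forall>\<^sub>F h in at (0::'a). norm h <= r / 2"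
   using r eventually_at[of "%h. norm h <= r / 2" "0::'a" UNIV]
   by (auto simp: dist_norm intro!: exI[of _ "r/2"])
  then show "\<forall>\<^sub>F h in at 0. norm (norm ((LINT y|M. exp ((\<theta> + h) \<bullet> T y) * w y) - (LINT y|M. exp (\<theta> \<bullet> T y) * w y) - L \<bullet> h) / norm h) <= K * norm h"
  proof eventually_elim
   case (elim h)
   show ?case
   proof (cases "h = 0")
    case False then show ?thesis using bd[OF elim] by (simp add: divide_le_eq power2_eq_square mult.assoc)
   qed simp
  qed
 qed
 then show "((%\<theta>. \<integral>y. exp (\<theta> \<bullet> T y) * w y \<partial>M) has_derivative
     (%h. (LINT y|M. (exp (\<theta> \<bullet> T y) * w y) *\<^sub>R T y) \<bullet> h)) (at \<theta>)"
  unfolding has_derivative_at L_def[symmetric] by (simp add: bounded_linear_inner_right)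
qed

section \<open>The Gaussian kernel and functions of Gaussian growth\<close>

lemma heat_kernel_nonneg: "0 <= hk s x y"
 by (simp add: heat_kernel_def)

lemma heat_kernel_pos: "s ~= 0 ==> 0 < hk s x y"
 by (simp add: heat_kernel_def)

lemma heat_kernel_commute: "hk s x y = hk s y x"
 by (simp add: heat_kernel_def norm_minus_commute)

lemma heat_kernel_measurable[measurable]:
 assumes [measurable]: "f \<in> borel_measurable M" "g \<in> borel_measurable M" "h \<in> borel_measurable M"
 shows "(%z. hk (f z) (g z) (h z :: real^'n::finite)) \<in> borel_measurable M"
 unfolding heat_kernel_def by measurable

text \<open>The kernel factorises over the coordinate directions into normal densities of standard
  deviation \<open>sqrt s\<close>, so Tonelli reduces the claim to dimension one.\<close>

lemma nn_integral_heat_kernel: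
 assumes s: "0 < s"
 shows "(\<integral>\<^sup>+ y. ennreal (hk s x (y::real^'n::finite)) \<partial>lborel) = 1"
proof -
 have eq: "hk s x y = (\<Prod>b\<in>Basis. normal_density (x \<bullet> b) (sqrt s) (y \<bullet> b))" for y
 proof -
  have "(norm (x - y))^2 = (\<Sum>b\<in>Basis. (y \<bullet> b - x \<bullet> b)\<^sup>2)"
   by (subst power2_norm_eq_inner, subst euclidean_inner)
    (simp add: inner_diff_left power2_eq_square algebra_simps)
  then have e: "exp (- ((norm (x - y))^2 / (2 * s))) = (\<Prod>b\<in>Basis. exp (- ((y \<bullet> b - x \<bullet> b)\<^sup>2 / (2 * s))))"
   by (simp add: exp_sum[symmetric] sum_negf sum_divide_distrib)
  have "(2 * pi * s) powr (- real CARD('n) / 2) = ((2 * pi * s) powr (- 1/2)) ^ CARD('n)"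
   using s by (simp add: powr_powr powr_realpow[symmetric])
  also have "(2 * pi * s) powr (- 1/2) = 1 / sqrt (2 * pi * s)"
   using s by (simp add: powr_minus powr_half_sqrt inverse_eq_divide)
  finally show ?thesis
   using s by (simp add: heat_kernel_def e normal_density_def prod_dividef power_one_over)
 qed
 have "(\<integral>\<^sup>+ y. ennreal (hk s x y) \<partial>lborel)
   = (\<integral>\<^sup>+ y. (\<Prod>b\<in>Basis. ennreal (normal_density (x \<bullet> b) (sqrt s) (y \<bullet> b))) \<partial>lborel)"
  by (simp add: eq prod_ennreal)
 also have "... = (\<Prod>b\<in>(Basis::(real^'n) set). \<integral>\<^sup>+ t. ennreal (normal_density (x \<bullet> b) (sqrt s) t) \<partial>lborel)"
  by (rule nn_integral_lborel_prod) auto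
 also have "... = 1"
 proof -
  have "(\<integral>\<^sup>+ t. ennreal (normal_density \<mu> (sqrt s) t) \<partial>lborel) = 1" for \<mu>
   using s integral_normal_density[of "sqrt s" \<mu>] integrable_normal_density[of "sqrt s" \<mu>]
   by (subst nn_integral_eq_integral) auto
  then show ?thesis by simp
 qed
 finally show ?thesis .
qed

lemma integrable_heat_kernel: "0 < s ==> integrable lborel (hk s (x::real^'n::finite))"
 and integral_heat_kernel: "0 < s ==> (LINT y|lborel. hk s x (y::real^'n)) = 1"
proof -
 assume s: "0 < s"
 have "(\<integral>\<^sup>+ y. ennreal (hk s x y) \<partial>lborel) = ennreal 1"
  using nn_integral_heat_kernel[OF s] by simp
 then have "has_bochner_integral lborel (hk s x) 1"
  by (intro has_bochner_integral_nn_integral) (auto simp: heat_kernel_nonneg)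
 then show "integrable lborel (hk s x)" "(LINT y|lborel. hk s x y) = 1"
  by (auto simp: has_bochner_integral_iff)
qed

lemma integrable_exp_quadratic:
 assumes b: "0 < b"
 shows "integrable lborel (%y::real^'n::finite. exp (a * norm y - b * (norm y)^2))"
proof -
 \<comment> \<open>With this variance the kernel uses up half of the quadratic term; completing the
   square lets the other half absorb the linear one.\<close>
 define s where "s = 1 / b"
 have s: "0 < s" using b by (simp add: s_def)
 define c where "c = exp (a\<^sup>2 / (2 * b)) / (2 * pi * s) powr (- real CARD('n) / 2)"
 show ?thesis
 proof (rule integrable_boundI[OF integrable_mult_right[OF integrable_heat_kernel[OF s], of c 0]])
  show "AE y in lborel. norm (exp (a * norm y - b * (norm y)^2)) <= norm (c * hk s 0 (y::real^'n))"
  proof (rule AE_I2)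
   fix y :: "real^'n"
   have "0 <= (a - b * norm y)\<^sup>2 / (2 * b)" using b by simp
   also have "... = a\<^sup>2 / (2 * b) - a * norm y + b * (norm y)^2 / 2"
    using b by (simp add: field_simps power2_eq_square)
   finally have "a * norm y - b * (norm y)^2 <= a\<^sup>2 / (2 * b) + - b * (norm y)^2 / 2" by simp
   then have "exp (a * norm y - b * (norm y)^2) <= exp (a\<^sup>2 / (2 * b)) * exp (- b * (norm y)^2 / 2)"
    by (simp add: mult_exp_exp)
   also have "... = c * hk s 0 y"
    using b by (simp add: c_def s_def heat_kernel_def field_simps)
   finally show "norm (exp (a * norm y - b * (norm y)^2)) <= norm (c * hk s 0 y)" by simp
  qed
 qed measurable
qed

text \<open>The kernel of variance \<open>s\<close> has quadratic coefficient 1 / (2 s), which is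
  admissible exactly when \<open>kap * s < 1\<close>. The strict inequality leaves room for the
  slack in \<open>has_derivative_exp_family\<close>, and the arbitrary linear factor
  \<open>a\<close> makes the class stable under polynomial weights, hence under the operations that
  produce derivatives of the heat flow.\<close>

definition gauss_class :: "real => (real^'n::finite => real) set" where
 "gauss_class kap = {w. w \<in> borel_measurable borel &
   (\<forall>\<alpha> a. kap / 2 < \<alpha> --> integrable lborel (%y. exp (a * norm y - \<alpha> * (norm y)^2) * w y))}"

lemma gauss_class_measurable[measurable_dest]: "w \<in> gauss_class kap ==> w \<in> borel_measurable borel"
 by (simp add: gauss_class_def)

lemma gauss_classI_bounded:
 assumes [measurable]: "borel_fun w" and bd: "!!y. \<bar>w y\<bar> <= M * exp (kap / 2 * (norm y)^2)"
 shows "w \<in> gauss_class kap"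
proof -
 have "integrable lborel (%y. exp (a * norm y - \<alpha> * (norm y)^2) * w y)" if "kap / 2 < \<alpha>" for \<alpha> a
 proof (rule integrable_boundI[OF integrable_mult_right[OF integrable_exp_quadratic[of "\<alpha> - kap / 2" a], of M]])
  show "AE y in lborel. norm (exp (a * norm y - \<alpha> * (norm y)^2) * w y)
   <= norm (M * exp (a * norm y - (\<alpha> - kap / 2) * (norm y)^2))"
  proof (rule AE_I2)
   fix y :: "real^'a"
   have "\<bar>w y\<bar> * exp (a * norm y - \<alpha> * (norm y)^2) <= M * exp (kap / 2 * (norm y)^2) * exp (a * norm y - \<alpha> * (norm y)^2)"
    by (intro mult_right_mono bd) auto
   also have "... = M * exp (a * norm y - (\<alpha> - kap / 2) * (norm y)^2)"
    by (simp add: mult_exp_exp algebra_simps)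
   also have "... <= \<bar>M\<bar> * exp (a * norm y - (\<alpha> - kap / 2) * (norm y)^2)"
    by (intro mult_right_mono) auto
   finally show "norm (exp (a * norm y - \<alpha> * (norm y)^2) * w y)
    <= norm (M * exp (a * norm y - (\<alpha> - kap / 2) * (norm y)^2))"
    by (simp add: abs_mult mult.commute)
  qed
 qed (use that in auto)
 then show ?thesis by (auto simp: gauss_class_def)
qed

lemma gauss_class_mult:
 assumes w: "w \<in> gauss_class kap" and [measurable]: "borel_fun q"
  and q: "!!y. \<bar>q y\<bar> <= A * exp (b * norm y)"
 shows "(%y. q y * w y) \<in> gauss_class kap"
proof -
 have [measurable]: "borel_fun w" using w by measurable
 have "integrable lborel (%y. exp (a * norm y - \<alpha> * (norm y)^2) * (q y * w y))" if "kap / 2 < \<alpha>" for \<alpha> a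
 proof (rule integrable_boundI)
  show "integrable lborel (%y. A * (exp ((a + b) * norm y - \<alpha> * (norm y)^2) * w y))"
   using w that by (auto simp: gauss_class_def)
  show "AE y in lborel. norm (exp (a * norm y - \<alpha> * (norm y)^2) * (q y * w y))
    <= norm (A * (exp ((a + b) * norm y - \<alpha> * (norm y)^2) * w y))"
  proof (rule AE_I2)
   fix y :: "real^'a"
   have A: "0 <= A" using q[of 0] by simp
   have "\<bar>q y\<bar> * (exp (a * norm y - \<alpha> * (norm y)^2) * \<bar>w y\<bar>)
     <= A * exp (b * norm y) * (exp (a * norm y - \<alpha> * (norm y)^2) * \<bar>w y\<bar>)"
    by (intro mult_right_mono q) auto
   also have "... = A * (exp ((a + b) * norm y - \<alpha> * (norm y)^2) * \<bar>w y\<bar>)"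
    by (simp add: mult_exp_exp algebra_simps)
   finally show "norm (exp (a * norm y - \<alpha> * (norm y)^2) * (q y * w y))
    <= norm (A * (exp ((a + b) * norm y - \<alpha> * (norm y)^2) * w y))"
    using A by (simp add: abs_mult ac_simps)
  qed
 qed measurable
 then show ?thesis by (auto simp: gauss_class_def)
qed

lemma gauss_class_nth: "w \<in> gauss_class kap ==> (%y. y $ i * w y) \<in> gauss_class kap"
proof (erule gauss_class_mult[where A=1 and b=1])
 show "\<bar>y $ i\<bar> <= 1 * exp (1 * norm y)" for y :: "real^'a"
  unfolding mult_1 using component_le_norm_cart[of y i] exp_ge_add_one_self[of "norm y"] by linarith
qed measurable

lemma gauss_class_norm2: "w \<in> gauss_class kap ==> (%y. (norm y)^2 * w y) \<in> gauss_class kap"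
proof (erule gauss_class_mult[where A=2 and b=1])
 show "\<bar>(norm y)^2\<bar> <= 2 * exp (1 * norm y)" for y :: "real^'a"
  using sq_le_exp[of "norm y"] by simp
qed measurable

section \<open>Differentiation of the heat flow jointly in time and space\<close>

definition heat_sg :: "real => (real^'n::finite => real) => real^'n => real" where
 "heat_sg s w x = (LINT y|lborel. w y * hk s x y)"

text \<open>This is the Gaussian as an exponential family: sufficient statistic (y, -|y|^2), natural
  parameter (x / s, 1 / (2 s)). Derivatives in time and in space thus come from a single
  differentiation in the natural parameter.\<close>

lemma heat_kernel_expand:
 fixes x y :: "real^'n::finite"
 assumes s: "0 < s"
 shows "hk s x y = ((2 * pi * s) powr (- real CARD('n) / 2) * exp (- (norm x)\<^sup>2 / (2 * s)))
   * exp (((1 / s) *\<^sub>R x, 1 / (2 * s)) \<bullet> (y, - (norm y)\<^sup>2))"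
proof -
 have *: "(norm (x - y))^2 = (norm x)^2 - 2 * (x \<bullet> y) + (norm y)^2"
  by (simp add: power2_norm_eq_inner inner_diff_left inner_diff_right inner_commute)
 have "- (norm (x - y))\<^sup>2 / (2 * s) = - (norm x)\<^sup>2 / (2 * s) + ((1 / s) *\<^sub>R x, 1 / (2 * s)) \<bullet> (y, - (norm y)\<^sup>2)"
  unfolding * using s by (simp add: divide_simps)
 then show ?thesis unfolding heat_kernel_def by (simp only: exp_add mult.assoc)
qed

lemma gauss_class_integrable_exp:
 fixes \<xi> :: "real^'n::finite"
 assumes w: "w \<in> gauss_class kap" and "kap / 2 < \<alpha>"
 shows "\<exists>r>0. integrable lborel (%y. exp ((\<xi>, \<alpha>) \<bullet> (y, - (norm y)\<^sup>2) + r * norm (y, - (norm y)\<^sup>2)) * w y)"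
proof -
 have [measurable]: "borel_fun w" using w by measurable
 \<comment> \<open>Half of the gap is given away, so that \<open>\<alpha> - r\<close> still exceeds
   \<open>kap / 2\<close>.\<close>
 define r where "r = (\<alpha> - kap / 2) / 2"
 have r: "0 < r" "kap / 2 < \<alpha> - r" using assms(2) by (auto simp: r_def field_simps)
 have "integrable lborel (%y. exp ((\<xi>, \<alpha>) \<bullet> (y, - (norm y)\<^sup>2) + r * norm (y, - (norm y)\<^sup>2)) * w y)"
 proof (rule integrable_boundI)
  show "integrable lborel (%y. exp ((norm \<xi> + r) * norm y - (\<alpha> - r) * (norm y)^2) * w y)"
   using w r by (auto simp: gauss_class_def)
  show "AE y in lborel. norm (exp ((\<xi>, \<alpha>) \<bullet> (y, - (norm y)\<^sup>2) + r * norm (y, - (norm y)\<^sup>2)) * w y)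
   <= norm (exp ((norm \<xi> + r) * norm y - (\<alpha> - r) * (norm y)^2) * w y)"
  proof (rule AE_I2)
   fix y :: "real^'n"
   have "norm (y, - (norm y)\<^sup>2) <= norm y + (norm y)^2"
    using norm_Pair_le[of y "- (norm y)\<^sup>2"] by simp
   then have "r * norm (y, - (norm y)\<^sup>2) <= r * (norm y + (norm y)^2)" using r by (intro mult_left_mono) auto
   moreover have "\<xi> \<bullet> y <= norm \<xi> * norm y" by (rule norm_cauchy_schwarz)
   ultimately have "(\<xi>, \<alpha>) \<bullet> (y, - (norm y)\<^sup>2) + r * norm (y, - (norm y)\<^sup>2) <= (norm \<xi> + r) * norm y - (\<alpha> - r) * (norm y)^2"
    by (simp add: algebra_simps)
   then show "norm (exp ((\<xi>, \<alpha>) \<bullet> (y, - (norm y)\<^sup>2) + r * norm (y, - (norm y)\<^sup>2)) * w y)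
    <= norm (exp ((norm \<xi> + r) * norm y - (\<alpha> - r) * (norm y)^2) * w y)"
    by (simp add: abs_mult mult_right_mono)
  qed
 qed measurable
 with r show ?thesis by blast
qed

lemma gauss_class_integrable_kernel:
 fixes x :: "real^'n::finite"
 assumes w: "w \<in> gauss_class kap" and s: "0 < s" "kap * s < 1"
 shows "integrable lborel (%y. w y * hk s x y)"
proof -
 have [measurable]: "borel_fun w" using w by measurable
 have "kap / 2 < 1 / (2 * s)" using s by (simp add: field_simps)
 from gauss_class_integrable_exp[OF w this, of "(1/s) *\<^sub>R x"] obtain r where r: "0 < r"
  and i: "integrable lborel (%y. exp (((1/s) *\<^sub>R x, 1 / (2 * s)) \<bullet> (y, - (norm y)\<^sup>2) + r * norm (y, - (norm y)\<^sup>2)) * w y)"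
  by blast
 have "integrable lborel (%y. exp (((1/s) *\<^sub>R x, 1 / (2 * s)) \<bullet> (y, - (norm y)\<^sup>2)) * w y)"
  by (rule integrable_boundI[OF i]) (use r in \<open>auto simp: abs_mult intro!: mult_right_mono\<close>)
 from integrable_mult_right[OF this, of "(2 * pi * s) powr (- real CARD('n) / 2) * exp (- (norm x)\<^sup>2 / (2 * s))"]
 show ?thesis by (simp add: heat_kernel_expand[OF s(1)] ac_simps)
qed

definition hvec :: "real => (real^'n::finite => real) => real^'n => real^'n" where
 "hvec s w x = (\<chi> i. heat_sg s (%y. y $ i * w y) x)"

text \<open>The integral of \<open>w\<close> against ((y - x) / s) \<open>hk s x y\<close>, the
  spatial gradient of the kernel, written through moments.\<close>

definition hgrad :: "real => (real^'n::finite => real) => real^'n => real^'n" where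
 "hgrad s w x = (1 / s) *\<^sub>R (hvec s w x - heat_sg s w x *\<^sub>R x)"

text \<open>The time derivative of the kernel is (|y - x|^2 / (2 s^2) - n / (2 s)) times the kernel;
  here the square is expanded into moments. In this form joint continuity and the heat equation
  reduce to facts about \<open>heat_sg\<close> of weighted functions.\<close>

definition htime :: "real => (real^'n::finite => real) => real^'n => real" where
 "htime s w x = (heat_sg s (%y. (norm y)^2 * w y) x - 2 * (x \<bullet> hvec s w x) + (norm x)^2 * heat_sg s w x) / (2 * s\<^sup>2)
   - real CARD('n) / (2 * s) * heat_sg s w x"

text \<open>The heat flow is an explicit prefactor \<open>exp (G p)\<close> times a Laplace
  transform evaluated at the natural parameter \<open>\<Theta> p\<close>; product and chain rule
  give the derivative, and its coefficients are recognised as moments.\<close>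

lemma heat_sg_has_derivative:
 fixes x :: "real^'n::finite"
 assumes w: "w \<in> gauss_class kap" and s: "0 < s" "kap * s < 1"
 shows "((%p. heat_sg (fst p) w (snd p)) has_derivative
   (%d. htime s w x * fst d + hgrad s w x \<bullet> snd d)) (at (s, x))"
proof -
 have [measurable]: "borel_fun w" using w by measurable
 define n where "n = real CARD('n)"
 define T :: "real^'n => (real^'n) \<times> real" where "T = (%y. (y, - (norm y)\<^sup>2))"
 have [measurable]: "T \<in> borel_measurable lborel" unfolding T_def by measurable
 define \<Lambda> where "\<Lambda> = (%q \<theta>. \<integral>y. exp (\<theta> \<bullet> T y) * (q y * w y) \<partial>lborel)"
 define G :: "real \<times> (real^'n) => real" where "G = (%p. - n / 2 * ln (2 * pi * fst p) - (snd p \<bullet> snd p) / (2 * fst p))"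
 define \<Theta> :: "real \<times> (real^'n) => (real^'n) \<times> real" where "\<Theta> = (%p. ((1 / fst p) *\<^sub>R snd p, 1 / (2 * fst p)))"
 \<comment> \<open>A general factor \<open>q\<close> is carried along because the same
   representation, with \<open>q\<close> a coordinate or the squared norm, translates the components
   of \<open>L\<close> back into heat flows.\<close>
 have rep: "heat_sg (fst p) (%y. q y * w y) (snd p) = exp (G p) * \<Lambda> q (\<Theta> p)" if "0 < fst p" for p q
 proof -
  have "q y * w y * hk (fst p) (snd p) y = exp (G p) * (exp (\<Theta> p \<bullet> T y) * (q y * w y))" for y
  proof -
   have "(2 * pi * fst p) powr (- real CARD('n) / 2) * exp (- (norm (snd p))\<^sup>2 / (2 * fst p)) = exp (G p)"
    using that by (simp add: powr_def mult_exp_exp G_def n_def power2_norm_eq_inner)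
   then show ?thesis unfolding heat_kernel_expand[OF that] \<Theta>_def T_def by simp
  qed
  then have "(%y. q y * w y * hk (fst p) (snd p) y) = (%y. exp (G p) * (exp (\<Theta> p \<bullet> T y) * (q y * w y)))" by blast
  then show ?thesis unfolding heat_sg_def \<Lambda>_def by simp
 qed
 have "kap / 2 < 1 / (2 * s)" using s by (simp add: field_simps)
 from gauss_class_integrable_exp[OF w this, of "(1/s) *\<^sub>R x"] obtain r where r: "0 < r"
  and i: "integrable lborel (%y. exp (\<Theta> (s, x) \<bullet> T y + r * norm (T y)) * w y)"
  unfolding T_def \<Theta>_def by auto
 define L where "L = (LINT y|lborel. (exp (\<Theta> (s, x) \<bullet> T y) * w y) *\<^sub>R T y)"
 have d\<Lambda>: "((%\<theta>. \<integral>y. exp (\<theta> \<bullet> T y) * w y \<partial>lborel) has_derivative (%h. L \<bullet> h)) (at (\<Theta> (s, x)))"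
  and iL: "integrable lborel (%y. (exp (\<Theta> (s, x) \<bullet> T y) * w y) *\<^sub>R T y)"
  unfolding L_def by (intro has_derivative_exp_family[OF _ _ r i]; measurable)+
 have L1: "fst L $ j = \<Lambda> (%y. y $ j) (\<Theta> (s, x))" for j
 proof -
  have "bounded_linear (%z::(real^'n) \<times> real. fst z $ j)"
   by (intro bounded_linear_compose[OF bounded_linear_vec_nth bounded_linear_fst])
  from integral_bounded_linear[OF this iL] show ?thesis
   unfolding L_def \<Lambda>_def by (simp add: T_def ac_simps)
 qed
 have L2: "snd L = - \<Lambda> (%y. (norm y)^2) (\<Theta> (s, x))"
  using integral_bounded_linear[OF bounded_linear_snd iL]
  unfolding L_def \<Lambda>_def by (simp add: T_def ac_simps)
 have dG: "(G has_derivative (%d. - n / (2 * s) * fst d - (x \<bullet> snd d) / s + (x \<bullet> x) * fst d / (2 * s\<^sup>2))) (at (s, x))"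
  unfolding G_def using s
  by (auto intro!: derivative_eq_intros ext simp: field_simps power2_eq_square inner_commute)
 have d\<Theta>: "(\<Theta> has_derivative (%d. ((1/s) *\<^sub>R snd d - (fst d / s\<^sup>2) *\<^sub>R x, - fst d / (2 * s\<^sup>2)))) (at (s, x))"
  unfolding \<Theta>_def using s
  by (intro has_derivative_Pair; auto intro!: derivative_eq_intros ext simp: field_simps power2_eq_square)
 have dE: "((%p. exp (G p)) has_derivative (%d. exp (G (s, x)) * (- n / (2 * s) * fst d - (x \<bullet> snd d) / s + (x \<bullet> x) * fst d / (2 * s\<^sup>2)))) (at (s, x))"
  using has_derivative_exp[OF dG] by (simp add: mult.commute)
 let ?D = "%d. exp (G (s, x)) * (L \<bullet> ((1/s) *\<^sub>R snd d - (fst d / s\<^sup>2) *\<^sub>R x, - fst d / (2 * s\<^sup>2)))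
   + exp (G (s, x)) * (- n / (2 * s) * fst d - (x \<bullet> snd d) / s + (x \<bullet> x) * fst d / (2 * s\<^sup>2)) * \<Lambda> (%_. 1) (\<Theta> (s, x))"
 have "((%p. exp (G p) * (LINT y|lborel. exp (\<Theta> p \<bullet> T y) * w y)) has_derivative ?D) (at (s, x))"
  using has_derivative_mult[OF dE has_derivative_compose[OF d\<Theta> d\<Lambda>]] by (simp add: \<Lambda>_def)
 then have "((%p. heat_sg (fst p) w (snd p)) has_derivative ?D) (at (s, x))"
 proof (rule has_derivative_transform_within_open[where s="{p. 0 < fst p}"])
  show "open {p::real \<times> (real^'n). 0 < fst p}" by (intro open_Collect_less continuous_intros)
  show "exp (G p) * (LINT y|lborel. exp (\<Theta> p \<bullet> T y) * w y) = heat_sg (fst p) w (snd p)" if "p \<in> {p. 0 < fst p}" for p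
   using rep[of p "%_. 1"] that by (simp add: \<Lambda>_def)
 qed (use s in auto)
 moreover have "?D = (%d. htime s w x * fst d + hgrad s w x \<bullet> snd d)"
 proof
  fix d :: "real \<times> (real^'n)"
  obtain \<sigma> e where d: "d = (\<sigma>, e)" by (cases d)
  define E where "E = exp (G (s, x))"
  have H0: "heat_sg s w x = E * \<Lambda> (%_. 1) (\<Theta> (s, x))" using rep[of "(s, x)" "%_. 1"] s by (simp add: E_def)
  have H1: "hvec s w x = E *\<^sub>R fst L" using rep[of "(s, x)" "%y. y $ _"] s by (simp add: E_def hvec_def vec_eq_iff L1)
  have H2: "heat_sg s (%y. (norm y)^2 * w y) x = - E * snd L" using rep[of "(s, x)" "%y. (norm y)^2"] s by (simp add: E_def L2)
  have Ld: "L \<bullet> (u, v) = fst L \<bullet> u + snd L * v" for u v by (cases L) simp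
  have nx: "(norm x)^2 = x \<bullet> x" by (rule power2_norm_eq_inner)
  show "?D d = htime s w x * fst d + hgrad s w x \<bullet> snd d"
   unfolding nx htime_def hgrad_def H0 H1 H2 d Ld n_def[symmetric] E_def[symmetric]
   using s(1) by (simp add: inner_diff_left inner_diff_right inner_commute power2_eq_square)
     (simp add: field_simps)
 qed
 ultimately show ?thesis by simp
qed

lemma heat_sg_has_derivative_space:
 assumes w: "w \<in> gauss_class kap" and s: "0 < s" "kap * s < 1"
 shows "(heat_sg s w has_derivative (%d. hgrad s w x \<bullet> d)) (at x)"
proof -
 have "((%x. (s, x)) has_derivative (%d. (0, d))) (at x)" by (auto intro!: derivative_eq_intros)
 from has_derivative_compose[OF this heat_sg_has_derivative[OF w s]] show ?thesis by simp
qed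

lemma heat_sg_DERIV_time:
 assumes w: "w \<in> gauss_class kap" and s: "0 < s" "kap * s < 1"
 shows "((%s. heat_sg s w x) has_real_derivative htime s w x) (at s)"
proof -
 have "((%s. (s, x)) has_derivative (%d. (d, 0))) (at s)" by (auto intro!: derivative_eq_intros)
 from has_derivative_compose[OF this heat_sg_has_derivative[OF w s]] show ?thesis
  by (simp add: has_field_derivative_def mult_commute_abs)
qed

lemma partial_deriv_heat_sg:
 assumes w: "w \<in> gauss_class kap" and s: "0 < s" "kap * s < 1"
 shows "pd i (heat_sg s w) = (%x. (1 / s) * (heat_sg s (%y. y $ i * w y) x - x $ i * heat_sg s w x))"
 using partial_deriv_eqI[OF heat_sg_has_derivative_space[OF w s]]
 by (auto simp: hgrad_def hvec_def inner_axis mult.commute)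

lemma heat_sg_differentiable:
 assumes w: "w \<in> gauss_class kap" and s: "0 < s" "kap * s < 1"
 shows "heat_sg s w differentiable (at x)"
 using heat_sg_has_derivative_space[OF w s] by (auto simp: differentiable_def)

lemma grad_heat_sg:
 assumes w: "w \<in> gauss_class kap" and s: "0 < s" "kap * s < 1"
 shows "grad (heat_sg s w) x = hgrad s w x"
 by (rule grad_eqI[OF heat_sg_has_derivative_space[OF w s]])

text \<open>A partial derivative of a heat flow combines the flows of \<open>w\<close> and of
  \<open>y $ i * w y\<close>. Both weights lie in the same class, so induction with \<open>w\<close>
  generalised closes up.\<close>

lemma smooth_k_heat_sg:
 assumes s: "0 < s" "kap * s < 1"
 shows "w \<in> gauss_class kap ==> smooth_k k (heat_sg s w)"
proof (induction k arbitrary: w)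
 case 0
 then show ?case using heat_sg_differentiable[OF _ s]
  by (auto intro!: differentiable_imp_continuous_on simp: differentiable_on_def)
next
 case (Suc k)
 have "smooth_k k (%x. (1 / s) * (heat_sg s (%y. y $ i * w y) x - x $ i * heat_sg s w x))" for i
  by (intro smooth_k_cmult smooth_k_diff smooth_k_mult smooth_k_nth Suc.IH gauss_class_nth Suc.prems)
 moreover have "contU (heat_sg s w)" using heat_sg_differentiable[OF Suc.prems s]
  by (auto intro!: differentiable_imp_continuous_on simp: differentiable_on_def)
 ultimately show ?case using heat_sg_differentiable[OF Suc.prems s] partial_deriv_heat_sg[OF Suc.prems s] by simp
qed

lemma heat_sg_sum:
 assumes "!!i. i \<in> I ==> w i \<in> gauss_class kap" and s: "0 < s" "kap * s < 1"
 shows "heat_sg s (%y. \<Sum>i\<in>I. w i y) x = (\<Sum>i\<in>I. heat_sg s (w i) x)"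
 unfolding heat_sg_def sum_distrib_right
 using gauss_class_integrable_kernel[OF assms(1) s] by (simp add: Bochner_Integration.integral_sum)

text \<open>The heat equation with generator half the Laplacian. Both sides are combinations of the
  same moments, and the summand with CARD('n) comes from differentiating the factor
  \<open>x $ i\<close>.\<close>

lemma laplacian_heat_sg:
 fixes x :: "real^'n::finite"
 assumes w: "w \<in> gauss_class kap" and s: "0 < s" "kap * s < 1"
 shows "laplacian (heat_sg s w) x = 2 * htime s w x"
proof -
 let ?H = "%w. heat_sg s w"
 have wi: "(%y. y $ i * w y) \<in> gauss_class kap" for i by (rule gauss_class_nth[OF w])
 have wii: "(%y. y $ i * (y $ i * w y)) \<in> gauss_class kap" for i by (rule gauss_class_nth[OF wi])
 have d: "?H w differentiable (at x)" "?H (%y. y $ i * w y) differentiable (at x)" for i x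
  by (rule heat_sg_differentiable[OF w s] heat_sg_differentiable[OF wi s])+
 have nth: "(%x::real^'n. x $ i) differentiable (at x)" for i x
  using smooth_k_nth[of "Suc 0" i] by auto
 have p: "pd i (?H w) x = (1 / s) * (?H (%y. y $ i * w y) x - x $ i * ?H w x)"
  "pd i (?H (%y. y $ i * w y)) x = (1 / s) * (?H (%y. y $ i * (y $ i * w y)) x - x $ i * ?H (%y. y $ i * w y) x)" for i x
  by (simp_all add: partial_deriv_heat_sg[OF w s] partial_deriv_heat_sg[OF wi s])
 have pp: "pd i (pd i (?H w)) x
   = (1 / s\<^sup>2) * (?H (%y. y $ i * (y $ i * w y)) x - 2 * (x $ i * ?H (%y. y $ i * w y) x) + (x $ i)\<^sup>2 * ?H w x) - 1 / s * ?H w x" for i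
 proof -
  have "pd i (pd i (?H w)) x
    = pd i (%x. (1 / s) * ?H (%y. y $ i * w y) x + (- (1 / s)) * (x $ i * ?H w x)) x"
   using partial_deriv_heat_sg[OF w s] by (simp add: algebra_simps)
  also have "... = (1 / s) * pd i (?H (%y. y $ i * w y)) x - (1 / s) * (x $ i * pd i (?H w) x + ?H w x)"
   by (simp only: partial_deriv_add differentiable_mult differentiable_const d nth partial_deriv_mult partial_deriv_const partial_deriv_nth)
     simp
  finally show ?thesis using s(1) unfolding p
   by (simp add: power2_eq_square) (simp add: field_simps)
 qed
 have "?H (%y. (norm y)^2 * w y) x = (\<Sum>i\<in>UNIV. ?H (%y. y $ i * (y $ i * w y)) x)"
  by (subst heat_sg_sum[OF wii s, symmetric])
   (simp add: power2_norm_eq_inner inner_vec_def sum_distrib_right mult.assoc)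
 moreover have "x \<bullet> hvec s w x = (\<Sum>i\<in>UNIV. x $ i * ?H (%y. y $ i * w y) x)"
  by (simp add: inner_vec_def hvec_def)
 moreover have "(norm x)^2 * ?H w x = (\<Sum>i\<in>UNIV. (x $ i)\<^sup>2 * ?H w x)"
  unfolding power2_norm_eq_inner by (simp add: inner_vec_def sum_distrib_right power2_eq_square)
 moreover have "laplacian (?H w) x = (1 / s\<^sup>2) * ((\<Sum>i\<in>UNIV. ?H (%y. y $ i * (y $ i * w y)) x)
   - 2 * (\<Sum>i\<in>UNIV. x $ i * ?H (%y. y $ i * w y) x) + (\<Sum>i\<in>UNIV. (x $ i)\<^sup>2 * ?H w x)) - real CARD('n) * (1 / s * ?H w x)"
  unfolding laplacian_def pp
  by (simp only: sum.distrib sum_subtractf sum_distrib_left[symmetric] sum_constant)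
   (simp only: mult.left_commute[of "real CARD('n)"])
 ultimately have "laplacian (?H w) x = (1 / s\<^sup>2) * (?H (%y. (norm y)^2 * w y) x
   - 2 * (x \<bullet> hvec s w x) + (norm x)^2 * ?H w x) - real CARD('n) * (1 / s * ?H w x)"
  by simp
 then show ?thesis using s(1) unfolding htime_def by (simp add: field_simps)
qed

lemma continuous_on_heat_sg:
 assumes w: "w \<in> gauss_class kap"
 shows "continuous_on {p. 0 < fst p & kap * fst p < 1} (%p. heat_sg (fst p) w (snd p))"
proof (rule continuous_at_imp_continuous_on, safe)
 fix s x assume "0 < fst (s::real, x::real^'a)" "kap * fst (s, x) < 1"
 with heat_sg_has_derivative[OF w, of s x]
 show "isCont (%p. heat_sg (fst p) w (snd p)) (s, x)"
  by (auto intro: has_derivative_continuous)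
qed

lemma continuous_on_hvec:
 assumes w: "w \<in> gauss_class kap"
 shows "continuous_on {p. 0 < fst p & kap * fst p < 1} (%p. hvec (fst p) w (snd p))"
 unfolding hvec_def by (subst continuous_on_vec_lambda) (auto intro!: continuous_on_heat_sg gauss_class_nth w)

lemma continuous_on_hgrad:
 assumes w: "w \<in> gauss_class kap"
 shows "continuous_on {p. 0 < fst p & kap * fst p < 1} (%p. hgrad (fst p) w (snd p))"
 unfolding hgrad_def by (intro continuous_intros continuous_on_hvec continuous_on_heat_sg w) auto

lemma continuous_on_htime:
 assumes w: "w \<in> gauss_class kap"
 shows "continuous_on {p. 0 < fst p & kap * fst p < 1} (%p. htime (fst p) w (snd p))"
 unfolding htime_def
 by (intro continuous_intros continuous_on_hvec continuous_on_heat_sg gauss_class_norm2 w) auto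

text \<open>Completing the square in \<open>x\<close>: given the endpoints, the intermediate point
  of a Brownian path is Gaussian with interpolated mean and variance ab / (a + b). Integrating
  \<open>x\<close> out gives Chapman--Kolmogorov.\<close>

lemma heat_kernel_bridge:
 fixes x y z :: "real^'n::finite"
 assumes a: "0 < a" and b: "0 < b"
 shows "hk a z x * hk b x y
  = hk (a + b) z y * hk (a * b / (a + b)) ((b / (a + b)) *\<^sub>R z + (a / (a + b)) *\<^sub>R y) x"
proof -
 define p where "p = - real CARD('n) / 2"
 have pref: "(2 * pi * a) powr p * (2 * pi * b) powr p = (2 * pi * (a + b)) powr p * (2 * pi * (a * b / (a + b))) powr p"
 proof -
  have "(2 * pi * a) powr p * (2 * pi * b) powr p = ((2 * pi * a) * (2 * pi * b)) powr p"
   using a b by (intro powr_mult[symmetric])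
  also have "(2 * pi * a) * (2 * pi * b) = (2 * pi * (a + b)) * (2 * pi * (a * b / (a + b)))"
   using a b by (simp add: field_simps)
  also have "... powr p = (2 * pi * (a + b)) powr p * (2 * pi * (a * b / (a + b))) powr p"
   using a b by (intro powr_mult)
  finally show ?thesis .
 qed
 define m where "m = (b / (a + b)) *\<^sub>R z + (a / (a + b)) *\<^sub>R y"
 have ab: "a + b ~= 0" using a b by simp
 have "(a + b) * ((norm (z - x))^2 * b + (norm (x - y))^2 * a) = a * b * (norm (z - y))^2 + (norm (b *\<^sub>R z + a *\<^sub>R y - (a + b) *\<^sub>R x))^2"
  unfolding power2_norm_eq_inner
  by (simp add: inner_diff_left inner_diff_right inner_add_left inner_add_right inner_commute algebra_simps)
 moreover have "b *\<^sub>R z + a *\<^sub>R y - (a + b) *\<^sub>R x = (a + b) *\<^sub>R (m - x)"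
  unfolding m_def using ab by (simp add: scaleR_add_right scaleR_diff_right)
 ultimately have k: "(a + b) * ((norm (z - x))^2 * b + (norm (x - y))^2 * a) = a * b * (norm (z - y))^2 + (a + b)\<^sup>2 * (norm (m - x))^2"
  using a b by (simp add: power_mult_distrib)
 have "(norm (z - x))^2 / (2 * a) + (norm (x - y))^2 / (2 * b) = ((a + b) * ((norm (z - x))^2 * b + (norm (x - y))^2 * a)) / (2 * a * b * (a + b))"
  using a b ab by (simp add: divide_simps)
 also have "... = (norm (z - y))^2 / (2 * (a + b)) + (norm (m - x))^2 / (2 * (a * b / (a + b)))"
  unfolding k using a b ab by (simp add: divide_simps power2_eq_square) (simp add: algebra_simps)
 finally have ex: "(norm (z - x))^2 / (2 * a) + (norm (x - y))^2 / (2 * b)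
   = (norm (z - y))^2 / (2 * (a + b)) + (norm (m - x))^2 / (2 * (a * b / (a + b)))" .
 have "hk a z x * hk b x y = ((2 * pi * a) powr p * (2 * pi * b) powr p) * exp (- ((norm (z - x))^2 / (2 * a) + (norm (x - y))^2 / (2 * b)))"
  unfolding heat_kernel_def p_def[symmetric] minus_add_distrib exp_add by simp
 also have "... = hk (a + b) z y * hk (a * b / (a + b)) m x"
  unfolding pref ex unfolding heat_kernel_def p_def[symmetric] minus_add_distrib exp_add by simp
 finally show ?thesis unfolding m_def .
qed

lemma nn_integral_heat_kernel_mult:
 assumes "0 < a" "0 < b"
 shows "(\<integral>\<^sup>+ x. ennreal (hk a z x * hk b x y) \<partial>lborel) = ennreal (hk (a + b) z (y::real^'n::finite))"
 unfolding heat_kernel_bridge[OF assms]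
 using assms by (simp add: ennreal_mult heat_kernel_nonneg nn_integral_cmult nn_integral_heat_kernel)

lemma heat_kernel_shift:
 fixes x w :: "real^'n::finite"
 assumes s: "0 < s"
 shows "\<bar>sqrt s\<bar> ^ DIM(real^'n) * hk s x (x + sqrt s *\<^sub>R w) = hk 1 0 w"
proof -
 have "sqrt s ^ CARD('n) = s powr (real CARD('n) / 2)"
  using s by (simp add: powr_half_sqrt[symmetric] powr_realpow[symmetric] powr_powr)
 then show ?thesis
  using s by (simp add: heat_kernel_def powr_mult powr_minus power_mult_distrib field_simps)
qed

lemma integral_heat_kernel_shift:
 fixes x :: "real^'n::finite" and G :: "real^'n => real"
 assumes s: "0 < s" and [measurable]: "borel_fun G"
 shows "(LINT y|lborel. G y * hk s x y) = (LINT w|lborel. G (x + sqrt s *\<^sub>R w) * hk 1 0 w)"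
proof -
 have "sqrt s ~= 0" using s by simp
 from lborel_affine[OF this, of x]
 have "(LINT y|lborel. G y * hk s x y)
  = (LINT y|(density (distr lborel borel (%w. x + sqrt s *\<^sub>R w)) (%_. ennreal (\<bar>sqrt s\<bar> ^ DIM(real^'n)))). G y * hk s x y)"
  by (simp only: ennreal_power abs_ge_zero)
 also have "... = (LINT w|lborel. (\<bar>sqrt s\<bar> ^ DIM(real^'n) * hk s x (x + sqrt s *\<^sub>R w)) * G (x + sqrt s *\<^sub>R w))"
  by (subst integral_density; simp add: integral_distr ac_simps)
 finally show ?thesis unfolding heat_kernel_shift[OF s] by (simp only: mult.commute)
qed

lemma nn_integral_heat_kernel_shift:
 fixes x :: "real^'n::finite" and G :: "real^'n => ennreal"
 assumes s: "0 < s" and [measurable]: "borel_fun G"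
 shows "(\<integral>\<^sup>+y. G y * hk s x y \<partial>lborel) = (\<integral>\<^sup>+w. G (x + sqrt s *\<^sub>R w) * hk 1 0 w \<partial>lborel)"
proof -
 have "sqrt s ~= 0" using s by simp
 from lborel_affine[OF this, of x]
 have "(\<integral>\<^sup>+y. G y * hk s x y \<partial>lborel)
  = (\<integral>\<^sup>+y. G y * hk s x y \<partial>density (distr lborel borel (%w. x + sqrt s *\<^sub>R w)) (%_. ennreal (\<bar>sqrt s\<bar> ^ DIM(real^'n))))"
  by (simp only: ennreal_power abs_ge_zero)
 also have "... = (\<integral>\<^sup>+w. ennreal (\<bar>sqrt s\<bar> ^ DIM(real^'n) * hk s x (x + sqrt s *\<^sub>R w)) * G (x + sqrt s *\<^sub>R w) \<partial>lborel)"
  by (subst nn_integral_density) (simp_all add: nn_integral_distr ennreal_mult heat_kernel_nonneg ac_simps)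
 finally show ?thesis unfolding heat_kernel_shift[OF s] by (simp only: mult.commute)
qed

lemma heat_sg_tendsto_initial:
 fixes h :: "real^'n::finite => real"
 assumes cont: "contU h" and k: "0 <= kap" and bd: "!!y. \<bar>h y\<bar> <= M * exp (kap / 2 * (norm y)^2)"
 shows "((%s. heat_sg s h x) \<longlongrightarrow> h x) (at_right 0)"
proof -
 \<comment> \<open>Up to this time \<open>kap * s\<close> is at most 1/4, so after the substitution
   y = x + sqrt(s) w the growth exp(|w|^2 / 4) loses against exp(-|w|^2 / 2) uniformly in
   \<open>s\<close>. The added 4 keeps the denominator positive when \<open>kap\<close> is
   0.\<close>
 define s0 where "s0 = 1 / (4 * kap + 4)"
 have ks0: "kap * s <= 1/4" if "s <= s0" for s
 proof -
  have "kap * s0 <= 1/4" using k by (simp add: s0_def divide_le_eq)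
  with mult_left_mono[OF that k] show ?thesis by linarith
 qed
 have s0p: "0 < s0" using k by (simp add: s0_def)
 have M: "0 <= M" using bd[of 0] by simp
 have [measurable]: "borel_fun h" using cont by (rule borel_contI)
 define C where "C = M * exp (kap * (norm x)^2) * (2 * pi) powr (- real CARD('n) / 2)"
 have dom: "\<bar>h (x + sqrt s *\<^sub>R w) * hk 1 0 w\<bar> <= C * exp (0 * norm w - 1/4 * (norm w)^2)" if s: "0 < s" "s <= s0" for s w
 proof -
  have "(norm (x + sqrt s *\<^sub>R w))^2 <= (norm x + sqrt s * norm w)^2"
   using norm_triangle_ineq[of x "sqrt s *\<^sub>R w"] s by (intro power_mono) auto
  also have "... <= 2 * (norm x)^2 + 2 * (sqrt s * norm w)\<^sup>2"
   using sum_squares_bound[of "norm x" "sqrt s * norm w"] by (simp add: power2_sum)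
  also have "... = 2 * (norm x)^2 + 2 * s * (norm w)^2" using s by (simp add: power_mult_distrib)
  finally have "kap / 2 * (norm (x + sqrt s *\<^sub>R w))^2 <= kap / 2 * (2 * (norm x)^2 + 2 * s * (norm w)^2)"
   using k by (intro mult_left_mono) auto
  also have "... = kap * (norm x)^2 + (kap * s) * (norm w)^2" by (simp add: algebra_simps)
  also have "... <= kap * (norm x)^2 + 1/4 * (norm w)^2" using ks0[OF s(2)] by (intro add_left_mono mult_right_mono) auto
  finally have "exp (kap / 2 * (norm (x + sqrt s *\<^sub>R w))^2) <= exp (kap * (norm x)^2) * exp (1/4 * (norm w)^2)"
   by (simp add: mult_exp_exp)
  then have "M * exp (kap / 2 * (norm (x + sqrt s *\<^sub>R w))^2) <= M * (exp (kap * (norm x)^2) * exp (1/4 * (norm w)^2))"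
   using M by (rule mult_left_mono)
  with bd[of "x + sqrt s *\<^sub>R w"] have "\<bar>h (x + sqrt s *\<^sub>R w)\<bar> <= M * (exp (kap * (norm x)^2) * exp (1/4 * (norm w)^2))" by linarith
  then have "\<bar>h (x + sqrt s *\<^sub>R w)\<bar> * hk 1 0 w <= M * (exp (kap * (norm x)^2) * exp (1/4 * (norm w)^2)) * hk 1 0 w"
   by (intro mult_right_mono heat_kernel_nonneg)
  also have "... = C * (exp (1/4 * (norm w)^2) * exp (- (norm w)\<^sup>2 / 2))"
   by (simp add: C_def heat_kernel_def)
  also have "exp (1/4 * (norm w)^2) * exp (- (norm w)\<^sup>2 / 2) = exp (0 * norm w - 1/4 * (norm w)^2)"
   by (simp add: mult_exp_exp)
  finally show ?thesis by (simp add: abs_mult heat_kernel_nonneg)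
 qed
 show ?thesis
 proof (rule tendsto_at_right_sequentially[OF s0p])
  fix S :: "nat => real" assume S: "!!n. 0 < S n" "!!n. S n < s0" "S ----> 0"
  have "(%n. \<integral>w. h (x + sqrt (S n) *\<^sub>R w) * hk 1 0 w \<partial>lborel) ----> (LINT w|lborel. h x * hk 1 0 (w::real^'n))"
  proof (rule integral_dominated_convergence)
   show "integrable lborel (%w::real^'n. C * exp (0 * norm w - 1/4 * (norm w)^2))"
    by (intro integrable_mult_right integrable_exp_quadratic) auto
   show "AE w in lborel. (%n. h (x + sqrt (S n) *\<^sub>R w) * hk 1 0 w) ----> h x * hk 1 0 w"
   proof (rule AE_I2)
    fix w :: "real^'n"
    have "(%n. x + sqrt (S n) *\<^sub>R w) ----> x + sqrt 0 *\<^sub>R w" by (intro tendsto_intros S)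
    moreover have "isCont h (x + sqrt 0 *\<^sub>R w)" using cont by (simp add: continuous_on_eq_continuous_at)
    ultimately have "(%n. h (x + sqrt (S n) *\<^sub>R w)) ----> h (x + sqrt 0 *\<^sub>R w)" by (rule isCont_tendsto_compose[rotated])
    then show "(%n. h (x + sqrt (S n) *\<^sub>R w) * hk 1 0 w) ----> h x * hk 1 0 w"
     by (intro tendsto_intros) simp
   qed
   show "AE w in lborel. norm (h (x + sqrt (S n) *\<^sub>R w) * hk 1 0 w) <= C * exp (0 * norm w - 1/4 * (norm w)^2)" for n
    using dom[OF S(1)[of n] less_imp_le[OF S(2)[of n]]] by simp
  qed measurable
  moreover have "heat_sg (S n) h x = (LINT w|lborel. h (x + sqrt (S n) *\<^sub>R w) * hk 1 0 w)" for n
   unfolding heat_sg_def by (rule integral_heat_kernel_shift[OF S(1)]) measurable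
  ultimately show "(%n. heat_sg (S n) h x) ----> h x"
   by (simp add: integral_heat_kernel)
 qed
qed

section \<open>Two-sided Gaussian bounds for the heat flow\<close>

lemma heat_sg_cong_AE:
 assumes "AE y in lborel. h y = h' y" "borel_fun h" "borel_fun h'"
 shows "heat_sg s h = heat_sg s h'"
 unfolding heat_sg_def using assms by (intro ext integral_cong_AE) (auto elim!: eventually_mono)

text \<open>Only the unit ball is kept: there \<open>h\<close> has a positive minimum and |x - y| <=
  |x| + 1.\<close>

lemma heat_sg_lower:
 fixes h :: "real^'n::finite => real"
 assumes h: "h \<in> gauss_class kap" and s: "0 < s" "kap * s < 1"
  and cont: "contU h" and pos: "!!y. 0 < h y"
 obtains c where "0 < c" "!!x. c * exp (- (norm x + 1)\<^sup>2 / (2 * s)) <= heat_sg s h x"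
proof -
 have "\<exists>z\<in>cball 0 1. \<forall>y\<in>cball (0::real^'n) 1. h z <= h y"
  by (intro continuous_attains_inf continuous_on_subset[OF cont]) auto
 then obtain z where "\<forall>y\<in>cball (0::real^'n) 1. h z <= h y" by blast
 then have z: "!!y. norm y <= 1 ==> h z <= h y" by auto
 define c where "c = h z * (2 * pi * s) powr (- real CARD('n) / 2) * measure lborel (cball (0::real^'n) 1)"
 have "0 < measure lborel (cball (0::real^'n) 1)" by (rule content_cball_pos) simp
 then have "0 < c" using pos[of z] s by (simp add: c_def)
 moreover have "c * exp (- (norm x + 1)\<^sup>2 / (2 * s)) <= heat_sg s h x" for x
 proof -
  define e where "e = h z * (2 * pi * s) powr (- real CARD('n) / 2) * exp (- (norm x + 1)\<^sup>2 / (2 * s))"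
  have "c * exp (- (norm x + 1)\<^sup>2 / (2 * s)) = (LINT y|lborel. e * indicator (cball (0::real^'n) 1) y)"
   by (simp add: c_def e_def)
  also have "... <= heat_sg s h x"
   unfolding heat_sg_def
  proof (rule integral_mono)
   show "integrable lborel (%y. e * indicator (cball (0::real^'n) 1) y :: real)"
    by (intro integrable_mult_right integrable_real_indicator) (use emeasure_bounded_finite[OF bounded_cball[of "0::real^'n" 1]] in auto)
   show "integrable lborel (%y. h y * hk s x y)" by (rule gauss_class_integrable_kernel[OF h s])
   fix y :: "real^'n"
   show "e * indicator (cball 0 1) y <= h y * hk s x y"
   proof (cases "norm y <= 1")
    case True
    have "norm (x - y) <= norm x + 1" using norm_triangle_ineq4[of x y] True by simp
    then have "(norm (x - y))^2 <= (norm x + 1)^2" by (intro power_mono) auto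
    then have "exp (- (norm x + 1)\<^sup>2 / (2 * s)) <= exp (- (norm (x - y))\<^sup>2 / (2 * s))"
     using s by (simp add: divide_right_mono)
    then have "h z * ((2 * pi * s) powr (- real CARD('n) / 2) * exp (- (norm x + 1)\<^sup>2 / (2 * s)))
      <= h y * ((2 * pi * s) powr (- real CARD('n) / 2) * exp (- (norm (x - y))\<^sup>2 / (2 * s)))"
     using z[OF True] pos[of y] pos[of z] by (intro mult_mono mult_left_mono) auto
    then show ?thesis using True by (simp add: e_def heat_kernel_def mult.assoc)
   qed (simp add: pos less_imp_le heat_kernel_nonneg)
  qed
  finally show ?thesis .
 qed
 ultimately show ?thesis by (rule that)
qed

text \<open>Completing the square: growth of rate \<open>kap\<close> turns the kernel into another
  normalised one, with variance \<open>s / (1 - kap * s)\<close> and dilated centre, times a factor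
  of rate \<open>kap / (1 - kap * s)\<close> in \<open>x\<close>. This is how the growth rate
  evolves under the flow.\<close>

lemma heat_kernel_tilt:
 fixes x y :: "real^'n::finite"
 assumes s: "0 < s" "kap * s < 1"
 shows "hk s x y * exp (kap / 2 * (norm y)^2)
  = (2 * pi * s) powr (- real CARD('n) / 2) / (2 * pi * (s / (1 - kap * s))) powr (- real CARD('n) / 2)
   * exp (kap / (1 - kap * s) / 2 * (norm x)^2) * hk (s / (1 - kap * s)) ((1 / (1 - kap * s)) *\<^sub>R x) y"
proof -
 define r where "r = 1 - kap * s"
 have r: "0 < r" "kap = (1 - r) / s" using s by (auto simp: r_def)
 define X Y Z where "X = (norm x)^2" and "Y = (norm y)^2" and "Z = x \<bullet> y"
 have e1: "(norm (x - y))^2 = X - 2 * Z + Y"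
  unfolding X_def Y_def Z_def power2_norm_eq_inner by (simp add: inner_diff_left inner_diff_right inner_commute)
 have e2: "(norm ((1 / r) *\<^sub>R x - y))^2 = X / r\<^sup>2 - 2 * Z / r + Y"
  unfolding X_def Y_def Z_def power2_norm_eq_inner using r
  by (simp add: inner_diff_left inner_diff_right inner_commute power2_eq_square)
 have e: "- (norm (x - y))\<^sup>2 / (2 * s) + kap / 2 * Y = kap / r / 2 * X + - (norm ((1 / r) *\<^sub>R x - y))\<^sup>2 / (2 * (s / r))"
  unfolding e1 e2 unfolding r(2) using r(1) s(1) by (simp add: field_simps power2_eq_square)
 have "hk s x y * exp (kap / 2 * Y) = (2 * pi * s) powr (- real CARD('n) / 2) * exp (- (norm (x - y))\<^sup>2 / (2 * s) + kap / 2 * Y)"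
  unfolding heat_kernel_def exp_add by simp
 also have "... = (2 * pi * s) powr (- real CARD('n) / 2) * (exp (kap / r / 2 * X) * exp (- (norm ((1 / r) *\<^sub>R x - y))\<^sup>2 / (2 * (s / r))))"
  unfolding e exp_add ..
 also have "... = (2 * pi * s) powr (- real CARD('n) / 2) / (2 * pi * (s / r)) powr (- real CARD('n) / 2)
   * exp (kap / r / 2 * X) * hk (s / r) ((1 / r) *\<^sub>R x) y"
  unfolding heat_kernel_def using s(1) r(1) by simp
 finally show ?thesis unfolding r_def X_def Y_def .
qed

lemma heat_sg_upper:
 fixes h :: "real^'n::finite => real"
 assumes [measurable]: "borel_fun h" and s: "0 < s" "kap * s < 1" and k: "0 <= kap"
  and bd: "!!y. \<bar>h y\<bar> <= M * exp (kap / 2 * (norm y)^2)"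
 obtains c where "0 < c" "!!x. \<bar>heat_sg s h x\<bar> <= c * exp (kap / (1 - kap * s) / 2 * (norm x)^2)"
proof -
 define r where "r = 1 - kap * s"
 have r: "0 < r" using s by (auto simp: r_def)
 have M: "0 <= M" using bd[of 0] by simp
 define c0 where "c0 = (2 * pi * s) powr (- real CARD('n) / 2) / (2 * pi * (s / r)) powr (- real CARD('n) / 2)"
 have c0: "0 < c0" using s r by (simp add: c0_def)
 have h: "h \<in> gauss_class kap" by (rule gauss_classI_bounded[OF _ bd]) measurable
 show ?thesis
 proof (rule that[of "M * c0 + 1"])
  show "0 < M * c0 + 1" using M c0 by (simp add: add_nonneg_pos)
  fix x :: "real^'n"
  let ?P = "M * (c0 * exp (kap / r / 2 * (norm x)^2))"
  have sr: "0 < s / r" using s r by simp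
  have "\<bar>heat_sg s h x\<bar> <= (LINT y|lborel. ?P * hk (s / r) ((1 / r) *\<^sub>R x) y)"
   unfolding heat_sg_def
  proof (rule integral_abs_le)
   show "integrable lborel (%y. h y * hk s x y)" by (rule gauss_class_integrable_kernel[OF h s])
   show "integrable lborel (%y. ?P * hk (s / r) ((1 / r) *\<^sub>R x) y)"
    by (intro integrable_mult_right integrable_heat_kernel sr)
   fix y :: "real^'n"
   have "\<bar>h y\<bar> * hk s x y <= M * exp (kap / 2 * (norm y)^2) * hk s x y"
    by (intro mult_right_mono bd heat_kernel_nonneg)
   also have "... = M * (hk s x y * exp (kap / 2 * (norm y)^2))" by simp
   also have "... = ?P * hk (s / r) ((1 / r) *\<^sub>R x) y"
    unfolding heat_kernel_tilt[OF s] r_def c0_def by (simp only: mult.assoc)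
   finally show "\<bar>h y * hk s x y\<bar> <= ?P * hk (s / r) ((1 / r) *\<^sub>R x) y"
    by (simp add: abs_mult heat_kernel_nonneg)
  qed
  also have "... = ?P" using integral_heat_kernel[OF sr, of "(1 / r) *\<^sub>R x"] by simp
  also have "... <= (M * c0 + 1) * exp (kap / r / 2 * (norm x)^2)" by (simp add: distrib_right)
  finally show "\<bar>heat_sg s h x\<bar> <= (M * c0 + 1) * exp (kap / (1 - kap * s) / 2 * (norm x)^2)"
   unfolding r_def .
 qed
qed

lemma heat_sg_pos:
 assumes h: "h \<in> gauss_class kap" and s: "0 < s" "kap * s < 1"
  and cont: "contU h" and pos: "!!y. 0 < h y"
 shows "0 < heat_sg s h x"
proof -
 from heat_sg_lower[OF assms] obtain c where "0 < c" "!!x. c * exp (- (norm x + 1)\<^sup>2 / (2 * s)) <= heat_sg s h x"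
  by blast
 moreover from this have "0 < c * exp (- (norm x + 1)\<^sup>2 / (2 * s))" by simp
 ultimately show ?thesis by (meson less_le_trans)
qed

text \<open>Gaussian bounds on both sides become quadratic growth of the logarithm, which is
  integrable against every measure with finite second moment.\<close>

lemma ln_heat_sg_bound:
 fixes h :: "real^'n::finite => real"
 assumes s: "0 < s" "kap * s < 1" and k: "0 <= kap"
  and cont: "contU h" and pos: "!!y. 0 < h y"
  and bd: "!!y. \<bar>h y\<bar> <= M * exp (kap / 2 * (norm y)^2)"
 obtains A where "0 <= A" "!!x. \<bar>ln (heat_sg s h x)\<bar> <= A * (1 + (norm x)^2)"
proof -
 have [measurable]: "borel_fun h" using cont by (rule borel_contI)
 have h: "h \<in> gauss_class kap" by (rule gauss_classI_bounded[OF _ bd]) measurable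
 obtain c where c: "0 < c" "!!x. c * exp (- (norm x + 1)\<^sup>2 / (2 * s)) <= heat_sg s h x"
  by (rule heat_sg_lower[OF h s cont pos]) blast
 define A where "A = kap / (1 - kap * s) / 2"
 obtain C where C: "0 < C" "0 <= A" "!!x. \<bar>heat_sg s h x\<bar> <= C * exp (A * (norm x)^2)"
 proof -
  have "0 <= A" using s k by (simp add: A_def)
  then show ?thesis by (rule_tac heat_sg_upper[OF _ s k bd, OF \<open>h \<in> borel_measurable borel\<close>]) (auto simp: A_def intro: that)
 qed
 define B where "B = \<bar>ln c\<bar> + \<bar>ln C\<bar> + A + 1 / s"
 show ?thesis
 proof (rule that[of B])
  show "0 <= B" using C s by (simp add: B_def)
  fix x :: "real^'n"
  have hp: "0 < heat_sg s h x" by (rule heat_sg_pos[OF h s cont pos])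
  have "ln (c * exp (- (norm x + 1)\<^sup>2 / (2 * s))) <= ln (heat_sg s h x)"
   using c hp by (subst ln_le_cancel_iff) auto
  then have "ln c - (norm x + 1)\<^sup>2 / (2 * s) <= ln (heat_sg s h x)" using c by (simp add: ln_mult)
  moreover have "(norm x + 1)^2 / (2 * s) <= (2 * (1 + (norm x)^2)) / (2 * s)"
   using s sum_squares_bound[of "norm x" 1] by (intro divide_right_mono) (auto simp: power2_sum)
  moreover have "(2 * (1 + (norm x)^2)) / (2 * s) = 1 / s * (1 + (norm x)^2)" using s by (simp add: divide_simps)
  moreover have "- \<bar>ln c\<bar> <= ln c" by simp
  ultimately have lo: "- \<bar>ln c\<bar> - 1 / s * (1 + (norm x)^2) <= ln (heat_sg s h x)" by linarith
  have "ln (heat_sg s h x) <= ln (C * exp (A * (norm x)^2))"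
   using C hp C(3)[of x] by (subst ln_le_cancel_iff) auto
  then have up: "ln (heat_sg s h x) <= \<bar>ln C\<bar> + A * (norm x)^2" using C by (simp add: ln_mult)
  have "\<bar>ln c\<bar> * 1 <= \<bar>ln c\<bar> * (1 + (norm x)^2)" "\<bar>ln C\<bar> * 1 <= \<bar>ln C\<bar> * (1 + (norm x)^2)"
   by (intro mult_left_mono; simp)+
  moreover have "A * (norm x)^2 <= A * (1 + (norm x)^2)" "0 <= 1 / s * (1 + (norm x)^2)" "0 <= A * (1 + (norm x)^2)"
   using C s by (auto intro!: mult_left_mono mult_nonneg_nonneg)
  ultimately show "\<bar>ln (heat_sg s h x)\<bar> <= B * (1 + (norm x)^2)"
   using lo up unfolding B_def distrib_right by linarith
 qed
qed

section \<open>Weakly continuous curves of probability measures\<close>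

lemma closed_indicator_approx:
 fixes A :: "'a::metric_space set"
 assumes "closed A" "A ~= {}"
 defines "F \<equiv> (%k x. max 0 (1 - real k * infdist x A))"
 shows "contU (F k)" "bounded (range (F k))" "!!x. 0 <= F k x & F k x <= 1"
  "!!x. (%k. F k x) ----> indicator A x"
proof -
 show 1: "0 <= F k x & F k x <= 1" for k x by (auto simp: F_def infdist_nonneg)
 show "contU (F k)" unfolding F_def by (intro continuous_intros)
 show "bounded (range (F k))" using 1 by (auto intro!: boundedI[of _ 1])
 fix x
 show "(%k. F k x) ----> indicator A x"
 proof (cases "x \<in> A")
  case True then show ?thesis by (simp add: F_def)
 next
  case False
  then have pos: "0 < infdist x A" using assms infdist_pos_not_in_closed by auto
  have "\<forall>\<^sub>F k in sequentially. F k x = 0"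
  proof -
   obtain N where "1 / infdist x A < real N" using reals_Archimedean2 by blast
   then have "\<forall>k\<ge>N. F k x = 0"
   proof (intro allI impI)
    fix k assume "N <= k"
    then have "real N * infdist x A <= real k * infdist x A" using pos by (intro mult_right_mono) auto
    moreover have "1 < real N * infdist x A" using \<open>1 / infdist x A < real N\<close> pos by (simp add: field_simps)
    ultimately show "F k x = 0" by (simp add: F_def)
   qed
   then show ?thesis by (auto simp: eventually_sequentially)
  qed
  then show ?thesis using False by (simp add: tendsto_eventually)
 qed
qed

lemma Int_stable_closed: "Int_stable (Collect closed :: 'a::topological_space set set)"
 by (auto simp: Int_stable_def)

lemma sets_borel_sigma_closed: "sets (borel :: 'a::topological_space measure) = sigma_sets UNIV (Collect closed)"
 by (subst borel_eq_closed) (simp add: sets_measure_of)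

lemma measure_closed_tendsto:
 assumes "prob_space M" "sets M = sets (borel :: 'a::metric_space measure)" "closed A" "A ~= {}"
 shows "(%k. \<integral>x. max 0 (1 - real k * infdist x A) \<partial>M) ----> measure M A"
proof -
 interpret prob_space M by fact
 note F = closed_indicator_approx[OF assms(3,4)]
 have [measurable]: "(%x. max 0 (1 - real k * infdist x A)) \<in> borel_measurable M" for k
  using borel_contI[OF F(1)] assms(2) measurable_cong_sets by blast
 have A: "A \<in> sets M" using assms by auto
 have "(%k. \<integral>x. max 0 (1 - real k * infdist x A) \<partial>M) ----> (LINT x|M. indicator A x)"
  using F(3,4) A by (intro integral_dominated_convergence[where w="%_. 1"]) auto
 then show ?thesis using A by simp
qed

lemma prob_measure_eqI_continuous:
 fixes M N :: "'a::metric_space measure"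
 assumes M: "prob_space M" "sets M = sets borel" and N: "prob_space N" "sets N = sets borel"
  and le: "!!h::'a => real. contU h ==> bounded (range h) ==> (LINT x|M. h x) <= (LINT x|N. h x)"
 shows "M = N"
proof (rule measure_eqI_generator_eq[OF Int_stable_closed, where \<Omega>=UNIV and A="%_. UNIV"])
 interpret M: prob_space M by fact
 interpret N: prob_space N by fact
 have eq: "(LINT x|M. h x) = (LINT x|N. h x)" if h: "contU h" "bounded (range h)" for h :: "'a => real"
 proof (rule antisym[OF le[OF h]])
  have "contU (%x. - h x)" "bounded (range (%x. - h x))"
   using h by (auto intro: continuous_intros simp: bounded_iff)
  from le[OF this] show "(LINT x|N. h x) <= (LINT x|M. h x)" by simp
 qed
 fix A :: "'a set" assume "A \<in> Collect closed"
 then have A: "closed A" by simp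
 show "emeasure M A = emeasure N A"
 proof (cases "A = {}")
  case False
  have "(%k. \<integral>x. max 0 (1 - real k * infdist x A) \<partial>M) ----> measure N A"
   using measure_closed_tendsto[OF N A False] closed_indicator_approx[OF A False] by (simp add: eq)
  with measure_closed_tendsto[OF M A False] have "measure M A = measure N A" by (rule LIMSEQ_unique)
  then show ?thesis by (simp add: M.emeasure_eq_measure N.emeasure_eq_measure)
 qed simp
next
 show "emeasure M UNIV ~= \<infinity>" for i :: nat
  using finite_measure.emeasure_finite[OF prob_space.finite_measure[OF M(1)]] by simp
qed (use M N in \<open>auto simp: sets_borel_sigma_closed[symmetric]\<close>)

lemma prob_curve_integral_continuous:
 assumes "prob_curve nu" "contU h" "bounded (range h)"
 shows "continuous_on {0..1} (%t. \<integral>x. (h x :: real) \<partial>nu t)"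
 using assms by (simp add: prob_curve_def)

text \<open>Measurability of a kernel concerns all real times, while \<open>prob_curve\<close>
  constrains only [0,1]; clamping extends a curve constantly.\<close>

definition clamp01 :: "real => real" where "clamp01 t = max 0 (min 1 t)"

lemma clamp01_range: "clamp01 t \<in> {0..1}" and clamp01_id: "t \<in> {0..1} ==> clamp01 t = t"
 by (auto simp: clamp01_def)

text \<open>On closed sets the mass is a pointwise limit of integrals of continuous functions, each
  continuous in time by weak continuity; closed sets are an intersection-stable generator.\<close>

lemma prob_curve_kernel:
 fixes nu :: "real => 'a::metric_space measure"
 assumes "prob_curve nu"
 shows "(%t. nu (clamp01 t)) \<in> borel \<rightarrow>\<^sub>M prob_algebra borel"
proof (rule measurable_prob_algebra_generated[OF sets_borel_sigma_closed Int_stable_closed])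
 have P: "prob_space (nu t)" "sets (nu t) = sets borel" if "t \<in> {0..1}" for t using assms that by (auto simp: prob_curve_def)
 show "prob_space (nu (clamp01 t))" "sets (nu (clamp01 t)) = sets borel" for t by (intro P clamp01_range)+
 fix A :: "'a set" assume "A \<in> Collect closed"
 then have A: "closed A" by simp
 show "borel_fun (%t. emeasure (nu (clamp01 t)) A)"
 proof (cases "A = {}")
  case False
  note F = closed_indicator_approx[OF A False]
  have c: "contU clamp01" unfolding clamp01_def[abs_def] by (intro continuous_intros)
  have "continuous_on {0..1} (%t. \<integral>x. max 0 (1 - real k * infdist x A) \<partial>nu t)" for k
   using assms F(1,2)[of k] unfolding prob_curve_def by blast
  then have "contU (%t. \<integral>x. max 0 (1 - real k * infdist x A) \<partial>nu (clamp01 t))" for k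
   by (rule continuous_on_compose2[OF _ c]) (use clamp01_range in auto)
  then have "borel_fun (%t. \<integral>x. max 0 (1 - real k * infdist x A) \<partial>nu (clamp01 t))" for k
   by (rule borel_contI)
  then have "borel_fun (%t. measure (nu (clamp01 t)) A)"
   by (rule borel_measurable_LIMSEQ_real[rotated])
    (rule measure_closed_tendsto[OF P[OF clamp01_range] A False])
  moreover have "emeasure (nu (clamp01 t)) A = ennreal (measure (nu (clamp01 t)) A)" for t
   using P(1)[OF clamp01_range] by (meson finite_measure.emeasure_eq_measure prob_space.finite_measure)
  ultimately show ?thesis by simp
 qed simp
qed auto

lemma prob_curve_nn_integral_measurable:
 fixes nu :: "real => 'a::{second_countable_topology,metric_space} measure"
 assumes "prob_curve nu" and F: "borel_fun (%(t, x). F t x)"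
 shows "borel_fun (%t. \<integral>\<^sup>+x. F t x \<partial>nu (clamp01 t))"
proof (rule nn_integral_measurable_subprob_algebra2)
 show "(%(t, x). F t x) \<in> borel_measurable (borel \<Otimes>\<^sub>M borel)" using F by (simp add: borel_prod)
 show "(%t. nu (clamp01 t)) \<in> borel \<rightarrow>\<^sub>M subprob_algebra borel"
  by (rule measurable_prob_algebraD[OF prob_curve_kernel[OF assms(1)]])
qed

text \<open>Spells out the default value 0 for functions that are not integrable, so that parameter
  integrals are measurable with no integrability assumption.\<close>

lemma lebesgue_integral_eq_nn:
 fixes f :: "'a => real"
 assumes "f \<in> borel_measurable M"
 shows "(LINT x|M. f x) = (if (\<integral>\<^sup>+x. ennreal \<bar>f x\<bar> \<partial>M) < \<infinity> then
   enn2real (\<integral>\<^sup>+x. ennreal (f x) \<partial>M) - enn2real (\<integral>\<^sup>+x. ennreal (- f x) \<partial>M) else 0)"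
 using assms real_lebesgue_integral_def[of M f] not_integrable_integral_eq[of M f]
 by (auto simp: integrable_iff_bounded)

lemma prob_curve_integral_measurable:
 fixes nu :: "real => 'a::{second_countable_topology,metric_space} measure" and F :: "real => 'a => real"
 assumes "prob_curve nu" and F: "borel_fun (%(t, x). F t x)"
 shows "borel_fun (%t. \<integral>x. F t x \<partial>nu (clamp01 t))"
proof -
 have m: "borel_fun (%(t, x). ennreal \<bar>F t x\<bar>)" "borel_fun (%(t, x). ennreal (F t x))"
  "borel_fun (%(t, x). ennreal (- F t x))"
  using F by (auto simp: case_prod_unfold)
 note [measurable] = prob_curve_nn_integral_measurable[OF assms(1) m(1)]
  prob_curve_nn_integral_measurable[OF assms(1) m(2)] prob_curve_nn_integral_measurable[OF assms(1) m(3)]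
 have "F t \<in> borel_measurable (nu (clamp01 t))" for t
 proof -
  have "borel_fun (%x. (%(t, x). F t x) (t, x))"
   by (rule measurable_compose[OF _ F]) (simp add: borel_prod[symmetric])
  moreover have "sets (nu (clamp01 t)) = sets borel" using assms clamp01_range[of t] by (auto simp: prob_curve_def)
  ultimately show ?thesis using measurable_cong_sets by (auto cong: measurable_cong_sets)
 qed
 then show ?thesis by (simp only: lebesgue_integral_eq_nn) measurable
qed

section \<open>Localising the Fokker--Planck equation in time\<close>

text \<open>A general interval is used because the dual potentials are backward heat flows started
  at an intermediate time. Time derivatives at the two ends are one-sided, and the functions may be
  nonzero there.\<close>

definition test_on :: "real => real => (real => real^'n::finite => real) => (real => real^'n => real) => bool" where
 "test_on a b ph pht \<longleftrightarrow>
   (\<exists>K. compact K & (\<forall>t\<in>{a..b}. \<forall>x. x \<notin> K --> ph t x = 0)) &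
   (\<forall>t\<in>{a..b}. smooth_fun (ph t)) &
   (\<forall>t\<in>{a..b}. \<forall>x. ((%s. ph s x) has_real_derivative pht t x) (at t within {a..b})) &
   strip_cont a b (%(t, x). ph t x) &
   strip_cont a b (%(t, x). pht t x) &
   strip_cont a b (%(t, x). grad (ph t) x) &
   strip_cont a b (%(t, x). laplacian (ph t) x)"

lemma test_fun_eq_test_on: "test_fun = test_on 0 1"
 by (intro ext) (simp add: test_fun_def test_on_def)

definition fpgen :: "real => (real => real^'n::finite => real) => (real => real^'n => real) => (real => real^'n => real^'n)
  => real => real^'n => real" where
 "fpgen eps ph pht v t x = pht t x + eps / 2 * laplacian (ph t) x + v t x \<bullet> grad (ph t) x"

lemma grad_laplacian_outside:
 fixes h :: "real^'n::finite => real"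
 assumes K: "closed K" and h: "!!x. x \<notin> K ==> h x = 0" and x: "x \<notin> K"
 shows "grad h x = 0" "laplacian h x = 0"
proof -
 have op: "open (- K)" using K by auto
 have p: "pd i h y = 0" if "y \<notin> K" for y i
 proof -
  have "((%_. 0) has_derivative (%_. 0)) (at y)" by simp
  then have "(h has_derivative (%_. 0)) (at y)"
   by (rule has_derivative_transform_within_open[OF _ op]) (use that h in auto)
  from partial_deriv_eqI[OF this] show ?thesis .
 qed
 have pp: "pd i (pd i h) x = 0" for i
 proof -
  have "((%_. 0) has_derivative (%_. 0)) (at x)" by simp
  then have "(pd i h has_derivative (%_. 0)) (at x)"
   by (rule has_derivative_transform_within_open[OF _ op]) (use x p in auto)
  from partial_deriv_eqI[OF this] show ?thesis .
 qed
 show "grad h x = 0" using p[OF x] by (simp add: vec_eq_iff grad_nth)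
 show "laplacian h x = 0" by (simp add: laplacian_def pp)
qed

lemma test_on_support:
 assumes t: "test_on a b ph pht" and ab: "a < b"
 obtains K where "compact K"
  "!!t x. t \<in> {a..b} ==> x \<notin> K ==> ph t x = 0" "!!t x. t \<in> {a..b} ==> x \<notin> K ==> pht t x = 0"
  "!!t x. t \<in> {a..b} ==> x \<notin> K ==> grad (ph t) x = 0" "!!t x. t \<in> {a..b} ==> x \<notin> K ==> laplacian (ph t) x = 0"
proof -
 from t obtain K where K: "compact K" "!!t x. t \<in> {a..b} ==> x \<notin> K ==> ph t x = 0"
  unfolding test_on_def by blast
 show ?thesis
 proof (rule that[OF K])
  fix t x assume tx: "t \<in> {a..b}" "x \<notin> K"
  show "grad (ph t) x = 0" "laplacian (ph t) x = 0"
   by (rule grad_laplacian_outside[OF compact_imp_closed[OF K(1)] _ tx(2)], rule K(2)[OF tx(1)], assumption)+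
  have "((%s. ph s x) has_real_derivative pht t x) (at t within {a..b})"
   using t tx unfolding test_on_def by blast
  moreover have "((%s. ph s x) has_real_derivative 0) (at t within {a..b})"
   by (rule has_field_derivative_transform_within[OF DERIV_const[of 0], of 1]) (use tx K in auto)
  ultimately show "pht t x = 0"
   by (rule has_field_derivative_unique) (use ab tx in \<open>simp add: trivial_limit_within islimpt_Icc\<close>)
 qed (use K in auto)
qed

lemma bounded_on_compact_support:
 fixes F :: "real => 'a::topological_space => 'b::real_normed_vector"
 assumes "compact K" "strip_cont a b (%(t, x). F t x)" "!!t x. t \<in> {a..b} ==> x \<notin> K ==> F t x = 0"
 shows "\<exists>B\<ge>0. \<forall>t\<in>{a..b}. \<forall>x. norm (F t x) <= B"
proof -
 have "continuous_on ({a..b} \<times> K) (%(t, x). F t x)" using assms(2) by (rule continuous_on_subset) auto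
 moreover have "compact ({a..b} \<times> K)" using assms(1) by (intro compact_Times) auto
 ultimately have "bounded ((%(t, x). F t x) ` ({a..b} \<times> K))" by (intro compact_imp_bounded compact_continuous_image)
 then obtain B where B: "\<forall>z\<in>{a..b} \<times> K. norm ((%(t, x). F t x) z) <= B" by (auto simp: bounded_iff)
 have "norm (F t x) <= max 0 B" if "t \<in> {a..b}" for t x
  using B assms(3)[OF that, of x] that by (cases "x \<in> K") (fastforce simp: le_max_iff_disj)+
 then show ?thesis by (intro exI[of _ "max 0 B"]) auto
qed

lemma test_on_bounds:
 assumes t: "test_on a b ph pht" and ab: "a < b"
 obtains B where "0 <= B"
  "!!t x. t \<in> {a..b} ==> \<bar>ph t x\<bar> <= B" "!!t x. t \<in> {a..b} ==> \<bar>pht t x\<bar> <= B"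
  "!!t x. t \<in> {a..b} ==> norm (grad (ph t) x) <= B" "!!t x. t \<in> {a..b} ==> \<bar>laplacian (ph t) x\<bar> <= B"
proof -
 obtain K where K: "compact K"
  "!!t x. t \<in> {a..b} ==> x \<notin> K ==> ph t x = 0" "!!t x. t \<in> {a..b} ==> x \<notin> K ==> pht t x = 0"
  "!!t x. t \<in> {a..b} ==> x \<notin> K ==> grad (ph t) x = 0" "!!t x. t \<in> {a..b} ==> x \<notin> K ==> laplacian (ph t) x = 0"
  by (rule test_on_support[OF assms]) blast
 have c: "strip_cont a b (%(t, x). ph t x)" "strip_cont a b (%(t, x). pht t x)"
   "strip_cont a b (%(t, x). grad (ph t) x)" "strip_cont a b (%(t, x). laplacian (ph t) x)"
  using t unfolding test_on_def by auto
 obtain B1 where B1: "0 <= B1" "\<forall>t\<in>{a..b}. \<forall>x. norm (ph t x) <= B1"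
  using bounded_on_compact_support[OF K(1) c(1) K(2)] by blast
 obtain B2 where B2: "0 <= B2" "\<forall>t\<in>{a..b}. \<forall>x. norm (pht t x) <= B2"
  using bounded_on_compact_support[OF K(1) c(2) K(3)] by blast
 obtain B3 where B3: "0 <= B3" "\<forall>t\<in>{a..b}. \<forall>x. norm (grad (ph t) x) <= B3"
  using bounded_on_compact_support[OF K(1) c(3) K(4)] by blast
 obtain B4 where B4: "0 <= B4" "\<forall>t\<in>{a..b}. \<forall>x. norm (laplacian (ph t) x) <= B4"
  using bounded_on_compact_support[OF K(1) c(4) K(5)] by blast
 note nn = B1(1) B2(1) B3(1) B4(1)
 show ?thesis
 proof (rule that[of "B1 + B2 + B3 + B4"])
  fix t x assume t: "t \<in> {a..b}"
  show "\<bar>ph t x\<bar> <= B1 + B2 + B3 + B4" using nn B1(2)[rule_format, OF t, of x] by simp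
  show "\<bar>pht t x\<bar> <= B1 + B2 + B3 + B4" using nn B2(2)[rule_format, OF t, of x] by simp
  show "norm (grad (ph t) x) <= B1 + B2 + B3 + B4" using nn B3(2)[rule_format, OF t, of x] by simp
  show "\<bar>laplacian (ph t) x\<bar> <= B1 + B2 + B3 + B4" using nn B4(2)[rule_format, OF t, of x] by simp
 qed (use nn in simp)
qed

lemma curve_integral_continuous:
 fixes nu :: "real => 'a::metric_space measure" and ph :: "real => 'a => real"
 assumes nu: "prob_curve nu" and ab: "0 <= a" "b <= 1"
  and K: "compact K" "!!t x. t \<in> {a..b} ==> x \<notin> K ==> ph t x = 0"
  and c: "strip_cont a b (%(t, x). ph t x)"
 shows "continuous_on {a..b} (%t. \<integral>x. ph t x \<partial>nu t)"
proof (rule continuous_on_iff[THEN iffD2], intro ballI allI impI)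
 fix t0 e :: real assume t0: "t0 \<in> {a..b}" and e: "0 < e"
 have P: "prob_space (nu t)" "sets (nu t) = sets borel" if "t \<in> {a..b}" for t using nu that ab by (auto simp: prob_curve_def)
 from bounded_on_compact_support[OF K(1) c K(2)] obtain B where "\<forall>t\<in>{a..b}. \<forall>x. norm (ph t x) <= B" by blast
 then have B: "!!t x. t \<in> {a..b} ==> norm (ph t x) <= B" by blast
 have cx: "contU (ph t)" if "t \<in> {a..b}" for t
  using continuous_on_compose2[OF c continuous_on_Pair[OF continuous_on_const[of UNIV t] continuous_on_id]] that
  by (auto simp: image_subset_iff)
 have int: "integrable (nu s) (ph t)" if "t \<in> {a..b}" "s \<in> {a..b}" for t s
 proof -
  interpret prob_space "nu s" by (rule P[OF that(2)])
  have "ph t \<in> borel_measurable (nu s)"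
   using borel_contI[OF cx[OF that(1)]] measurable_cong_sets[OF P(2)[OF that(2)] refl] by blast
  then show ?thesis using B[OF that(1)] by (intro integrable_const_bound[of _ B]) auto
 qed
 have "uniformly_continuous_on ({a..b} \<times> K) (%(t, x). ph t x)"
  using K(1) by (intro compact_uniformly_continuous continuous_on_subset[OF c] compact_Times) auto
 then obtain d1 where d1: "0 < d1" "!!z z'. z \<in> {a..b} \<times> K ==> z' \<in> {a..b} \<times> K ==> dist z' z < d1 ==> dist ((%(t, x). ph t x) z') ((%(t, x). ph t x) z) < e / 2"
  unfolding uniformly_continuous_on_def using e by (metis half_gt_zero)
 have ct: "continuous_on {0..1} (%t. \<integral>x. ph t0 x \<partial>nu t)"
 proof -
  have "bounded (range (ph t0))" by (rule boundedI[of _ B]) (use B[OF t0] in auto)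
  then show ?thesis by (intro prob_curve_integral_continuous[OF nu] cx t0)
 qed
 have t01: "t0 \<in> {0..1}" using t0 ab by auto
 from mp[OF spec[OF bspec[OF ct[unfolded continuous_on_iff] t01]] half_gt_zero[OF e]]
 obtain d2 where d2: "0 < d2" "\<forall>t\<in>{0..1}. dist t t0 < d2 --> dist (LINT x|(nu t). ph t0 x) (LINT x|(nu t0). ph t0 x) < e / 2"
  by blast
 show "\<exists>d>0. \<forall>t\<in>{a..b}. dist t t0 < d --> dist (LINT x|(nu t). ph t x) (LINT x|(nu t0). ph t0 x) < e"
 proof (intro exI[of _ "min d1 d2"] conjI ballI impI)
  fix t assume t: "t \<in> {a..b}" "dist t t0 < min d1 d2"
  interpret prob_space "nu t" by (rule P[OF t(1)])
  have le: "\<bar>ph t x - ph t0 x\<bar> <= e / 2" for x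
  proof (cases "x \<in> K")
   case True
   then show ?thesis using d1(2)[of "(t0, x)" "(t, x)"] t t0 by (auto simp: dist_real_def dist_Pair_Pair)
  qed (use K(2) t t0 e in simp)
  have "\<bar>(LINT x|(nu t). ph t x) - (LINT x|(nu t). ph t0 x)\<bar> = \<bar>\<integral>x. ph t x - ph t0 x \<partial>nu t\<bar>"
   using int t t0 by simp
  also have "... <= (LINT x|(nu t). e / 2)" using int[OF t(1) t(1)] int[OF t0 t(1)] le by (intro integral_abs_le) auto
  also have "... = e / 2" using prob_space by simp
  finally have "dist (LINT x|(nu t). ph t x) (LINT x|(nu t). ph t0 x) <= e / 2" by (simp add: dist_real_def)
  moreover have "dist (LINT x|(nu t). ph t0 x) (LINT x|(nu t0). ph t0 x) < e / 2" using d2(2) t ab by auto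
  ultimately show "dist (LINT x|(nu t). ph t x) (LINT x|(nu t0). ph t0 x) < e"
   using dist_triangle[of "\<integral>x. ph t x \<partial>nu t" "\<integral>x. ph t0 x \<partial>nu t0" "\<integral>x. ph t0 x \<partial>nu t"] by linarith
 qed (use d1 d2 in auto)
qed

lemma fp_pairD:
 assumes "fp_pair eps nu v"
 shows "prob_curve nu" "borel_fun (%(t, x). v t x)"
  "!!t. t \<in> {0..1} ==> prob_space (nu t)" "!!t. t \<in> {0..1} ==> sets (nu t) = sets borel"
  "!!t. t \<in> {0..1} ==> integrable (nu t) (%x. norm (v t x))"
  "set_integrable lborel {0..1} (%t. \<integral>x. norm (v t x) \<partial>nu t)"
  "!!ph pht. test_on 0 1 ph pht ==> (LINT t:{0..1}|lborel. (LINT x|(nu t). fpgen eps ph pht v t x)) = (LINT x|(nu 1). ph 1 x) - (LINT x|(nu 0). ph 0 x)"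
 using assms by (auto simp: fp_pair_def prob_curve_def test_fun_eq_test_on fpgen_def)

lemma borel_slice: "(%(t, x). F t x) \<in> borel_measurable (borel :: (real \<times> 'a::{second_countable_topology,metric_space}) measure) ==> F t \<in> borel_measurable borel"
proof -
 assume F: "(%(t, x). F t x) \<in> borel_measurable (borel :: (real \<times> 'a) measure)"
 have "borel_fun (%x. (%(t, x). F t x) (t, x))"
  by (rule measurable_compose[OF _ F]) (simp add: borel_prod[symmetric])
 then show ?thesis by simp
qed

lemma fpgen_integrable:
 fixes v :: "real => real^'n::finite => real^'n"
 assumes nu: "prob_curve nu" and v: "borel_fun (%(t, x). v t x)"
  "!!t. t \<in> {a..b} ==> integrable (nu t) (%x. norm (v t x))"
  "set_integrable lborel {a..b} (%t. \<integral>x. norm (v t x) \<partial>nu t)"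
  and ab: "0 <= a" "a < b" "b <= 1" and t: "test_on a b ph pht"
 shows "!!t. t \<in> {a..b} ==> integrable (nu t) (fpgen eps ph pht v t)"
  and "set_integrable lborel {a..b} (%t. \<integral>x. fpgen eps ph pht v t x \<partial>nu t)"
proof -
 obtain B where B: "0 <= B"
  "!!t x. t \<in> {a..b} ==> \<bar>ph t x\<bar> <= B" "!!t x. t \<in> {a..b} ==> \<bar>pht t x\<bar> <= B"
  "!!t x. t \<in> {a..b} ==> norm (grad (ph t) x) <= B" "!!t x. t \<in> {a..b} ==> \<bar>laplacian (ph t) x\<bar> <= B" by (rule test_on_bounds[OF t ab(2)]) blast
 have P: "prob_space (nu t)" "sets (nu t) = sets borel" if "t \<in> {a..b}" for t using nu that ab by (auto simp: prob_curve_def)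
 have cs: "{a..b} \<times> (UNIV::(real^'n) set) \<in> sets borel" by (intro borel_closed closed_Times) auto
 have c: "strip_cont a b (%(t, x). pht t x)"
   "strip_cont a b (%(t, x). grad (ph t) x)" "strip_cont a b (%(t, x). laplacian (ph t) x)"
  using t unfolding test_on_def by auto
 note [measurable] = borel_measurable_continuous_on_indicator[OF cs c(1)]
  borel_measurable_continuous_on_indicator[OF cs c(2)] borel_measurable_continuous_on_indicator[OF cs c(3)] v(1)
 let ?I = "%t x. indicator ({a..b} \<times> UNIV) (t, x :: real^'n) :: real"
 \<comment> \<open>Continuity is known only over the strip, so indicators give a function that is
   Borel on the whole space and agrees with \<open>fpgen\<close> for times in [a,b].\<close>
 define F where "F = (%t x. ?I t x *\<^sub>R (pht t x) + eps / 2 * (?I t x *\<^sub>R laplacian (ph t) x) + v t x \<bullet> (?I t x *\<^sub>R grad (ph t) x))"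
 have "borel_fun (%z. indicator ({a..b} \<times> UNIV) z *\<^sub>R (%(t, x). pht t x) z + eps / 2 * (indicator ({a..b} \<times> UNIV) z *\<^sub>R (%(t, x). laplacian (ph t) x) z)
   + (%(t, x). v t x) z \<bullet> (indicator ({a..b} \<times> UNIV) z *\<^sub>R (%(t, x). grad (ph t) x) z))" by measurable
 moreover have "(%z. indicator ({a..b} \<times> UNIV) z *\<^sub>R (%(t, x). pht t x) z + eps / 2 * (indicator ({a..b} \<times> UNIV) z *\<^sub>R (%(t, x). laplacian (ph t) x) z)
   + (%(t, x). v t x) z \<bullet> (indicator ({a..b} \<times> UNIV) z *\<^sub>R (%(t, x). grad (ph t) x) z)) = (%(t, x). F t x)"
  by (auto simp: F_def)
 ultimately have Fm: "borel_fun (%(t, x). F t x)" by simp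
 have F: "F t = fpgen eps ph pht v t" if "t \<in> {a..b}" for t
  using that by (auto simp: F_def fpgen_def)
 define C where "C = B + \<bar>eps\<bar> / 2 * B"
 have bd: "\<bar>fpgen eps ph pht v t x\<bar> <= C + B * norm (v t x)" if t: "t \<in> {a..b}" for t x
 proof -
  have "\<bar>v t x \<bullet> grad (ph t) x\<bar> <= norm (v t x) * norm (grad (ph t) x)" by (rule Cauchy_Schwarz_ineq2)
  also have "... <= norm (v t x) * B" by (intro mult_left_mono B t) auto
  finally have 1: "\<bar>v t x \<bullet> grad (ph t) x\<bar> <= B * norm (v t x)" by (simp add: mult.commute)
  have "\<bar>eps / 2 * laplacian (ph t) x\<bar> <= \<bar>eps\<bar> / 2 * B" unfolding abs_mult using B(5)[OF t, of x] by (intro mult_mono) auto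
  with 1 B(3)[OF t, of x] show ?thesis unfolding fpgen_def C_def by linarith
 qed
 have meas: "fpgen eps ph pht v t \<in> borel_measurable (nu t)" if "t \<in> {a..b}" for t
  using borel_slice[OF Fm, of t] unfolding F[OF that] using measurable_cong_sets[OF P(2)[OF that] refl] by blast
 have i: "integrable (nu t) (fpgen eps ph pht v t)" if t: "t \<in> {a..b}" for t
 proof -
  interpret prob_space "nu t" by (rule P[OF t])
  have "integrable (nu t) (%x. C + B * norm (v t x))" using v(2)[OF t] by simp
  then show ?thesis using bd[OF t] meas[OF t] by (rule_tac integrable_boundI) (auto intro!: AE_I2 order_trans[OF bd[OF t]])
 qed
 then show "!!t. t \<in> {a..b} ==> integrable (nu t) (fpgen eps ph pht v t)" .
 have ibd: "\<bar>\<integral>x. fpgen eps ph pht v t x \<partial>nu t\<bar> <= C + B * (LINT x|(nu t). norm (v t x))" if t: "t \<in> {a..b}" for t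
 proof -
  interpret prob_space "nu t" by (rule P[OF t])
  have "\<bar>\<integral>x. fpgen eps ph pht v t x \<partial>nu t\<bar> <= (LINT x|(nu t). C + B * norm (v t x))"
   using i[OF t] v(2)[OF t] bd[OF t] by (intro integral_abs_le) auto
  also have "... = C + B * (LINT x|(nu t). norm (v t x))" using v(2)[OF t] prob_space by simp
  finally show ?thesis .
 qed
 have "set_integrable lborel {a..b} (%t. C + B * (LINT x|(nu t). norm (v t x)))"
 proof (intro set_integral_add set_integrable_mult_right)
  show "set_integrable lborel {a..b} (%t. C)" by (intro borel_integrable_atLeastAtMost') auto
 qed (rule v(3))
 then show "set_integrable lborel {a..b} (%t. \<integral>x. fpgen eps ph pht v t x \<partial>nu t)"
  unfolding set_integrable_def
 proof (rule integrable_boundI)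
  have "(%t. indicator {a..b} t *\<^sub>R (LINT x|(nu (clamp01 t)). F t x)) \<in> borel_measurable lborel"
   using prob_curve_integral_measurable[OF nu Fm] by simp
  also have "(%t. indicator {a..b} t *\<^sub>R (LINT x|(nu (clamp01 t)). F t x)) = (%t. indicator {a..b} t *\<^sub>R (LINT x|(nu t). fpgen eps ph pht v t x))"
   using ab by (auto simp: indicator_def F clamp01_id)
  finally show "(%t. indicator {a..b} t *\<^sub>R (LINT x|(nu t). fpgen eps ph pht v t x)) \<in> borel_measurable lborel" .
  show "AE t in lborel. norm (indicator {a..b} t *\<^sub>R (LINT x|(nu t). fpgen eps ph pht v t x)) <= norm (indicator {a..b} t *\<^sub>R (C + B * (LINT x|(nu t). norm (v t x))))"
   using ibd by (intro AE_I2) (force simp: indicator_def)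
 qed
qed

section \<open>A time cutoff of class C^1\<close>

lemma max0_sq_DERIV: "((%u::real. (max 0 u)\<^sup>2) has_real_derivative 2 * max 0 u) (at u)"
proof -
 consider "u < 0" | "u = 0" | "u > 0" by linarith
 then show ?thesis
 proof cases
  case 1
  have "((%_. 0) has_real_derivative 2 * max 0 u) (at u)" using 1 by simp
  then show ?thesis
   by (rule has_field_derivative_transform_within_open[where S="{..<0}"]) (use 1 in auto)
 next
  case 3
  have "((%u. u\<^sup>2) has_real_derivative 2 * max 0 u) (at u)" using 3 by (auto intro!: derivative_eq_intros)
  then show ?thesis
   by (rule has_field_derivative_transform_within_open[where S="{0<..}"]) (use 3 in auto)
 next
  case 2
  have "((%h::real. (max 0 h)\<^sup>2 / h) \<longlongrightarrow> 0) (at 0)"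
  proof (rule Lim_null_comparison)
   show "((%h::real. \<bar>h\<bar>) \<longlongrightarrow> 0) (at 0)" by (auto intro!: tendsto_eq_intros)
   show "\<forall>\<^sub>F h in at (0::real). norm ((max 0 h)\<^sup>2 / h) <= \<bar>h\<bar>"
    by (rule always_eventually) (auto simp: max_def power2_eq_square)
  qed
  then show ?thesis using 2 by (simp add: DERIV_def)
 qed
qed

text \<open>The primitive of a tent of mass 1 on [0,1], rising from 0 to 1. Piecewise quadratics
  suffice, because test functions are only C^1 in time.\<close>

definition ramp :: "real => real" where
 "ramp u = 2 * (max 0 u)\<^sup>2 - 4 * (max 0 (u - 1/2))\<^sup>2 + 2 * (max 0 (u - 1))\<^sup>2"

definition ramp' :: "real => real" where
 "ramp' u = 4 * max 0 u - 8 * max 0 (u - 1/2) + 4 * max 0 (u - 1)"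

lemma ramp_DERIV: "(ramp has_real_derivative ramp' u) (at u)"
proof -
 have "((%u. (max 0 (u - c))\<^sup>2) has_real_derivative 2 * max 0 (u - c) * 1) (at u)" for c
  by (rule DERIV_chain2[where f="%u. (max 0 u)\<^sup>2" and g="%u. u - c"])
   (auto intro!: max0_sq_DERIV derivative_eq_intros)
 from DERIV_add[OF DERIV_diff[OF DERIV_cmult[OF this[of 0], of 2] DERIV_cmult[OF this[of "1/2"], of 4]] DERIV_cmult[OF this[of 1], of 2]]
 show ?thesis unfolding ramp_def[abs_def] ramp'_def by simp
qed

lemma ramp_le0: "u <= 0 ==> ramp u = 0" "u <= 0 ==> ramp' u = 0"
 by (simp_all add: ramp_def ramp'_def)

lemma ramp_ge1: "1 <= u ==> ramp u = 1" "1 <= u ==> ramp' u = 0"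
 by (simp_all add: ramp_def ramp'_def power2_eq_square algebra_simps)

lemma ramp'_nonneg: "0 <= ramp' u"
 by (auto simp: ramp'_def max_def)

lemma ramp_range: "0 <= ramp u" "ramp u <= 1"
proof -
 have mono: "ramp x <= ramp y" if "x <= y" for x y
  using DERIV_nonneg_imp_nondecreasing[OF that, of ramp] ramp_DERIV ramp'_nonneg by blast
 show "0 <= ramp u" using mono[of "min 0 u" u] ramp_le0(1)[of "min 0 u"] by simp
 show "ramp u <= 1" using mono[of u "max 1 u"] ramp_ge1(1)[of "max 1 u"] by simp
qed

lemma continuous_ramp': "continuous_on A ramp'"
 unfolding ramp'_def[abs_def] by (intro continuous_intros)

text \<open>Rises on [a, a + 1/k] and falls on [b - 1/k, b]. The shift by 1 places the descent to
  the left of \<open>b\<close>, so that value and derivative both vanish at and beyond the two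
  ends.\<close>

definition cut :: "real => real => real => real => real" where
 "cut k a b t = ramp (k * (t - a)) - ramp (k * (t - b) + 1)"

definition cut' :: "real => real => real => real => real" where
 "cut' k a b t = k * ramp' (k * (t - a)) - k * ramp' (k * (t - b) + 1)"

lemma ramp_affine_DERIV: "((%t. ramp (k * t + c)) has_real_derivative k * ramp' (k * t + c)) (at t)"
proof -
 have "((%t. ramp (k * t + c)) has_real_derivative ramp' (k * t + c) * k) (at t)"
  by (rule DERIV_chain2[where f=ramp and g="%t. k * t + c", OF ramp_DERIV]) (auto intro!: derivative_eq_intros)
 then show ?thesis by (metis mult.commute)
qed

lemma cut_DERIV: "(cut k a b has_real_derivative cut' k a b t) (at t)"
 unfolding cut_def[abs_def] cut'_def
 using ramp_affine_DERIV[of k "- k * a" t] ramp_affine_DERIV[of k "1 - k * b" t]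
 by (auto intro!: DERIV_diff simp: algebra_simps)

lemma cut_outside:
 assumes "0 < k" "1 <= k * (b - a)" "t <= a \<or> b <= t"
 shows "cut k a b t = 0" "cut' k a b t = 0"
proof -
 have "k * (t - a) <= 0 & k * (t - b) + 1 <= 0 \<or> 1 <= k * (t - a) & 1 <= k * (t - b) + 1"
  using assms(3)
 proof
  assume "t <= a"
  then have "k * (t - a) <= 0" using assms(1) by (simp add: mult_le_0_iff)
  moreover have "k * (t - b) = k * (t - a) - k * (b - a)" by (simp add: algebra_simps)
  ultimately show ?thesis using assms(2) by linarith
 next
  assume "b <= t"
  then have "0 <= k * (t - b)" using assms(1) by simp
  moreover have "k * (t - b) = k * (t - a) - k * (b - a)" by (simp add: algebra_simps)
  ultimately show ?thesis using assms(2) by linarith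
 qed
 then show "cut k a b t = 0" "cut' k a b t = 0"
  by (auto simp: cut_def cut'_def ramp_le0 ramp_ge1)
qed

lemma cut_abs_le: "\<bar>cut k a b t\<bar> <= 1"
 using ramp_range[of "k * (t - a)"] ramp_range[of "k * (t - b) + 1"] by (simp add: cut_def abs_le_iff)

lemma continuous_cut': "continuous_on A (cut' k a b)"
 unfolding cut'_def[abs_def]
 by (intro continuous_intros continuous_on_compose2[OF continuous_ramp'[of UNIV]]) auto

lemma continuous_cut: "continuous_on A (cut k a b)"
 using cut_DERIV by (meson DERIV_isCont continuous_at_imp_continuous_on)

lemma approximate_identity:
 fixes m :: "real => real"
 assumes m: "continuous_on {a..b} m" and c: "c \<in> {a..b}"
  and q: "!!k t. 0 <= q k t" "!!k. continuous_on {a..b} (q k)"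
   "!!k. (LINT t:{a..b}|lborel. q k t) = 1" "!!k t. t \<in> {a..b} ==> 1 / real (Suc k) < \<bar>t - c\<bar> ==> q k t = 0"
 shows "(%k. LINT t:{a..b}|lborel. q k t * m t) ----> m c"
proof (rule LIMSEQ_I)
 fix e :: real assume e: "0 < e"
 from mp[OF spec[OF bspec[OF m[unfolded continuous_on_iff] c]] half_gt_zero[OF e]]
 obtain d where d: "0 < d" "\<forall>t\<in>{a..b}. dist t c < d --> dist (m t) (m c) < e / 2"
  by blast
 obtain N where N: "1 / d < real N" using reals_Archimedean2 by blast
 have iq: "set_integrable lborel {a..b} (%t. q k t * f t)" if "continuous_on {a..b} f" for k f
  using q(2) that by (intro borel_integrable_atLeastAtMost' continuous_intros)
 show "\<exists>N. \<forall>k\<ge>N. norm ((LINT t:{a..b}|lborel. q k t * m t) - m c) < e"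
 proof (intro exI[of _ N] allI impI)
  fix k assume k: "N <= k"
  have kd: "1 / real (Suc k) < d"
  proof -
   have "1 / d < real (Suc k)" using N k by linarith
   then show ?thesis using d(1) by (simp add: field_simps)
  qed
  have 1: "(LINT t:{a..b}|lborel. q k t * m c) = m c"
   using q(3)[of k] by simp
  have "(LINT t:{a..b}|lborel. q k t * m t) - m c = (LINT t:{a..b}|lborel. q k t * m t - q k t * m c)"
   using set_integral_diff(2)[OF iq[OF m, of k] iq[OF continuous_on_const[of _ "m c"], of k]] 1 by simp
  also have "norm ... <= (LINT t:{a..b}|lborel. q k t * (e / 2))"
   unfolding set_lebesgue_integral_def real_norm_def
  proof (rule integral_abs_le)
   show "integrable lborel (%t. indicator {a..b} t *\<^sub>R (q k t * m t - q k t * m c))"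
    using set_integral_diff(1)[OF iq[OF m, of k] iq[OF continuous_on_const[of _ "m c"], of k]]
    by (simp add: set_integrable_def)
   show "integrable lborel (%t. indicator {a..b} t *\<^sub>R (q k t * (e / 2)))"
    using iq[OF continuous_on_const[of _ "e/2"], of k] by (simp add: set_integrable_def)
   fix t
   have "\<bar>q k t * m t - q k t * m c\<bar> <= q k t * (e / 2)" if t: "t \<in> {a..b}"
   proof (cases "1 / real (Suc k) < \<bar>t - c\<bar>")
    case False
    then have "\<bar>m t - m c\<bar> <= e / 2" using d(2) t kd by (force simp: dist_real_def)
    then have "q k t * \<bar>m t - m c\<bar> <= q k t * (e / 2)" using q(1) by (intro mult_left_mono) auto
    then show ?thesis by (simp add: right_diff_distrib[symmetric] abs_mult q(1))
   qed (use q(4)[OF t] in simp)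
   then show "\<bar>indicator {a..b} t *\<^sub>R (q k t * m t - q k t * m c)\<bar> <= indicator {a..b} t *\<^sub>R (q k t * (e / 2))"
    by (auto simp: indicator_def)
  qed
  also have "... = e / 2" using q(3)[of k] by simp
  also have "... < e" using e by simp
  finally show "norm ((LINT t:{a..b}|lborel. q k t * m t) - m c) < e" .
 qed
qed

text \<open>A factor that vanishes together with its derivative makes the product with any bounded
  function differentiable. It is applied at and beyond the ends of [a,b], where the clamped test
  function may have a kink.\<close>

lemma zero_mult_DERIV:
 fixes \<theta> q :: "real => real"
 assumes "(\<theta> has_real_derivative 0) (at t)" "\<theta> t = 0" "!!s. \<bar>q s\<bar> <= B"
 shows "((%s. \<theta> s * q s) has_real_derivative 0) (at t)"
 unfolding DERIV_def
proof (rule Lim_null_comparison)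
 have *: "((%h. (\<theta> (t + h) - \<theta> t) / h) \<longlongrightarrow> 0) (at 0)" using assms(1) by (simp add: DERIV_def)
 then show "((%h. B * \<bar>(\<theta> (t + h) - \<theta> t) / h\<bar>) \<longlongrightarrow> 0) (at 0)"
  using tendsto_mult[OF tendsto_const[of B] tendsto_rabs[OF *]] by (simp only: abs_zero mult_zero_right)
 have "norm ((\<theta> (t + h) * q (t + h) - \<theta> t * q t) / h) <= B * \<bar>(\<theta> (t + h) - \<theta> t) / h\<bar>" for h
 proof -
  have "\<bar>q (t + h)\<bar> * \<bar>\<theta> (t + h) / h\<bar> <= B * \<bar>\<theta> (t + h) / h\<bar>" by (intro mult_right_mono assms) auto
  then show ?thesis using assms(2) by (simp add: abs_mult mult.commute)
 qed
 then show "\<forall>\<^sub>F h in at 0. norm ((\<theta> (t + h) * q (t + h) - \<theta> t * q t) / h) <= B * \<bar>(\<theta> (t + h) - \<theta> t) / h\<bar>" by simp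
qed

definition clampab :: "real => real => real => real" where "clampab a b t = max a (min b t)"

text \<open>A test function on [a,b] is frozen outside the interval by clamping and then multiplied
  by the cutoff, which makes it a test function on [0,1] with zero boundary values in time.\<close>

lemma test_on_cutoff:
 assumes t: "test_on a b ph pht" and ab: "a < b" and k: "0 < k" "1 <= k * (b - a)"
 shows "test_on 0 1 (%t x. cut k a b t * ph (clampab a b t) x)
  (%t x. cut' k a b t * ph (clampab a b t) x + cut k a b t * pht (clampab a b t) x)"
  and "!!t x. grad (%x. cut k a b t * ph (clampab a b t) x) x = cut k a b t *\<^sub>R grad (ph (clampab a b t)) x"
  and "!!t x. laplacian (%x. cut k a b t * ph (clampab a b t) x) x = cut k a b t * laplacian (ph (clampab a b t)) x"
proof -
 have cl: "clampab a b t \<in> {a..b}" for t using ab by (auto simp: clampab_def)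
 have cc: "continuous_on A (clampab a b)" for A unfolding clampab_def[abs_def] by (intro continuous_intros)
 have sm: "smooth_k n (ph (clampab a b t))" for t n using t cl[of t] unfolding test_on_def smooth_fun_iff_smooth_k by blast
 have df: "ph (clampab a b t) differentiable (at x)" for t x by (rule smooth_k_differentiable[OF sm])
 show G: "grad (%x. cut k a b t * ph (clampab a b t) x) x = cut k a b t *\<^sub>R grad (ph (clampab a b t)) x" for t x
  by (rule grad_cmult[OF df])
 show L: "laplacian (%x. cut k a b t * ph (clampab a b t) x) x = cut k a b t * laplacian (ph (clampab a b t)) x" for t x
  by (rule laplacian_cmult[OF sm])
 have c: "strip_cont a b (%(t, x). ph t x)" "strip_cont a b (%(t, x). pht t x)"
   "strip_cont a b (%(t, x). grad (ph t) x)" "strip_cont a b (%(t, x). laplacian (ph t) x)"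
  using t unfolding test_on_def by auto
 have cp: "continuous_on ({0..1} \<times> UNIV) (%z::real \<times> (real^'a). (clampab a b (fst z), snd z))"
  by (intro continuous_intros continuous_on_compose2[OF cc[of UNIV]]) auto
 have r: "(%z::real \<times> (real^'a). (clampab a b (fst z), snd z)) ` ({0..1} \<times> UNIV) \<subseteq> {a..b} \<times> UNIV" using cl by auto
 note cs = continuous_on_compose2[OF c(1) cp r] continuous_on_compose2[OF c(2) cp r]
   continuous_on_compose2[OF c(3) cp r] continuous_on_compose2[OF c(4) cp r]
 have cf: "continuous_on ({0..1} \<times> UNIV) (%z::real \<times> (real^'a). cut k a b (fst z))" "continuous_on ({0..1} \<times> UNIV) (%z::real \<times> (real^'a). cut' k a b (fst z))"
  by (rule continuous_on_compose2[OF continuous_cut[of UNIV]] continuous_on_compose2[OF continuous_cut'[of UNIV]]; auto intro!: continuous_intros)+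
 obtain B where B: "!!t x. t \<in> {a..b} ==> \<bar>ph t x\<bar> <= B" by (rule test_on_bounds[OF t ab]) blast
 have der: "((%s. cut k a b s * ph (clampab a b s) x) has_real_derivative
   cut' k a b t * ph (clampab a b t) x + cut k a b t * pht (clampab a b t) x) (at t)" for s x t
 proof (cases "a < t & t < b")
  case True
  then have id: "clampab a b t = t" by (simp add: clampab_def)
  have "((%s. ph s x) has_real_derivative pht t x) (at t within {a..b})" using True t unfolding test_on_def by auto
  then have "((%s. ph s x) has_real_derivative pht t x) (at t)" using True by (simp add: at_within_Icc_at)
  from DERIV_mult[OF cut_DERIV[of k a b t] this]
  have "((%s. cut k a b s * ph s x) has_real_derivative cut' k a b t * ph t x + cut k a b t * pht t x) (at t)"
   by (simp add: algebra_simps)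
  then show ?thesis unfolding id
   by (rule has_field_derivative_transform_within_open[where S="{a<..<b}"]) (use True in \<open>auto simp: clampab_def\<close>)
 next
  case False
  then have o: "cut k a b t = 0" "cut' k a b t = 0" using cut_outside[OF k] by auto
  have "((%s. cut k a b s * ph (clampab a b s) x) has_real_derivative 0) (at t)"
   using cut_DERIV[of k a b t] o B[OF cl] by (intro zero_mult_DERIV[where B=B]) auto
  then show ?thesis by (simp add: o)
 qed
 from t obtain K where K: "compact K" "!!t x. t \<in> {a..b} ==> x \<notin> K ==> ph t x = 0" unfolding test_on_def by blast
 show "test_on 0 1 (%t x. cut k a b t * ph (clampab a b t) x)
  (%t x. cut' k a b t * ph (clampab a b t) x + cut k a b t * pht (clampab a b t) x)"
  unfolding test_on_def G L
 proof (intro conjI ballI allI)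
  show "\<exists>K. compact K & (\<forall>t\<in>{0..1}. \<forall>x. x \<notin> K --> cut k a b t * ph (clampab a b t) x = 0)"
   using K cl by auto
  show "smooth_fun (%x. cut k a b t * ph (clampab a b t) x)" for t
   unfolding smooth_fun_iff_smooth_k by (intro allI smooth_k_cmult sm)
  show "((%s. cut k a b s * ph (clampab a b s) x) has_real_derivative
   cut' k a b t * ph (clampab a b t) x + cut k a b t * pht (clampab a b t) x) (at t within {0..1})" for t x
   by (rule has_field_derivative_at_within[OF der])
 qed (use cs cf in \<open>auto simp: case_prod_unfold intro!: continuous_intros\<close>)
qed

text \<open>Testing with the cutoff times \<open>ph\<close> makes both global boundary terms vanish.
  The derivative of the cutoff splits into two approximate identities concentrating at
  \<open>a\<close> and \<open>b\<close>; continuity of t |-> integral of ph_t d nu_t turns them into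
  the boundary terms of the smaller interval.\<close>

lemma fp_local:
 fixes v :: "real => real^'n::finite => real^'n"
 assumes fp: "fp_pair eps nu v" and ab: "0 <= a" "a < b" "b <= 1" and t: "test_on a b ph pht"
 shows "(LINT t:{a..b}|lborel. (LINT x|(nu t). fpgen eps ph pht v t x)) = (LINT x|(nu b). ph b x) - (LINT x|(nu a). ph a x)"
proof -
 note D = fp_pairD[OF fp]
 define m where "m = (%t. \<integral>x. ph t x \<partial>nu t)"
 define w where "w = (%t. \<integral>x. fpgen eps ph pht v t x \<partial>nu t)"
 have sub: "{a..b} \<subseteq> {0..1}" using ab by auto
 have viL: "set_integrable lborel {a..b} (%t. \<integral>x. norm (v t x) \<partial>nu t)"
  by (rule set_integrable_subset[OF D(6)]) (use sub in auto)
 have gi: "!!t. t \<in> {a..b} ==> integrable (nu t) (fpgen eps ph pht v t)" and wi: "set_integrable lborel {a..b} w"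
  unfolding w_def using fpgen_integrable[OF D(1,2) _ viL ab t] D(5) sub by blast+
 from t obtain K where K: "compact K" "!!t x. t \<in> {a..b} ==> x \<notin> K ==> ph t x = 0" unfolding test_on_def by blast
 have c: "strip_cont a b (%(t, x). ph t x)" using t unfolding test_on_def by auto
 have mc: "continuous_on {a..b} m" unfolding m_def by (rule curve_integral_continuous[OF D(1) ab(1,3) K c])
 obtain B where B: "!!t x. t \<in> {a..b} ==> \<bar>ph t x\<bar> <= B" by (rule test_on_bounds[OF t ab(2)]) blast
 have phi_i: "integrable (nu t) (ph t)" if "t \<in> {a..b}" for t
 proof -
  have t01: "t \<in> {0..1}" using that sub by auto
  interpret prob_space "nu t" by (rule D(3)[OF t01])
  have "smooth_k 0 (ph t)" using t that unfolding test_on_def smooth_fun_iff_smooth_k by blast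
  then have "ph t \<in> borel_measurable (nu t)"
   using borel_contI measurable_cong_sets[OF D(4)[OF t01] refl] by auto
  then show ?thesis using B[OF that] by (intro integrable_const_bound[of _ B]) auto
 qed
 obtain N where N: "1 / (b - a) < real N" using reals_Archimedean2 by blast
 \<comment> \<open>The offset \<open>N\<close> guarantees \<open>1 <= kk j * (b - a)\<close> for
   every \<open>j\<close>, so rise and descent of the cutoff do not overlap.\<close>
 define kk where "kk = (%j. real (Suc (N + j)))"
 have kk: "0 < kk j" "1 <= kk j * (b - a)" for j
 proof -
  show "0 < kk j" by (simp add: kk_def)
  have "1 / (b - a) <= kk j" using N by (simp add: kk_def)
  then show "1 <= kk j * (b - a)" using ab by (simp add: field_simps)
 qed
 have id: "(LINT t:{a..b}|lborel. cut' (kk j) a b t * m t + cut (kk j) a b t * w t) = 0" for j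
 proof -
  let ?ph = "%t x. cut (kk j) a b t * ph (clampab a b t) x"
  let ?pht = "%t x. cut' (kk j) a b t * ph (clampab a b t) x + cut (kk j) a b t * pht (clampab a b t) x"
  note T = test_on_cutoff[OF t ab(2) kk[of j]]
  have e: "indicator {0..1} t *\<^sub>R (LINT x|(nu t). fpgen eps ?ph ?pht v t x) = indicator {a..b} t *\<^sub>R (cut' (kk j) a b t * m t + cut (kk j) a b t * w t)" for t
  proof (cases "t \<in> {a..b}")
   case True
   then have cl: "clampab a b t = t" by (auto simp: clampab_def)
   have "fpgen eps ?ph ?pht v t x = cut' (kk j) a b t * ph t x + cut (kk j) a b t * fpgen eps ph pht v t x" for x
    unfolding fpgen_def T(2,3) unfolding cl by (simp add: algebra_simps)
   then show ?thesis using True sub phi_i[OF True] gi[OF True] by (auto simp: m_def w_def indicator_def)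
  next
   case False
   then have "cut (kk j) a b t = 0" "cut' (kk j) a b t = 0" using cut_outside[OF kk[of j]] by auto
   then have "fpgen eps ?ph ?pht v t x = 0" for x unfolding fpgen_def T(2,3) by simp
   then show ?thesis using False by simp
  qed
  have z: "cut (kk j) a b 0 = 0" "cut (kk j) a b 1 = 0" using cut_outside[OF kk[of j]] ab by auto
  show ?thesis using D(7)[OF T(1)] unfolding set_lebesgue_integral_def e by (simp add: z)
 qed
 have wm: "(%t. indicator {a..b} t *\<^sub>R w t) \<in> borel_measurable lborel" using wi unfolding set_integrable_def by auto
 have cutm[measurable]: "borel_fun (cut k a b)" for k
  by (rule borel_contI[OF continuous_cut])
 have i1: "set_integrable lborel {a..b} (%t. cut (kk j) a b t * w t)" for j
  unfolding set_integrable_def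
 proof (rule integrable_boundI[OF wi[unfolded set_integrable_def]])
  have "(%t. cut (kk j) a b t * (indicator {a..b} t *\<^sub>R w t)) \<in> borel_measurable lborel" using wm by measurable
  then show "(%t. indicator {a..b} t *\<^sub>R (cut (kk j) a b t * w t)) \<in> borel_measurable lborel" by (simp add: ac_simps)
  show "AE t in lborel. norm (indicator {a..b} t *\<^sub>R (cut (kk j) a b t * w t)) <= norm (indicator {a..b} t *\<^sub>R w t)"
   using cut_abs_le[of "kk j" a b] by (intro AE_I2) (simp add: abs_mult indicator_def mult_left_le_one_le)
 qed
 have l1: "(%j. LINT t:{a..b}|lborel. cut (kk j) a b t * w t) ----> (LINT t:{a..b}|lborel. w t)"
  unfolding set_lebesgue_integral_def
 proof (rule integral_dominated_convergence[where w="%t. norm (indicator {a..b} t *\<^sub>R w t)"])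
  show "integrable lborel (%t. norm (indicator {a..b} t *\<^sub>R w t))" using wi unfolding set_integrable_def by (rule integrable_norm)
  show "(%t. indicator {a..b} t *\<^sub>R w t) \<in> borel_measurable lborel" by (rule wm)
  show "(%t. indicator {a..b} t *\<^sub>R (cut (kk j) a b t * w t)) \<in> borel_measurable lborel" for j
   using i1[of j] unfolding set_integrable_def by auto
  show "AE t in lborel. norm (indicator {a..b} t *\<^sub>R (cut (kk j) a b t * w t)) <= norm (indicator {a..b} t *\<^sub>R w t)" for j
   using cut_abs_le[of "kk j" a b] by (intro AE_I2) (simp add: abs_mult indicator_def mult_left_le_one_le)
  \<comment> \<open>At the two ends the cutoff is 0 for every \<open>j\<close>, so convergence to
    the indicator holds only off this null set.\<close>
  have "AE t in lborel. t ~= a" "AE t in lborel. t ~= b" by (rule AE_lborel_singleton)+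
  then show "AE t in lborel. (%j. indicator {a..b} t *\<^sub>R (cut (kk j) a b t * w t)) ----> indicator {a..b} t *\<^sub>R w t"
  proof eventually_elim
   case (elim t)
   show ?case
   proof (cases "t \<in> {a..b}")
    case True
    with elim have tt: "a < t" "t < b" by auto
    obtain M1 where M1: "1 / (t - a) < real M1" using reals_Archimedean2 by blast
    obtain M2 where M2: "1 / (b - t) < real M2" using reals_Archimedean2 by blast
    have "\<forall>\<^sub>F j in sequentially. cut (kk j) a b t = 1"
    proof (rule eventually_sequentiallyI[of "max M1 M2"])
     fix j assume j: "max M1 M2 <= j"
     have "1 / (t - a) <= kk j" "1 / (b - t) <= kk j" using j M1 M2 by (auto simp: kk_def)
     then have "1 <= kk j * (t - a)" "1 <= kk j * (b - t)" using tt by (auto simp: field_simps)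
     moreover from this(2) have "kk j * (t - b) + 1 <= 0" by (simp add: algebra_simps)
     ultimately show "cut (kk j) a b t = 1" by (simp add: cut_def ramp_ge1 ramp_le0)
    qed
    then have "(%j. cut (kk j) a b t) ----> 1" by (rule tendsto_eventually)
    from tendsto_mult_right[OF this, of "w t"] show ?thesis using True by simp
   qed simp
  qed
 qed
 define q1 where "q1 = (%j t. kk j * ramp' (kk j * (t - a)))"
 define q2 where "q2 = (%j t. kk j * ramp' (kk j * (t - b) + 1))"
 have q0: "0 <= q1 j t" "0 <= q2 j t" for j t using kk(1)[of j] ramp'_nonneg by (auto simp: q1_def q2_def)
 have qc: "continuous_on A (q1 j)" "continuous_on A (q2 j)" for j A unfolding q1_def q2_def
  by (intro continuous_intros continuous_on_compose2[OF continuous_ramp'[of UNIV]]; auto)+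
 have FTC: "(LINT t:{a..b}|lborel. kk j * ramp' (kk j * t + c)) = ramp (kk j * b + c) - ramp (kk j * a + c)" for j c
 proof -
  have "contU (%t. kk j * ramp' (kk j * t + c))"
   by (intro continuous_intros continuous_on_compose2[OF continuous_ramp'[of UNIV]]) auto
  then have "(LINT t|lborel. kk j * ramp' (kk j * t + c) * indicator {a..b} t) = ramp (kk j * b + c) - ramp (kk j * a + c)"
   using ab by (intro integral_FTC_Icc_real ramp_affine_DERIV) (auto simp: continuous_on_eq_continuous_at)
  then show ?thesis unfolding set_lebesgue_integral_def by (simp add: mult.commute)
 qed
 have l2: "(%j. LINT t:{a..b}|lborel. q1 j t * m t) ----> m a"
 proof (rule approximate_identity[OF mc _ q0(1) qc(1)])
  show "(LINT t:{a..b}|lborel. q1 j t) = 1" for j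
   using FTC[of j "- kk j * a"] kk[of j] by (simp add: q1_def right_diff_distrib ramp_le0 ramp_ge1)
  fix j t assume "t \<in> {a..b}" "1 / real (Suc j) < \<bar>t - a\<bar>"
  then have "1 / real (Suc j) < t - a" by auto
  then have "1 < real (Suc j) * (t - a)" by (simp add: field_simps)
  also have "... <= kk j * (t - a)" using \<open>t \<in> {a..b}\<close> by (intro mult_right_mono) (auto simp: kk_def)
  finally show "q1 j t = 0" by (simp add: q1_def ramp_ge1)
 qed (use ab in auto)
 have l3: "(%j. LINT t:{a..b}|lborel. q2 j t * m t) ----> m b"
 proof (rule approximate_identity[OF mc _ q0(2) qc(2)])
  show "(LINT t:{a..b}|lborel. q2 j t) = 1" for j
   using FTC[of j "1 - kk j * b"] kk[of j] by (simp add: q2_def right_diff_distrib ramp_le0 ramp_ge1 add.commute diff_add_eq add_diff_eq)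
  fix j t assume "t \<in> {a..b}" "1 / real (Suc j) < \<bar>t - b\<bar>"
  then have "1 / real (Suc j) < b - t" by auto
  then have "1 < real (Suc j) * (b - t)" by (simp add: field_simps)
  also have "... <= kk j * (b - t)" using \<open>t \<in> {a..b}\<close> by (intro mult_right_mono) (auto simp: kk_def)
  finally have "kk j * (t - b) + 1 <= 0" by (simp add: algebra_simps)
  then show "q2 j t = 0" by (simp add: q2_def ramp_le0)
 qed (use ab in auto)
 have qi: "set_integrable lborel {a..b} (%t. q1 j t * m t)" "set_integrable lborel {a..b} (%t. q2 j t * m t)" for j
  by (intro borel_integrable_atLeastAtMost' continuous_intros mc qc)+
 have split: "(LINT t:{a..b}|lborel. q1 j t * m t) - (LINT t:{a..b}|lborel. q2 j t * m t) + (LINT t:{a..b}|lborel. cut (kk j) a b t * w t) = 0" for j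
 proof -
  have "(LINT t:{a..b}|lborel. q1 j t * m t) - (LINT t:{a..b}|lborel. q2 j t * m t) + (LINT t:{a..b}|lborel. cut (kk j) a b t * w t)
   = (LINT t:{a..b}|lborel. (q1 j t * m t - q2 j t * m t) + cut (kk j) a b t * w t)"
   using set_integral_add(2)[OF set_integral_diff(1)[OF qi[of j]] i1[of j]] set_integral_diff(2)[OF qi[of j]] by simp
  also have "... = (LINT t:{a..b}|lborel. cut' (kk j) a b t * m t + cut (kk j) a b t * w t)"
   by (simp add: q1_def q2_def cut'_def left_diff_distrib)
  finally show ?thesis using id by simp
 qed
 have "(%j. (LINT t:{a..b}|lborel. q1 j t * m t) - (LINT t:{a..b}|lborel. q2 j t * m t) + (LINT t:{a..b}|lborel. cut (kk j) a b t * w t))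
   ----> m a - m b + (LINT t:{a..b}|lborel. w t)"
  by (intro tendsto_intros l1 l2 l3)
 then have "m a - m b + (LINT t:{a..b}|lborel. w t) = 0" unfolding split by (simp add: LIMSEQ_const_iff)
 then show ?thesis unfolding m_def w_def by simp
qed

section \<open>The dual lower bound for the kinetic cost\<close>

lemma gauss_class_const_bounded:
 assumes [measurable]: "borel_fun h" and "!!y. \<bar>h y\<bar> <= M"
 shows "h \<in> gauss_class 0"
 using assms by (intro gauss_classI_bounded[of _ M]) auto

lemma heat_sg_range:
 fixes h :: "real^'n::finite => real"
 assumes [measurable]: "borel_fun h" and c: "0 <= c" and bd: "!!y. c <= h y" "!!y. h y <= M" and s: "0 < s"
 shows "c <= heat_sg s h x" "heat_sg s h x <= M"
proof -
 have "\<bar>h y\<bar> <= M" for y using bd[of y] c by simp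
 then have h: "h \<in> gauss_class 0" by (intro gauss_class_const_bounded[of _ M]) auto
 have i: "integrable lborel (%y. h y * hk s x y)" using gauss_class_integrable_kernel[OF h s] by simp
 have k: "integrable lborel (%y. d * hk s x y)" "(LINT y|lborel. d * hk s x y) = d" for d
  using integrable_heat_kernel[OF s, of x] integral_heat_kernel[OF s, of x] by auto
 have "(LINT y|lborel. c * hk s x y) <= heat_sg s h x"
  unfolding heat_sg_def by (intro integral_mono k i mult_right_mono bd heat_kernel_nonneg)
 then show "c <= heat_sg s h x" by (simp only: k)
 have "heat_sg s h x <= (LINT y|lborel. M * hk s x y)"
  unfolding heat_sg_def by (intro integral_mono k i mult_right_mono bd heat_kernel_nonneg)
 then show "heat_sg s h x <= M" by (simp only: k)
qed

lemma hgrad_nth: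
 fixes w :: "real^'n::finite => real"
 assumes w: "w \<in> gauss_class kap" and s: "0 < s" "kap * s < 1"
 shows "hgrad s w x $ i = (1 / s) * (LINT y|lborel. (w y * hk s x y) * (y $ i - x $ i))"
  "integrable lborel (%y. (w y * hk s x y) * (y $ i - x $ i))"
proof -
 have 1: "integrable lborel (%y. y $ i * w y * hk s x y)"
  by (rule gauss_class_integrable_kernel[OF gauss_class_nth[OF w] s])
 have 2: "integrable lborel (%y. w y * hk s x y)" by (rule gauss_class_integrable_kernel[OF w s])
 have eq: "(%y. (w y * hk s x y) * (y $ i - x $ i)) = (%y. y $ i * w y * hk s x y - x $ i * (w y * hk s x y))"
  by (auto simp: algebra_simps)
 show "integrable lborel (%y. (w y * hk s x y) * (y $ i - x $ i))" unfolding eq using 1 2 by simp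
 have "(LINT y|lborel. (w y * hk s x y) * (y $ i - x $ i)) = heat_sg s (%y. y $ i * w y) x - x $ i * heat_sg s w x"
  unfolding eq using 1 2 by (simp add: heat_sg_def)
 then show "hgrad s w x $ i = (1 / s) * (LINT y|lborel. (w y * hk s x y) * (y $ i - x $ i))"
  unfolding hgrad_def hvec_def by (simp add: mult.commute)
qed

text \<open>A first moment is traded for a doubled variance through z exp(-z^2 / 2) <= exp(-z^2 /
  4); the power of 2 is the quotient of the normalising constants.\<close>

lemma norm_mult_heat_kernel_le:
 fixes x y :: "real^'n::finite"
 assumes s: "0 < s"
 shows "norm (y - x) * hk s x y <= sqrt s * 2 powr (real CARD('n) / 2) * hk (2 * s) x y"
proof -
 define z where "z = norm (y - x) / sqrt s"
 have z: "norm (y - x) = sqrt s * z" using s by (simp add: z_def)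
 have zz: "(norm (x - y))^2 = s * z\<^sup>2" using s by (simp add: z power_mult_distrib norm_minus_commute[of x y])
 have "0 <= (1 - z / 2)\<^sup>2" by simp
 then have "z <= 1 + z\<^sup>2 / 4" by (simp add: power2_eq_square algebra_simps)
 also have "... <= exp (z\<^sup>2 / 4)" by (rule exp_ge_add_one_self)
 finally have "z * exp (- (z\<^sup>2 / 2)) <= exp (z\<^sup>2 / 4) * exp (- (z\<^sup>2 / 2))" by (intro mult_right_mono) auto
 then have ze: "z * exp (- (z\<^sup>2 / 2)) <= exp (- (z\<^sup>2 / 4))" by (simp add: mult_exp_exp)
 have p: "(2 * pi * s) powr (- real CARD('n) / 2) = 2 powr (real CARD('n) / 2) * (2 * pi * (2 * s)) powr (- real CARD('n) / 2)"
 proof -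
  have "2 powr (real CARD('n) / 2) * 2 powr (real CARD('n) / 2) = (2::real) powr real CARD('n)" by (simp flip: powr_add)
  then show ?thesis using s by (simp add: powr_mult powr_minus field_simps)
 qed
 have "norm (y - x) * hk s x y = sqrt s * (2 * pi * s) powr (- real CARD('n) / 2) * (z * exp (- (z\<^sup>2 / 2)))"
  unfolding heat_kernel_def zz z using s by simp
 also have "... <= sqrt s * (2 * pi * s) powr (- real CARD('n) / 2) * exp (- (z\<^sup>2 / 4))"
  using s by (intro mult_left_mono ze) auto
 also have "... = sqrt s * 2 powr (real CARD('n) / 2) * hk (2 * s) x y"
  unfolding heat_kernel_def zz p using s by simp
 finally show ?thesis .
qed

text \<open>The bound is uniform for heat times at least \<open>\<delta>\<close>, so the dual
  potential has bounded gradient over a whole closed time interval.\<close>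

lemma hgrad_bound:
 fixes h :: "real^'n::finite => real"
 assumes [measurable]: "borel_fun h" and bd: "!!y. \<bar>h y\<bar> <= M" and s: "\<delta> <= s" and d: "0 < \<delta>"
 shows "norm (hgrad s h x) <= real CARD('n) * (M * 2 powr (real CARD('n) / 2) / sqrt \<delta>)"
proof -
 have s0: "0 < s" using s d by simp
 have h: "h \<in> gauss_class 0" using bd by (intro gauss_class_const_bounded) auto
 have M: "0 <= M" using bd[of 0] by simp
 let ?P = "2 powr (real CARD('n) / 2)"
 have nn: "0 <= M * ?P" using M by simp
 have comp: "\<bar>hgrad s h x $ i\<bar> <= M * ?P / sqrt \<delta>" for i
 proof -
  note H = hgrad_nth[OF h s0, of x i]
  have "\<bar>\<integral>y. (h y * hk s x y) * (y $ i - x $ i) \<partial>lborel\<bar> <= (LINT y|lborel. (M * sqrt s * ?P) * hk (2 * s) x y)"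
  proof (rule integral_abs_le)
   show "integrable lborel (%y. (M * sqrt s * ?P) * hk (2 * s) x y)"
    using s0 by (intro integrable_mult_right integrable_heat_kernel) auto
   fix y :: "real^'n"
   have "\<bar>y $ i - x $ i\<bar> <= norm (y - x)" using component_le_norm_cart[of "y - x" i] by simp
   then have "\<bar>h y\<bar> * (\<bar>y $ i - x $ i\<bar> * hk s x y) <= M * (norm (y - x) * hk s x y)"
    using M bd by (intro mult_mono mult_right_mono heat_kernel_nonneg) (auto simp: heat_kernel_nonneg)
   also have "... <= M * (sqrt s * ?P * hk (2 * s) x y)"
    by (intro mult_left_mono norm_mult_heat_kernel_le s0 M)
   finally show "\<bar>(h y * hk s x y) * (y $ i - x $ i)\<bar> <= (M * sqrt s * ?P) * hk (2 * s) x y"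
    by (simp add: abs_mult heat_kernel_nonneg ac_simps)
  qed (use H(2) in simp)
  also have "... = M * sqrt s * ?P" using integral_heat_kernel[of "2 * s" x] s0 by simp
  finally have "\<bar>hgrad s h x $ i\<bar> <= (1 / s) * (M * sqrt s * ?P)"
   using H(1) s0 by (simp add: abs_mult divide_right_mono)
  also have "... = M * ?P / sqrt s"
   using s0 by (simp add: field_simps real_sqrt_mult_self flip: power2_eq_square)
  also have "... <= M * ?P / sqrt \<delta>" using s d nn by (intro divide_left_mono) auto
  finally show ?thesis .
 qed
 have "norm (hgrad s h x) <= (\<Sum>i\<in>UNIV. \<bar>hgrad s h x $ i\<bar>)" by (rule norm_le_l1_cart)
 also have "... <= (\<Sum>i\<in>(UNIV::'n set). M * ?P / sqrt \<delta>)" by (intro sum_mono comp) 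
 finally show ?thesis by simp
qed

lemma fp_energy_measurable:
 fixes v :: "real => real^'n::finite => real^'n"
 assumes "fp_pair eps nu v"
 shows "(%t. indicator {0..1} t * (\<integral>\<^sup>+x. ennreal ((norm (v t x))^2 / 2) \<partial>nu t)) \<in> borel_measurable borel"
proof -
 note D = fp_pairD[OF assms]
 have "borel_fun (%(t, x). ennreal ((norm (v t x))^2 / 2))"
  using D(2) by (auto simp: case_prod_unfold)
 from prob_curve_nn_integral_measurable[OF D(1) this]
 have "(%t. indicator {0..1} t * (\<integral>\<^sup>+x. ennreal ((norm (v t x))^2 / 2) \<partial>nu (clamp01 t))) \<in> borel_measurable borel" by measurable
 also have "(%t. indicator {0..1} t * (\<integral>\<^sup>+x. ennreal ((norm (v t x))^2 / 2) \<partial>nu (clamp01 t)))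
   = (%t. indicator {0..1} t * (\<integral>\<^sup>+x. ennreal ((norm (v t x))^2 / 2) \<partial>nu t))"
  by (auto simp: indicator_def clamp01_id)
 finally show ?thesis .
qed

lemma scale_le_half_square:
 fixes v p :: "'a::real_inner"
 assumes "0 <= b" "b <= 1"
 shows "b * (v \<bullet> p - (norm p)\<^sup>2 / 2) <= (norm v)^2 / 2"
proof -
 have "0 <= (norm (v - p))^2" by simp
 then have "v \<bullet> p - (norm p)\<^sup>2 / 2 <= (norm v)^2 / 2"
  unfolding power2_norm_eq_inner by (simp add: inner_diff_left inner_diff_right inner_commute)
 then have "b * (v \<bullet> p - (norm p)\<^sup>2 / 2) <= b * ((norm v)^2 / 2)" using assms by (intro mult_left_mono) auto
 also have "... <= 1 * ((norm v)^2 / 2)" using assms by (intro mult_right_mono) auto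
 finally show ?thesis by simp
qed

text \<open>The extra heat time \<open>\<delta>\<close> keeps the potential smooth, with bounded
  gradient, up to \<open>t = b\<close>. With the Hamilton--Jacobi--Bellman equation the generator
  becomes v.p - |p|^2 / 2, at most |v|^2 / 2 by Young. The spatial cutoff costs O(1/R), paid for by
  the integrability of |v| alone.\<close>

lemma fp_lower_smooth:
 fixes v :: "real => real^'n::finite => real^'n" and h :: "real^'n => real"
 assumes fp: "fp_pair eps nu v" and eps: "0 < eps" and ab: "0 <= a" "a < b" "b <= 1" and d: "0 < \<delta>"
  and hm[measurable]: "borel_fun h" and c: "0 < c" and hb: "!!y. c <= h y" "!!y. h y <= M"
  and fin: "(\<integral>\<^sup>+t\<in>{a..b}. (\<integral>\<^sup>+x. ennreal ((norm (v t x))^2 / 2) \<partial>nu t) \<partial>lborel) < \<infinity>"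
 shows "(LINT x|(nu b). eps * ln (heat_sg \<delta> h x)) - (LINT x|(nu a). eps * ln (heat_sg (eps * (b - a) + \<delta>) h x))
   <= enn2real (\<integral>\<^sup>+t\<in>{a..b}. (\<integral>\<^sup>+x. ennreal ((norm (v t x))^2 / 2) \<partial>nu t) \<partial>lborel)"
proof -
 note D = fp_pairD[OF fp]
 have sub: "{a..b} \<subseteq> {0..1}" using ab by auto
 have hM: "\<bar>h y\<bar> <= M" for y using hb[of y] c by simp
 have h: "h \<in> gauss_class 0" using hM by (intro gauss_class_const_bounded) auto
 define \<sigma> where "\<sigma> = (%t. eps * (b - t) + \<delta>)"
 have \<sigma>: "\<delta> <= \<sigma> t" "0 < \<sigma> t" if "t \<in> {a..b}" for t using that eps d by (auto simp: \<sigma>_def add_nonneg_pos)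
 define u where "u = (%t. heat_sg (\<sigma> t) h)"
 have u: "c <= u t x" "u t x <= M" "0 < u t x" if "t \<in> {a..b}" for t x
  using heat_sg_range[OF hm less_imp_le[OF c] hb \<sigma>(2)[OF that], of x] c by (auto simp: u_def)
 define \<psi> where "\<psi> = (%t x. eps * ln (u t x))"
 define \<Psi> where "\<Psi> = eps * (\<bar>ln c\<bar> + \<bar>ln M\<bar>)"
 have \<Psi>: "\<bar>\<psi> t x\<bar> <= \<Psi>" if "t \<in> {a..b}" for t x
 proof -
  have "ln c <= ln (u t x)" "ln (u t x) <= ln M" using u[OF that, of x] c by auto
  then have "\<bar>ln (u t x)\<bar> <= \<bar>ln c\<bar> + \<bar>ln M\<bar>" by linarith
  then show ?thesis using eps by (simp add: \<psi>_def \<Psi>_def abs_mult)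
 qed
 have \<Psi>0: "0 <= \<Psi>" using eps by (simp add: \<Psi>_def)
 define p where "p = (%t x. (eps / u t x) *\<^sub>R hgrad (\<sigma> t) h x)"
 define G where "G = eps / c * (real CARD('n) * (M * 2 powr (real CARD('n) / 2) / sqrt \<delta>))"
 have G: "norm (p t x) <= G" if "t \<in> {a..b}" for t x
 proof -
  have "eps / u t x * norm (hgrad (\<sigma> t) h x) <= eps / c * (real CARD('n) * (M * 2 powr (real CARD('n) / 2) / sqrt \<delta>))"
   using u[OF that, of x] eps c hgrad_bound[OF hm hM \<sigma>(1)[OF that] d, of x]
   by (intro mult_mono divide_left_mono) auto
  then show ?thesis using u[OF that, of x] eps by (simp add: p_def G_def)
 qed
 have G0: "0 <= G" using G[of a 0] ab by (auto intro: order_trans[OF norm_ge_zero])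
 obtain B where B: "0 <= B" "!!R (x::real^'n). 0 < R ==> norm (grad (bump R) x) <= B / R"
  "!!R (x::real^'n). 0 < R ==> \<bar>laplacian (bump R) x\<bar> <= B / R\<^sup>2" by (rule bump_bounds) blast
 \<comment> \<open>Collects the terms in which a derivative falls on the cutoff: gradient against
   \<open>p\<close>, Laplacian against \<open>\<psi>\<close>, and \<open>v\<close> against the
   gradient. Each is O(1/R), the Laplacian one because \<open>R\<close> is at least 1.\<close>
 define DD where "DD = eps * B * G + \<Psi> * (eps / 2 * B + B)"
 have DD: "0 <= DD" using eps B(1) G0 \<Psi>0 by (simp add: DD_def)
 have smu: "smooth_k k (u t)" if "t \<in> {a..b}" for k t
  unfolding u_def using smooth_k_heat_sg[OF \<sigma>(2)[OF that], of 0 h k] h by simp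
 have smln: "smooth_k k (%x. ln (u t x))" if "t \<in> {a..b}" for k t
  by (rule smooth_k_ln[OF smu[OF that] u(3)[OF that]])
 have sm\<psi>: "smooth_k k (\<psi> t)" if "t \<in> {a..b}" for k t
  unfolding \<psi>_def by (rule smooth_k_cmult[OF smln[OF that]])
 have ldiff: "(%x. ln (u t x)) differentiable (at x)" if "t \<in> {a..b}" for t x by (rule smooth_k_differentiable[OF smln[OF that]])
 have grad\<psi>: "grad (\<psi> t) x = p t x" if t: "t \<in> {a..b}" for t x
 proof -
  have "grad (\<psi> t) x = eps *\<^sub>R grad (%x. ln (u t x)) x" unfolding \<psi>_def by (rule grad_cmult[OF ldiff[OF t]])
  also have "grad (%x. ln (u t x)) x = (1 / u t x) *\<^sub>R grad (u t) x"
   using u(3)[OF t, of x] by (intro grad_comp smooth_k_differentiable[OF smu[OF t]] DERIV_ln_divide)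
  also have "grad (u t) x = hgrad (\<sigma> t) h x" unfolding u_def using grad_heat_sg[OF h \<sigma>(2)[OF t]] by simp
  finally show ?thesis by (simp add: p_def)
 qed
 have lap\<psi>: "laplacian (\<psi> t) x = eps * (2 * htime (\<sigma> t) h x / u t x - (norm (hgrad (\<sigma> t) h x))\<^sup>2 / (u t x)\<^sup>2)" if t: "t \<in> {a..b}" for t x
 proof -
  have "laplacian (\<psi> t) x = eps * laplacian (%x. ln (u t x)) x" unfolding \<psi>_def by (rule laplacian_cmult[OF smln[OF t]])
  also have "laplacian (%x. ln (u t x)) x = laplacian (u t) x / u t x - (norm (grad (u t) x))\<^sup>2 / (u t x)\<^sup>2"
   by (rule laplacian_ln[OF smu[OF t] u(3)[OF t]])
  also have "laplacian (u t) x = 2 * htime (\<sigma> t) h x" unfolding u_def using laplacian_heat_sg[OF h \<sigma>(2)[OF t]] by simp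
  also have "grad (u t) x = hgrad (\<sigma> t) h x" unfolding u_def using grad_heat_sg[OF h \<sigma>(2)[OF t]] by simp
  finally show ?thesis .
 qed
 define \<psi>t where "\<psi>t = (%t x. - eps\<^sup>2 * htime (\<sigma> t) h x / u t x)"
 \<comment> \<open>The time derivative cancels the \<open>htime\<close> term of the Laplacian; what
   survives is the squared-gradient term produced by the logarithm.\<close>
 have hjb: "\<psi>t t x + eps / 2 * laplacian (\<psi> t) x = - (norm (p t x))\<^sup>2 / 2" if t: "t \<in> {a..b}" for t x
  unfolding lap\<psi>[OF t] \<psi>t_def p_def using u(3)[OF t, of x] eps
  by (simp add: power_mult_distrib power_divide) (simp add: field_simps power2_eq_square)
 have der: "((%s. \<psi> s x) has_real_derivative \<psi>t t x) (at t)" if t: "t \<in> {a..b}" for t x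
 proof -
  have "((%s. heat_sg (\<sigma> s) h x) has_real_derivative htime (\<sigma> t) h x * (- eps)) (at t)"
   using heat_sg_DERIV_time[OF h \<sigma>(2)[OF t]]
   by (intro DERIV_chain2[where f="%s. heat_sg s h x" and g=\<sigma>]) (auto simp: \<sigma>_def intro!: derivative_eq_intros)
  then have "((%s. ln (heat_sg (\<sigma> s) h x)) has_real_derivative (1 / heat_sg (\<sigma> t) h x) * (htime (\<sigma> t) h x * (- eps))) (at t)"
   using u(3)[OF t, of x] unfolding u_def by (intro DERIV_chain2[where f=ln] DERIV_ln_divide)
  from DERIV_cmult[OF this, of eps] show ?thesis unfolding \<psi>_def u_def \<psi>t_def by (simp add: power2_eq_square ac_simps)
 qed
 have cp: "strip_cont a b (%z::real \<times> (real^'n). (\<sigma> (fst z), snd z))"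
  unfolding \<sigma>_def by (intro continuous_intros)
 have rg: "(%z::real \<times> (real^'n). (\<sigma> (fst z), snd z)) ` ({a..b} \<times> UNIV) \<subseteq> {p. 0 < fst p & 0 * fst p < 1}" using \<sigma> by auto
 have cu: "strip_cont a b (%z. u (fst z) (snd z))"
  unfolding u_def using continuous_on_compose2[OF continuous_on_heat_sg[OF h] cp rg] by simp
 have cg: "strip_cont a b (%z. hgrad (\<sigma> (fst z)) h (snd z))"
  using continuous_on_compose2[OF continuous_on_hgrad[OF h] cp rg] by simp
 have ct: "strip_cont a b (%z. htime (\<sigma> (fst z)) h (snd z))"
  using continuous_on_compose2[OF continuous_on_htime[OF h] cp rg] by simp
 have un0: "!!z. z \<in> {a..b} \<times> UNIV ==> u (fst z) (snd z) ~= 0" using u(3) by (metis SigmaE fst_conv less_irrefl)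
 have up0: "!!z. z \<in> {a..b} \<times> UNIV ==> 0 < u (fst z) (snd z)" using u(3) by auto
 have c\<psi>: "strip_cont a b (%z. \<psi> (fst z) (snd z))"
  unfolding \<psi>_def using un0 by (intro continuous_intros cu) auto
 have cp': "strip_cont a b (%z. p (fst z) (snd z))"
  unfolding p_def using un0 by (intro continuous_intros cu cg) auto
 have c\<psi>t: "strip_cont a b (%z. \<psi>t (fst z) (snd z))"
  unfolding \<psi>t_def using un0 by (intro continuous_intros cu ct) auto
 have cl: "strip_cont a b (%z. eps * (2 * htime (\<sigma> (fst z)) h (snd z) / u (fst z) (snd z) - (norm (hgrad (\<sigma> (fst z)) h (snd z)))\<^sup>2 / (u (fst z) (snd z))\<^sup>2))"
  using un0 by (intro continuous_intros cu ct cg) auto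
 have cb: "strip_cont a b (%z::real \<times> (real^'n). bump R (snd z))"
   "strip_cont a b (%z::real \<times> (real^'n). grad (bump R) (snd z))"
   "strip_cont a b (%z::real \<times> (real^'n). laplacian (bump R) (snd z))" for R
  by (rule continuous_on_compose2[OF smooth_k_continuous[OF smooth_k_bump[of 0]]] continuous_on_compose2[OF continuous_on_grad[OF smooth_k_bump]]
    continuous_on_compose2[OF continuous_on_laplacian[OF smooth_k_bump]]; auto intro!: continuous_intros)+
 have gradphi: "grad (%x. bump R x * \<psi> t x) x = bump R x *\<^sub>R p t x + \<psi> t x *\<^sub>R grad (bump R) x" if t: "t \<in> {a..b}" for R t x
  by (subst grad_mult[OF smooth_k_differentiable[OF smooth_k_bump] smooth_k_differentiable[OF sm\<psi>[OF t]]]) (simp add: grad\<psi>[OF t])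
 have lapphi: "laplacian (%x. bump R x * \<psi> t x) x = bump R x * laplacian (\<psi> t) x + 2 * (grad (bump R) x \<bullet> p t x) + \<psi> t x * laplacian (bump R) x" if t: "t \<in> {a..b}" for R t x
  by (subst laplacian_mult[OF smooth_k_bump sm\<psi>[OF t]]) (simp add: grad\<psi>[OF t])
 have T: "test_on a b (%t x. bump R x * \<psi> t x) (%t x. bump R x * \<psi>t t x)" if R: "0 < R" for R
  unfolding test_on_def
 proof (intro conjI ballI allI)
  show "\<exists>K. compact K & (\<forall>t\<in>{a..b}. \<forall>x. x \<notin> K --> bump R x * \<psi> t x = 0)"
   by (intro exI[of _ "cball 0 R"] conjI ballI allI impI) (auto intro!: bump_eq_0 R)
  show "smooth_fun (%x. bump R x * \<psi> t x)" if "t \<in> {a..b}" for t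
   unfolding smooth_fun_iff_smooth_k by (intro allI smooth_k_mult smooth_k_bump sm\<psi> that)
  show "((%s. bump R x * \<psi> s x) has_real_derivative bump R x * \<psi>t t x) (at t within {a..b})" if "t \<in> {a..b}" for t x
   by (rule has_field_derivative_at_within[OF DERIV_cmult[OF der[OF that]]])
  show "strip_cont a b (%(t, x). bump R x * \<psi> t x)"
   unfolding case_prod_unfold by (intro continuous_intros cb c\<psi>)
  show "strip_cont a b (%(t, x). bump R x * \<psi>t t x)"
   unfolding case_prod_unfold by (intro continuous_intros cb c\<psi>t)
  have "strip_cont a b (%z. bump R (snd z) *\<^sub>R p (fst z) (snd z) + \<psi> (fst z) (snd z) *\<^sub>R grad (bump R) (snd z))"
   by (intro continuous_intros cb c\<psi> cp')
  then show "strip_cont a b (%(t, x). grad (%x. bump R x * \<psi> t x) x)"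
   by (rule continuous_on_eq) (auto simp: gradphi)
  have "strip_cont a b (%z. bump R (snd z) * (eps * (2 * htime (\<sigma> (fst z)) h (snd z) / u (fst z) (snd z) - (norm (hgrad (\<sigma> (fst z)) h (snd z)))\<^sup>2 / (u (fst z) (snd z))\<^sup>2))
    + 2 * (grad (bump R) (snd z) \<bullet> p (fst z) (snd z)) + \<psi> (fst z) (snd z) * laplacian (bump R) (snd z))"
   by (intro continuous_intros cb c\<psi> cp' cl[unfolded mult.assoc[symmetric]])
  then show "strip_cont a b (%(t, x). laplacian (%x. bump R x * \<psi> t x) x)"
   by (rule continuous_on_eq) (auto simp: lapphi lap\<psi>)
 qed
 let ?E = "%t. \<integral>\<^sup>+x. ennreal ((norm (v t x))^2 / 2) \<partial>nu t"
 have Em: "borel_fun (%t. indicator {a..b} t * ?E t)"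
 proof -
  have "borel_fun (%t. indicator {a..b} t * (indicator {0..1} t * ?E t))"
   using fp_energy_measurable[OF fp] by measurable
  also have "(%t. indicator {a..b} t * (indicator {0..1} t * ?E t)) = (%t. indicator {a..b} t * ?E t)"
   using sub by (auto simp: indicator_def)
  finally show ?thesis .
 qed
 have fin': "(\<integral>\<^sup>+t. indicator {a..b} t * ?E t \<partial>lborel) < \<infinity>" using fin by (simp add: mult.commute)
 have Eae: "AE t in lborel. indicator {a..b} t * ?E t < \<infinity>"
  using nn_integral_PInf_AE[of "%t. indicator {a..b} t * ?E t" lborel] Em fin' by (auto simp: less_top)
 define k where "k = (%t. enn2real (indicator {a..b} t * ?E t))"
 have hk: "has_bochner_integral lborel k (enn2real (\<integral>\<^sup>+t. indicator {a..b} t * ?E t \<partial>lborel))"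
 proof (rule has_bochner_integral_nn_integral)
  show "k \<in> borel_measurable lborel" unfolding k_def using Em by measurable
  have "(\<integral>\<^sup>+t. ennreal (k t) \<partial>lborel) = (\<integral>\<^sup>+t. indicator {a..b} t * ?E t \<partial>lborel)"
   using Eae by (intro nn_integral_cong_AE) (auto simp: k_def less_top elim!: eventually_mono)
  then show "(\<integral>\<^sup>+t. ennreal (k t) \<partial>lborel) = ennreal (enn2real (\<integral>\<^sup>+t. indicator {a..b} t * ?E t \<partial>lborel))"
   using fin' by (simp add: less_top)
 qed (auto simp: k_def)
 have vi: "set_integrable lborel {a..b} (%t. \<integral>x. norm (v t x) \<partial>nu t)"
  by (rule set_integrable_subset[OF D(6)]) (use sub in auto)
 define J where "J = (LINT t:{a..b}|lborel. 1 + (LINT x|(nu t). norm (v t x)))"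
 have vi1: "set_integrable lborel {a..b} (%t. 1 + (LINT x|(nu t). norm (v t x)))"
  by (intro set_integral_add vi borel_integrable_atLeastAtMost') auto
 have main: "(LINT x|(nu b). bump R x * \<psi> b x) - (LINT x|(nu a). bump R x * \<psi> a x)
   <= enn2real (\<integral>\<^sup>+t. indicator {a..b} t * ?E t \<partial>lborel) + DD / R * J" if R: "1 <= R" for R
 proof -
  have R0: "0 < R" using R by simp
  let ?g = "fpgen eps (%t x. bump R x * \<psi> t x) (%t x. bump R x * \<psi>t t x) v"
  have Dv: "!!t. t \<in> {a..b} ==> integrable (nu t) (%x. norm (v t x))" using D(5) sub by blast
  note gi = fpgen_integrable[OF D(1,2) Dv vi ab T[OF R0]]
  have gi1: "integrable (nu t) (?g t)" if "t \<in> {a..b}" for t by (rule gi(1)[OF _ that])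
  have gi2: "set_integrable lborel {a..b} (%t. \<integral>x. ?g t x \<partial>nu t)" by (rule gi(2))
  have pw: "?g t x <= (norm (v t x))^2 / 2 + DD / R * (1 + norm (v t x))" if t: "t \<in> {a..b}" for t x
  proof -
   have "?g t x = bump R x * (v t x \<bullet> p t x + (\<psi>t t x + eps / 2 * laplacian (\<psi> t) x)) + eps * (grad (bump R) x \<bullet> p t x)
     + \<psi> t x * (eps / 2 * laplacian (bump R) x + v t x \<bullet> grad (bump R) x)"
    unfolding fpgen_def gradphi[OF t] lapphi[OF t] by (simp add: inner_add_right algebra_simps)
   also have "... = bump R x * (v t x \<bullet> p t x - (norm (p t x))\<^sup>2 / 2) + eps * (grad (bump R) x \<bullet> p t x)
     + \<psi> t x * (eps / 2 * laplacian (bump R) x + v t x \<bullet> grad (bump R) x)"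
    unfolding hjb[OF t] by simp
   also have "... <= (norm (v t x))^2 / 2 + eps * (B / R * G) + \<Psi> * (eps / 2 * (B / R) + norm (v t x) * (B / R))"
   proof (intro add_mono)
    show "bump R x * (v t x \<bullet> p t x - (norm (p t x))\<^sup>2 / 2) <= (norm (v t x))^2 / 2"
     by (intro scale_le_half_square bump_range)
    have "grad (bump R) x \<bullet> p t x <= norm (grad (bump R) x) * norm (p t x)" by (rule norm_cauchy_schwarz)
    also have "... <= B / R * G" using B(2)[OF R0, of x] G[OF t, of x] B(1) R0 by (intro mult_mono) auto
    finally show "eps * (grad (bump R) x \<bullet> p t x) <= eps * (B / R * G)" using eps by (intro mult_left_mono) auto
    have "B / R\<^sup>2 <= B / R" using B(1) R by (intro divide_left_mono) (auto simp: power2_eq_square)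
    then have 1: "\<bar>laplacian (bump R) x\<bar> <= B / R" using B(3)[OF R0, of x] by linarith
    have "\<bar>v t x \<bullet> grad (bump R) x\<bar> <= norm (v t x) * norm (grad (bump R) x)" by (rule Cauchy_Schwarz_ineq2)
    also have "... <= norm (v t x) * (B / R)" using B(2)[OF R0, of x] by (intro mult_left_mono) auto
    finally have 2: "\<bar>v t x \<bullet> grad (bump R) x\<bar> <= norm (v t x) * (B / R)" .
    have "\<bar>eps / 2 * laplacian (bump R) x\<bar> <= eps / 2 * (B / R)"
     unfolding abs_mult using eps 1 by (intro mult_mono) auto
    with 2 have 3: "\<bar>eps / 2 * laplacian (bump R) x + v t x \<bullet> grad (bump R) x\<bar> <= eps / 2 * (B / R) + norm (v t x) * (B / R)" by linarith
    have "\<psi> t x * (eps / 2 * laplacian (bump R) x + v t x \<bullet> grad (bump R) x)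
     <= \<bar>\<psi> t x\<bar> * \<bar>eps / 2 * laplacian (bump R) x + v t x \<bullet> grad (bump R) x\<bar>"
     unfolding abs_mult[symmetric] by (rule abs_ge_self)
    also have "... <= \<Psi> * (eps / 2 * (B / R) + norm (v t x) * (B / R))"
     using \<Psi>[OF t, of x] 3 \<Psi>0 by (intro mult_mono) auto
    finally show "\<psi> t x * (eps / 2 * laplacian (bump R) x + v t x \<bullet> grad (bump R) x) <= \<Psi> * (eps / 2 * (B / R) + norm (v t x) * (B / R))" .
   qed
   also have "... <= (norm (v t x))^2 / 2 + DD / R * (1 + norm (v t x))"
   proof -
    have "DD / R * (1 + norm (v t x)) - (eps * (B / R * G) + \<Psi> * (eps / 2 * (B / R) + norm (v t x) * (B / R)))
      = (\<Psi> * B + (eps * B * G + \<Psi> * (eps / 2 * B)) * norm (v t x)) / R"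
     using R0 by (simp add: DD_def field_simps)
    also have "... \<ge> 0" using \<Psi>0 B(1) G0 eps R0 by (intro divide_nonneg_pos add_nonneg_nonneg mult_nonneg_nonneg) auto
    finally show ?thesis by linarith
   qed
   finally show ?thesis .
  qed
  have ptw: "AE t in lborel. indicator {a..b} t *\<^sub>R (LINT x|(nu t). ?g t x) <= k t + DD / R * (indicator {a..b} t *\<^sub>R (1 + (LINT x|(nu t). norm (v t x))))"
   using Eae
  proof eventually_elim
   case (elim t)
   show ?case
   proof (cases "t \<in> {a..b}")
    case True
    then have t01: "t \<in> {0..1}" using sub by auto
    interpret prob_space "nu t" by (rule D(3)[OF t01])
    have vm: "v t \<in> borel_measurable (nu t)"
     using borel_slice[OF D(2)] measurable_cong_sets[OF D(4)[OF t01] refl] by blast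
    have Ef: "?E t < \<infinity>" using elim True by simp
    then have iv: "integrable (nu t) (%x. (norm (v t x))^2 / 2)"
     using vm by (intro integrableI_bounded) auto
    have kt: "k t = (LINT x|(nu t). (norm (v t x))^2 / 2)"
    proof -
     have "(LINT x|(nu t). (norm (v t x))^2 / 2) = enn2real (?E t)"
      by (rule integral_eq_nn_integral) (use vm in auto)
     then show ?thesis unfolding k_def using True by simp
    qed
    have "(LINT x|(nu t). ?g t x) <= (LINT x|(nu t). (norm (v t x))^2 / 2 + DD / R * (1 + norm (v t x)))"
     using gi1[OF True] iv D(5)[OF t01] pw[OF True] by (intro integral_mono) auto
    also have "... = k t + DD / R * (1 + (LINT x|(nu t). norm (v t x)))"
     using iv D(5)[OF t01] prob_space kt by simp
    finally show ?thesis using True by simp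
   qed (simp add: k_def)
  qed
  have "(LINT x|(nu b). bump R x * \<psi> b x) - (LINT x|(nu a). bump R x * \<psi> a x) = (LINT t:{a..b}|lborel. (LINT x|(nu t). ?g t x))"
   using fp_local[OF fp ab T[OF R0]] by simp
  also have "... <= (LINT t|lborel. k t + DD / R * (indicator {a..b} t *\<^sub>R (1 + (LINT x|(nu t). norm (v t x)))))"
   unfolding set_lebesgue_integral_def
  proof (rule integral_mono_AE[OF _ _ ptw])
   show "integrable lborel (%t. indicator {a..b} t *\<^sub>R (LINT x|(nu t). ?g t x))" using gi2 by (simp add: set_integrable_def)
   show "integrable lborel (%t. k t + DD / R * (indicator {a..b} t *\<^sub>R (1 + (LINT x|(nu t). norm (v t x)))))"
    using hk vi1 by (intro Bochner_Integration.integrable_add integrable_mult_right) (auto simp: set_integrable_def has_bochner_integral_iff)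
  qed
  also have "... = (LINT t|lborel. k t) + DD / R * J"
   unfolding J_def set_lebesgue_integral_def
   using hk vi1 by (subst Bochner_Integration.integral_add) (auto simp: set_integrable_def has_bochner_integral_iff)
  also have "(LINT t|lborel. k t) = enn2real (\<integral>\<^sup>+t. indicator {a..b} t * ?E t \<partial>lborel)" using hk by (simp add: has_bochner_integral_iff)
  finally show ?thesis .
 qed
 have lim: "(%j. \<integral>x. bump (real (Suc j)) x * \<psi> t x \<partial>nu t) ----> (LINT x|(nu t). \<psi> t x)" if t: "t \<in> {a..b}" for t
 proof -
  have t01: "t \<in> {0..1}" using t sub by auto
  interpret prob_space "nu t" by (rule D(3)[OF t01])
  have m: "\<psi> t \<in> borel_measurable (nu t)" "bump R \<in> borel_measurable (nu t)" for R
   using borel_contI[OF smooth_k_continuous[OF sm\<psi>[OF t]]]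
    borel_contI[OF smooth_k_continuous[OF smooth_k_bump]] measurable_cong_sets[OF D(4)[OF t01] refl] by blast+
  show ?thesis
  proof (rule integral_dominated_convergence[where w="%_. \<Psi>"])
   show "AE x in nu t. (%j. bump (real (Suc j)) x * \<psi> t x) ----> \<psi> t x"
   proof (rule AE_I2)
    fix x show "(%j. bump (real (Suc j)) x * \<psi> t x) ----> \<psi> t x"
     using tendsto_mult_right[OF bump_tendsto_1[of x], of "\<psi> t x"] by simp
   qed
   show "AE x in nu t. norm (bump (real (Suc j)) x * \<psi> t x) <= \<Psi>" for j
   proof (rule AE_I2)
    fix x
    have "\<bar>bump (real (Suc j)) x\<bar> * \<bar>\<psi> t x\<bar> <= 1 * \<Psi>" using bump_range[of "real (Suc j)" x] \<Psi>[OF t, of x] by (intro mult_mono) auto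
    then show "norm (bump (real (Suc j)) x * \<psi> t x) <= \<Psi>" by (simp add: abs_mult)
   qed
  qed (use m in auto)
 qed
 have lim2: "(%j. enn2real (\<integral>\<^sup>+t. indicator {a..b} t * ?E t \<partial>lborel) + DD / real (Suc j) * J) ----> enn2real (\<integral>\<^sup>+t. indicator {a..b} t * ?E t \<partial>lborel) + 0 * J"
  by (intro tendsto_intros LIMSEQ_Suc[OF lim_const_over_n])
 have "(LINT x|(nu b). \<psi> b x) - (LINT x|(nu a). \<psi> a x) <= enn2real (\<integral>\<^sup>+t. indicator {a..b} t * ?E t \<partial>lborel) + 0 * J"
  by (rule LIMSEQ_le[OF tendsto_diff[OF lim lim] lim2]) (use ab main in auto)
 then show ?thesis unfolding \<psi>_def u_def \<sigma>_def by (simp add: mult.commute)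
qed

text \<open>Let the additional heat time tend to 0: at time \<open>b\<close> through the initial
  trace of the flow, at time \<open>a\<close> through its continuity in time. The flow preserves the
  bounds by \<open>c\<close> and \<open>M\<close>, so the logarithms stay uniformly bounded.\<close>

lemma fp_lower:
 fixes v :: "real => real^'n::finite => real^'n" and h :: "real^'n => real"
 assumes fp: "fp_pair eps nu v" and eps: "0 < eps" and ab: "0 <= a" "a < b" "b <= 1"
  and cont: "contU h" and c: "0 < c" and hb: "!!y. c <= h y" "!!y. h y <= M"
  and fin: "(\<integral>\<^sup>+t\<in>{a..b}. (\<integral>\<^sup>+x. ennreal ((norm (v t x))^2 / 2) \<partial>nu t) \<partial>lborel) < \<infinity>"
 shows "(LINT x|(nu b). eps * ln (h x)) - (LINT x|(nu a). eps * ln (heat_sg (eps * (b - a)) h x))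
   <= enn2real (\<integral>\<^sup>+t\<in>{a..b}. (\<integral>\<^sup>+x. ennreal ((norm (v t x))^2 / 2) \<partial>nu t) \<partial>lborel)"
proof -
 note D = fp_pairD[OF fp]
 have hm: "borel_fun h" using cont by (rule borel_contI)
 have hM: "\<bar>h y\<bar> <= M" for y using hb[of y] c by simp
 have h: "h \<in> gauss_class 0" using hM hm by (intro gauss_class_const_bounded) auto
 define K where "K = \<bar>ln c\<bar> + \<bar>ln M\<bar>"
 have lnb: "\<bar>ln z\<bar> <= K" if "c <= z" "z <= M" for z
 proof -
  have "ln c <= ln z" "ln z <= ln M" using that c by auto
  then show ?thesis unfolding K_def by linarith
 qed
 define \<delta> where "\<delta> = (%j. 1 / real (Suc j))"
 have \<delta>: "0 < \<delta> j" "\<delta> ----> 0" for j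
  using LIMSEQ_Suc[OF lim_const_over_n, of 1] by (auto simp: \<delta>_def)
 have ev: "filterlim \<delta> (at_right 0) sequentially"
  using \<delta>(2) less_imp_neq[OF \<delta>(1), symmetric] \<delta>(1) by (auto simp: filterlim_at intro!: always_eventually)
 have lim: "(%j. \<integral>x. eps * ln (F j x) \<partial>nu t) ----> (LINT x|(nu t). eps * ln (F' x))"
  if t: "t \<in> {0..1}" and F: "!!x. (%j. F j x) ----> F' x" "!!j x. c <= F j x" "!!j x. F j x <= M" "!!j. F j \<in> borel_measurable borel" for t F F'
 proof -
  interpret prob_space "nu t" by (rule D(3)[OF t])
  have m: "F j \<in> borel_measurable (nu t)" for j using F(4) measurable_cong_sets[OF D(4)[OF t] refl] by blast
  have m': "F' \<in> borel_measurable (nu t)" by (rule borel_measurable_LIMSEQ_real[OF F(1) m])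
  have F'c: "c <= F' x" for x by (rule LIMSEQ_le_const[OF F(1)]) (use F(2) in auto)
  show ?thesis
  proof (rule integral_dominated_convergence[where w="%_. eps * K"])
   show "AE x in nu t. (%j. eps * ln (F j x)) ----> eps * ln (F' x)"
   proof (rule AE_I2)
    fix x show "(%j. eps * ln (F j x)) ----> eps * ln (F' x)"
     using F'c[of x] c by (intro tendsto_intros F(1)) auto
   qed
   show "AE x in nu t. norm (eps * ln (F j x)) <= eps * K" for j
    using lnb[OF F(2,3)] eps by (auto simp: abs_mult)
  qed (use m m' in auto)
 qed
 have hsm: "borel_fun (heat_sg s h)" if "0 < s" for s
  using smooth_k_continuous[OF smooth_k_heat_sg[OF that, of 0 h 0]] h by (intro borel_contI) auto
 have l1: "(%j. \<integral>x. eps * ln (heat_sg (\<delta> j) h x) \<partial>nu b) ----> (LINT x|(nu b). eps * ln (h x))"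
 proof (rule lim)
  show "(%j. heat_sg (\<delta> j) h x) ----> h x" for x
   by (rule filterlim_compose[OF heat_sg_tendsto_initial[OF cont order_refl, of M] ev]) (use hM in simp)
 qed (use ab heat_sg_range[OF hm less_imp_le[OF c] hb \<delta>(1)] hsm \<delta> in auto)
 have s: "0 < eps * (b - a)" using eps ab by simp
 have l2: "(%j. \<integral>x. eps * ln (heat_sg (eps * (b - a) + \<delta> j) h x) \<partial>nu a) ----> (LINT x|(nu a). eps * ln (heat_sg (eps * (b - a)) h x))"
 proof (rule lim)
  show "(%j. heat_sg (eps * (b - a) + \<delta> j) h x) ----> heat_sg (eps * (b - a)) h x" for x
  proof (rule isCont_tendsto_compose[where g="%s. heat_sg s h x"])
   show "isCont (%s. heat_sg s h x) (eps * (b - a))" using DERIV_isCont[OF heat_sg_DERIV_time[OF h s]] by simp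
   show "(%j. eps * (b - a) + \<delta> j) ----> eps * (b - a)" using tendsto_add[OF tendsto_const \<delta>(2)] by simp
  qed
  have sj: "0 < eps * (b - a) + \<delta> j" for j using s \<delta>(1)[of j] by linarith
  show "c <= heat_sg (eps * (b - a) + \<delta> j) h x" "heat_sg (eps * (b - a) + \<delta> j) h x <= M" for j x
   using heat_sg_range[OF hm less_imp_le[OF c] hb sj] by auto
  show "heat_sg (eps * (b - a) + \<delta> j) h \<in> borel_measurable borel" for j by (rule hsm[OF sj])
 qed (use ab in auto)
 show ?thesis
  by (rule LIMSEQ_le_const2[OF tendsto_diff[OF l1 l2]])
   (use fp_lower_smooth[OF fp eps ab \<delta>(1) hm c hb fin] in blast)
qed

section \<open>The Schroedinger system with regular potentials\<close>

lemma ennreal_heat_sg: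
 assumes h: "h \<in> gauss_class kap" and s: "0 < s" "kap * s < 1" and pos: "!!y. 0 <= h y"
 shows "ennreal (heat_sg s h x) = (\<integral>\<^sup>+y. ennreal (h y * hk s x y) \<partial>lborel)"
 unfolding heat_sg_def using gauss_class_integrable_kernel[OF h s, of x] pos
 by (intro nn_integral_eq_integral[symmetric]) (auto simp: heat_kernel_nonneg)

lemma nn_heat_semigroup:
 fixes h :: "real^'n::finite => ennreal"
 assumes [measurable]: "borel_fun h" and ab: "0 < a" "0 < b"
 shows "(\<integral>\<^sup>+y. (\<integral>\<^sup>+z. h z * ennreal (hk b y z) \<partial>lborel) * ennreal (hk a x y) \<partial>lborel)
  = (\<integral>\<^sup>+z. h z * ennreal (hk (a + b) x z) \<partial>lborel)"
proof -
 have "(\<integral>\<^sup>+y. (\<integral>\<^sup>+z. h z * ennreal (hk b y z) \<partial>lborel) * ennreal (hk a x y) \<partial>lborel)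
  = (\<integral>\<^sup>+y. (\<integral>\<^sup>+z. h z * ennreal (hk a x y * hk b y z) \<partial>lborel) \<partial>lborel)"
  by (simp add: ennreal_mult heat_kernel_nonneg nn_integral_cmult[symmetric] ac_simps)
 also have "... = (\<integral>\<^sup>+z. (\<integral>\<^sup>+y. h z * ennreal (hk a x y * hk b y z) \<partial>lborel) \<partial>lborel)"
  by (rule lborel_pair.Fubini') measurable
 also have "... = (\<integral>\<^sup>+z. h z * ennreal (hk (a + b) x z) \<partial>lborel)"
  by (simp add: nn_integral_cmult nn_integral_heat_kernel_mult[OF ab])
 finally show ?thesis .
qed

lemma heat_sg_gauss_bound:
 fixes h :: "real^'n::finite => real"
 assumes [measurable]: "borel_fun h" and s: "0 < s" "kap * s < 1" and k: "0 <= kap"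
  and bd: "!!y. \<bar>h y\<bar> <= M * exp (kap / 2 * (norm y)^2)"
 shows "heat_sg s h \<in> gauss_class (kap / (1 - kap * s))"
proof -
 have h: "h \<in> gauss_class kap" by (rule gauss_classI_bounded[OF _ bd]) measurable
 obtain c where c: "!!x. \<bar>heat_sg s h x\<bar> <= c * exp (kap / (1 - kap * s) / 2 * (norm x)^2)"
  by (rule heat_sg_upper[OF _ s k bd]) (auto intro: that)
 show ?thesis
  by (rule gauss_classI_bounded[OF _ c])
   (rule borel_contI[OF smooth_k_continuous[OF smooth_k_heat_sg[OF s h]]])
qed

lemma one_plus_sq_le_exp: "0 <= A ==> A * (1 + z\<^sup>2) <= (3 * A) * exp z" if "0 <= z" for z :: real
proof -
 assume A: "0 <= A"
 have "1 <= exp z" using that by simp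
 then have "1 + z\<^sup>2 <= 3 * exp z" using sq_le_exp[OF that] by linarith
 from mult_left_mono[OF this A] show ?thesis by simp
qed

text \<open>Gibbs' inequality for the density $h\,r_\sigma(x,\cdot)/u$ against the Gaussian translated by $\sigma\nabla\log u$.\<close>

lemma heat_sg_entropy_bound:
 fixes h :: "real^'n::finite => real"
 assumes h: "h \<in> gauss_class kap" and s: "0 < s" "kap * s < 1" and pos: "!!y. 0 < h y" and u: "0 < heat_sg s h x"
  and A: "0 <= A" and ln: "!!y. \<bar>ln (h y)\<bar> <= A * (1 + (norm y)^2)"
 shows "integrable lborel (%y. h y * ln (h y) * hk s x y)"
  and "heat_sg s h x * ln (heat_sg s h x) + s / 2 * (norm (hgrad s h x))^2 / heat_sg s h x
   <= (LINT y|lborel. h y * ln (h y) * hk s x y)"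
proof -
 have [measurable]: "borel_fun h" using h by measurable
 define u where "u = heat_sg s h x"
 define p where "p = (1 / u) *\<^sub>R hgrad s h x"
 have u0: "0 < u" using u by (simp add: u_def)
 have lnh: "(%y. ln (h y) * h y) \<in> gauss_class kap"
 proof (rule gauss_class_mult[OF h])
  show "\<bar>ln (h y)\<bar> <= (3 * A) * exp (1 * norm y)" for y
   using ln[of y] one_plus_sq_le_exp[OF norm_ge_zero A, of y] by simp
 qed measurable
 show il: "integrable lborel (%y. h y * ln (h y) * hk s x y)"
  using gauss_class_integrable_kernel[OF lnh s, of x] by (simp add: mult.commute)
 have i0: "integrable lborel (%y. h y * hk s x y)" by (rule gauss_class_integrable_kernel[OF h s])
 have i1: "integrable lborel (%y. (h y * hk s x y) * (p \<bullet> (y - x)))"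
 proof -
  have "integrable lborel (%y. \<Sum>i\<in>UNIV. p $ i * ((h y * hk s x y) * (y $ i - x $ i)))"
   by (intro Bochner_Integration.integrable_sum integrable_mult_right hgrad_nth(2)[OF h s])
  then show ?thesis by (simp add: inner_vec_def sum_distrib_left ac_simps)
 qed
 have m1: "(LINT y|lborel. (h y * hk s x y) * (p \<bullet> (y - x))) = s * u * (norm p)^2"
 proof -
  have "(LINT y|lborel. (h y * hk s x y) * (p \<bullet> (y - x)))
    = (LINT y|lborel. (\<Sum>i\<in>UNIV. p $ i * ((h y * hk s x y) * (y $ i - x $ i))))"
   by (simp add: inner_vec_def sum_distrib_left ac_simps)
  also have "... = (\<Sum>i\<in>UNIV. p $ i * (s * hgrad s h x $ i))"
   using hgrad_nth[OF h s, of x] s by (subst Bochner_Integration.integral_sum) auto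
  also have "... = s * (p \<bullet> hgrad s h x)" by (simp add: inner_vec_def sum_distrib_left ac_simps)
  also have "hgrad s h x = u *\<^sub>R p" using u0 by (simp add: p_def)
  finally show ?thesis by (simp add: power2_norm_eq_inner)
 qed
 have sh: "hk s x y * exp (p \<bullet> (y - x) - s * (norm p)^2 / 2) = hk s (x + s *\<^sub>R p) y" for y
 proof -
  have "(norm (x + s *\<^sub>R p - y))^2 = (norm (x - y))^2 - 2 * s * (p \<bullet> (y - x)) + s\<^sup>2 * (norm p)^2"
   unfolding power2_norm_eq_inner
   by (simp add: inner_add_left inner_add_right inner_diff_left inner_diff_right inner_commute power2_eq_square algebra_simps)
  then have "- (norm (x + s *\<^sub>R p - y))\<^sup>2 / (2 * s) = - (norm (x - y))\<^sup>2 / (2 * s) + (p \<bullet> (y - x) - s * (norm p)^2 / 2)"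
   using s by (simp add: field_simps power2_eq_square)
  then show ?thesis unfolding heat_kernel_def by (simp only: exp_add mult.assoc)
 qed
 have pw: "(h y * hk s x y) * (p \<bullet> (y - x)) - (s * (norm p)^2 / 2) * (h y * hk s x y)
   + ln u * (h y * hk s x y) - h y * ln (h y) * hk s x y
   <= u * hk s (x + s *\<^sub>R p) y - h y * hk s x y" for y
 proof -
  define E where "E = p \<bullet> (y - x) - s * (norm p)^2 / 2"
  have "ln (exp E * u / h y) <= exp E * u / h y - 1"
   using u0 pos[of y] by (intro ln_le_minus_one) auto
  moreover have "ln (exp E * u / h y) = E + ln u - ln (h y)"
   using u0 pos[of y] by (simp add: ln_div ln_mult)
  ultimately have "h y * (E + ln u - ln (h y)) <= h y * (exp E * u / h y - 1)"
   using pos[of y] by (intro mult_left_mono) auto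
  also have "... = u * exp E - h y" using pos[of y] by (simp add: field_simps)
  finally have "h y * (E + ln u - ln (h y)) * hk s x y <= (u * exp E - h y) * hk s x y"
   by (intro mult_right_mono heat_kernel_nonneg)
  then show ?thesis unfolding sh[symmetric] E_def by (simp add: algebra_simps)
 qed
 have "(LINT y|lborel. (h y * hk s x y) * (p \<bullet> (y - x)) - (s * (norm p)^2 / 2) * (h y * hk s x y)
   + ln u * (h y * hk s x y) - h y * ln (h y) * hk s x y)
   <= (LINT y|lborel. u * hk s (x + s *\<^sub>R p) y - h y * hk s x y)"
  using i0 i1 il integrable_heat_kernel[OF s(1), of "x + s *\<^sub>R p"]
  by (intro integral_mono pw Bochner_Integration.integrable_add Bochner_Integration.integrable_diff integrable_mult_right) auto
 also have "... = 0" using i0 integrable_heat_kernel[OF s(1), of "x + s *\<^sub>R p"] integral_heat_kernel[OF s(1), of "x + s *\<^sub>R p"]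
  by (simp add: u_def heat_sg_def)
 also have "(LINT y|lborel. (h y * hk s x y) * (p \<bullet> (y - x)) - (s * (norm p)^2 / 2) * (h y * hk s x y)
   + ln u * (h y * hk s x y) - h y * ln (h y) * hk s x y)
   = s * u * (norm p)^2 - (s * (norm p)^2 / 2) * u + ln u * u - (LINT y|lborel. h y * ln (h y) * hk s x y)"
  using i0 i1 il m1 by (simp add: u_def heat_sg_def)
 \<comment> \<open>The tilt contributes s u |p|^2 and its normalisation removes half of it; the
   remaining half becomes the kinetic energy.\<close>
 finally have "u * ln u + s / 2 * (u * (norm p)^2) <= (LINT y|lborel. h y * ln (h y) * hk s x y)"
  by (simp add: algebra_simps)
 moreover have "u * (norm p)^2 = (norm (hgrad s h x))^2 / u"
  using u0 by (simp add: p_def power_divide power2_eq_square)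
 ultimately show "heat_sg s h x * ln (heat_sg s h x) + s / 2 * (norm (hgrad s h x))^2 / heat_sg s h x
   <= (LINT y|lborel. h y * ln (h y) * hk s x y)" by (simp add: u_def)
qed

text \<open>The Schroedinger system in regular form. The assumptions are arranged so that exchanging
  \<open>f\<close> and \<open>g\<close> gives another instance, which provides time reversal; the
  mass is stated at the initial end and transported by \<open>rho_mass\<close>.\<close>

locale schroedinger =
 fixes f g :: "real^'n::finite => real" and eps kap M A0 :: real
 assumes eps: "0 < eps" and kap: "0 <= kap" "kap * eps < 1" and A0: "0 <= A0"
  and f_cont: "contU f" and g_cont: "contU g"
  and f_pos: "!!x. 0 < f x" and g_pos: "!!x. 0 < g x"
  and f_bd: "!!x. f x <= M * exp (kap / 2 * (norm x)^2)" and g_bd: "!!x. g x <= M * exp (kap / 2 * (norm x)^2)"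
  and f_ln: "!!x. \<bar>ln (f x)\<bar> <= A0 * (1 + (norm x)^2)" and g_ln: "!!x. \<bar>ln (g x)\<bar> <= A0 * (1 + (norm x)^2)"
  and mass: "(\<integral>\<^sup>+x. ennreal (f x * heat_sg eps g x) \<partial>lborel) = 1"
  and mom0: "(\<integral>\<^sup>+x. ennreal ((norm x)^2 * (f x * heat_sg eps g x)) \<partial>lborel) < \<infinity>"
  and mom1: "(\<integral>\<^sup>+x. ennreal ((norm x)^2 * (g x * heat_sg eps f x)) \<partial>lborel) < \<infinity>"
begin

lemma f_meas[measurable]: "borel_fun f" and g_meas[measurable]: "borel_fun g"
 using f_cont g_cont by (auto intro: borel_contI)

lemma f_bd': "\<bar>f x\<bar> <= M * exp (kap / 2 * (norm x)^2)" and g_bd': "\<bar>g x\<bar> <= M * exp (kap / 2 * (norm x)^2)"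
 using f_bd[of x] f_pos[of x] g_bd[of x] g_pos[of x] by auto

lemma f_gc: "f \<in> gauss_class kap" and g_gc: "g \<in> gauss_class kap"
 by (rule gauss_classI_bounded[OF f_meas f_bd'] gauss_classI_bounded[OF g_meas g_bd'])+

lemma ks: "s <= eps ==> kap * s < 1"
 using mult_left_mono[of s eps kap] kap by linarith

text \<open>The endpoints are separate cases because the kernel of variance 0 is identically 0
  (\<open>0 powr _ = 0\<close>) instead of acting as the identity.\<close>

definition F :: "real => real^'n => real" where "F t = (if t = 0 then f else heat_sg (eps * t) f)"
definition G :: "real => real^'n => real" where "G t = (if t = 1 then g else heat_sg (eps * (1 - t)) g)"
definition rho :: "real => real^'n => real" where "rho t x = F t x * G t x"

lemma time_F: "t \<in> {0..1} ==> t ~= 0 ==> 0 < eps * t & kap * (eps * t) < 1"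
 using eps ks[of "eps * t"] by (auto simp: mult_le_cancel_left1)

lemma time_G: "t \<in> {0..1} ==> t ~= 1 ==> 0 < eps * (1 - t) & kap * (eps * (1 - t)) < 1"
 using time_F[of "1 - t"] by auto

lemma F_pos: "t \<in> {0..1} ==> 0 < F t x"
 using f_pos heat_sg_pos[OF f_gc _ _ f_cont f_pos] time_F[of t] by (auto simp: F_def)

lemma G_pos: "t \<in> {0..1} ==> 0 < G t x"
 using g_pos heat_sg_pos[OF g_gc _ _ g_cont g_pos] time_G[of t] by (auto simp: G_def)

lemma F_cont: "t \<in> {0..1} ==> contU (F t)"
 using f_cont smooth_k_continuous[OF smooth_k_heat_sg[OF _ _ f_gc]] time_F[of t] by (auto simp: F_def)

lemma G_cont: "t \<in> {0..1} ==> contU (G t)"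
 using g_cont smooth_k_continuous[OF smooth_k_heat_sg[OF _ _ g_gc]] time_G[of t] by (auto simp: G_def)

lemma F_meas: "t \<in> {0..1} ==> F t \<in> borel_measurable borel" and G_meas: "t \<in> {0..1} ==> G t \<in> borel_measurable borel"
 using F_cont G_cont by (auto intro: borel_contI)

lemma rho_pos: "t \<in> {0..1} ==> 0 < rho t x"
 using F_pos G_pos by (simp add: rho_def)

lemma rho_meas: "t \<in> {0..1} ==> rho t \<in> borel_measurable borel"
 using F_meas[of t] G_meas[of t] unfolding rho_def[abs_def] by (intro borel_measurable_times) auto

lemma rho_cont: "t \<in> {0..1} ==> contU (rho t)"
 unfolding rho_def[abs_def] by (intro continuous_intros F_cont G_cont)

lemma G_ln: "t \<in> {0..1} ==> \<exists>A\<ge>0. \<forall>x. \<bar>ln (G t x)\<bar> <= A * (1 + (norm x)^2)"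
proof (cases "t = 1")
 case True then show ?thesis using g_ln A0 by (auto simp: G_def)
next
 case False
 assume "t \<in> {0..1}"
 with False have "0 < eps * (1 - t)" "kap * (eps * (1 - t)) < 1" using time_G by auto
 from ln_heat_sg_bound[OF this kap(1) g_cont g_pos g_bd'] False show ?thesis by (auto simp: G_def)
qed

section \<open>Mass and second moments of the interpolation\<close>

lemma F_step:
 assumes t: "0 <= s" "s < t" "t <= 1"
 shows "ennreal (F t y) = (\<integral>\<^sup>+x. ennreal (F s x) * ennreal (hk (eps * (t - s)) x y) \<partial>lborel)"
proof -
 have t01: "t \<in> {0..1}" "t ~= 0" using t by auto
 have Ft: "ennreal (F t y) = (\<integral>\<^sup>+z. ennreal (f z) * ennreal (hk (eps * t) y z) \<partial>lborel)"
  using ennreal_heat_sg[OF f_gc, of "eps * t" y] time_F[OF t01] t01 f_pos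
  by (simp add: F_def less_imp_le ennreal_mult heat_kernel_nonneg)
 show ?thesis
 proof (cases "s = 0")
  case True then show ?thesis using Ft by (simp add: F_def heat_kernel_commute[of _ y])
 next
  case False
  have s01: "s \<in> {0..1}" using t by auto
  have "ennreal (F s x) = (\<integral>\<^sup>+z. ennreal (f z) * ennreal (hk (eps * s) x z) \<partial>lborel)" for x
   using ennreal_heat_sg[OF f_gc, of "eps * s" x] time_F[OF s01 False] False f_pos
   by (simp add: F_def less_imp_le ennreal_mult heat_kernel_nonneg)
  then have "(\<integral>\<^sup>+x. ennreal (F s x) * ennreal (hk (eps * (t - s)) x y) \<partial>lborel)
    = (\<integral>\<^sup>+x. (\<integral>\<^sup>+z. ennreal (f z) * ennreal (hk (eps * s) x z) \<partial>lborel) * ennreal (hk (eps * (t - s)) y x) \<partial>lborel)"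
   by (simp add: heat_kernel_commute[of _ y])
  also have "... = (\<integral>\<^sup>+z. ennreal (f z) * ennreal (hk (eps * (t - s) + eps * s) y z) \<partial>lborel)"
   using t False eps by (intro nn_heat_semigroup) auto
  also have "eps * (t - s) + eps * s = eps * t" by (simp add: algebra_simps)
  finally show ?thesis using Ft by simp
 qed
qed

lemma G_step:
 assumes t: "0 <= s" "s < t" "t <= 1"
 shows "ennreal (G s x) = (\<integral>\<^sup>+y. ennreal (G t y) * ennreal (hk (eps * (t - s)) x y) \<partial>lborel)"
proof -
 have s01: "s \<in> {0..1}" "s ~= 1" using t by auto
 have Gs: "ennreal (G s x) = (\<integral>\<^sup>+z. ennreal (g z) * ennreal (hk (eps * (1 - s)) x z) \<partial>lborel)"
  using ennreal_heat_sg[OF g_gc, of "eps * (1 - s)" x] time_G[OF s01] s01 g_pos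
  by (simp add: G_def less_imp_le ennreal_mult heat_kernel_nonneg)
 show ?thesis
 proof (cases "t = 1")
  case True then show ?thesis using Gs by (simp add: G_def)
 next
  case False
  have t01: "t \<in> {0..1}" using t by auto
  have "ennreal (G t y) = (\<integral>\<^sup>+z. ennreal (g z) * ennreal (hk (eps * (1 - t)) y z) \<partial>lborel)" for y
   using ennreal_heat_sg[OF g_gc, of "eps * (1 - t)" y] time_G[OF t01 False] False g_pos
   by (simp add: G_def less_imp_le ennreal_mult heat_kernel_nonneg)
  then have "(\<integral>\<^sup>+y. ennreal (G t y) * ennreal (hk (eps * (t - s)) x y) \<partial>lborel)
    = (\<integral>\<^sup>+z. ennreal (g z) * ennreal (hk (eps * (t - s) + eps * (1 - t)) x z) \<partial>lborel)"
   using t False eps by (simp add: nn_heat_semigroup)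
  also have "eps * (t - s) + eps * (1 - t) = eps * (1 - s)" by (simp add: algebra_simps)
  finally show ?thesis using Gs by simp
 qed
qed

text \<open>Tonelli moves the heat flow from \<open>W\<close> to \<open>F s\<close>. With
  \<open>W\<close> the factor \<open>G t\<close> this transports mass; with \<open>W\<close> equal
  to G_t |ln G_t| it gives the integrability behind the entropy inequality.\<close>

lemma weighted_step:
 fixes W :: "real^'n => ennreal"
 assumes t: "0 <= s" "s < t" "t <= 1" and [measurable]: "borel_fun W"
 shows "(\<integral>\<^sup>+x. ennreal (F s x) * (\<integral>\<^sup>+y. W y * ennreal (hk (eps * (t - s)) x y) \<partial>lborel) \<partial>lborel)
  = (\<integral>\<^sup>+y. ennreal (F t y) * W y \<partial>lborel)"
proof -
 have [measurable]: "borel_fun (F s)" using t by (intro F_meas) auto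
 have "(\<integral>\<^sup>+x. ennreal (F s x) * (\<integral>\<^sup>+y. W y * ennreal (hk (eps * (t - s)) x y) \<partial>lborel) \<partial>lborel)
  = (\<integral>\<^sup>+x. (\<integral>\<^sup>+y. ennreal (F s x) * (W y * ennreal (hk (eps * (t - s)) x y)) \<partial>lborel) \<partial>lborel)"
  by (simp add: nn_integral_cmult)
 also have "... = (\<integral>\<^sup>+y. (\<integral>\<^sup>+x. ennreal (F s x) * (W y * ennreal (hk (eps * (t - s)) x y)) \<partial>lborel) \<partial>lborel)"
  by (rule lborel_pair.Fubini') measurable
 also have "... = (\<integral>\<^sup>+y. W y * (\<integral>\<^sup>+x. ennreal (F s x) * ennreal (hk (eps * (t - s)) x y) \<partial>lborel) \<partial>lborel)"
  by (simp add: nn_integral_cmult[symmetric] ac_simps)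
 finally show ?thesis by (simp add: F_step[OF t, symmetric] mult.commute)
qed

lemma rho_mass:
 assumes "t \<in> {0..1}"
 shows "(\<integral>\<^sup>+x. ennreal (rho t x) \<partial>lborel) = 1"
proof -
 have 0: "(\<integral>\<^sup>+x. ennreal (rho 0 x) \<partial>lborel) = 1" using mass by (simp add: rho_def F_def G_def)
 show ?thesis
 proof (cases "t = 0")
  case False
  then have t: "0 <= (0::real)" "0 < t" "t <= 1" "(0::real) \<in> {0..1}" using assms by auto
  have [measurable]: "borel_fun (G t)" by (rule G_meas[OF assms])
  have "(\<integral>\<^sup>+x. ennreal (rho t x) \<partial>lborel) = (\<integral>\<^sup>+x. ennreal (F t x) * ennreal (G t x) \<partial>lborel)"
   using F_pos[OF assms] G_pos[OF assms] by (simp add: rho_def ennreal_mult less_imp_le)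
  also have "... = (\<integral>\<^sup>+x. ennreal (F 0 x) * ennreal (G 0 x) \<partial>lborel)"
   using weighted_step[OF t(1-3), of "%y. ennreal (G t y)"] by (simp add: G_step[OF t(1-3)])
  also have "... = (\<integral>\<^sup>+x. ennreal (rho 0 x) \<partial>lborel)"
   using F_pos[OF t(4)] G_pos[OF t(4)] by (simp add: rho_def ennreal_mult less_imp_le)
  finally show ?thesis using 0 by simp
 qed (use 0 in simp)
qed

definition mu :: "real => (real^'n) measure" where "mu t = density lborel (%x. ennreal (rho t x))"

lemma mu_prob: "t \<in> {0..1} ==> prob_space (mu t)"
 using rho_mass rho_meas[of t] by (intro prob_spaceI) (simp add: mu_def emeasure_density)

lemma mu_sets[simp]: "sets (mu t) = sets borel" "space (mu t) = UNIV"
 by (simp_all add: mu_def)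

lemma nn_integral_mu: "t \<in> {0..1} ==> W \<in> borel_measurable borel ==> (\<integral>\<^sup>+x. W x \<partial>mu t) = (\<integral>\<^sup>+x. ennreal (rho t x) * W x \<partial>lborel)"
 using rho_meas[of t] unfolding mu_def by (subst nn_integral_density) auto

lemma heat_second_moment:
 obtains K where "0 <= K" "!!c m. 0 < c ==> c <= eps ==> (\<integral>\<^sup>+x. ennreal ((norm x)^2) * ennreal (hk c m (x::real^'n)) \<partial>lborel) <= ennreal (2 * (norm m)^2 + K)"
proof -
 have "(%_. 1) \<in> (gauss_class 0 :: (real^'n => real) set)" by (rule gauss_classI_bounded[of _ 1]) auto
 from gauss_class_integrable_kernel[OF gauss_class_norm2[OF this], of 1 0]
 have i: "integrable lborel (%w::real^'n. (norm w)^2 * hk 1 0 w)" by simp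
 define K1 where "K1 = (LINT w|lborel. (norm w)^2 * hk 1 0 (w::real^'n))"
 have K1: "0 <= K1" unfolding K1_def by (intro integral_nonneg_AE AE_I2) (simp add: heat_kernel_nonneg)
 have K1nn: "(\<integral>\<^sup>+w. ennreal ((norm w)^2 * hk 1 0 (w::real^'n)) \<partial>lborel) = ennreal K1"
  unfolding K1_def using i by (intro nn_integral_eq_integral) (auto simp: heat_kernel_nonneg)
 show ?thesis
 proof (rule that[of "2 * eps * K1"])
  show "0 <= 2 * eps * K1" using K1 eps by simp
  fix c :: real and m :: "real^'n" assume c: "0 < c" "c <= eps"
  have "(\<integral>\<^sup>+x. ennreal ((norm x)^2) * ennreal (hk c m x) \<partial>lborel)
    = (\<integral>\<^sup>+w. ennreal ((norm (m + sqrt c *\<^sub>R w))^2) * ennreal (hk 1 0 w) \<partial>lborel)"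
   by (rule nn_integral_heat_kernel_shift[OF c(1)]) measurable
  also have "... <= (\<integral>\<^sup>+w. ennreal (2 * (norm m)^2) * ennreal (hk 1 0 w) + ennreal (2 * eps) * ennreal ((norm w)^2 * hk 1 0 (w::real^'n)) \<partial>lborel)"
  proof (rule nn_integral_mono)
   fix w :: "real^'n"
   have "(norm (m + sqrt c *\<^sub>R w))^2 <= (norm m + sqrt c * norm w)^2"
    using norm_triangle_ineq[of m "sqrt c *\<^sub>R w"] c by (intro power_mono) auto
   also have "... <= 2 * (norm m)^2 + 2 * (sqrt c * norm w)\<^sup>2"
    using sum_squares_bound[of "norm m" "sqrt c * norm w"] by (simp add: power2_sum)
   also have "... <= 2 * (norm m)^2 + 2 * eps * (norm w)^2" using c by (simp add: power_mult_distrib mult_right_mono)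
   finally have "(norm (m + sqrt c *\<^sub>R w))^2 * hk 1 0 w <= (2 * (norm m)^2 + 2 * eps * (norm w)^2) * hk 1 0 w"
    by (intro mult_right_mono heat_kernel_nonneg)
   then have "ennreal ((norm (m + sqrt c *\<^sub>R w))^2 * hk 1 0 w)
     <= ennreal (2 * (norm m)^2 * hk 1 0 w + (2 * eps) * ((norm w)^2 * hk 1 0 w))"
    by (intro ennreal_leI) (simp add: algebra_simps)
   then show "ennreal ((norm (m + sqrt c *\<^sub>R w))^2) * ennreal (hk 1 0 w)
    <= ennreal (2 * (norm m)^2) * ennreal (hk 1 0 w) + ennreal (2 * eps) * ennreal ((norm w)^2 * hk 1 0 w)"
    using eps by (simp add: ennreal_mult[symmetric] ennreal_plus[symmetric] heat_kernel_nonneg del: ennreal_plus)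
  qed
  also have "... = ennreal (2 * (norm m)^2) + ennreal (2 * eps) * ennreal K1"
   by (subst nn_integral_add; simp add: nn_integral_cmult nn_integral_heat_kernel K1nn del: ennreal_mult)
  also have "... = ennreal (2 * (norm m)^2 + 2 * eps * K1)"
   using eps K1 by (simp add: ennreal_mult[symmetric] ennreal_plus[symmetric] del: ennreal_plus)
  finally show "(\<integral>\<^sup>+x. ennreal ((norm x)^2) * ennreal (hk c m x) \<partial>lborel) <= ennreal (2 * (norm m)^2 + 2 * eps * K1)" .
 qed
qed

text \<open>Given both endpoints, the position at an interior time is a Brownian bridge whose mean
  lies between them and whose variance is at most \<open>eps\<close>. Its second moment is therefore
  controlled by those of the two endpoints.\<close>

lemma mu_second_moment:
 assumes t: "t \<in> {0..1}"
 shows "(\<integral>\<^sup>+x. ennreal ((norm x)^2) \<partial>mu t) < \<infinity>"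
proof -
 have z01: "(0::real) \<in> {0..1}" "(1::real) \<in> {0..1}" by auto
 have e: "(\<integral>\<^sup>+x. ennreal ((norm x)^2) \<partial>mu t) = (\<integral>\<^sup>+x. ennreal ((norm x)^2 * rho t x) \<partial>lborel)" if "t \<in> {0..1}" for t
  using rho_pos[OF that] by (subst nn_integral_mu[OF that]) (simp_all add: ennreal_mult less_imp_le mult.commute)
 have fin0: "(\<integral>\<^sup>+x. ennreal ((norm x)^2) \<partial>mu 0) < \<infinity>" using mom0 unfolding e[OF z01(1)] by (simp add: rho_def F_def G_def)
 have fin1: "(\<integral>\<^sup>+x. ennreal ((norm x)^2) \<partial>mu 1) < \<infinity>" using mom1 unfolding e[OF z01(2)] by (simp add: rho_def F_def G_def mult.commute)
 consider "t = 0" | "t = 1" | "0 < t" "t < 1" using t by fastforce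
 then show ?thesis
 proof cases
  case 3
  obtain K where K: "0 <= K" "!!c m. 0 < c ==> c <= eps ==> (\<integral>\<^sup>+x. ennreal ((norm x)^2) * ennreal (hk c m (x::real^'n)) \<partial>lborel) <= ennreal (2 * (norm m)^2 + K)"
   by (rule heat_second_moment) blast
  define a b where "a = eps * t" and "b = eps * (1 - t)"
  have ab: "0 < a" "0 < b" "a + b = eps" using 3 eps by (auto simp: a_def b_def algebra_simps)
  define c where "c = a * b / (a + b)"
  have c: "0 < c" "c <= eps"
  proof -
   show "0 < c" using ab by (simp add: c_def)
   have "c = a * (b / (a + b))" by (simp add: c_def)
   also have "... <= a * 1" using ab(1,2) by (intro mult_left_mono) auto
   also have "... <= eps" using ab by simp
   finally show "c <= eps" .
  qed
  define m where "m = (%z y::real^'n. (b / (a + b)) *\<^sub>R z + (a / (a + b)) *\<^sub>R y)"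
  have hb: "hk a z x * hk b x y = hk eps z y * hk c (m z y) x" for z x y
   unfolding heat_kernel_bridge[OF ab(1,2)] c_def m_def ab(3) ..
  have m: "(norm (m z y))^2 <= 2 * (norm z)^2 + 2 * (norm y)^2" for z y
  proof -
   have "norm (m z y) <= norm ((b / (a + b)) *\<^sub>R z) + norm ((a / (a + b)) *\<^sub>R y)" unfolding m_def by (rule norm_triangle_ineq)
   also have "... = b / (a + b) * norm z + a / (a + b) * norm y" using ab(1,2) by simp
   also have "... <= 1 * norm z + 1 * norm y" using ab(1,2) by (intro add_mono mult_right_mono) auto
   finally have "(norm (m z y))^2 <= (norm z + norm y)^2" by (intro power_mono) auto
   also have "... <= 2 * (norm z)^2 + 2 * (norm y)^2" using sum_squares_bound[of "norm z" "norm y"] by (simp add: power2_sum)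
   finally show ?thesis .
  qed
  have [measurable]: "borel_fun (G t)" by (rule G_meas[OF t])
  have [measurable]: "borel_fun (F 1)" by (rule F_meas) auto
  have Gt: "ennreal (G t x) = (\<integral>\<^sup>+y. ennreal (g y) * ennreal (hk b x y) \<partial>lborel)" for x
   using G_step[of t 1 x] 3 by (simp add: G_def b_def)
  have F0: "F 0 = f" by (simp add: F_def)
  have "(\<integral>\<^sup>+x. ennreal ((norm x)^2) \<partial>mu t) = (\<integral>\<^sup>+x. ennreal (F t x) * (ennreal (G t x) * ennreal ((norm x)^2)) \<partial>lborel)"
   using F_pos[OF t] G_pos[OF t] by (subst nn_integral_mu[OF t]) (simp_all add: rho_def ennreal_mult less_imp_le mult.assoc)
  also have "... = (\<integral>\<^sup>+z. ennreal (f z) * (\<integral>\<^sup>+x. (ennreal (G t x) * ennreal ((norm x)^2)) * ennreal (hk a z x) \<partial>lborel) \<partial>lborel)"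
   using weighted_step[of 0 t "%x. ennreal (G t x) * ennreal ((norm x)^2)"] 3 by (simp add: F0 a_def)
  also have "... <= (\<integral>\<^sup>+z. ennreal (f z) * (\<integral>\<^sup>+y. (ennreal (g y) * ennreal (4 * (norm z)^2 + 4 * (norm y)^2 + K)) * ennreal (hk eps z y) \<partial>lborel) \<partial>lborel)"
  proof (rule nn_integral_mono, rule mult_left_mono)
   fix z :: "real^'n"
   have "(\<integral>\<^sup>+x. (ennreal (G t x) * ennreal ((norm x)^2)) * ennreal (hk a z x) \<partial>lborel)
     = (\<integral>\<^sup>+x. (\<integral>\<^sup>+y. ennreal (g y) * (ennreal ((norm x)^2) * ennreal (hk a z x * hk b x y)) \<partial>lborel) \<partial>lborel)"
    unfolding Gt
   proof (rule nn_integral_cong)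
    fix x :: "real^'n"
    have "(\<integral>\<^sup>+y. ennreal (g y) * ennreal (hk b x y) \<partial>lborel) * ennreal ((norm x)^2) * ennreal (hk a z x)
     = (\<integral>\<^sup>+y. (ennreal (g y) * ennreal (hk b x y)) * (ennreal ((norm x)^2) * ennreal (hk a z x)) \<partial>lborel)"
     by (subst nn_integral_multc) (auto simp: mult.assoc)
    also have "... = (\<integral>\<^sup>+y. ennreal (g y) * (ennreal ((norm x)^2) * ennreal (hk a z x * hk b x y)) \<partial>lborel)"
     by (intro nn_integral_cong) (simp add: ennreal_mult heat_kernel_nonneg ac_simps)
    finally show "(\<integral>\<^sup>+y. ennreal (g y) * ennreal (hk b x y) \<partial>lborel) * ennreal ((norm x)^2) * ennreal (hk a z x)
     = (\<integral>\<^sup>+y. ennreal (g y) * (ennreal ((norm x)^2) * ennreal (hk a z x * hk b x y)) \<partial>lborel)" .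
   qed
   also have "... = (\<integral>\<^sup>+y. (\<integral>\<^sup>+x. ennreal (g y) * (ennreal ((norm x)^2) * ennreal (hk a z x * hk b x y)) \<partial>lborel) \<partial>lborel)"
    by (rule lborel_pair.Fubini') measurable
   also have "... = (\<integral>\<^sup>+y. (ennreal (g y) * (\<integral>\<^sup>+x. ennreal ((norm x)^2) * ennreal (hk c (m z y) x) \<partial>lborel)) * ennreal (hk eps z y) \<partial>lborel)"
    unfolding hb
    by (simp add: nn_integral_cmult[symmetric] nn_integral_multc[symmetric] ennreal_mult heat_kernel_nonneg ac_simps)
   also have "... <= (\<integral>\<^sup>+y. (ennreal (g y) * ennreal (4 * (norm z)^2 + 4 * (norm y)^2 + K)) * ennreal (hk eps z y) \<partial>lborel)"
   proof (intro nn_integral_mono mult_right_mono mult_left_mono)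
    fix y
    have "(\<integral>\<^sup>+x. ennreal ((norm x)^2) * ennreal (hk c (m z y) x) \<partial>lborel) <= ennreal (2 * (norm (m z y))^2 + K)" by (rule K(2)[OF c])
    also have "... <= ennreal (4 * (norm z)^2 + 4 * (norm y)^2 + K)" using m[of z y] by (intro ennreal_leI) linarith
    finally show "(\<integral>\<^sup>+x. ennreal ((norm x)^2) * ennreal (hk c (m z y) x) \<partial>lborel) <= ennreal (4 * (norm z)^2 + 4 * (norm y)^2 + K)" .
   qed auto
   finally show "(\<integral>\<^sup>+x. (ennreal (G t x) * ennreal ((norm x)^2)) * ennreal (hk a z x) \<partial>lborel)
     <= (\<integral>\<^sup>+y. (ennreal (g y) * ennreal (4 * (norm z)^2 + 4 * (norm y)^2 + K)) * ennreal (hk eps z y) \<partial>lborel)" .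
  qed auto
  also have "... = (\<integral>\<^sup>+z. ennreal (f z) * (\<integral>\<^sup>+y. (ennreal (g y) * ennreal (4 * (norm z)^2 + K)) * ennreal (hk eps z y)
     + (ennreal (g y) * ennreal (4 * (norm y)^2)) * ennreal (hk eps z y) \<partial>lborel) \<partial>lborel)"
  proof -
   have "ennreal (4 * (norm z)^2 + 4 * (norm y)^2 + K) = ennreal (4 * (norm z)^2 + K) + ennreal (4 * (norm y)^2)" for z y :: "real^'n"
    using K(1) by (subst ennreal_plus[symmetric]) (auto simp: algebra_simps)
   then show ?thesis by (simp only: distrib_left distrib_right)
  qed
  also have "... = (\<integral>\<^sup>+z. ennreal (f z) * (ennreal (4 * (norm z)^2 + K) * ennreal (G 0 z)) \<partial>lborel)
    + (\<integral>\<^sup>+z. ennreal (f z) * (\<integral>\<^sup>+y. (ennreal (g y) * ennreal (4 * (norm y)^2)) * ennreal (hk eps z y) \<partial>lborel) \<partial>lborel)"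
  proof -
   have [measurable]: "borel_fun (G 0)" by (rule G_meas) auto
   have "(\<integral>\<^sup>+y. (ennreal (g y) * ennreal (4 * (norm z)^2 + K)) * ennreal (hk eps z y) \<partial>lborel) = ennreal (4 * (norm z)^2 + K) * ennreal (G 0 z)" for z
   proof -
    have "(\<integral>\<^sup>+y. (ennreal (g y) * ennreal (4 * (norm z)^2 + K)) * ennreal (hk eps z y) \<partial>lborel)
     = (\<integral>\<^sup>+y. ennreal (4 * (norm z)^2 + K) * (ennreal (g y) * ennreal (hk eps z y)) \<partial>lborel)"
     by (simp only: ac_simps)
    also have "... = ennreal (4 * (norm z)^2 + K) * (\<integral>\<^sup>+y. ennreal (g y) * ennreal (hk eps z y) \<partial>lborel)"
     by (rule nn_integral_cmult) measurable
    finally show ?thesis using G_step[of 0 1 z] by (simp add: G_def)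
   qed
   then show ?thesis by (simp add: nn_integral_add distrib_left)
  qed
  also have "(\<integral>\<^sup>+z. ennreal (f z) * (\<integral>\<^sup>+y. (ennreal (g y) * ennreal (4 * (norm y)^2)) * ennreal (hk eps z y) \<partial>lborel) \<partial>lborel)
    = (\<integral>\<^sup>+y. ennreal (F 1 y) * (ennreal (g y) * ennreal (4 * (norm y)^2)) \<partial>lborel)"
   using weighted_step[of 0 1 "%y. ennreal (g y) * ennreal (4 * (norm y)^2)"] by (simp add: F0)
  also have "... = 4 * (\<integral>\<^sup>+x. ennreal ((norm x)^2) \<partial>mu 1)"
   unfolding e[OF z01(2)] using F_pos[OF z01(2)] g_pos
   by (subst nn_integral_cmult[symmetric]) (simp_all add: rho_def G_def ennreal_mult less_imp_le ac_simps)
  also have "(\<integral>\<^sup>+z. ennreal (f z) * (ennreal (4 * (norm z)^2 + K) * ennreal (G 0 z)) \<partial>lborel)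
    = 4 * (\<integral>\<^sup>+x. ennreal ((norm x)^2) \<partial>mu 0) + ennreal K * (\<integral>\<^sup>+x. ennreal (rho 0 x) \<partial>lborel)"
  proof -
   have [measurable]: "borel_fun (rho 0)" by (rule rho_meas) auto
   have "ennreal (f z) * (ennreal (4 * (norm z)^2 + K) * ennreal (G 0 z)) = 4 * ennreal ((norm z)^2 * rho 0 z) + ennreal K * ennreal (rho 0 z)" for z
    using f_pos[of z] G_pos[OF z01(1), of z] K(1)
    by (simp add: rho_def F0 ennreal_mult less_imp_le distrib_left distrib_right ac_simps)
   then show ?thesis unfolding e[OF z01(1)] by (simp add: nn_integral_add nn_integral_cmult)
  qed
  finally have "(\<integral>\<^sup>+x. ennreal ((norm x)^2) \<partial>mu t) <= 4 * (\<integral>\<^sup>+x. ennreal ((norm x)^2) \<partial>mu 0) + ennreal K * (\<integral>\<^sup>+x. ennreal (rho 0 x) \<partial>lborel)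
    + 4 * (\<integral>\<^sup>+x. ennreal ((norm x)^2) \<partial>mu 1)" .
  also have "... < \<infinity>" using fin0 fin1 rho_mass[OF z01(1)] by (simp add: ennreal_mult_less_top)
  finally show ?thesis .
 qed (use fin0 fin1 in auto)
qed

end

section \<open>The entropy inequality over a time step\<close>

context schroedinger
begin

definition psi :: "real => real^'n => real" where "psi t x = eps * ln (G t x)"
definition vel :: "real => real^'n => real^'n" where "vel t x = (eps / G t x) *\<^sub>R hgrad (eps * (1 - t)) g x"
definition ent :: "real => real" where "ent t = (LINT x|(mu t). psi t x)"

lemma sets_mu_cong[measurable_cong]: "sets (mu t) = sets borel"
 by simp

lemma hgrad_g_cont:
 assumes "t \<in> {0..1}" "t ~= 1"
 shows "contU (hgrad (eps * (1 - t)) g)"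
proof -
 have "hgrad (eps * (1 - t)) g = grad (heat_sg (eps * (1 - t)) g)"
  using grad_heat_sg[OF g_gc] time_G[OF assms] by (intro ext) simp
 then show ?thesis using continuous_on_grad[OF smooth_k_heat_sg[OF _ _ g_gc]] time_G[OF assms] by simp
qed

lemma mu_integrable_quadratic:
 fixes q :: "real^'n => real"
 assumes t: "t \<in> {0..1}" and [measurable]: "borel_fun q" and q: "!!x. \<bar>q x\<bar> <= A * (1 + (norm x)^2)"
 shows "integrable (mu t) q"
proof (rule integrable_boundI)
 interpret prob_space "mu t" by (rule mu_prob[OF t])
 have "integrable (mu t) (%x. (norm x)^2)"
  using mu_second_moment[OF t] by (intro integrableI_bounded) auto
 then show "integrable (mu t) (%x. A * (1 + (norm x)^2))" by simp
 show "AE x in mu t. norm (q x) <= norm (A * (1 + (norm x)^2))"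
  using q by (intro AE_I2) (auto intro: order_trans[OF _ abs_ge_self])
qed auto

lemma psi_meas: "t \<in> {0..1} ==> psi t \<in> borel_measurable borel"
 using G_meas[of t] unfolding psi_def[abs_def] by simp

lemma psi_integrable:
 assumes t: "t \<in> {0..1}"
 shows "integrable (mu t) (psi t)" "integrable (mu t) (%x. ln (G t x))"
proof -
 obtain A where A: "0 <= A" "!!x. \<bar>ln (G t x)\<bar> <= A * (1 + (norm x)^2)" using G_ln[OF t] by blast
 show "integrable (mu t) (%x. ln (G t x))"
  using A(2) G_meas[OF t] by (intro mu_integrable_quadratic[OF t, of _ A]) auto
 then show "integrable (mu t) (psi t)" unfolding psi_def[abs_def] by simp
qed

lemma integral_mu: "t \<in> {0..1} ==> q \<in> borel_measurable borel ==> (LINT x|(mu t). q x) = (LINT x|lborel. rho t x * q x)"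
 and integrable_mu: "t \<in> {0..1} ==> q \<in> borel_measurable borel ==> integrable (mu t) q \<longleftrightarrow> integrable lborel (%x. rho t x * q x)"
 for q :: "real^'n => real"
 using rho_pos[of t] rho_meas[of t] unfolding mu_def
 by (auto simp: integral_density integrable_density less_imp_le)

text \<open>By \<open>heat_sg_upper\<close>, \<open>G t\<close> has the larger rate kap / (1 - kap
  eps (1 - t)). Flowing it for the further time eps (t - s) is admissible precisely because kap eps
  (1 - s) < 1.\<close>

lemma G_semigroup:
 assumes t: "0 <= s" "s < t" "t <= 1"
 obtains kap' where "G t \<in> gauss_class kap'" "0 < eps * (t - s)" "kap' * (eps * (t - s)) < 1"
  "G s = heat_sg (eps * (t - s)) (G t)" "!!x. hgrad (eps * (t - s)) (G t) x = hgrad (eps * (1 - s)) g x"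
proof -
 have s01: "s \<in> {0..1}" "s ~= 1" and t01: "t \<in> {0..1}" using t by auto
 define r where "r = 1 - kap * (eps * (1 - t))"
 have r: "0 < r" using ks[of "eps * (1 - t)"] t eps by (simp add: r_def mult_le_cancel_left1)
 define kap' where "kap' = kap / r"
 have sig: "0 < eps * (t - s)" using t eps by simp
 have gc: "G t \<in> gauss_class kap'"
 proof (cases "t = 1")
  case True then show ?thesis using g_gc by (simp add: G_def kap'_def r_def)
 next
  case False
  then show ?thesis using heat_sg_gauss_bound[OF g_meas _ _ kap(1) g_bd'] time_G[OF t01]
   by (simp add: G_def kap'_def r_def)
 qed
 have "kap * (eps * (t - s)) < r"
  using time_G[OF s01] by (simp add: r_def algebra_simps)
 then have k': "kap' * (eps * (t - s)) < 1" using r by (simp add: kap'_def field_simps)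
 have eq: "G s x = heat_sg (eps * (t - s)) (G t) x" for x
 proof -
  have "ennreal (G s x) = ennreal (heat_sg (eps * (t - s)) (G t) x)"
   using G_step[OF t, of x] ennreal_heat_sg[OF gc sig k', of x] G_pos[OF t01]
   by (simp add: ennreal_mult heat_kernel_nonneg less_imp_le)
  moreover have "0 <= heat_sg (eps * (t - s)) (G t) x"
   using heat_sg_pos[OF gc sig k' G_cont[OF t01] G_pos[OF t01], of x] by simp
  ultimately show ?thesis using G_pos[OF s01(1), of x] by (simp add: less_imp_le)
 qed
 show ?thesis
 proof (rule that[OF gc sig k'])
  show E: "G s = heat_sg (eps * (t - s)) (G t)" using eq by auto
  show "hgrad (eps * (t - s)) (G t) x = hgrad (eps * (1 - s)) g x" for x
   using grad_heat_sg[OF gc sig k', of x] grad_heat_sg[OF g_gc, of "eps * (1 - s)" x] time_G[OF s01] s01(2)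
   by (simp add: E[symmetric]) (simp add: G_def)
 qed
qed

text \<open>The pointwise bound \<open>heat_sg_entropy_bound\<close> for the flow from
  \<open>t\<close> back to \<open>s\<close> is integrated against \<open>F s\<close>. Its right side
  becomes the integral of rho_t ln G_t by Fubini, its left side that of rho_s ln G_s plus energy.
  The energy at \<open>s\<close> is thus below every forward difference quotient of
  \<open>ent\<close>.\<close>

lemma energy_step:
 assumes t: "0 <= s" "s < t" "t <= 1"
 shows "ent s <= ent t"
  and "(\<integral>\<^sup>+x. ennreal ((norm (vel s x))^2 / 2) \<partial>mu s) <= ennreal ((ent t - ent s) / (t - s))"
proof -
 have s01: "s \<in> {0..1}" "s ~= 1" and t01: "t \<in> {0..1}" using t by auto
 define \<sigma> where "\<sigma> = eps * (t - s)"
 obtain kap' where gc: "G t \<in> gauss_class kap'" "0 < \<sigma>" "kap' * \<sigma> < 1"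
  and Gs: "G s = heat_sg \<sigma> (G t)" and hg: "!!x. hgrad \<sigma> (G t) x = hgrad (eps * (1 - s)) g x"
  unfolding \<sigma>_def by (rule G_semigroup[OF t]) blast
 obtain A where A: "0 <= A" "!!x. \<bar>ln (G t x)\<bar> <= A * (1 + (norm x)^2)" using G_ln[OF t01] by blast
 have [measurable]: "borel_fun (G t)" "borel_fun (F t)" "borel_fun (G s)" "borel_fun (F s)"
  by (rule G_meas F_meas t01 s01)+
 note EB = heat_sg_entropy_bound[OF gc G_pos[OF t01] _ A]
 define q where "q = (%x y. F s x * (G t y * ln (G t y) * hk \<sigma> x y))"
 have qm[measurable]: "(%(x, y). q x y) \<in> borel_measurable (lborel \<Otimes>\<^sub>M lborel)" unfolding q_def by measurable
 have FtG: "ennreal (\<bar>q x y\<bar>) = ennreal (F s x) * (ennreal (G t y * \<bar>ln (G t y)\<bar>) * ennreal (hk \<sigma> x y))" for x y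
  using F_pos[OF s01(1), of x] G_pos[OF t01, of y]
  by (simp add: q_def abs_mult ennreal_mult[symmetric] less_imp_le heat_kernel_nonneg)
 have qfin: "(\<integral>\<^sup>+x. (\<integral>\<^sup>+y. ennreal \<bar>q x y\<bar> \<partial>lborel) \<partial>lborel) < \<infinity>"
 proof -
  have "(\<integral>\<^sup>+x. (\<integral>\<^sup>+y. ennreal \<bar>q x y\<bar> \<partial>lborel) \<partial>lborel)
   = (\<integral>\<^sup>+x. ennreal (F s x) * (\<integral>\<^sup>+y. ennreal (G t y * \<bar>ln (G t y)\<bar>) * ennreal (hk \<sigma> x y) \<partial>lborel) \<partial>lborel)"
   unfolding FtG by (simp add: nn_integral_cmult)
  also have "... = (\<integral>\<^sup>+y. ennreal (F t y) * ennreal (G t y * \<bar>ln (G t y)\<bar>) \<partial>lborel)"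
   unfolding \<sigma>_def by (rule weighted_step[OF t]) measurable
  also have "... = (\<integral>\<^sup>+y. ennreal \<bar>rho t y * ln (G t y)\<bar> \<partial>lborel)"
   using F_pos[OF t01] G_pos[OF t01] by (simp add: rho_def ennreal_mult[symmetric] less_imp_le abs_mult mult.assoc)
  also have "... < \<infinity>" using psi_integrable(2)[OF t01] by (subst (asm) integrable_mu[OF t01]) (auto simp: integrable_iff_bounded)
  finally show ?thesis .
 qed
 have qi: "integrable (lborel \<Otimes>\<^sub>M lborel) (%(x, y). q x y)"
 proof (rule integrableI_bounded[OF qm])
  have "(\<integral>\<^sup>+z. ennreal (norm (case z of (x, y) => q x y)) \<partial>(lborel \<Otimes>\<^sub>M lborel)) = (\<integral>\<^sup>+x. (\<integral>\<^sup>+y. ennreal \<bar>q x y\<bar> \<partial>lborel) \<partial>lborel)"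
   by (subst lborel.nn_integral_fst[symmetric]) (auto intro!: nn_integral_cong)
  with qfin show "(\<integral>\<^sup>+z. ennreal (norm (case z of (x, y) => q x y)) \<partial>(lborel \<Otimes>\<^sub>M lborel)) < \<infinity>" by simp
 qed
 have Qi: "integrable lborel (%x. \<integral>y. q x y \<partial>lborel)" by (rule lborel_pair.integrable_fst[OF qi])
 have Ft: "(LINT x|lborel. F s x * hk \<sigma> x y) = F t y" for y
 proof -
  have "(\<integral>\<^sup>+x. ennreal (F s x * hk \<sigma> x y) \<partial>lborel) = ennreal (F t y)"
   using F_step[OF t, of y] F_pos[OF s01(1)] by (simp add: \<sigma>_def ennreal_mult less_imp_le heat_kernel_nonneg)
  then show ?thesis
   using F_pos[OF s01(1)] F_pos[OF t01, of y] by (subst integral_eq_nn_integral) (auto simp: heat_kernel_nonneg less_imp_le)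
 qed
 have Qint: "(LINT x|lborel. (LINT y|lborel. q x y)) = ent t / eps"
 proof -
  have "(LINT x|lborel. (LINT y|lborel. q x y)) = (LINT y|lborel. (LINT x|lborel. q x y))"
   by (rule lborel_pair.Fubini_integral[OF qi, symmetric])
  also have "... = (LINT y|lborel. rho t y * ln (G t y))"
  proof (rule LINT_cong[OF refl])
   fix y
   have "(LINT x|lborel. q x y) = (LINT x|lborel. (G t y * ln (G t y)) * (F s x * hk \<sigma> x y))"
    by (simp add: q_def ac_simps)
   also have "... = (G t y * ln (G t y)) * F t y" by (simp only: integral_mult_right_zero Ft)
   finally show "(LINT x|lborel. q x y) = rho t y * ln (G t y)" by (simp add: rho_def)
  qed
  also have "... = ent t / eps"
   unfolding ent_def psi_def using eps by (simp add: integral_mu[OF t01, symmetric])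
  finally show ?thesis .
 qed
 have ri: "integrable lborel (%x. rho s x * ln (G s x))" using psi_integrable(2)[OF s01(1)] by (subst (asm) integrable_mu[OF s01(1)]) auto
 have rint: "(LINT x|lborel. rho s x * ln (G s x)) = ent s / eps"
  unfolding ent_def psi_def using eps by (simp add: integral_mu[OF s01(1), symmetric])
 define D where "D = (%x. (LINT y|lborel. q x y) - rho s x * ln (G s x))"
 have Di: "integrable lborel D" "(LINT x|lborel. D x) = (ent t - ent s) / eps"
  unfolding D_def using Qi ri Qint rint by (auto simp: diff_divide_distrib)
 \<comment> \<open>As \<open>\<sigma>\<close> is eps (t - s), this is (t - s) / eps times the
   kinetic energy density at time \<open>s\<close>.\<close>
 define N where "N = (%x. F s x * (\<sigma> / 2 * (norm (hgrad (eps * (1 - s)) g x))\<^sup>2 / G s x))"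
 have N0: "0 <= N x" for x using F_pos[OF s01(1), of x] G_pos[OF s01(1), of x] gc(2) by (simp add: N_def)
 have ND: "N x <= D x" for x
 proof -
  have "G s x * ln (G s x) + \<sigma> / 2 * (norm (hgrad (eps * (1 - s)) g x))\<^sup>2 / G s x <= (LINT y|lborel. G t y * ln (G t y) * hk \<sigma> x y)"
   using EB(2)[of x] G_pos[OF s01(1), of x] unfolding Gs[symmetric] hg by simp
  then have "F s x * (G s x * ln (G s x) + \<sigma> / 2 * (norm (hgrad (eps * (1 - s)) g x))\<^sup>2 / G s x) <= F s x * (LINT y|lborel. G t y * ln (G t y) * hk \<sigma> x y)"
   using F_pos[OF s01(1), of x] by (intro mult_left_mono) auto
  then show ?thesis unfolding N_def D_def q_def rho_def by (simp add: distrib_left mult.assoc)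
 qed
 have "0 <= (LINT x|lborel. D x)" using ND N0 by (intro integral_nonneg_AE AE_I2) (meson order_trans)
 then show "ent s <= ent t" using Di(2) eps by (simp add: zero_le_divide_iff)
 have hgm[measurable]: "hgrad (eps * (1 - s)) g \<in> borel_measurable borel"
  by (rule borel_contI[OF hgrad_g_cont[OF s01]])
 have NM: "borel_fun N" unfolding N_def by measurable
 have vN: "ennreal (rho s x) * ennreal ((norm (vel s x))^2 / 2) = ennreal (eps / (t - s)) * ennreal (N x)" for x
 proof -
  have eq: "rho s x * ((norm (vel s x))^2 / 2) = eps / (t - s) * N x"
   using G_pos[OF s01(1), of x] t eps by (simp add: rho_def vel_def N_def \<sigma>_def power_divide power_mult_distrib field_simps power2_eq_square)
  have "ennreal (rho s x) * ennreal ((norm (vel s x))^2 / 2) = ennreal (rho s x * ((norm (vel s x))^2 / 2))"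
   using rho_pos[OF s01(1), of x] by (intro ennreal_mult[symmetric]) (auto simp: less_imp_le)
  also have "... = ennreal (eps / (t - s) * N x)" by (simp only: eq)
  also have "... = ennreal (eps / (t - s)) * ennreal (N x)" using N0[of x] t eps by (intro ennreal_mult) auto
  finally show ?thesis .
 qed
 have vm: "borel_fun (%x. ennreal ((norm (vel s x))^2 / 2))"
  unfolding vel_def by measurable
 have "(\<integral>\<^sup>+x. ennreal ((norm (vel s x))^2 / 2) \<partial>mu s) = ennreal (eps / (t - s)) * (\<integral>\<^sup>+x. ennreal (N x) \<partial>lborel)"
  using NM by (subst nn_integral_mu[OF s01(1) vm]) (simp add: vN nn_integral_cmult)
 also have "... <= ennreal (eps / (t - s)) * (\<integral>\<^sup>+x. ennreal (D x) \<partial>lborel)"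
  using ND by (intro mult_left_mono nn_integral_mono ennreal_leI) auto
 also have "(\<integral>\<^sup>+x. ennreal (D x) \<partial>lborel) = ennreal ((ent t - ent s) / eps)"
  using Di ND N0 by (subst nn_integral_eq_integral) (auto intro: order_trans)
 also have "ennreal (eps / (t - s)) * ennreal ((ent t - ent s) / eps) = ennreal ((ent t - ent s) / (t - s))"
  using t eps by (subst ennreal_mult'[symmetric]) auto
 finally show "(\<integral>\<^sup>+x. ennreal ((norm (vel s x))^2 / 2) \<partial>mu s) <= ennreal ((ent t - ent s) / (t - s))" .
qed

text \<open>Time reversal. It transfers statements about \<open>F\<close> to \<open>G\<close>, and
  it supplies the velocity at the terminal marginal as an initial velocity of the reversed
  interpolation.\<close>

lemma rev: "schroedinger g f eps kap M A0"
proof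
 show "(\<integral>\<^sup>+x. ennreal (g x * heat_sg eps f x) \<partial>lborel) = 1"
  using rho_mass[of 1] by (simp add: rho_def F_def G_def mult.commute)
qed (rule eps kap A0 f_cont g_cont f_pos g_pos f_bd g_bd f_ln g_ln mom0 mom1)+

end

text \<open>Integrated difference quotients of a monotone function telescope.\<close>

lemma integral_difference_quotient_le:
 fixes K :: "real => ennreal" and e :: "real => real"
 assumes Km: "borel_fun (%t. indicator {0<..<1} t * K t)"
  and mono: "!!s t. 0 <= s ==> s < t ==> t <= 1 ==> e s <= e t"
  and step: "!!s t. 0 <= s ==> s < t ==> t <= 1 ==> K s <= ennreal ((e t - e s) / (t - s))"
 shows "(\<integral>\<^sup>+t. indicator {0<..<1} t * K t \<partial>lborel) <= ennreal (e 1 - e 0)"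
proof -
 define w where "w = (%t. ennreal (e (clamp01 t) - e 0))"
 have mono': "e s <= e t" if "0 <= s" "s <= t" "t <= 1" for s t
  using mono[of s t] that by (cases "s = t") auto
 have "mono (%t. e (clamp01 t) - e 0)"
 proof (rule monoI)
  fix x y :: real assume "x <= y"
  then have "clamp01 x <= clamp01 y" by (auto simp: clamp01_def)
  then show "e (clamp01 x) - e 0 <= e (clamp01 y) - e 0"
   using mono'[of "clamp01 x" "clamp01 y"] clamp01_range[of x] clamp01_range[of y] by simp
 qed
 then have "borel_fun (%t. e (clamp01 t) - e 0)" by (rule borel_measurable_mono)
 then have wm[measurable]: "borel_fun w" unfolding w_def by measurable
 have wJ: "w t <= ennreal (e 1 - e 0)" for t
  unfolding w_def using mono'[of "clamp01 t" 1] clamp01_range[of t] by (intro ennreal_leI) simp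
 have bound: "(\<integral>\<^sup>+t. indicator {0<..1 - d} t * K t \<partial>lborel) <= ennreal (e 1 - e 0)" if d: "0 < d" "d < 1" for d
 proof -
  have Km'[measurable]: "borel_fun (%t. indicator {0<..1 - d} t * K t)"
  proof -
   have "borel_fun (%t. indicator {0<..1 - d} t * (indicator {0<..<1} t * K t))" using Km by measurable
   also have "(%t. indicator {0<..1 - d} t * (indicator {0<..<1} t * K t)) = (%t. indicator {0<..1 - d} t * K t)"
    using d by (auto simp: indicator_def)
   finally show ?thesis .
  qed
  \<comment> \<open>After integration the right side is the integral of \<open>w\<close> shifted by
    \<open>d\<close>. It exceeds the unshifted one only through a strip of length \<open>d\<close>
    at the end, where \<open>w\<close> is at most e(1) - e(0); subtracting the common finite
    integral and dividing by \<open>d\<close> gives the bound.\<close>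
  have pw: "ennreal d * (indicator {0<..1 - d} t * K t) + indicator {0<..1 - d} t * w t <= indicator {0<..1 - d} t * w (t + d)" for t
  proof (cases "t \<in> {0<..1 - d}")
   case True
   have "ennreal d * K t <= ennreal d * ennreal ((e (t + d) - e t) / d)"
    using step[of t "t + d"] True d by (intro mult_left_mono) auto
   also have "... = ennreal (e (t + d) - e t)" using d mono[of t "t + d"] True by (subst ennreal_mult'[symmetric]) auto
   finally have "ennreal d * K t + ennreal (e t - e 0) <= ennreal (e (t + d) - e t) + ennreal (e t - e 0)" by (rule add_right_mono)
   also have "... = ennreal (e (t + d) - e 0)"
    using mono[of t "t + d"] mono[of 0 t] True d by (subst ennreal_plus[symmetric]) auto
   finally show ?thesis using True d by (simp add: w_def clamp01_id)
  qed simp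
  let ?W = "\<integral>\<^sup>+t. indicator {0<..1 - d} t * w t \<partial>lborel"
  have "ennreal d * (\<integral>\<^sup>+t. indicator {0<..1 - d} t * K t \<partial>lborel) + ?W
   = (\<integral>\<^sup>+t. ennreal d * (indicator {0<..1 - d} t * K t) + indicator {0<..1 - d} t * w t \<partial>lborel)"
   by (simp add: nn_integral_add nn_integral_cmult)
  also have "... <= (\<integral>\<^sup>+t. indicator {0<..1 - d} t * w (t + d) \<partial>lborel)" by (rule nn_integral_mono[OF pw])
  also have "... = (\<integral>\<^sup>+t. indicator {d<..1} t * w t \<partial>lborel)"
   by (subst (2) nn_integral_real_affine[where c=1 and t=d])
    (auto simp: indicator_def add.commute intro!: nn_integral_cong)
  also have "... <= (\<integral>\<^sup>+t. indicator {0<..1 - d} t * w t + ennreal (e 1 - e 0) * indicator {1 - d<..1} t \<partial>lborel)"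
   using wJ d by (intro nn_integral_mono) (auto simp: indicator_def)
  also have "... = ?W + ennreal (e 1 - e 0) * ennreal d"
   using d by (simp add: nn_integral_add nn_integral_cmult)
  finally have *: "ennreal d * (\<integral>\<^sup>+t. indicator {0<..1 - d} t * K t \<partial>lborel) + ?W <= ennreal d * ennreal (e 1 - e 0) + ?W"
   by (simp add: ac_simps)
  have "?W <= (\<integral>\<^sup>+t. ennreal (e 1 - e 0) * indicator {0<..1 - d} t \<partial>lborel)"
   using wJ by (intro nn_integral_mono) (auto simp: indicator_def)
  also have "... < \<infinity>" using d by (simp add: nn_integral_cmult ennreal_mult_less_top)
  finally have "?W ~= \<top>" by simp
  with *[unfolded add.commute[of _ ?W] ennreal_add_left_cancel_le]
  have "ennreal d * (\<integral>\<^sup>+t. indicator {0<..1 - d} t * K t \<partial>lborel) <= ennreal d * ennreal (e 1 - e 0)"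
   by simp
  then show ?thesis using d by (subst (asm) ennreal_mult_le_mult_iff) auto
 qed
 have "(\<integral>\<^sup>+t. indicator {0<..<1} t * K t \<partial>lborel) = (\<integral>\<^sup>+t. (SUP n. indicator {0<..1 - 1 / real (n + 2)} t * (indicator {0<..<1} t * K t)) \<partial>lborel)"
 proof (rule nn_integral_cong)
  fix t :: real
  show "indicator {0<..<1} t * K t = (SUP n. indicator {0<..1 - 1 / real (n + 2)} t * (indicator {0<..<1} t * K t))"
  proof (cases "t \<in> {0<..<1}")
   case True
   obtain n where n: "1 / (1 - t) < real n" using reals_Archimedean2 by blast
   then have "1 / (1 - t) < real (n + 2)" by simp
   then have "t <= 1 - 1 / real (n + 2)" using True by (simp add: field_simps)
   then have "indicator {0<..1 - 1 / real (n + 2)} t * (indicator {0<..<1} t * K t) = K t" using True by simp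
   then have "K t <= (SUP n. indicator {0<..1 - 1 / real (n + 2)} t * (indicator {0<..<1} t * K t))"
    by (intro SUP_upper2[of n]) auto
   moreover have "(SUP n. indicator {0<..1 - 1 / real (n + 2)} t * (indicator {0<..<1} t * K t)) <= K t"
    by (intro SUP_least) (auto simp: indicator_def)
   ultimately show ?thesis using True by (simp add: antisym)
  qed simp
 qed
 also have "... = (SUP n. \<integral>\<^sup>+t. indicator {0<..1 - 1 / real (n + 2)} t * (indicator {0<..<1} t * K t) \<partial>lborel)"
 proof (rule nn_integral_monotone_convergence_SUP)
  show "incseq (%n t. indicator {0<..1 - 1 / real (n + 2)} t * (indicator {0<..<1} t * K t))"
  proof (intro incseq_SucI le_funI)
   fix n t
   have "1 / real (Suc n + 2) <= 1 / real (n + 2)" by (intro divide_left_mono) auto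
   then show "indicator {0<..1 - 1 / real (n + 2)} t * (indicator {0<..<1} t * K t) <= indicator {0<..1 - 1 / real (Suc n + 2)} t * (indicator {0<..<1} t * K t)"
    by (auto simp: indicator_def)
  qed
 qed (use Km in measurable)
 also have "... <= ennreal (e 1 - e 0)"
 proof (rule SUP_least)
  fix n
  have "(\<integral>\<^sup>+t. indicator {0<..1 - 1 / real (n + 2)} t * (indicator {0<..<1} t * K t) \<partial>lborel) = (\<integral>\<^sup>+t. indicator {0<..1 - 1 / real (n + 2)} t * K t \<partial>lborel)"
  proof (intro nn_integral_cong)
   fix t :: real
   have "0 < 1 / real (n + 2)" by simp
   then have "t \<in> {0<..1 - 1 / real (n + 2)} ==> t \<in> {0<..<1}"
    unfolding greaterThanAtMost_iff greaterThanLessThan_iff by linarith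
   then show "indicator {0<..1 - 1 / real (n + 2)} t * (indicator {0<..<1} t * K t) = indicator {0<..1 - 1 / real (n + 2)} t * K t"
    by (simp add: indicator_def)
  qed
  also have "... <= ennreal (e 1 - e 0)" by (rule bound) auto
  finally show "(\<integral>\<^sup>+t. indicator {0<..1 - 1 / real (n + 2)} t * (indicator {0<..<1} t * K t) \<partial>lborel) <= ennreal (e 1 - e 0)" .
 qed
 finally show ?thesis .
qed

text \<open>Translation invariance makes every difference quotient integrate to 0. The mean value
  theorem bounds the quotients on a fixed ball and the support bounds them outside, so dominated
  convergence passes to the derivative.\<close>

lemma integral_partial_deriv_eq_0:
 fixes Y :: "real^'n::finite => real"
 assumes Y: "smooth_k (Suc 0) Y" and K: "compact K" "!!x. x \<notin> K ==> Y x = 0"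
 shows "integrable lborel (pd i Y)" "(LINT x|lborel. pd i Y x) = 0"
proof -
 define e where "e = (axis i 1 :: real^'n)"
 have ne: "norm e = 1" by (simp add: e_def norm_axis_1)
 have pc: "contU (pd i Y)" using Y by simp
 have Yc: "contU Y" using Y by simp
 have [measurable]: "borel_fun (pd i Y)" "borel_fun Y"
  by (rule borel_contI[OF pc] borel_contI[OF Yc])+
 have p0: "pd i Y x = 0" if "x \<notin> K" for x
  using grad_laplacian_outside(1)[OF compact_imp_closed[OF K(1)] K(2) that] grad_nth[of Y x i] by simp
 obtain R where R: "K \<subseteq> cball 0 R" "0 < R"
  using bounded_subset_ballD[OF compact_imp_bounded[OF K(1)], of 0] ball_subset_cball by blast
 have "compact (pd i Y ` K)" by (intro compact_continuous_image continuous_on_subset[OF pc] K) auto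
 from compact_imp_bounded[OF this] obtain B where "\<forall>z\<in>pd i Y ` K. norm z <= B" by (auto simp: bounded_iff)
 then have B: "\<bar>pd i Y x\<bar> <= max B 0" for x
  using p0[of x] by (cases "x \<in> K") (auto simp: le_max_iff_disj)
 have der: "((%h. Y (x + h *\<^sub>R e)) has_real_derivative pd i Y (x + h *\<^sub>R e)) (at h)" for x h
 proof -
  have 1: "((%h. x + h *\<^sub>R e) has_derivative (%d. d *\<^sub>R e)) (at h)" by (auto intro!: derivative_eq_intros)
  have 2: "(Y has_derivative (%d. grad Y (x + h *\<^sub>R e) \<bullet> d)) (at (x + h *\<^sub>R e))"
   by (rule has_derivative_grad[OF smooth_k_differentiable[OF Y]])
  from has_derivative_compose[OF 1 2] show ?thesis
   by (simp add: has_field_derivative_def e_def inner_axis grad_nth mult_commute_abs)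
 qed
 have Yi: "integrable lborel Y"
 proof -
  have "integrable lborel (%x. indicator K x *\<^sub>R Y x)"
   by (intro borel_integrable_compact K continuous_on_subset[OF Yc]) auto
  moreover have "(%x. indicator K x *\<^sub>R Y x) = Y" using K(2) by (intro ext) (auto simp: indicator_def)
  ultimately show ?thesis by simp
 qed
 define q where "q = (%n x. (Y (x + (1 / real (Suc n)) *\<^sub>R e) - Y x) / (1 / real (Suc n)))"
 have qm: "q n \<in> borel_measurable lborel" for n unfolding q_def by measurable
 have bi: "integrable lborel (%x::real^'n. indicator (cball 0 (R + 1)) x *\<^sub>R max B 0)"
  by (intro borel_integrable_compact) auto
 have qb: "\<bar>q n x\<bar> <= indicator (cball 0 (R + 1)) x *\<^sub>R max B 0" for n x
 proof (cases "norm x <= R + 1")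
  case True
  obtain z where "q n x = pd i Y (x + z *\<^sub>R e)"
  proof -
   have "0 < 1 / real (Suc n)" by simp
   from MVT2[OF this, of "%h. Y (x + h *\<^sub>R e)" "%h. pd i Y (x + h *\<^sub>R e)"] der
   obtain z where "Y (x + (1 / real (Suc n)) *\<^sub>R e) - Y (x + 0 *\<^sub>R e) = (1 / real (Suc n) - 0) * pd i Y (x + z *\<^sub>R e)" by blast
   then have "q n x = pd i Y (x + z *\<^sub>R e)" by (simp add: q_def)
   then show ?thesis by (rule that)
  qed
  then show ?thesis using B True by simp
 next
  case False
  have "norm x <= norm (x + (1 / real (Suc n)) *\<^sub>R e) + norm ((1 / real (Suc n)) *\<^sub>R e)"
   using norm_triangle_ineq4[of "x + (1 / real (Suc n)) *\<^sub>R e" "(1 / real (Suc n)) *\<^sub>R e"] by simp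
  also have "norm ((1 / real (Suc n)) *\<^sub>R e) <= 1" by (simp add: ne)
  finally have "x + (1 / real (Suc n)) *\<^sub>R e \<notin> K" "x \<notin> K" using False R by auto
  then show ?thesis using K(2) False by (simp add: q_def)
 qed
 have lim: "(%n. q n x) ----> pd i Y x" for x
 proof -
  have "((%h. (Y (x + h *\<^sub>R e) - Y x) / h) \<longlongrightarrow> pd i Y x) (at 0)"
   using der[of x 0] by (simp add: DERIV_def)
  moreover have "filterlim (%n. 1 / real (Suc n)) (at 0) sequentially"
   using LIMSEQ_Suc[OF lim_const_over_n, of 1] by (auto simp: filterlim_at)
  ultimately show ?thesis unfolding q_def by (rule filterlim_compose)
 qed
 have q0: "(LINT x|lborel. q n x) = 0" for n
 proof -
  let ?c = "(1 / real (Suc n)) *\<^sub>R e"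
  have "integrable lborel Y \<longleftrightarrow> integrable lborel (%x. Y (?c + x))"
   by (subst lborel_distr_plus[of ?c, symmetric]) (simp add: integrable_distr_eq)
  moreover have "(LINT x|lborel. Y x) = (LINT x|lborel. Y (?c + x))"
   by (subst lborel_distr_plus[of ?c, symmetric]) (simp add: integral_distr)
  ultimately show ?thesis using Yi unfolding q_def by (simp add: add.commute)
 qed
 show "integrable lborel (pd i Y)"
  by (rule integrable_dominated_convergence[where s=q and w="%x. indicator (cball 0 (R + 1)) x *\<^sub>R max B 0"])
   (use qm bi qb lim in auto)
 have "(%n. \<integral>x. q n x \<partial>lborel) ----> (LINT x|lborel. pd i Y x)"
  by (rule integral_dominated_convergence[where w="%x. indicator (cball 0 (R + 1)) x *\<^sub>R max B 0"])
   (use qm bi qb lim in auto)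
 then show "(LINT x|lborel. pd i Y x) = 0" unfolding q0 by (simp add: LIMSEQ_const_iff)
qed

section \<open>The interpolation solves the Fokker--Planck equation\<close>

context schroedinger
begin

lemma F_time_cont: "continuous_on {0..1} (%t. F t x)"
 unfolding continuous_on_def
proof
 fix t :: real assume t: "t \<in> {0..1}"
 show "((%t. F t x) \<longlongrightarrow> F t x) (at t within {0..1})"
 proof (cases "t = 0")
  case True
  have "((%t. heat_sg (eps * t) f x) \<longlongrightarrow> f x) (at 0 within {0..1})"
  proof (rule filterlim_compose[OF heat_sg_tendsto_initial[OF f_cont kap(1) f_bd']])
   have "((%t. eps * t) \<longlongrightarrow> eps * 0) (at 0 within {0..1})" by (intro tendsto_intros)
   moreover have "\<forall>\<^sub>F t in at 0 within {0..1}. eps * t \<in> {0<..} & eps * t ~= 0"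
    using eps unfolding eventually_at_filter by (intro always_eventually) auto
   ultimately show "filterlim (%t. eps * t) (at_right 0) (at 0 within {0..1})"
    unfolding filterlim_at by simp
  qed
  then have "((%t. F t x) \<longlongrightarrow> f x) (at 0 within {0..1})"
   by (rule Lim_transform_eventually) (unfold eventually_at_filter, intro always_eventually, auto simp: F_def)
  then show ?thesis using True by (simp add: F_def)
 next
  case False
  note s = time_F[OF t False]
  have c1: "isCont (%s. heat_sg s f x) (eps * t)" using DERIV_isCont[OF heat_sg_DERIV_time[OF f_gc]] s by blast
  have c2: "isCont (%t. eps * t) t" by (intro continuous_intros)
  have "isCont (%t. heat_sg (eps * t) f x) t" by (rule isCont_o2[OF c2 c1])
  then have "((%t. heat_sg (eps * t) f x) \<longlongrightarrow> F t x) (at t within {0..1})"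
   using False by (auto simp: isCont_def F_def intro: tendsto_within_subset)
  then show ?thesis
  proof (rule Lim_transform_eventually)
   have "\<forall>\<^sub>F s in nhds t. s ~= 0" using False by (intro t1_space_nhds)
   then show "\<forall>\<^sub>F s in at t within {0..1}. heat_sg (eps * s) f x = F s x"
    unfolding eventually_at_filter by eventually_elim (simp add: F_def)
  qed
 qed
qed

lemma G_eq_rev: "G t = schroedinger.F g eps (1 - t)"
 by (simp add: G_def schroedinger.F_def[OF rev])

lemma G_time_cont: "continuous_on {0..1} (%t. G t x)"
 unfolding G_eq_rev
 by (rule continuous_on_compose2[OF schroedinger.F_time_cont[OF rev]]) (auto intro!: continuous_intros)

text \<open>The densities converge pointwise and all have mass 1, so Scheffe's lemma gives
  convergence in L^1, which is stronger than the weak continuity required.\<close>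

lemma mu_curve: "prob_curve mu"
 unfolding prob_curve_def
proof (intro conjI ballI allI impI)
 fix h :: "real^'n => real" assume "contU h & bounded (range h)"
 then have h: "contU h" "bounded (range h)" by auto
 then have [measurable]: "borel_fun h" by (intro borel_contI)
 obtain B where B: "!!x. \<bar>h x\<bar> <= B" using h(2) by (auto simp: bounded_iff)
 have B0: "0 <= B" using B[of 0] by linarith
 show "continuous_on {0..1} (%t. \<integral>x. h x \<partial>mu t)"
  unfolding continuous_on_sequentially
 proof (intro allI ballI impI)
  fix S :: "nat => real" and t assume t: "t \<in> {0..1}" and "(\<forall>n. S n \<in> {0..1}) & S ----> t"
  then have S: "!!n. S n \<in> {0..1}" "S ----> t" by auto
  have rm[measurable]: "rho (S n) \<in> borel_measurable borel" "borel_fun (rho t)" for n using S t by (auto intro: rho_meas)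
  have mass: "(\<integral>\<^sup>+x. ennreal (norm (rho s x)) \<partial>lborel) = 1" if "s \<in> {0..1}" for s
   using rho_mass[OF that] rho_pos[OF that] by (simp add: less_imp_le)
  have ri: "integrable lborel (rho s)" if "s \<in> {0..1}" for s
   using mass[OF that] rho_meas[OF that] by (intro integrableI_bounded) auto
  have sch: "(%n. \<integral>\<^sup>+x. ennreal (norm (rho (S n) x - rho t x)) \<partial>lborel) ----> 0"
  proof (rule Scheffe_lemma2)
   show "AE x in lborel. (%n. rho (S n) x) ----> rho t x"
   proof (rule AE_I2)
    fix x
    have "continuous_on {0..1} (%t. rho t x)" unfolding rho_def by (intro continuous_intros F_time_cont G_time_cont)
    then show "(%n. rho (S n) x) ----> rho t x"
     using S t unfolding continuous_on_sequentially by (auto simp: o_def)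
   qed
  qed (use rm ri[OF t] mass[OF S(1)] mass[OF t] in auto)
  have ii: "integrable lborel (%x. rho s x * h x)" if "s \<in> {0..1}" for s
  proof (rule integrable_boundI[OF integrable_mult_left[OF ri[OF that], of B]])
   show "(%x. rho s x * h x) \<in> borel_measurable lborel" using rho_meas[OF that] by measurable
   show "AE x in lborel. norm (rho s x * h x) <= norm (rho s x * B)"
    using B B0 by (intro AE_I2) (simp add: abs_mult mult_left_mono)
  qed
  have "(%n. \<bar>(LINT x|(mu (S n)). h x) - (LINT x|(mu t). h x)\<bar>) ----> 0"
  proof (rule tendsto_sandwich[OF _ _ tendsto_const])
   have "(%n. \<integral>\<^sup>+x. ennreal (norm (rho (S n) x - rho t x)) \<partial>lborel) ----> ennreal 0" using sch by simp
   then have "(%n. enn2real (\<integral>\<^sup>+x. ennreal (norm (rho (S n) x - rho t x)) \<partial>lborel)) ----> 0"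
    by (rule tendsto_enn2real) simp
   from tendsto_mult_left[OF this, of B]
   show "(%n. B * enn2real (\<integral>\<^sup>+x. ennreal (norm (rho (S n) x - rho t x)) \<partial>lborel)) ----> 0" by simp
   show "\<forall>\<^sub>F n in sequentially. \<bar>(LINT x|(mu (S n)). h x) - (LINT x|(mu t). h x)\<bar> <= B * enn2real (\<integral>\<^sup>+x. ennreal (norm (rho (S n) x - rho t x)) \<partial>lborel)"
   proof (rule always_eventually, rule allI)
    fix n
    have di: "integrable lborel (%x. norm (rho (S n) x - rho t x))" using ri[OF S(1)] ri[OF t] by auto
    have "(LINT x|(mu (S n)). h x) - (LINT x|(mu t). h x) = (LINT x|lborel. rho (S n) x * h x - rho t x * h x)"
     using ii[OF S(1)] ii[OF t] by (simp add: integral_mu[OF S(1)] integral_mu[OF t])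
    also have "\<bar>...\<bar> <= (LINT x|lborel. B * norm (rho (S n) x - rho t x))"
    proof (rule integral_abs_le)
     show "\<bar>rho (S n) x * h x - rho t x * h x\<bar> <= B * norm (rho (S n) x - rho t x)" for x
      unfolding left_diff_distrib[symmetric] abs_mult
      using mult_right_mono[OF B[of x], of "\<bar>rho (S n) x - rho t x\<bar>"] by (simp add: mult.commute)
    qed (use ii[OF S(1)] ii[OF t] di in auto)
    also have "... = B * enn2real (\<integral>\<^sup>+x. ennreal (norm (rho (S n) x - rho t x)) \<partial>lborel)"
     using di by (simp add: integral_eq_nn_integral)
    finally show "\<bar>(LINT x|(mu (S n)). h x) - (LINT x|(mu t). h x)\<bar> <= B * enn2real (\<integral>\<^sup>+x. ennreal (norm (rho (S n) x - rho t x)) \<partial>lborel)" .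
   qed
  qed auto
  then have "(%n. (LINT x|(mu (S n)). h x) - (LINT x|(mu t). h x)) ----> 0" by (simp add: tendsto_rabs_zero_iff)
  then show "((%t. \<integral>x. h x \<partial>mu t) \<circ> S) ----> (LINT x|(mu t). h x)" by (simp add: o_def LIM_zero_iff)
 qed
qed (use mu_prob in auto)

lemma interior_cont:
 shows "continuous_on ({0<..<1} \<times> UNIV) (%z. F (fst z) (snd z))"
  "continuous_on ({0<..<1} \<times> UNIV) (%z. G (fst z) (snd z))"
  "continuous_on ({0<..<1} \<times> UNIV) (%z. hgrad (eps * fst z) f (snd z))"
  "continuous_on ({0<..<1} \<times> UNIV) (%z. hgrad (eps * (1 - fst z)) g (snd z))"
  "continuous_on ({0<..<1} \<times> UNIV) (%z. htime (eps * fst z) f (snd z))"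
  "continuous_on ({0<..<1} \<times> UNIV) (%z. htime (eps * (1 - fst z)) g (snd z))"
proof -
 let ?A = "{0<..<1::real} \<times> (UNIV :: (real^'n) set)"
 have 1: "continuous_on ?A (%z. (eps * fst z, snd z))" "continuous_on ?A (%z. (eps * (1 - fst z), snd z))"
  by (intro continuous_intros)+
 have 2: "(%z. (eps * fst z, snd z)) ` ?A \<subseteq> {p. 0 < fst p & kap * fst p < 1}"
  using time_F by auto
 have 3: "(%z. (eps * (1 - fst z), snd z)) ` ?A \<subseteq> {p. 0 < fst p & kap * fst p < 1}"
  using time_G by auto
 have "continuous_on ?A (%z. heat_sg (eps * fst z) f (snd z))" "continuous_on ?A (%z. heat_sg (eps * (1 - fst z)) g (snd z))"
  using continuous_on_compose2[OF continuous_on_heat_sg[OF f_gc] 1(1) 2] continuous_on_compose2[OF continuous_on_heat_sg[OF g_gc] 1(2) 3] by auto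
 then show "continuous_on ?A (%z. F (fst z) (snd z))" "continuous_on ?A (%z. G (fst z) (snd z))"
  by (auto intro: continuous_on_eq simp: F_def G_def)
 show "continuous_on ?A (%z. hgrad (eps * fst z) f (snd z))" "continuous_on ?A (%z. htime (eps * fst z) f (snd z))"
  using continuous_on_compose2[OF continuous_on_hgrad[OF f_gc] 1(1) 2] continuous_on_compose2[OF continuous_on_htime[OF f_gc] 1(1) 2] by auto
 show "continuous_on ?A (%z. hgrad (eps * (1 - fst z)) g (snd z))" "continuous_on ?A (%z. htime (eps * (1 - fst z)) g (snd z))"
  using continuous_on_compose2[OF continuous_on_hgrad[OF g_gc] 1(2) 3] continuous_on_compose2[OF continuous_on_htime[OF g_gc] 1(2) 3] by auto
qed

lemma energy_le:
 "(\<integral>\<^sup>+t. indicator {0<..<1} t * (\<integral>\<^sup>+x. ennreal ((norm (vel t x))^2 / 2) \<partial>mu t) \<partial>lborel) <= ennreal (ent 1 - ent 0)"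
proof (rule integral_difference_quotient_le)
 let ?A = "{0<..<1::real} \<times> (UNIV :: (real^'n) set)"
 have gn: "z \<in> ?A ==> G (fst z) (snd z) ~= 0" for z using G_pos[of "fst z" "snd z"] by auto
 have "continuous_on ?A (%z. rho (fst z) (snd z) * ((norm (vel (fst z) (snd z)))^2 / 2))"
  unfolding rho_def vel_def using gn by (intro continuous_intros interior_cont) auto
 then have m: "(%z. indicator ?A z *\<^sub>R (rho (fst z) (snd z) * ((norm (vel (fst z) (snd z)))^2 / 2))) \<in> borel_measurable borel"
  by (intro borel_measurable_continuous_on_indicator borel_open open_Times) auto
 then have "(%(t, x). ennreal (indicator ?A (t, x) * (rho t x * ((norm (vel t x))^2 / 2)))) \<in> borel_measurable (borel \<Otimes>\<^sub>M lborel)"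
  by (subst measurable_cong_sets[OF sets_pair_measure_cong[OF refl sets_lborel] refl]) (simp add: borel_prod case_prod_unfold)
 then have "(%t. \<integral>\<^sup>+x. ennreal (indicator ?A (t, x) * (rho t x * ((norm (vel t x))^2 / 2))) \<partial>lborel) \<in> borel_measurable borel"
  using lborel.borel_measurable_nn_integral by simp
 also have "(%t. \<integral>\<^sup>+x. ennreal (indicator ?A (t, x) * (rho t x * ((norm (vel t x))^2 / 2))) \<partial>lborel)
   = (%t. indicator {0<..<1} t * (\<integral>\<^sup>+x. ennreal ((norm (vel t x))^2 / 2) \<partial>mu t))"
 proof
  fix t :: real
  show "(\<integral>\<^sup>+x. ennreal (indicator ?A (t, x) * (rho t x * ((norm (vel t x))^2 / 2))) \<partial>lborel)
   = indicator {0<..<1} t * (\<integral>\<^sup>+x. ennreal ((norm (vel t x))^2 / 2) \<partial>mu t)"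
  proof (cases "t \<in> {0<..<1}")
   case True
   then have t01: "t \<in> {0..1}" "t ~= 1" by auto
   have [measurable]: "hgrad (eps * (1 - t)) g \<in> borel_measurable borel" "borel_fun (G t)"
    by (rule borel_contI[OF hgrad_g_cont[OF t01]] G_meas[OF t01(1)])+
   have "borel_fun (%x. ennreal ((norm (vel t x))^2 / 2))" unfolding vel_def by measurable
   moreover have "ennreal (rho t x * ((norm (vel t x))^2 / 2)) = ennreal (rho t x) * ennreal ((norm (vel t x))^2 / 2)" for x
    using rho_pos[OF t01(1), of x] by (intro ennreal_mult) auto
   ultimately show ?thesis using True by (simp only: nn_integral_mu[OF t01(1)]) simp
  qed simp
 qed
 finally show "(%t. indicator {0<..<1} t * (\<integral>\<^sup>+x. ennreal ((norm (vel t x))^2 / 2) \<partial>mu t)) \<in> borel_measurable borel" .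
qed (rule energy_step; assumption)+

lemma ent_mono: "ent 0 <= ent 1"
 by (rule energy_step(1)) auto

text \<open>The left integrand is the time derivative of ph_t rho_t, because \<open>F\<close> solves
  the forward and \<open>G\<close> the backward heat equation. It differs from the generator term by
  eps / 2 times the divergence of \<open>Y\<close>, that is rho grad ph + ph (F grad G - G grad F),
  which is compactly supported and integrates to 0.\<close>

lemma fpgen_divergence:
 assumes t: "t \<in> {0<..<1}" and phi: "!!k. smooth_k k (ph t)" and K: "compact K" "!!x. x \<notin> K ==> ph t x = 0"
  and v: "!!x. v t x = vel t x" and phit: "contU (pht t)" "!!x. x \<notin> K ==> pht t x = 0"
 shows "(LINT x|lborel. pht t x * rho t x + ph t x * (eps * htime (eps * t) f x * G t x - F t x * (eps * htime (eps * (1 - t)) g x)))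
  = (LINT x|lborel. rho t x * fpgen eps ph pht v t x)"
proof -
 have t01: "t \<in> {0..1}" "t ~= 0" "t ~= 1" using t by auto
 note sF = time_F[OF t01(1,2)] and sG = time_G[OF t01(1,3)]
 have Fe: "F t = heat_sg (eps * t) f" and Ge: "G t = heat_sg (eps * (1 - t)) g" using t01 by (auto simp: F_def G_def)
 have sm: "smooth_k k (F t)" "smooth_k k (G t)" for k
  unfolding Fe Ge using smooth_k_heat_sg[OF _ _ f_gc] smooth_k_heat_sg[OF _ _ g_gc] sF sG by auto
 have sp: "smooth_k k (pd i (F t))" "smooth_k k (pd i (G t))" "smooth_k k (pd i (ph t))" for k i
  using sm(1)[of "Suc k"] sm(2)[of "Suc k"] phi[of "Suc k"] by auto
 define Y where "Y = (%i x. pd i (ph t) x * (F t x * G t x) + ph t x * (F t x * pd i (G t) x - G t x * pd i (F t) x))"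
 have sY: "smooth_k k (Y i)" for k i
  unfolding Y_def by (intro smooth_k_add smooth_k_mult smooth_k_diff sm sp phi)
 have Y0: "Y i x = 0" if "x \<notin> K" for x i
  using grad_laplacian_outside(1)[OF compact_imp_closed[OF K(1)] K(2) that] K(2)[OF that]
   grad_nth[of "ph t" x i]
  by (simp add: Y_def)
 have d: "h differentiable (at x)" if "!!k. smooth_k k h" for h :: "real^'n => real" and x by (rule smooth_k_differentiable[OF that])
 have dY: "pd i (Y i) x = pd i (pd i (ph t)) x * (F t x * G t x)
   + 2 * (F t x * (pd i (ph t) x * pd i (G t) x))
   + ph t x * (F t x * pd i (pd i (G t)) x - G t x * pd i (pd i (F t)) x)" for i x
 proof -
  have a1: "pd i (%x. F t x * G t x) x = F t x * pd i (G t) x + G t x * pd i (F t) x"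
   by (intro partial_deriv_mult d sm)
  have a2: "pd i (%x. F t x * pd i (G t) x) x = F t x * pd i (pd i (G t)) x + pd i (G t) x * pd i (F t) x"
   by (intro partial_deriv_mult d sm sp)
  have a3: "pd i (%x. (-1) * (G t x * pd i (F t) x)) x = (-1) * (G t x * pd i (pd i (F t)) x + pd i (F t) x * pd i (G t) x)"
   by (subst partial_deriv_mult[OF differentiable_const d[OF smooth_k_mult[OF sm(2) sp(1)]]], subst partial_deriv_mult[OF d[OF sm(2)] d[OF sp(1)]])
    (simp add: partial_deriv_const)
  have a4: "pd i (%x. F t x * pd i (G t) x + (-1) * (G t x * pd i (F t) x)) x
    = pd i (%x. F t x * pd i (G t) x) x + pd i (%x. (-1) * (G t x * pd i (F t) x)) x"
   by (intro partial_deriv_add d smooth_k_mult smooth_k_const sm sp)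
  have a5: "pd i (%x. ph t x * (F t x * pd i (G t) x + (-1) * (G t x * pd i (F t) x))) x
    = ph t x * pd i (%x. F t x * pd i (G t) x + (-1) * (G t x * pd i (F t) x)) x
     + (F t x * pd i (G t) x + (-1) * (G t x * pd i (F t) x)) * pd i (ph t) x"
   by (intro partial_deriv_mult d smooth_k_add smooth_k_mult smooth_k_const sm sp phi)
  have a6: "pd i (%x. pd i (ph t) x * (F t x * G t x)) x
    = pd i (ph t) x * pd i (%x. F t x * G t x) x + (F t x * G t x) * pd i (pd i (ph t)) x"
   by (intro partial_deriv_mult d smooth_k_mult sm sp)
  have "Y i = (%x. pd i (ph t) x * (F t x * G t x) + ph t x * (F t x * pd i (G t) x + (-1) * (G t x * pd i (F t) x)))"
   by (simp add: Y_def)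
  then have "pd i (Y i) x = pd i (%x. pd i (ph t) x * (F t x * G t x)) x
    + pd i (%x. ph t x * (F t x * pd i (G t) x + (-1) * (G t x * pd i (F t) x))) x"
   by (simp only:) (intro partial_deriv_add d smooth_k_add smooth_k_mult smooth_k_const sm sp phi)
  then show ?thesis unfolding a5 a6 a4 a3 a2 a1 by (simp add: algebra_simps)
 qed
 have lapF: "laplacian (F t) x = 2 * htime (eps * t) f x" and lapG: "laplacian (G t) x = 2 * htime (eps * (1 - t)) g x"
   and gG: "grad (G t) x = hgrad (eps * (1 - t)) g x" for x
  unfolding Fe Ge using laplacian_heat_sg[OF f_gc] laplacian_heat_sg[OF g_gc] grad_heat_sg[OF g_gc] sF sG by auto
 have sum: "(\<Sum>i\<in>UNIV. pd i (Y i) x) = laplacian (ph t) x * (F t x * G t x)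
   + 2 * (F t x * (grad (ph t) x \<bullet> grad (G t) x)) + ph t x * (F t x * laplacian (G t) x - G t x * laplacian (F t) x)" for x
  unfolding dY laplacian_def inner_vec_def grad_nth
  by (simp add: sum.distrib sum_subtractf sum_distrib_left sum_distrib_right right_diff_distrib)
 have eq: "rho t x * fpgen eps ph pht v t x = (pht t x * rho t x + ph t x * (eps * htime (eps * t) f x * G t x - F t x * (eps * htime (eps * (1 - t)) g x)))
   + eps / 2 * (\<Sum>i\<in>UNIV. pd i (Y i) x)" for x
 proof -
  have "rho t x * (v t x \<bullet> grad (ph t) x) = eps * (F t x * (grad (ph t) x \<bullet> grad (G t) x))"
   using G_pos[OF t01(1), of x] by (simp add: v vel_def rho_def gG inner_commute)
  then show ?thesis unfolding sum fpgen_def distrib_left lapF lapG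
   by (simp add: rho_def algebra_simps)
 qed
 have iS: "integrable lborel (%x. \<Sum>i\<in>UNIV. pd i (Y i) x)" "(LINT x|lborel. (\<Sum>i\<in>UNIV. pd i (Y i) x)) = 0"
  using integral_partial_deriv_eq_0[OF sY K(1) Y0] by (auto simp: Bochner_Integration.integral_sum)
 have iW: "integrable lborel (%x. pht t x * rho t x + ph t x * (eps * htime (eps * t) f x * G t x - F t x * (eps * htime (eps * (1 - t)) g x)))"
 proof -
  let ?W = "%x. pht t x * rho t x + ph t x * (eps * htime (eps * t) f x * G t x - F t x * (eps * htime (eps * (1 - t)) g x))"
  have "htime (eps * t) f = (%x. laplacian (F t) x / 2)" "htime (eps * (1 - t)) g = (%x. laplacian (G t) x / 2)"
   using lapF lapG by auto
  then have "contU (htime (eps * t) f)" "contU (htime (eps * (1 - t)) g)"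
   using continuous_on_laplacian[OF sm(1)] continuous_on_laplacian[OF sm(2)] by (auto intro!: continuous_intros)
  then have "contU ?W"
   using smooth_k_continuous[OF phi[of 0]] phit(1) smooth_k_continuous[OF sm(1)] smooth_k_continuous[OF sm(2)] rho_cont[OF t01(1)]
   by (intro continuous_intros)
  then have "integrable lborel (%x. indicator K x *\<^sub>R ?W x)"
   by (intro borel_integrable_compact K(1)) (auto intro: continuous_on_subset)
  moreover have "(%x. indicator K x *\<^sub>R ?W x) = ?W" using K(2) phit(2) by (auto simp: indicator_def fun_eq_iff)
  ultimately show ?thesis by simp
 qed
 show ?thesis unfolding eq using iS iW by simp
qed

end

context schroedinger
begin

lemma vel_meas: "t \<in> {0..1} ==> t ~= 1 ==> vel t \<in> borel_measurable borel"
proof -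
 assume t: "t \<in> {0..1}" "t ~= 1"
 have [measurable]: "hgrad (eps * (1 - t)) g \<in> borel_measurable borel" "borel_fun (G t)"
  by (rule borel_contI[OF hgrad_g_cont[OF t]] G_meas[OF t(1)])+
 show ?thesis unfolding vel_def[abs_def] by measurable
qed

text \<open>Comparison with the terminal time 1 in \<open>energy_step\<close> bounds the energy at
  each single earlier time, since a Fokker--Planck pair requires integrability at every time and not
  merely almost every one.\<close>

lemma vel_integrable:
 assumes t: "0 <= t" "t < 1"
 shows "integrable (mu t) (%x. (norm (vel t x))^2)" "integrable (mu t) (%x. norm (vel t x))"
proof -
 have t01: "t \<in> {0..1}" "t ~= 1" using t by auto
 interpret prob_space "mu t" by (rule mu_prob[OF t01(1)])
 have [measurable]: "borel_fun (vel t)" by (rule vel_meas[OF t01])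
 have "(\<integral>\<^sup>+x. ennreal ((norm (vel t x))^2 / 2) \<partial>mu t) < \<infinity>"
  by (rule le_less_trans[OF energy_step(2)[of t 1]]) (use t in auto)
 then have "integrable (mu t) (%x. (norm (vel t x))^2 / 2)" by (intro integrableI_bounded) auto
 from integrable_mult_right[OF this, of 2] show i: "integrable (mu t) (%x. (norm (vel t x))^2)" by simp
 show "integrable (mu t) (%x. norm (vel t x))"
 proof (rule integrable_boundI)
  show "integrable (mu t) (%x. 1 + (norm (vel t x))^2)" using i by simp
  have "z <= 1 + z\<^sup>2" for z :: real
  proof -
   have "0 <= (z - 1 / 2)\<^sup>2" by simp
   also have "... = z\<^sup>2 - z + 1 / 4" by (simp add: power2_eq_square algebra_simps)
   finally show ?thesis by linarith
  qed
  then show "AE x in mu t. norm (norm (vel t x)) <= norm (1 + (norm (vel t x))^2)" by (intro AE_I2) simp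
 qed measurable
qed

text \<open>The fundamental theorem of calculus is applied pointwise in \<open>x\<close>, then
  Fubini. The interval stays inside ]0,1[, away from the ends where \<open>f\<close> and
  \<open>g\<close> are merely continuous.\<close>

lemma fp_interior_identity:
 assumes T: "test_on 0 1 ph pht" and v: "!!t x. 0 <= t ==> t < 1 ==> v t x = vel t x" and ab: "0 < a" "a < b" "b < 1"
  and gm: "!!t. t \<in> {0<..<1} ==> fpgen eps ph pht v t \<in> borel_measurable borel"
 shows "(LINT t:{a..b}|lborel. (LINT x|(mu t). fpgen eps ph pht v t x)) = (LINT x|(mu b). ph b x) - (LINT x|(mu a). ph a x)"
proof -
 obtain K where K: "compact K" "!!t x. t \<in> {0..1} ==> x \<notin> K ==> ph t x = 0" "!!t x. t \<in> {0..1} ==> x \<notin> K ==> pht t x = 0"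
  by (rule test_on_support[OF T]) auto
 have c: "continuous_on ({0..1} \<times> UNIV) (%z. ph (fst z) (snd z))" "continuous_on ({0..1} \<times> UNIV) (%z. pht (fst z) (snd z))"
  using T unfolding test_on_def by (auto simp: case_prod_unfold)
 let ?O = "{0<..<1::real} \<times> (UNIV :: (real^'n) set)"
 have co: "continuous_on ?O (%z. ph (fst z) (snd z))" "continuous_on ?O (%z. pht (fst z) (snd z))"
  by (rule continuous_on_subset[OF c(1)] continuous_on_subset[OF c(2)]; auto)+
 define W where "W = (%t x. pht t x * rho t x + ph t x * (eps * htime (eps * t) f x * G t x - F t x * (eps * htime (eps * (1 - t)) g x)))"
 have Wc: "continuous_on ?O (%z. W (fst z) (snd z))"
  unfolding W_def rho_def by (intro continuous_intros co interior_cont)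
 have W0: "W t x = 0" if "t \<in> {0..1}" "x \<notin> K" for t x using K(2,3)[OF that] by (simp add: W_def)
 have sub: "{a..b} \<times> K \<subseteq> ?O" using ab by auto
 have "integrable lborel (%z. indicator ({a..b} \<times> K) z *\<^sub>R W (fst z) (snd z))"
  by (intro borel_integrable_compact compact_Times K(1) continuous_on_subset[OF Wc sub]) auto
 moreover have "(%z. indicator ({a..b} \<times> K) z *\<^sub>R W (fst z) (snd z)) = (%(t, x). indicator {a..b} t * W t x)"
 proof (rule ext)
  fix z :: "real \<times> (real^'n)"
  show "indicator ({a..b} \<times> K) z *\<^sub>R W (fst z) (snd z) = (case z of (t, x) => indicator {a..b} t * W t x)"
  proof (cases "fst z \<in> {a..b} & snd z \<notin> K")
   case True
   then have "W (fst z) (snd z) = 0" using ab by (intro W0) auto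
   then show ?thesis by (simp add: case_prod_unfold)
  qed (cases z, auto simp: indicator_def)
 qed
 ultimately have Wi: "integrable (lborel \<Otimes>\<^sub>M lborel) (%(t, x). indicator {a..b} t * W t x)"
  by (simp add: lborel_prod)
 have der: "((%t. ph t x * rho t x) has_real_derivative W t x) (at t)" if t: "0 < t" "t < 1" for t x
 proof -
  have t01: "t \<in> {0..1}" "t ~= 0" "t ~= 1" using t by auto
  have d1: "((%s. ph s x) has_real_derivative pht t x) (at t)"
   using T t unfolding test_on_def by (metis at_within_Icc_at atLeastAtMost_iff less_imp_le)
  have "((%s. heat_sg (eps * s) f x) has_real_derivative htime (eps * t) f x * eps) (at t)"
   using heat_sg_DERIV_time[OF f_gc] time_F[OF t01(1,2)]
   by (intro DERIV_chain2[where f="%s. heat_sg s f x" and g="%s. eps * s"]) (auto intro!: derivative_eq_intros)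
  then have d2: "((%s. F s x) has_real_derivative htime (eps * t) f x * eps) (at t)"
   by (rule has_field_derivative_transform_within_open[where S="{0<..<1}"]) (use t in \<open>auto simp: F_def\<close>)
  have "((%s. heat_sg (eps * (1 - s)) g x) has_real_derivative htime (eps * (1 - t)) g x * (- eps)) (at t)"
   using heat_sg_DERIV_time[OF g_gc] time_G[OF t01(1,3)]
   by (intro DERIV_chain2[where f="%s. heat_sg s g x" and g="%s. eps * (1 - s)"]) (auto intro!: derivative_eq_intros)
  then have d3: "((%s. G s x) has_real_derivative htime (eps * (1 - t)) g x * (- eps)) (at t)"
   by (rule has_field_derivative_transform_within_open[where S="{0<..<1}"]) (use t in \<open>auto simp: G_def\<close>)
  from DERIV_mult[OF d1 DERIV_mult[OF d2 d3]] show ?thesis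
   unfolding rho_def W_def by (simp add: algebra_simps)
 qed
 have inner: "(LINT t|lborel. indicator {a..b} t * W t x) = ph b x * rho b x - ph a x * rho a x" for x
 proof -
  have "continuous_on {0<..<1} (%t. W t x)"
   by (rule continuous_on_compose2[OF Wc, of _ "%t. (t, x)", simplified]) (auto intro!: continuous_intros)
  then have "isCont (%t. W t x) t" if "0 < t" "t < 1" for t using that by (simp add: continuous_on_eq_continuous_at)
  then have "(LINT t|lborel. W t x * indicator {a..b} t) = ph b x * rho b x - ph a x * rho a x"
   using ab der by (intro integral_FTC_Icc_real) auto
  then show ?thesis by (simp add: mult.commute)
 qed
 have phc: "contU (ph t)" "contU (pht t)" if "t \<in> {0..1}" for t
 proof -
  have cP: "contU (%x::real^'n. (t, x))" by (intro continuous_on_Pair continuous_on_const continuous_on_id)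
  show "contU (ph t)" "contU (pht t)"
   using continuous_on_compose2[OF c(1) cP] continuous_on_compose2[OF c(2) cP] that by (auto simp: image_subset_iff)
 qed
 have phm: "ph t \<in> borel_measurable borel" if "t \<in> {0..1}" for t by (rule borel_contI[OF phc(1)[OF that]])
 have pri: "integrable lborel (%x. ph t x * rho t x)" if t: "t \<in> {0..1}" for t
 proof -
  have "integrable lborel (%x. indicator K x *\<^sub>R (ph t x * rho t x))"
   by (intro borel_integrable_compact K(1) continuous_intros continuous_on_subset[OF phc(1)[OF t]] continuous_on_subset[OF rho_cont[OF t]]) auto
  moreover have "(%x. indicator K x *\<^sub>R (ph t x * rho t x)) = (%x. ph t x * rho t x)" using K(2)[OF t] by (intro ext) (auto simp: indicator_def)
  ultimately show ?thesis by simp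
 qed
 have "(LINT t:{a..b}|lborel. (LINT x|(mu t). fpgen eps ph pht v t x)) = (LINT t|lborel. (LINT x|lborel. indicator {a..b} t * W t x))"
  unfolding set_lebesgue_integral_def
 proof (intro LINT_cong refl)
  fix t
  show "indicator {a..b} t *\<^sub>R (LINT x|(mu t). fpgen eps ph pht v t x) = (LINT x|lborel. indicator {a..b} t * W t x)"
  proof (cases "t \<in> {a..b}")
   case True
   then have t: "t \<in> {0<..<1}" "t \<in> {0..1}" using ab by auto
   have sm: "smooth_k k (ph t)" for k using T t(2) unfolding test_on_def smooth_fun_iff_smooth_k by blast
   have "(LINT x|lborel. W t x) = (LINT x|lborel. rho t x * fpgen eps ph pht v t x)"
    unfolding W_def
    by (rule fpgen_divergence[where ph=ph and pht=pht and v=v and K=K])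
     (use t v sm K(1) K(2)[OF t(2)] phc(2)[OF t(2)] K(3)[OF t(2)] in auto)
   then show ?thesis using True integral_mu[OF t(2) gm[OF t(1)]] by simp
  qed simp
 qed
 also have "... = (LINT x|lborel. (LINT t|lborel. indicator {a..b} t * W t x))"
  by (rule lborel_pair.Fubini_integral[OF Wi, symmetric])
 also have "... = (LINT x|lborel. ph b x * rho b x) - (LINT x|lborel. ph a x * rho a x)"
  unfolding inner using pri[of a] pri[of b] ab by simp
 also have "... = (LINT x|(mu b). ph b x) - (LINT x|(mu a). ph a x)"
  using ab by (simp add: integral_mu phm mult.commute)
 finally show ?thesis .
qed

lemma fp_mu:
 assumes Bv: "borel_fun (%(t, x). v t x)" and v: "!!t x. 0 <= t ==> t < 1 ==> v t x = vel t x"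
  and v1: "integrable (mu 1) (%x. norm (v 1 x))"
 shows "fp_pair eps mu v"
  and "(\<integral>\<^sup>+t\<in>{0..1}. (\<integral>\<^sup>+x. ennreal ((norm (v t x))^2 / 2) \<partial>mu t) \<partial>lborel) <= ennreal (ent 1 - ent 0)"
proof -
 have AE01: "AE t in lborel. t ~= (0::real)" "AE t in lborel. t ~= (1::real)" by (rule AE_lborel_singleton)+
 let ?K = "%t. \<integral>\<^sup>+x. ennreal ((norm (v t x))^2 / 2) \<partial>mu t"
 have vm: "borel_fun (v t)" for t by (rule borel_slice[OF Bv])
 have eq: "(\<integral>\<^sup>+t\<in>{0..1}. ?K t \<partial>lborel) = (\<integral>\<^sup>+t. indicator {0<..<1} t * (\<integral>\<^sup>+x. ennreal ((norm (vel t x))^2 / 2) \<partial>mu t) \<partial>lborel)"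
  using AE01 by (intro nn_integral_cong_AE) (auto simp: indicator_def v elim!: eventually_elim2)
 show en: "(\<integral>\<^sup>+t\<in>{0..1}. ?K t \<partial>lborel) <= ennreal (ent 1 - ent 0)" unfolding eq by (rule energy_le)
 have vi: "integrable (mu t) (%x. norm (v t x))" if "t \<in> {0..1}" for t
 proof (cases "t = 1")
  case False
  then have "0 <= t" "t < 1" using that by auto
  then show ?thesis using vel_integrable(2)[of t] v[of t] by simp
 qed (use v1 in simp)
 have set_i: "set_integrable lborel {0..1} (%t. \<integral>x. norm (v t x) \<partial>mu t)"
  unfolding set_integrable_def
 proof (rule integrableI_bounded)
  have "borel_fun (%(t, x). norm (v t x))" using Bv by (simp add: case_prod_unfold)
  from prob_curve_integral_measurable[OF mu_curve this]
  have "(%t. indicator {0..1} t *\<^sub>R (LINT x|(mu (clamp01 t)). norm (v t x))) \<in> borel_measurable lborel" by simp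
  also have "(%t. indicator {0..1} t *\<^sub>R (LINT x|(mu (clamp01 t)). norm (v t x))) = (%t. indicator {0..1} t *\<^sub>R (LINT x|(mu t). norm (v t x)))"
   by (auto simp: indicator_def clamp01_id)
  finally show "(%t. indicator {0..1} t *\<^sub>R (LINT x|(mu t). norm (v t x))) \<in> borel_measurable lborel" .
  have Km: "borel_fun (%t. indicator {0..1} t * ?K t)"
  proof -
   have "borel_fun (%(t, x). ennreal ((norm (v t x))^2 / 2))" using Bv by (simp add: case_prod_unfold)
   from prob_curve_nn_integral_measurable[OF mu_curve this]
   have "(%t. indicator {0..1} t * (\<integral>\<^sup>+x. ennreal ((norm (v t x))^2 / 2) \<partial>mu (clamp01 t))) \<in> borel_measurable borel" by measurable
   also have "(%t. indicator {0..1} t * (\<integral>\<^sup>+x. ennreal ((norm (v t x))^2 / 2) \<partial>mu (clamp01 t))) = (%t. indicator {0..1} t * ?K t)"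
    by (auto simp: indicator_def clamp01_id)
   finally show ?thesis .
  qed
  have pw: "ennreal (norm (indicator {0..1} t *\<^sub>R (LINT x|(mu t). norm (v t x)))) <= indicator {0..1} t + indicator {0..1} t * ?K t" for t
  proof (cases "t \<in> {0..1}")
   case True
   interpret prob_space "mu t" by (rule mu_prob[OF True])
   have "ennreal (LINT x|(mu t). norm (v t x)) = (\<integral>\<^sup>+x. ennreal (norm (v t x)) \<partial>mu t)"
    using vi[OF True] by (intro nn_integral_eq_integral[symmetric]) auto
   also have "... <= (\<integral>\<^sup>+x. 1 + ennreal ((norm (v t x))^2 / 2) \<partial>mu t)"
   proof (rule nn_integral_mono)
    fix x
    have "0 <= (norm (v t x) - 1)^2" by simp
    then have "norm (v t x) <= 1 + (norm (v t x))^2 / 2" by (simp add: power2_diff)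
    then have "ennreal (norm (v t x)) <= ennreal (1 + (norm (v t x))^2 / 2)" by (rule ennreal_leI)
    also have "... = 1 + ennreal ((norm (v t x))^2 / 2)" by (subst ennreal_plus) auto
    finally show "ennreal (norm (v t x)) <= 1 + ennreal ((norm (v t x))^2 / 2)" .
   qed
   also have "... = 1 + ?K t" using vm[of t] emeasure_space_1 by (subst nn_integral_add) auto
   finally show ?thesis using True by (simp add: abs_of_nonneg integral_nonneg_AE)
  qed simp
  have "(\<integral>\<^sup>+t. ennreal (norm (indicator {0..1} t *\<^sub>R (LINT x|(mu t). norm (v t x)))) \<partial>lborel)
   <= (\<integral>\<^sup>+t. indicator {0..1} t + indicator {0..1} t * ?K t \<partial>lborel)" by (rule nn_integral_mono[OF pw])
  also have "... = (\<integral>\<^sup>+t. indicator {0..1::real} t \<partial>lborel) + (\<integral>\<^sup>+t. indicator {0..1} t * ?K t \<partial>lborel)"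
   using Km by (intro nn_integral_add) auto
  also have "(\<integral>\<^sup>+t. indicator {0..1::real} t \<partial>lborel) = 1" by simp
  also have "(\<integral>\<^sup>+t. indicator {0..1} t * ?K t \<partial>lborel) <= ennreal (ent 1 - ent 0)" using en by (simp add: mult.commute)
  also have "1 + ennreal (ent 1 - ent 0) < \<infinity>" by simp
  finally show "(\<integral>\<^sup>+t. ennreal (norm (indicator {0..1} t *\<^sub>R (LINT x|(mu t). norm (v t x)))) \<partial>lborel) < \<infinity>" by (simp add: add_left_mono)
 qed
 have weak: "(LINT t:{0..1}|lborel. (LINT x|(mu t). fpgen eps ph pht v t x)) = (LINT x|(mu 1). ph 1 x) - (LINT x|(mu 0). ph 0 x)"
  if T: "test_on 0 1 ph pht" for ph pht
 proof -
  define w where "w = (%t. \<integral>x. fpgen eps ph pht v t x \<partial>mu t)"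
  define m where "m = (%t. \<integral>x. ph t x \<partial>mu t)"
  note FI = fpgen_integrable[OF mu_curve Bv vi set_i order_refl zero_less_one order_refl T]
  have gi: "integrable (mu t) (fpgen eps ph pht v t)" if "t \<in> {0..1}" for t by (rule FI(1)[OF _ that])
  have wi: "set_integrable lborel {0..1} w" unfolding w_def by (rule FI(2))
  have gm: "fpgen eps ph pht v t \<in> borel_measurable borel" if "t \<in> {0<..<1}" for t
   using borel_measurable_integrable[OF gi[of t]] that by simp
  from T obtain K where K: "compact K" "!!t x. t \<in> {0..1} ==> x \<notin> K ==> ph t x = 0" unfolding test_on_def by blast
  have mc: "continuous_on {0..1} m"
   unfolding m_def by (rule curve_integral_continuous[OF mu_curve _ _ K]) (use T in \<open>auto simp: test_on_def\<close>)
  \<comment> \<open>Three successors make every term at most 1/3, hence smaller than its complement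
    to 1.\<close>
  define an where "an = (%n. 1 / real (Suc (Suc (Suc n))))"
  have an: "0 < an n" "an n < 1 - an n" "1 - an n < 1" for n by (auto simp: an_def field_simps)
  have anl: "an ----> 0"
   using LIMSEQ_Suc[OF LIMSEQ_Suc[OF LIMSEQ_Suc[OF lim_const_over_n[of 1]]]] by (simp add: an_def)
  have id: "(LINT t:{an n..1 - an n}|lborel. w t) = m (1 - an n) - m (an n)" for n
   unfolding w_def m_def by (rule fp_interior_identity[OF T v an gm])
  have an1: "an n <= 1" for n using an[of n] by linarith
  have l1: "(%n. m (1 - an n)) ----> m 1" "(%n. m (an n)) ----> m 0"
  proof -
   have "(%n. 1 - an n) ----> 1 - 0" by (intro tendsto_intros anl)
   then show "(%n. m (1 - an n)) ----> m 1"
    using an1 an(1) by (intro continuous_on_tendsto_compose[OF mc]) (auto intro!: always_eventually less_imp_le)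
   show "(%n. m (an n)) ----> m 0"
    using an1 an(1) by (intro continuous_on_tendsto_compose[OF mc anl]) (auto intro!: always_eventually less_imp_le)
  qed
  have "(%n. LINT t:{an n..1 - an n}|lborel. w t) ----> (LINT t:{0..1}|lborel. w t)"
   unfolding set_lebesgue_integral_def
  proof (rule integral_dominated_convergence[where w="%t. norm (indicator {0..1} t *\<^sub>R w t)"])
   have wm: "(%t. indicator {0..1} t *\<^sub>R w t) \<in> borel_measurable lborel" using wi by (auto simp: set_integrable_def)
   then show "(%t. indicator {0..1} t *\<^sub>R w t) \<in> borel_measurable lborel" .
   have sub: "indicator {an n..1 - an n} t *\<^sub>R w t = indicator {an n..1 - an n} t * (indicator {0..1} t *\<^sub>R w t)" for n t
    using an[of n] by (auto simp: indicator_def)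
   show "(%t. indicator {an n..1 - an n} t *\<^sub>R w t) \<in> borel_measurable lborel" for n
    unfolding sub using wm by measurable
   show "integrable lborel (%t. norm (indicator {0..1} t *\<^sub>R w t))" using wi unfolding set_integrable_def by (rule integrable_norm)
   show "AE t in lborel. norm (indicator {an n..1 - an n} t *\<^sub>R w t) <= norm (indicator {0..1} t *\<^sub>R w t)" for n
    unfolding sub by (intro AE_I2) (auto simp: indicator_def)
   show "AE t in lborel. (%n. indicator {an n..1 - an n} t *\<^sub>R w t) ----> indicator {0..1} t *\<^sub>R w t"
    using AE01
   proof eventually_elim
    case (elim t)
    show ?case
    proof (cases "t \<in> {0..1}")
     case True
     then have t: "0 < t" "0 < 1 - t" using elim by auto
     have "\<forall>\<^sub>F n in sequentially. an n < t & an n < 1 - t"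
      using order_tendstoD(2)[OF anl t(1)] order_tendstoD(2)[OF anl t(2)] by eventually_elim auto
     then have "\<forall>\<^sub>F n in sequentially. indicator {an n..1 - an n} t *\<^sub>R w t = indicator {0..1} t *\<^sub>R w t"
      by eventually_elim (use True in auto)
     then show ?thesis by (rule tendsto_eventually)
    next
     case False
     then have "(%n. indicator {an n..1 - an n} t *\<^sub>R w t) = (%n. 0)" unfolding sub by simp
     then show ?thesis using False by (simp only:) simp
    qed
   qed
  qed
  moreover have "(%n. LINT t:{an n..1 - an n}|lborel. w t) ----> m 1 - m 0"
   unfolding id by (intro tendsto_diff l1)
  ultimately have "(LINT t:{0..1}|lborel. w t) = m 1 - m 0" by (rule LIMSEQ_unique)
  then show ?thesis by (simp add: w_def m_def)
 qed
 show "fp_pair eps mu v"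
  unfolding fp_pair_def
 proof (intro conjI mu_curve Bv ballI allI impI set_i)
  show "integrable (mu t) (%x. norm (v t x))" if "t \<in> {0..1}" for t by (rule vi[OF that])
  fix ph pht :: "real => real^'n => real" assume "test_fun ph pht"
  then have "test_on 0 1 ph pht" by (simp add: test_fun_eq_test_on)
  from weak[OF this]
  show "(LINT t:{0..1}|lborel. (LINT x|(mu t). pht t x + eps / 2 * laplacian (ph t) x + v t x \<bullet> grad (ph t) x))
    = (LINT x|(mu 1). ph 1 x) - (LINT x|(mu 0). ph 0 x)" by (simp add: fpgen_def)
 qed
qed

end

lemma exp_le_quadratic: "\<bar>z\<bar> <= 1 ==> exp z <= 1 + z + 3 * z\<^sup>2" for z :: real
proof -
 assume z: "\<bar>z\<bar> <= 1"
 have "exp z - 1 - z <= z\<^sup>2 * exp \<bar>z\<bar>" using exp_remainder_bound[of z] by linarith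
 also have "... <= z\<^sup>2 * 3" using z exp_le by (intro mult_left_mono) (auto intro: order_trans[of _ "exp 1"])
 finally show ?thesis by simp
qed

text \<open>For U >= 1 the increment is absorbed multiplicatively, U + d <= U (1 + d0); otherwise U
  + d <= 1 + d0. The bound dominates the logarithms when the lifts of the truncations tend to
  0.\<close>

lemma ln_add_bound:
 fixes U d d0 :: real
 assumes U: "0 < U" and d: "0 <= d" "d <= d0"
 shows "\<bar>ln (U + d)\<bar> <= \<bar>ln U\<bar> + ln (1 + d0)"
proof -
 have d0: "0 <= d0" using d by simp
 have l0: "0 <= ln (1 + d0)" using d0 by simp
 have lo: "ln U <= ln (U + d)" using U d by simp
 have "ln (U + d) <= \<bar>ln U\<bar> + ln (1 + d0)"
 proof (cases "1 <= U")
  case True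
  have "d <= U * d0" using mult_mono[OF True d(2)] U d by simp
  then have "U + d <= U * (1 + d0)" by (simp add: algebra_simps)
  then have "ln (U + d) <= ln (U * (1 + d0))" using U d d0 by (subst ln_le_cancel_iff) auto
  also have "... = ln U + ln (1 + d0)" using U d0 by (simp add: ln_mult)
  finally show ?thesis by linarith
 next
  case False
  then have "ln (U + d) <= ln (1 + d0)" using U d by (subst ln_le_cancel_iff) auto
  then show ?thesis by linarith
 qed
 with lo l0 show ?thesis by linarith
qed

section \<open>The dual bound for regular potentials and the marginals of minimizers\<close>

context schroedinger
begin

lemma heat_sg_mono:
 fixes h k :: "real^'n => real"
 assumes "h \<in> gauss_class a" "k \<in> gauss_class b" "0 < s" "a * s < 1" "b * s < 1" "!!y. h y <= k y"
 shows "heat_sg s h x <= heat_sg s k x"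
 unfolding heat_sg_def
 using gauss_class_integrable_kernel[OF assms(1,3,4)] gauss_class_integrable_kernel[OF assms(2,3,5)] assms(6)
 by (intro integral_mono mult_right_mono heat_kernel_nonneg) auto

lemma gauss_class_mono: "w \<in> gauss_class a ==> a <= b ==> w \<in> gauss_class b"
 by (auto simp: gauss_class_def)

lemma gauss_class_add: "w \<in> gauss_class a ==> w' \<in> gauss_class a ==> (%y. w y + w' y) \<in> gauss_class a"
 by (auto simp: gauss_class_def distrib_left)

lemma gauss_class_cmult: "w \<in> gauss_class a ==> (%y. c * w y) \<in> gauss_class a"
 using gauss_class_mult[of w a "%_. c" "\<bar>c\<bar>" 0] by simp

lemma gauss_class_const: "0 <= a ==> (%y. c) \<in> gauss_class a"
 by (rule gauss_class_mono[OF gauss_class_const_bounded[of _ "\<bar>c\<bar>"]]) auto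

lemma heat_sg_linear:
 assumes "h \<in> gauss_class a" "k \<in> gauss_class a" "0 < s" "a * s < 1"
 shows "heat_sg s (%y. c * h y + d * k y) x = c * heat_sg s h x + d * heat_sg s k x"
 unfolding heat_sg_def distrib_right mult.assoc
 using gauss_class_integrable_kernel[OF assms(1,3,4), of x] gauss_class_integrable_kernel[OF assms(2,3,4), of x]
 by simp

lemma heat_sg_const: "0 < s ==> heat_sg s (%y. c) x = c"
 using integral_heat_kernel[of s x] by (simp add: heat_sg_def)

abbreviation energy where
 "energy nu v a b \<equiv> (\<integral>\<^sup>+t\<in>{a..b}. (\<integral>\<^sup>+x. ennreal ((norm (v t x))^2 / 2) \<partial>nu t) \<partial>(lborel::real measure))"

lemma G_class:
 assumes T: "0 < T" "T < 1"
 obtains kap' where "0 <= kap'" "G T \<in> gauss_class kap'" "kap' * (eps * T) < 1" "G 0 = heat_sg (eps * T) (G T)" "0 < eps * T"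
proof -
 obtain kap' where k: "G T \<in> gauss_class kap'" "0 < eps * (T - 0)" "kap' * (eps * (T - 0)) < 1" "G 0 = heat_sg (eps * (T - 0)) (G T)"
  by (rule G_semigroup[of 0 T]) (use T in auto)
 show ?thesis
 proof (rule that[of "max 0 kap'"])
  show "max 0 kap' * (eps * T) < 1" using k by (simp add: max_def)
  show "G T \<in> gauss_class (max 0 kap')" by (rule gauss_class_mono[OF k(1)]) simp
 qed (use k in auto)
qed

text \<open>Concatenates the dual bounds on $[0,T]$ and $[T,1]$, with the potential tilted at time $T$;
 the truncations of $g$ tend to $g$.\<close>

lemma dual_bound:
 fixes v :: "real => real^'n => real^'n" and ch :: "real^'n => real"
 assumes fp: "fp_pair eps nu v" and nu0: "nu 0 = mu 0" and nu1: "nu 1 = mu 1" and fin: "energy nu v 0 1 < \<infinity>"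
  and T: "0 < T" "T < 1" and ch: "contU ch" "!!x. \<bar>ch x\<bar> <= c"
 shows "(LINT x|(mu 1). psi 1 x) + eps * (LINT x|(nu T). ch x) - eps * (LINT x|(mu 0). ln (heat_sg (eps * T) (%y. G T y * exp (ch y)) x))
  <= enn2real (energy nu v 0 1)"
proof -
 note D = fp_pairD[OF fp]
 obtain kap' where kap': "0 <= kap'" "G T \<in> gauss_class kap'" "kap' * (eps * T) < 1" "G 0 = heat_sg (eps * T) (G T)" "0 < eps * T"
  by (rule G_class[OF T]) blast
 have T01: "T \<in> {0..1}" "T ~= 1" and z01: "(0::real) \<in> {0..1}" "(1::real) \<in> {0..1}" using T by auto
 note sG = time_G[OF T01]
 have GT: "G T = heat_sg (eps * (1 - T)) g" using T by (simp add: G_def)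
 have c0: "0 <= c" using ch(2)[of 0] by linarith
 have chm[measurable]: "borel_fun ch" by (rule borel_contI[OF ch(1)])
 define d where "d = (%k. 1 / real (Suc k))"
 have d: "0 < d k" "d k <= 1" for k by (auto simp: d_def)
 have dl: "d ----> 0" unfolding d_def using LIMSEQ_Suc[OF lim_const_over_n[of 1]] by simp
 \<comment> \<open>The minimum caps the potential, and adding \<open>d k\<close> lifts it above a
   positive constant: both bounds are what \<open>fp_lower\<close> requires.\<close>
 define h where "h = (%k y. min (g y) (real (Suc k)) + d k)"
 have hc: "contU (h k)" for k unfolding h_def by (intro continuous_intros g_cont)
 have hb: "d k <= h k y" "h k y <= real (Suc k) + 1" for k y using g_pos[of y] d[of k] by (auto simp: h_def)
 have hg: "h k y <= g y + d k" for k y by (simp add: h_def)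
 have hm[measurable]: "borel_fun (h k)" for k by (rule borel_contI[OF hc])
 have h0: "h k \<in> gauss_class 0" for k
  using hb[of k] d(1)[of k] by (intro gauss_class_const_bounded[of _ "real (Suc k) + 1"] hm) (smt (verit))
 define u where "u = (%k. heat_sg (eps * (1 - T)) (h k))"
 have u: "d k <= u k y" "u k y <= real (Suc k) + 1" for k y
  unfolding u_def using heat_sg_range[OF hm less_imp_le[OF d(1)] hb, of "eps * (1 - T)"] sG by auto
 have uc: "contU (u k)" for k
  unfolding u_def using smooth_k_continuous[OF smooth_k_heat_sg[OF _ _ h0]] sG by simp
 have uG: "u k y <= G T y + d k" for k y
 proof -
  have "u k y <= heat_sg (eps * (1 - T)) (%y. 1 * g y + d k * 1) y"
   unfolding u_def using sG hg
   by (intro heat_sg_mono[OF h0 gauss_class_add[OF gauss_class_cmult[OF g_gc] gauss_class_const[OF kap(1)]]]) auto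
  also have "... = 1 * heat_sg (eps * (1 - T)) g y + d k * heat_sg (eps * (1 - T)) (%y. 1) y"
   using sG by (intro heat_sg_linear[OF g_gc gauss_class_const[OF kap(1)]]) auto
  also have "... = G T y + d k" using sG by (simp add: GT heat_sg_const)
  finally show ?thesis .
 qed
 \<comment> \<open>The potential used on [0,T] exceeds the one arriving from [T,1] by the factor
   \<open>exp (ch y)\<close>. When the two bounds are added, the logarithms of \<open>u k\<close>
   cancel and \<open>eps * ch\<close> remains, integrated against \<open>nu T\<close>.\<close>
 define b where "b = (%k y. u k y * exp (ch y))"
 have bc: "contU (b k)" for k unfolding b_def by (intro continuous_intros uc ch(1))
 have ec: "exp (- c) <= exp (ch y)" "exp (ch y) <= exp c" for y using ch(2)[of y] by auto
 have bb: "d k * exp (- c) <= b k y" "b k y <= (real (Suc k) + 1) * exp c" for k y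
  unfolding b_def using u[of k y] d(1)[of k] ec[of y] by (auto intro!: mult_mono)
 have cpos: "0 < d k * exp (- c)" for k using d(1)[of k] by simp
 have bm[measurable]: "borel_fun (b k)" for k by (rule borel_contI[OF bc])
 have b0: "b k \<in> gauss_class 0" for k
  using bb[of k] cpos[of k] by (intro gauss_class_const_bounded[of _ "(real (Suc k) + 1) * exp c"] bm) (smt (verit))
 define U where "U = heat_sg (eps * T) (%y. G T y * exp (ch y))"
 have Ge: "(%y. G T y * exp (ch y)) \<in> gauss_class kap'"
 proof -
  have "(%y. exp (ch y) * G T y) \<in> gauss_class kap'"
   by (rule gauss_class_mult[OF kap'(2), of _ "exp c" 0]) (use ec in auto)
  then show ?thesis by (simp add: mult.commute)
 qed
 have G0p: "0 < G 0 x" for x by (rule G_pos[OF z01(1)])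
 have Ulo: "exp (- c) * G 0 x <= U x" and Uup: "U x <= exp c * G 0 x" for x
 proof -
  have e: "heat_sg (eps * T) (%y. a * G T y) x = a * G 0 x" for a
   using heat_sg_linear[OF kap'(2) kap'(2,5,3), of a 0 x] by (simp add: kap'(4))
  have "heat_sg (eps * T) (%y. exp (- c) * G T y) x <= U x"
   unfolding U_def using G_pos[OF T01(1)] ec kap'(3,5)
   by (intro heat_sg_mono[OF gauss_class_cmult[OF kap'(2)] Ge]) (auto simp: mult.commute intro: mult_left_mono less_imp_le)
  then show "exp (- c) * G 0 x <= U x" by (simp only: e)
  have "U x <= heat_sg (eps * T) (%y. exp c * G T y) x"
   unfolding U_def using G_pos[OF T01(1)] ec kap'(3,5)
   by (intro heat_sg_mono[OF Ge gauss_class_cmult[OF kap'(2)]]) (auto simp: mult.commute intro: mult_left_mono less_imp_le)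
  then show "U x <= exp c * G 0 x" by (simp only: e)
 qed
 have Up: "0 < U x" for x using Ulo[of x] G0p[of x] by (smt (verit) exp_gt_zero mult_pos_pos)
 have Um[measurable]: "borel_fun U"
  unfolding U_def using smooth_k_continuous[OF smooth_k_heat_sg[OF kap'(5,3) Ge]] by (rule borel_contI)
 have Uln: "\<bar>ln (U x)\<bar> <= \<bar>ln (G 0 x)\<bar> + c" for x
 proof -
  have "ln (exp (- c) * G 0 x) <= ln (U x)" "ln (U x) <= ln (exp c * G 0 x)"
   using Ulo[of x] Uup[of x] G0p[of x] Up[of x] by (auto intro!: ln_mono)
  then show ?thesis using G0p[of x] by (simp add: ln_mult)
 qed
 have Uli: "integrable (mu 0) (%x. \<bar>ln (U x)\<bar>)"
 proof (rule integrable_boundI)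
  interpret prob_space "mu 0" by (rule mu_prob[OF z01(1)])
  show "integrable (mu 0) (%x. \<bar>ln (G 0 x)\<bar> + c)" using psi_integrable(2)[OF z01(1)] by simp
  show "AE x in mu 0. norm \<bar>ln (U x)\<bar> <= norm (\<bar>ln (G 0 x)\<bar> + c)" using Uln c0 by (intro AE_I2) auto
 qed measurable
 \<comment> \<open>The lift \<open>d k\<close> is harmless after the flow: constants are preserved
   and the tilt is at most \<open>exp c\<close>, so it reappears as an additive term tending to
   0.\<close>
 have bU: "heat_sg (eps * T) (b k) x <= U x + d k * exp c" for k x
 proof -
  have "b k y <= 1 * (G T y * exp (ch y)) + (d k * exp c) * 1" for y
  proof -
   have "b k y <= (G T y + d k) * exp (ch y)" unfolding b_def by (intro mult_right_mono uG) auto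
   also have "... <= G T y * exp (ch y) + d k * exp c" using ec(2)[of y] d(1)[of k] by (simp add: distrib_right mult_left_mono)
   finally show ?thesis by simp
  qed
  then have "heat_sg (eps * T) (b k) x <= heat_sg (eps * T) (%y. 1 * (G T y * exp (ch y)) + (d k * exp c) * 1) x"
   using kap'(3,5) by (intro heat_sg_mono[OF b0 gauss_class_add[OF gauss_class_cmult[OF Ge] gauss_class_const[OF kap'(1)]]]) auto
  also have "... = 1 * U x + (d k * exp c) * heat_sg (eps * T) (%y. 1) x"
   unfolding U_def using kap' by (intro heat_sg_linear[OF Ge gauss_class_const]) auto
  also have "... = U x + d k * exp c" using kap'(5) by (simp add: heat_sg_const)
  finally show ?thesis .
 qed
 have en_split: "energy nu v 0 T + energy nu v T 1 <= energy nu v 0 1"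
 proof -
  let ?E = "%t. \<integral>\<^sup>+x. ennreal ((norm (v t x))^2 / 2) \<partial>nu t"
  note m = fp_energy_measurable[OF fp]
  have sub: "(%t. indicator S t * ?E t) \<in> borel_measurable lborel" if "S \<subseteq> {0..1}" "S \<in> sets borel" for S
  proof -
   have "borel_fun (%t. indicator S t * (indicator {0..1} t * ?E t))" using m that(2) by measurable
   also have "(%t. indicator S t * (indicator {0..1} t * ?E t)) = (%t. indicator S t * ?E t)"
    using that(1) by (intro ext) (auto split: split_indicator)
   finally show ?thesis by simp
  qed
  have "energy nu v 0 T + energy nu v T 1 = (\<integral>\<^sup>+t. indicator {0..T} t * ?E t + indicator {T..1} t * ?E t \<partial>lborel)"
   using sub[of "{0..T}"] sub[of "{T..1}"] T by (subst nn_integral_add) (auto simp: mult.commute)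
  also have "... = energy nu v 0 1"
   using AE_lborel_singleton[of T] T by (intro nn_integral_cong_AE) (auto simp: indicator_def elim!: eventually_mono)
  finally show ?thesis by simp
 qed
 have fin': "energy nu v 0 T < \<infinity>" "energy nu v T 1 < \<infinity>"
  using order_le_less_trans[OF order_trans[OF _ en_split] fin] by auto
 have main: "(LINT x|(mu 1). eps * ln (h k x)) + eps * (LINT x|(nu T). ch x) - (LINT x|(mu 0). eps * ln (U x + d k * exp c)) <= enn2real (energy nu v 0 1)" for k
 proof -
  interpret PT: prob_space "nu T" by (rule D(3)[OF T01(1)])
  interpret P0: prob_space "mu 0" by (rule mu_prob[OF z01(1)])
  have [measurable_cong]: "sets (nu T) = sets borel" by (rule D(4)[OF T01(1)])
  have [measurable]: "borel_fun (u k)" by (rule borel_contI[OF uc])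
  have A1: "(LINT x|(nu 1). eps * ln (h k x)) - (LINT x|(nu T). eps * ln (u k x)) <= enn2real (energy nu v T 1)"
   unfolding u_def by (rule fp_lower[OF fp eps _ _ _ hc d(1) hb fin'(2)]) (use T in auto)
  have A2: "(LINT x|(nu T). eps * ln (b k x)) - (LINT x|(nu 0). eps * ln (heat_sg (eps * (T - 0)) (b k) x)) <= enn2real (energy nu v 0 T)"
   by (rule fp_lower[OF fp eps _ _ _ bc cpos bb fin'(1)]) (use T in auto)
  have iu: "integrable (nu T) (%x. ln (u k x))"
  proof (rule PT.integrable_const_bound[of _ "\<bar>ln (d k)\<bar> + \<bar>ln (real (Suc k) + 1)\<bar>"])
   have "ln (d k) <= ln (u k x)" "ln (u k x) <= ln (real (Suc k) + 1)" for x
    using u[of k x] d(1)[of k] by (auto intro!: ln_mono)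
   then have "\<bar>ln (u k x)\<bar> <= \<bar>ln (d k)\<bar> + \<bar>ln (real (Suc k) + 1)\<bar>" for x by (smt (verit))
   then show "AE x in nu T. norm (ln (u k x)) <= \<bar>ln (d k)\<bar> + \<bar>ln (real (Suc k) + 1)\<bar>" by simp
  qed measurable
  have ich: "integrable (nu T) ch" using ch(2) by (intro PT.integrable_const_bound[of _ c]) auto
  have "(LINT x|(nu T). eps * ln (b k x)) = (LINT x|(nu T). eps * ln (u k x) + eps * ch x)"
  proof (intro LINT_cong refl)
   fix x have "0 < u k x" using u(1)[of k x] d(1)[of k] by linarith
   then show "eps * ln (b k x) = eps * ln (u k x) + eps * ch x" by (simp add: b_def ln_mult distrib_left)
  qed
  then have B1: "(LINT x|(nu T). eps * ln (b k x)) = (LINT x|(nu T). eps * ln (u k x)) + eps * (LINT x|(nu T). ch x)"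
   using iu ich by simp
  have B2: "(LINT x|(mu 0). eps * ln (heat_sg (eps * T) (b k) x)) <= (LINT x|(mu 0). eps * ln (U x + d k * exp c))"
  proof (rule integral_mono)
   have hbr: "d k * exp (- c) <= heat_sg (eps * T) (b k) x" "heat_sg (eps * T) (b k) x <= (real (Suc k) + 1) * exp c" for x
    using heat_sg_range[OF bm less_imp_le[OF cpos] bb kap'(5)] by auto
   have [measurable]: "heat_sg (eps * T) (b k) \<in> borel_measurable borel"
    using smooth_k_continuous[OF smooth_k_heat_sg[OF kap'(5) _ b0]] by (intro borel_contI) auto
   show "integrable (mu 0) (%x. eps * ln (heat_sg (eps * T) (b k) x))"
   proof (rule integrable_mult_right, rule P0.integrable_const_bound[of _ "\<bar>ln (d k * exp (- c))\<bar> + \<bar>ln ((real (Suc k) + 1) * exp c)\<bar>"])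
    have "ln (d k * exp (- c)) <= ln (heat_sg (eps * T) (b k) x)" "ln (heat_sg (eps * T) (b k) x) <= ln ((real (Suc k) + 1) * exp c)" for x
     using hbr[of x] cpos[of k] by (auto intro!: ln_mono)
    then have "\<bar>ln (heat_sg (eps * T) (b k) x)\<bar> <= \<bar>ln (d k * exp (- c))\<bar> + \<bar>ln ((real (Suc k) + 1) * exp c)\<bar>" for x by (smt (verit))
    then show "AE x in mu 0. norm (ln (heat_sg (eps * T) (b k) x)) <= \<bar>ln (d k * exp (- c))\<bar> + \<bar>ln ((real (Suc k) + 1) * exp c)\<bar>" by simp
   qed measurable
   show "integrable (mu 0) (%x. eps * ln (U x + d k * exp c))"
   proof (rule integrable_mult_right, rule integrable_boundI)
    show "integrable (mu 0) (%x. \<bar>ln (U x)\<bar> + ln (1 + exp c))" using Uli by simp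
    show "AE x in mu 0. norm (ln (U x + d k * exp c)) <= norm (\<bar>ln (U x)\<bar> + ln (1 + exp c))"
     using ln_add_bound[OF Up, of "d k * exp c" "exp c"] d[of k] by (intro AE_I2) (auto intro: order_trans[OF _ abs_ge_self])
   qed measurable
   show "eps * ln (heat_sg (eps * T) (b k) x) <= eps * ln (U x + d k * exp c)" for x
    using bU[of k x] hbr(1)[of x] cpos[of k] eps by (intro mult_left_mono ln_mono) auto
  qed
  have "enn2real (energy nu v 0 T) + enn2real (energy nu v T 1) = enn2real (energy nu v 0 T + energy nu v T 1)"
   using fin' by (intro enn2real_plus[symmetric]) auto
  also have "... <= enn2real (energy nu v 0 1)" using en_split fin by (intro enn2real_mono) auto
  finally show ?thesis using A1 A2 B1 B2 unfolding nu0 nu1 by simp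
 qed
 have L1: "(%k. \<integral>x. eps * ln (h k x) \<partial>mu 1) ----> (LINT x|(mu 1). psi 1 x)"
 proof (rule integral_dominated_convergence[where w="%x. eps * (\<bar>ln (G 1 x)\<bar> + ln 2)"])
  interpret prob_space "mu 1" by (rule mu_prob[OF z01(2)])
  show "integrable (mu 1) (%x. eps * (\<bar>ln (G 1 x)\<bar> + ln 2))" using psi_integrable(2)[OF z01(2)] by simp
  show "AE x in mu 1. norm (eps * ln (h k x)) <= eps * (\<bar>ln (G 1 x)\<bar> + ln 2)" for k
  proof (rule AE_I2)
   fix x
   have "h k x <= g x + 1" using hg[of k x] d(2)[of k] by linarith
   then have "ln (h k x) <= ln (g x + 1)" using hb(1)[of k x] d(1)[of k] by (intro ln_mono) auto
   also have "... <= \<bar>ln (g x)\<bar> + ln (1 + 1)" using ln_add_bound[OF g_pos[of x], of 1 1] by linarith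
   finally have 1: "ln (h k x) <= \<bar>ln (g x)\<bar> + ln 2" by simp
   have "min (g x) 1 <= h k x" using d(1)[of k] by (auto simp: h_def min_def)
   then have "ln (min (g x) 1) <= ln (h k x)" using g_pos[of x] by (intro ln_mono) auto
   moreover have "- \<bar>ln (g x)\<bar> <= ln (min (g x) 1)" by (auto simp: min_def)
   moreover have "0 <= ln (2::real)" by simp
   ultimately have "\<bar>ln (h k x)\<bar> <= \<bar>ln (g x)\<bar> + ln 2" using 1 by linarith
   then show "norm (eps * ln (h k x)) <= eps * (\<bar>ln (G 1 x)\<bar> + ln 2)" using eps by (simp add: abs_mult G_def)
  qed
  show "AE x in mu 1. (%k. eps * ln (h k x)) ----> psi 1 x"
  proof (rule AE_I2)
   fix x
   have "(%k. g x + d k) ----> g x + 0" by (intro tendsto_intros dl)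
   moreover have "\<forall>\<^sub>F k in sequentially. g x + d k = h k x"
   proof -
    obtain N where "g x < real N" using reals_Archimedean2 by blast
    then show ?thesis by (intro eventually_sequentiallyI[of N]) (auto simp: h_def)
   qed
   ultimately have "(%k. h k x) ----> g x" using Lim_transform_eventually by fastforce
   then have "(%k. eps * ln (h k x)) ----> eps * ln (g x)" using g_pos[of x] by (intro tendsto_intros) auto
   then show "(%k. eps * ln (h k x)) ----> psi 1 x" by (simp add: psi_def G_def)
  qed
  show "psi 1 \<in> borel_measurable (mu 1)" using psi_meas[OF z01(2)] by measurable
 qed measurable
 have L2: "(%k. \<integral>x. eps * ln (U x + d k * exp c) \<partial>mu 0) ----> (LINT x|(mu 0). eps * ln (U x))"
 proof (rule integral_dominated_convergence[where w="%x. eps * (\<bar>ln (U x)\<bar> + ln (1 + exp c))"])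
  interpret prob_space "mu 0" by (rule mu_prob[OF z01(1)])
  show "integrable (mu 0) (%x. eps * (\<bar>ln (U x)\<bar> + ln (1 + exp c)))" using Uli by simp
  show "AE x in mu 0. norm (eps * ln (U x + d k * exp c)) <= eps * (\<bar>ln (U x)\<bar> + ln (1 + exp c))" for k
   using ln_add_bound[OF Up, of "d k * exp c" "exp c"] d[of k] eps by (intro AE_I2) (simp add: abs_mult)
  show "AE x in mu 0. (%k. eps * ln (U x + d k * exp c)) ----> eps * ln (U x)"
  proof (rule AE_I2)
   fix x
   have "(%k. eps * ln (U x + d k * exp c)) ----> eps * ln (U x + 0 * exp c)" using Up[of x] by (intro tendsto_intros dl) auto
   then show "(%k. eps * ln (U x + d k * exp c)) ----> eps * ln (U x)" by simp
  qed
 qed measurable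
 have "(LINT x|(mu 1). psi 1 x) + eps * (LINT x|(nu T). ch x) - (LINT x|(mu 0). eps * ln (U x)) <= enn2real (energy nu v 0 1)"
  by (rule LIMSEQ_le_const2[OF tendsto_diff[OF tendsto_add[OF L1 tendsto_const] L2]]) (use main in blast)
 then show ?thesis by (simp add: U_def)
qed

text \<open>The dual bound with zero tilt; the intermediate time 1/2 is an arbitrary interior
  choice.\<close>

lemma energy_ge:
 assumes "fp_pair eps nu v" "nu 0 = mu 0" "nu 1 = mu 1" "energy nu v 0 1 < \<infinity>"
 shows "ent 1 - ent 0 <= enn2real (energy nu v 0 1)"
proof -
 obtain kap' where kap': "G 0 = heat_sg (eps * (1/2)) (G (1/2))"
  by (rule G_class[of "1/2"]) auto
 have "(LINT x|(mu 1). psi 1 x) + eps * (LINT x|(nu (1/2)). 0) - eps * (LINT x|(mu 0). ln (heat_sg (eps * (1/2)) (%y. G (1/2) y * exp 0) x)) <= enn2real (energy nu v 0 1)"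
  by (rule dual_bound[OF assms, of "1/2" "%_. 0" 0]) auto
 moreover have "heat_sg (eps * (1/2)) (%y. G (1/2) y * exp 0) = G 0" using kap' by (simp add: eta_contract_eq)
 ultimately show ?thesis by (simp add: ent_def psi_def)
qed

text \<open>At the optimum the dual bound leaves no room, so tilting by \<open>l * ch\<close> can
  change the two sides only compatibly. At first order in \<open>l\<close> the initial term changes
  by the integral of \<open>ch\<close> against \<open>mu T\<close>, which bounds the integral
  against \<open>nu T\<close>; signs and scaling of the test function give equality of the
  measures.\<close>

lemma minimizer_marginals:
 assumes fp: "fp_pair eps nu v" and nu: "nu 0 = mu 0" "nu 1 = mu 1" and fin: "energy nu v 0 1 < \<infinity>"
  and opt: "enn2real (energy nu v 0 1) <= ent 1 - ent 0" and T: "T \<in> {0..1}"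
 shows "nu T = mu T"
proof -
 consider "T = 0" | "T = 1" | "0 < T" "T < 1" using T by fastforce
 then show ?thesis
 proof cases
  case 3
  note D = fp_pairD[OF fp]
  obtain kap' where kap': "0 <= kap'" "G T \<in> gauss_class kap'" "kap' * (eps * T) < 1" "G 0 = heat_sg (eps * T) (G T)" "0 < eps * T"
   by (rule G_class[OF 3]) blast
  have z01: "(0::real) \<in> {0..1}" "(1::real) \<in> {0..1}" by auto
  have GTm[measurable]: "borel_fun (G T)" by (rule G_meas[OF T])
  have G0p: "0 < G 0 x" for x by (rule G_pos[OF z01(1)])
  have small: "(LINT x|(nu T). ch x) <= (LINT x|(mu T). ch x)" if ch: "contU ch" "!!x. \<bar>ch x\<bar> <= 1" for ch :: "real^'n => real"
  proof -
   have chm[measurable]: "borel_fun ch" by (rule borel_contI[OF ch(1)])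
   interpret PT: prob_space "mu T" by (rule mu_prob[OF T])
   interpret P0: prob_space "mu 0" by (rule mu_prob[OF z01(1)])
   have ich: "integrable (mu T) ch" by (rule PT.integrable_const_bound[where B = 1, OF AE_I2]) (use ch(2) in auto)
   \<comment> \<open>Shifting by 1 makes the test function nonnegative, so that the transport
     identity, stated for nonnegative integrals, applies.\<close>
   define W where "W = (%x. ch x + 1)"
   have W: "0 <= W x" "W x <= 2" for x using ch(2)[of x] by (auto simp: W_def)
   have [measurable]: "borel_fun W" unfolding W_def by measurable
   have GW: "(%y. G T y * W y) \<in> gauss_class kap'"
   proof -
    have "(%y. W y * G T y) \<in> gauss_class kap'" by (rule gauss_class_mult[OF kap'(2), of _ 2 0]) (use W in auto)
    then show ?thesis by (simp add: mult.commute)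
   qed
   define Q where "Q = heat_sg (eps * T) (%y. G T y * W y)"
   have Qm[measurable]: "borel_fun Q"
    unfolding Q_def using smooth_k_continuous[OF smooth_k_heat_sg[OF kap'(5,3) GW]] by (rule borel_contI)
   have Q0: "0 <= Q x" for x unfolding Q_def heat_sg_def using G_pos[OF T] W
    by (intro integral_nonneg_AE AE_I2 mult_nonneg_nonneg) (auto simp: heat_kernel_nonneg less_imp_le)
   have Qnn: "(\<integral>\<^sup>+x. ennreal (Q x / G 0 x) \<partial>mu 0) = (\<integral>\<^sup>+x. ennreal (W x) \<partial>mu T)"
   proof -
    have F0: "F 0 = f" by (simp add: F_def)
    have [measurable]: "borel_fun (G 0)" by (rule G_meas[OF z01(1)])
    have "(\<integral>\<^sup>+x. ennreal (Q x / G 0 x) \<partial>mu 0) = (\<integral>\<^sup>+x. ennreal (F 0 x) * ennreal (Q x) \<partial>lborel)"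
    proof (subst nn_integral_mu[OF z01(1)])
     show "(\<integral>\<^sup>+x. ennreal (rho 0 x) * ennreal (Q x / G 0 x) \<partial>lborel) = (\<integral>\<^sup>+x. ennreal (F 0 x) * ennreal (Q x) \<partial>lborel)"
     proof (rule nn_integral_cong)
      fix x
      have "ennreal (rho 0 x) * ennreal (Q x / G 0 x) = ennreal (rho 0 x * (Q x / G 0 x))"
       using rho_pos[OF z01(1), of x] Q0[of x] G0p[of x] by (intro ennreal_mult[symmetric]) auto
      also have "rho 0 x * (Q x / G 0 x) = F 0 x * Q x" using G0p[of x] by (simp add: rho_def)
      also have "ennreal (F 0 x * Q x) = ennreal (F 0 x) * ennreal (Q x)" using F_pos[OF z01(1), of x] Q0[of x] by (intro ennreal_mult) auto
      finally show "ennreal (rho 0 x) * ennreal (Q x / G 0 x) = ennreal (F 0 x) * ennreal (Q x)" .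
     qed
    qed measurable
    also have "... = (\<integral>\<^sup>+x. ennreal (F 0 x) * (\<integral>\<^sup>+y. ennreal (G T y * W y) * ennreal (hk (eps * (T - 0)) x y) \<partial>lborel) \<partial>lborel)"
     unfolding Q_def using G_pos[OF T] W
     by (simp add: ennreal_heat_sg[OF GW kap'(5,3)] ennreal_mult heat_kernel_nonneg less_imp_le)
    also have "... = (\<integral>\<^sup>+y. ennreal (F T y) * ennreal (G T y * W y) \<partial>lborel)"
     by (rule weighted_step) (use 3 in auto)
    also have "... = (\<integral>\<^sup>+y. ennreal (rho T y) * ennreal (W y) \<partial>lborel)"
     using F_pos[OF T] G_pos[OF T] W by (simp add: rho_def ennreal_mult less_imp_le mult.assoc)
    also have "... = (\<integral>\<^sup>+x. ennreal (W x) \<partial>mu T)" by (subst nn_integral_mu[OF T]) auto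
    finally show ?thesis .
   qed
   have WT: "(\<integral>\<^sup>+x. ennreal (W x) \<partial>mu T) = ennreal ((LINT x|(mu T). ch x) + 1)"
    using ich W PT.prob_space by (subst nn_integral_eq_integral) (auto simp: W_def)
   have WTp: "0 <= (LINT x|(mu T). ch x) + 1"
   proof -
    have "0 <= (LINT x|(mu T). W x)" using W by simp
    then show ?thesis using ich PT.prob_space by (simp add: W_def)
   qed
   have hb: "has_bochner_integral (mu 0) (%x. Q x / G 0 x) ((LINT x|(mu T). ch x) + 1)"
   proof (rule has_bochner_integral_nn_integral)
    have [measurable]: "borel_fun (G 0)" by (rule G_meas[OF z01(1)])
    show "(%x. Q x / G 0 x) \<in> borel_measurable (mu 0)" by measurable
    show "(\<integral>\<^sup>+x. ennreal (Q x / G 0 x) \<partial>mu 0) = ennreal ((LINT x|(mu T). ch x) + 1)" using Qnn WT by simp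
   qed (use Q0 G0p WTp in \<open>auto simp: less_imp_le\<close>)
   \<comment> \<open>The exponential is replaced by its second-order bound with remainder 3 l^2;
     after division by \<open>l\<close> the error is 3 l, which tends to 0.\<close>
   have step: "(LINT x|(nu T). ch x) <= (LINT x|(mu T). ch x) + 3 * l" if l: "0 < l" "l <= 1" for l
   proof -
    define U where "U = heat_sg (eps * T) (%y. G T y * exp (l * ch y))"
    have lb: "\<bar>l * ch y\<bar> <= 1" for y using mult_mono[of l 1 "\<bar>ch y\<bar>" 1] l ch(2)[of y] by (simp add: abs_mult)
    have Ge: "(%y. G T y * exp (l * ch y)) \<in> gauss_class kap'"
    proof -
     have "exp (l * ch y) <= exp 1" for y using lb[of y] by simp
     then have "(%y. exp (l * ch y) * G T y) \<in> gauss_class kap'" by (intro gauss_class_mult[OF kap'(2), of _ "exp 1" 0]) auto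
     then show ?thesis by (simp add: mult.commute)
    qed
    have Ub: "U x <= (1 - l + 3 * l\<^sup>2) * G 0 x + l * Q x" for x
    proof -
     have "U x <= heat_sg (eps * T) (%y. (1 - l + 3 * l\<^sup>2) * G T y + l * (G T y * W y)) x"
      unfolding U_def
     proof (rule heat_sg_mono[OF Ge gauss_class_add[OF gauss_class_cmult[OF kap'(2)] gauss_class_cmult[OF GW]] kap'(5,3,3)])
      fix y
      have "exp (l * ch y) <= 1 + l * ch y + 3 * (l * ch y)\<^sup>2" by (rule exp_le_quadratic[OF lb])
      also have "(l * ch y)\<^sup>2 <= l\<^sup>2" using ch(2)[of y] by (simp add: power_mult_distrib mult_left_le abs_square_le_1)
      finally have "exp (l * ch y) <= (1 - l + 3 * l\<^sup>2) + l * W y" by (simp add: W_def algebra_simps)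
      then have "G T y * exp (l * ch y) <= G T y * ((1 - l + 3 * l\<^sup>2) + l * W y)"
       using G_pos[OF T, of y] by (intro mult_left_mono) auto
      then show "G T y * exp (l * ch y) <= (1 - l + 3 * l\<^sup>2) * G T y + l * (G T y * W y)" by (simp add: algebra_simps)
     qed
     also have "... = (1 - l + 3 * l\<^sup>2) * G 0 x + l * Q x"
      unfolding Q_def kap'(4) by (rule heat_sg_linear[OF kap'(2) GW kap'(5,3)])
     finally show ?thesis .
    qed
    have Up: "0 < U x" for x
     unfolding U_def using G_pos[OF T]
     by (intro heat_sg_pos[OF Ge kap'(5,3)] continuous_intros G_cont[OF T] ch(1)) auto
    have "(LINT x|(mu 1). psi 1 x) + eps * (LINT x|(nu T). l * ch x) - eps * (LINT x|(mu 0). ln (U x)) <= enn2real (energy nu v 0 1)"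
     unfolding U_def using lb ch(1) by (intro dual_bound[OF fp nu fin 3]) (auto intro!: continuous_intros)
    also have "... <= (LINT x|(mu 1). psi 1 x) - eps * (LINT x|(mu 0). ln (G 0 x))" using opt by (simp add: ent_def psi_def)
    finally have "eps * (l * (LINT x|(nu T). ch x)) <= eps * ((LINT x|(mu 0). ln (U x)) - (LINT x|(mu 0). ln (G 0 x)))"
     by (simp add: algebra_simps)
    then have *: "l * (LINT x|(nu T). ch x) <= (LINT x|(mu 0). ln (U x)) - (LINT x|(mu 0). ln (G 0 x))" using eps by simp
    have pw: "ln (U x) - ln (G 0 x) <= - l + 3 * l\<^sup>2 + l * (Q x / G 0 x)" for x
    proof -
     have "ln (U x) - ln (G 0 x) = ln (U x / G 0 x)" using Up[of x] G0p[of x] by (simp add: ln_div)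
     also have "... <= U x / G 0 x - 1" using Up[of x] G0p[of x] by (intro ln_le_minus_one) auto
     also have "U x / G 0 x <= ((1 - l + 3 * l\<^sup>2) * G 0 x + l * Q x) / G 0 x" using Ub[of x] G0p[of x] by (intro divide_right_mono) auto
     also have "... = 1 - l + 3 * l\<^sup>2 + l * (Q x / G 0 x)" using G0p[of x] by (simp add: add_divide_distrib)
     finally show ?thesis by simp
    qed
    have iU: "integrable (mu 0) (%x. ln (U x))"
    proof (rule integrable_boundI)
     show "integrable (mu 0) (%x. \<bar>ln (G 0 x)\<bar> + 1 )" using psi_integrable(2)[OF z01(1)] by simp
     have [measurable]: "borel_fun U"
      unfolding U_def using smooth_k_continuous[OF smooth_k_heat_sg[OF kap'(5,3) Ge]] by (rule borel_contI)
     show "(%x. ln (U x)) \<in> borel_measurable (mu 0)" by measurable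
     have e: "heat_sg (eps * T) (%y. a * G T y) x = a * G 0 x" for a x
      using heat_sg_linear[OF kap'(2) kap'(2,5,3), of a 0 x] by (simp add: kap'(4))
     have ee: "exp (- 1) <= exp (l * ch y)" "exp (l * ch y) <= exp 1" for y using lb[of y] by auto
     have "\<bar>ln (U x)\<bar> <= \<bar>ln (G 0 x)\<bar> + 1" for x
     proof -
      have "heat_sg (eps * T) (%y. exp (- 1) * G T y) x <= U x"
       unfolding U_def using G_pos[OF T] ee
       by (intro heat_sg_mono[OF gauss_class_cmult[OF kap'(2)] Ge kap'(5,3,3)]) (auto simp: mult.commute intro: mult_left_mono less_imp_le)
      then have 1: "exp (- 1) * G 0 x <= U x" by (simp only: e)
      have "U x <= heat_sg (eps * T) (%y. exp 1 * G T y) x"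
       unfolding U_def using G_pos[OF T] ee
       by (intro heat_sg_mono[OF Ge gauss_class_cmult[OF kap'(2)] kap'(5,3,3)]) (auto simp: mult.commute intro: mult_left_mono less_imp_le)
      then have 2: "U x <= exp 1 * G 0 x" by (simp only: e)
      have "ln (exp (- 1) * G 0 x) <= ln (U x)" "ln (U x) <= ln (exp 1 * G 0 x)"
       using 1 2 G0p[of x] Up[of x] by (auto intro!: ln_mono)
      then show ?thesis using G0p[of x] by (simp add: ln_mult)
     qed
     then show "AE x in mu 0. norm (ln (U x)) <= norm (\<bar>ln (G 0 x)\<bar> + 1)" by (intro AE_I2) (auto intro: order_trans[OF _ abs_ge_self])
    qed
    have "(LINT x|(mu 0). ln (U x)) - (LINT x|(mu 0). ln (G 0 x)) = (LINT x|(mu 0). ln (U x) - ln (G 0 x))"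
     using iU psi_integrable(2)[OF z01(1)] by simp
    also have "... <= (LINT x|(mu 0). (- l + 3 * l\<^sup>2) + l * (Q x / G 0 x))"
     using iU psi_integrable(2)[OF z01(1)] hb pw
     by (intro integral_mono Bochner_Integration.integrable_diff Bochner_Integration.integrable_add P0.integrable_const integrable_mult_right)
      (auto simp: has_bochner_integral_iff)
    also have "... = (- l + 3 * l\<^sup>2) + l * ((LINT x|(mu T). ch x) + 1)"
     using hb P0.prob_space by (subst Bochner_Integration.integral_add) (auto simp: has_bochner_integral_iff simp del: times_divide_eq_right)
    also have "... = l * ((LINT x|(mu T). ch x) + 3 * l)" by (simp add: algebra_simps power2_eq_square)
    finally have "l * (LINT x|(nu T). ch x) <= l * ((LINT x|(mu T). ch x) + 3 * l)" using * by linarith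
    then show ?thesis using l by simp
   qed
   show ?thesis
   proof (rule field_le_epsilon)
    fix e :: real assume "0 < e"
    then show "(LINT x|(nu T). ch x) <= (LINT x|(mu T). ch x) + e"
     using step[of "min 1 (e / 3)"] by (cases "3 <= e") (auto simp: min_def)
   qed
  qed
  show ?thesis
  proof (rule prob_measure_eqI_continuous[OF D(3)[OF T] D(4)[OF T] mu_prob[OF T] mu_sets(1)])
   fix h :: "real^'n => real" assume h: "contU h" "bounded (range h)"
   obtain B where B: "0 < B" "!!x. \<bar>h x\<bar> <= B" using h(2) by (auto simp: bounded_pos)
   have "(LINT x|(nu T). (1 / B) * h x) <= (LINT x|(mu T). (1 / B) * h x)"
    using B h(1) by (intro small continuous_intros) (auto simp: abs_mult divide_le_eq)
   then show "(LINT x|(nu T). h x) <= (LINT x|(mu T). h x)" using B(1) by (simp add: divide_le_cancel)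
  qed
 qed (use nu in auto)
qed

end

section \<open>Joint measurability of the gradient of the potential\<close>

text \<open>Projections of Borel sets need not be Borel, but an F-sigma set in Euclidean space is a
  countable union of compact sets, and these project to compact sets. This handles the quantifier
  over nearby points in the differentiability criterion.\<close>

lemma fsigma_in_fst_image_borel:
 fixes E :: "('a::euclidean_space \<times> 'b::euclidean_space) set"
 assumes "fsigma_in euclidean E"
 shows "fst ` E \<in> sets borel"
proof -
 obtain \<U> where U: "countable \<U>" "!!C. C \<in> \<U> ==> closed C" "\<Union>\<U> = E"
 proof -
  from assms obtain \<U> where "countable \<U>" "\<U> \<subseteq> Collect (closedin euclidean)" "\<Union>\<U> = E"
   unfolding fsigma_in_def union_of_def by (elim exE conjE)
  then show ?thesis by (intro that[of \<U>]) auto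
 qed
 have "fst ` E = (\<Union>C\<in>\<U>. \<Union>n::nat. fst ` (C \<inter> cball 0 (real n)))"
 proof -
  have "fst ` C = (\<Union>n::nat. fst ` (C \<inter> cball 0 (real n)))" for C :: "('a \<times> 'b) set"
  proof -
   have "C = (\<Union>n::nat. C \<inter> cball 0 (real n))"
   proof (intro set_eqI iffI)
    fix z assume "z \<in> C"
    moreover obtain n :: nat where "norm z <= real n" using real_arch_simple by blast
    ultimately show "z \<in> (\<Union>n::nat. C \<inter> cball 0 (real n))" by auto
   qed auto
   then show ?thesis by (metis image_UN)
  qed
  then show ?thesis unfolding U(3)[symmetric] image_Union by (rule SUP_cong[OF refl])
 qed
 also have "... \<in> sets borel"
  using U(1,2) by (intro sets.countable_UN' sets.countable_UN image_subsetI)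
   (auto intro!: borel_compact compact_continuous_image continuous_on_fst closed_Int_compact)
 finally show ?thesis .
qed

lemma open_fsigma_in_euclidean: "open S ==> fsigma_in euclidean S"
 for S :: "'a::metric_space set"
 by (intro open_imp_fsigma_in metrizable_space_euclidean) auto

text \<open>If the zeros are dense in a half-space with \<open>x\<close> on its boundary, the affine
  approximation at \<open>x\<close> must be o(|y - x|) there. Hence value and derivative vanish
  along all directions pointing inwards, and these span.\<close>

lemma zero_on_halfspace_derivative:
 fixes d :: "'a::euclidean_space => real"
 assumes D: "(d has_derivative L) (at x)" and a: "a ~= 0" and Z: "{y. a \<bullet> y > a \<bullet> x} \<subseteq> closure {y. d y = 0}"
 shows "d x = 0" "L = (%h. 0)"
proof -
 have L: "bounded_linear L" by (rule has_derivative_bounded_linear[OF D])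
 interpret L: bounded_linear L by (rule L)
 have key: "\<exists>\<delta>>0. \<forall>y. norm (y - x) < \<delta> & a \<bullet> y > a \<bullet> x --> \<bar>d x + L (y - x)\<bar> <= e * norm (y - x)" if e: "0 < e" for e
 proof -
  obtain \<delta> where d: "0 < \<delta>" "!!y. norm (y - x) < \<delta> ==> norm (d y - d x - L (y - x)) <= e * norm (y - x)"
   using D e unfolding has_derivative_at_alt by blast
  let ?S = "{y. \<bar>d x + L (y - x)\<bar> <= e * norm (y - x)}"
  have cl: "closed ?S"
  proof -
   have "contU (%y. L (y - x))" by (intro L.continuous_on continuous_on_diff continuous_on_id continuous_on_const)
   then show ?thesis by (intro closed_Collect_le continuous_on_rabs continuous_on_add continuous_intros)
  qed
  have "ball x \<delta> \<inter> {y. d y = 0} \<subseteq> ?S"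
  proof
   fix y assume "y \<in> ball x \<delta> \<inter> {y. d y = 0}"
   then have "norm (y - x) < \<delta>" "d y = 0" by (auto simp: dist_norm norm_minus_commute)
   with d(2)[of y] show "y \<in> ?S" by (simp add: abs_minus_commute)
  qed
  then have "closure (ball x \<delta> \<inter> {y. d y = 0}) \<subseteq> ?S" using cl by (simp add: closure_minimal)
  moreover have "ball x \<delta> \<inter> closure {y. d y = 0} \<subseteq> closure (ball x \<delta> \<inter> {y. d y = 0})"
   by (rule open_Int_closure_subset) simp
  ultimately have sub: "ball x \<delta> \<inter> closure {y. d y = 0} \<subseteq> ?S" by (rule order_trans[rotated])
  have "y \<in> ?S" if "norm (y - x) < \<delta> & a \<bullet> y > a \<bullet> x" for y
  proof (rule subsetD[OF sub])
   show "y \<in> ball x \<delta> \<inter> closure {y. d y = 0}" using that subsetD[OF Z, of y] by (simp add: dist_norm norm_minus_commute)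
  qed
  then show ?thesis using d(1) by (intro exI[of _ \<delta>]) simp
 qed
 have ray: "\<bar>d x + s * L h\<bar> <= e * (s * norm h)" if "0 < s" "s * norm h < \<delta>" "a \<bullet> h > 0"
  and "!!y. norm (y - x) < \<delta> & a \<bullet> y > a \<bullet> x ==> \<bar>d x + L (y - x)\<bar> <= e * norm (y - x)" for s h e \<delta>
 proof -
  have "norm (x + s *\<^sub>R h - x) < \<delta> & a \<bullet> (x + s *\<^sub>R h) > a \<bullet> x" using that(1-3) by (simp add: inner_add_right)
  from that(4)[OF this] show ?thesis using that(1) by (simp add: L.scaleR)
 qed
 have aa: "0 < a \<bullet> a" using a by simp
 show d0: "d x = 0"
 proof -
  obtain \<delta> where d: "0 < \<delta>" "!!y. norm (y - x) < \<delta> & a \<bullet> y > a \<bullet> x ==> \<bar>d x + L (y - x)\<bar> <= 1 * norm (y - x)"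
   using key[of 1] by (auto simp: dist_norm)
  have "((%s. \<bar>d x + s * L a\<bar> - 1 * (s * norm a)) \<longlongrightarrow> \<bar>d x + 0 * L a\<bar> - 1 * (0 * norm a)) (at_right 0)"
   by (intro tendsto_intros)
  moreover have "eventually (%s. \<bar>d x + s * L a\<bar> - 1 * (s * norm a) <= 0) (at_right 0)"
   unfolding eventually_at_right_field
  proof (intro exI[of _ "\<delta> / norm a"] conjI allI impI)
   show "0 < \<delta> / norm a" using d(1) a by simp
   fix s :: real assume "0 < s" "s < \<delta> / norm a"
   then show "\<bar>d x + s * L a\<bar> - 1 * (s * norm a) <= 0"
    using ray[OF _ _ aa d(2), of s] a by (simp add: field_simps)
  qed
  ultimately have "\<bar>d x + 0 * L a\<bar> - 1 * (0 * norm a) <= 0" by (rule tendsto_upperbound) simp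
  then show ?thesis by simp
 qed
 have Lpos: "L h = 0" if h: "a \<bullet> h > 0" for h
 proof -
  have hn: "h ~= 0" using h by auto
  have "\<bar>L h\<bar> <= 0 + e" if e: "0 < e" for e
  proof -
   have "0 < e / norm h" using e hn by simp
   from key[OF this] obtain \<delta> where d: "0 < \<delta>"
    "!!y. norm (y - x) < \<delta> & a \<bullet> y > a \<bullet> x ==> \<bar>d x + L (y - x)\<bar> <= e / norm h * norm (y - x)" by blast
   define s where "s = \<delta> / (2 * norm h)"
   have s: "0 < s" "s * norm h < \<delta>" using d(1) hn by (auto simp: s_def)
   have "s * \<bar>L h\<bar> <= s * e" using ray[OF s h d(2)] d0 s(1) hn by (simp add: abs_mult field_simps)
   then show ?thesis using s(1) by simp
  qed
  then have "\<bar>L h\<bar> <= 0" by (rule field_le_epsilon)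
  then show ?thesis by simp
 qed
 show "L = (%h. 0)"
 proof
  fix h
  define l where "l = (1 + \<bar>a \<bullet> h\<bar>) / (a \<bullet> a)"
  have "a \<bullet> (h + l *\<^sub>R a) = a \<bullet> h + (1 + \<bar>a \<bullet> h\<bar>)" using aa by (simp add: l_def inner_add_right)
  then have "L (h + l *\<^sub>R a) = 0" by (intro Lpos) linarith
  then show "L h = 0" using Lpos[OF aa] by (simp add: L.add L.scaleR)
 qed
qed

text \<open>Since the only possible derivative is 0, differentiability becomes d(y) = o(|y - x|).
  Tolerances 1/(m+1) and radii 1/(k+1) make the criterion a countable combination.\<close>

lemma zero_on_halfspace_differentiable_iff:
 fixes d :: "'a::euclidean_space => real"
 assumes a: "a ~= 0" and Z: "{y. a \<bullet> y > a \<bullet> x} \<subseteq> closure {y. d y = 0}"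
 shows "d differentiable (at x) \<longleftrightarrow>
  (\<forall>m::nat. \<exists>k::nat. \<forall>y. norm (y - x) < 1 / real (Suc k) --> \<bar>d y\<bar> <= norm (y - x) / real (Suc m))" (is "_ \<longleftrightarrow> ?R")
proof
 assume "d differentiable (at x)"
 then obtain L where D: "(d has_derivative L) (at x)" by (auto simp: differentiable_def)
 note z = zero_on_halfspace_derivative[OF D a Z]
 show ?R
 proof
  fix m :: nat
  have "0 < 1 / real (Suc m)" by simp
  then obtain \<delta> where d: "0 < \<delta>" "!!y. norm (y - x) < \<delta> ==> norm (d y - d x - L (y - x)) <= 1 / real (Suc m) * norm (y - x)"
   using D unfolding has_derivative_at_alt by blast
  obtain k :: nat where "1 / real (Suc k) < \<delta>" using nat_approx_posE[OF d(1)] by (auto simp: inverse_eq_divide)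
  then show "\<exists>k::nat. \<forall>y. norm (y - x) < 1 / real (Suc k) --> \<bar>d y\<bar> <= norm (y - x) / real (Suc m)"
   using d(2) by (intro exI[of _ k]) (auto simp: z)
 qed
next
 assume R: ?R
 have d0: "d x = 0"
 proof -
  obtain k :: nat where "!!y. norm (y - x) < 1 / real (Suc k) ==> \<bar>d y\<bar> <= norm (y - x) / real (Suc 0)" using R by blast
  from this[of x] show ?thesis by simp
 qed
 have "(d has_derivative (%h. 0)) (at x)"
  unfolding has_derivative_at_alt
 proof (intro conjI allI impI)
  fix e :: real assume "0 < e"
  then obtain m :: nat where m: "1 / real (Suc m) < e" using nat_approx_posE by (auto simp: inverse_eq_divide)
  obtain k :: nat where k: "!!y. norm (y - x) < 1 / real (Suc k) ==> \<bar>d y\<bar> <= norm (y - x) / real (Suc m)" using R by blast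
  have "\<bar>d y\<bar> <= e * norm (y - x)" if "norm (y - x) < 1 / real (Suc k)" for y
  proof -
   have "\<bar>d y\<bar> <= 1 / real (Suc m) * norm (y - x)" using k[OF that] by simp
   also have "... <= e * norm (y - x)" using m by (intro mult_right_mono) auto
   finally show ?thesis .
  qed
  then show "\<exists>\<delta>>0. \<forall>y. norm (y - x) < \<delta> --> norm (d y - d x - 0) <= e * norm (y - x)"
   by (intro exI[of _ "1 / real (Suc k)"] conjI allI impI) (simp_all only: d0 diff_0_right real_norm_def of_nat_0_less_iff zero_less_Suc zero_less_divide_1_iff)
 qed (rule bounded_linear_zero)
 then show "d differentiable (at x)" by (auto simp: differentiable_def)
qed

text \<open>Without a derivative, \<open>frechet_derivative\<close> selects from the empty
  predicate, the same one for every function and point; the default gradient is therefore a single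
  constant vector.\<close>

lemma grad_not_differentiable:
 fixes h h' :: "real^'n::finite => real"
 assumes "~ h differentiable (at x)" "~ h' differentiable (at x')"
 shows "grad h x = grad h' x'"
proof -
 have "frechet_derivative h (at x) = frechet_derivative h' (at x')"
  using assms unfolding frechet_derivative_def differentiable_def by simp
 then show ?thesis by (simp add: grad_def)
qed

text \<open>With nonempty interior, separation from the interior extends to \<open>D\<close> through
  the closure. With empty interior, \<open>D\<close> lies in a hyperplane and the open side avoiding
  it is chosen by its position relative to \<open>x\<close>.\<close>

lemma convex_not_interior_halfspace:
 fixes D :: "'a::euclidean_space set"
 assumes D: "convex D" and x: "x \<notin> interior D"
 obtains a where "a ~= 0" "{y. a \<bullet> y > a \<bullet> x} \<inter> D = {}"
proof (cases "interior D = {}")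
 case True
 obtain a b where ab: "a ~= 0" "D \<subseteq> {y. a \<bullet> y = b}" by (rule empty_interior_subset_hyperplane[OF D True])
 show ?thesis
 proof (cases "b <= a \<bullet> x")
  case True then show ?thesis using ab by (intro that[of a]) auto
 next
  case False then show ?thesis using ab by (intro that[of "- a"]) auto
 qed
next
 case False
 obtain a b where ab: "a ~= 0" "\<forall>y\<in>interior D. a \<bullet> y <= b" "\<forall>y\<in>{x}. a \<bullet> y \<ge> b"
  using separating_hyperplane_sets[OF convex_interior[OF D] convex_singleton False, of x] x by auto
 have "closure (interior D) \<subseteq> {y. a \<bullet> y <= b}" using ab(2) by (intro closure_minimal closed_halfspace_le) auto
 then have "D \<subseteq> {y. a \<bullet> y <= b}" using convex_closure_interior[OF D False] closure_subset[of D] by auto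
 then show ?thesis using ab by (intro that[of a]) auto
qed

section \<open>Heat integrals for variances of either sign\<close>

lemma heat_kernel_tendsto:
 assumes "X ----> s" "Y ----> x" "s ~= 0"
 shows "(%n. hk (X n) (Y n) y) ----> hk s x y"
 unfolding heat_kernel_def using assms by (intro tendsto_intros tendsto_powr) auto

text \<open>The identity holds also for negative \<open>s\<close>, where the kernel grows; such
  variances occur at times beyond 1.\<close>

lemma heat_kernel_split:
 fixes x y :: "real^'n::finite"
 assumes s: "s ~= 0"
 shows "hk s x y = ((2 * pi * s) powr (- real CARD('n) / 2) * exp (- (norm x)\<^sup>2 / (2 * s)))
   * (exp (((1 / s) *\<^sub>R x) \<bullet> y) * exp (- (norm y)\<^sup>2 / (2 * s)))"
proof -
 have "(norm (x - y))^2 = (norm x)^2 - 2 * (x \<bullet> y) + (norm y)^2"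
  by (simp add: power2_norm_eq_inner inner_diff_left inner_diff_right inner_commute)
 then have "- (norm (x - y))\<^sup>2 / (2 * s) = - ((norm x)^2 - 2 * (x \<bullet> y) + (norm y)^2) / (2 * s)" by (simp only:)
 also have "... = - (norm x)\<^sup>2 / (2 * s) + (((1 / s) *\<^sub>R x) \<bullet> y + - (norm y)\<^sup>2 / (2 * s))"
  using s by (simp add: field_simps)
 finally have "- (norm (x - y))\<^sup>2 / (2 * s) = - (norm x)\<^sup>2 / (2 * s) + (((1 / s) *\<^sub>R x) \<bullet> y + - (norm y)\<^sup>2 / (2 * s))" .
 then have "exp (- (norm (x - y))\<^sup>2 / (2 * s)) = exp (- (norm x)\<^sup>2 / (2 * s)) * (exp (((1 / s) *\<^sub>R x) \<bullet> y) * exp (- (norm y)\<^sup>2 / (2 * s)))"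
  by (simp only: exp_add)
 then show ?thesis by (simp only: heat_kernel_def mult.assoc)
qed

lemma borel_measurable_vecI:
 fixes f :: "'a => real^'n::finite"
 assumes "!!i. (%x. f x $ i) \<in> borel_measurable M"
 shows "f \<in> borel_measurable M"
 using assms by (subst borel_measurable_euclidean_space) (auto simp: Basis_vec_def inner_axis)

lemma grad_not_differentiable_const: "\<exists>c. \<forall>(h :: real^'n::finite => real) x. ~ h differentiable (at x) --> grad h x = c"
proof (cases "\<exists>(h :: real^'n => real) x. ~ h differentiable (at x)")
 case True
 then obtain h :: "real^'n => real" and x where "~ h differentiable (at x)" by blast
 then have "\<forall>h' x'. ~ h' differentiable (at x') --> grad h' x' = grad h x" using grad_not_differentiable by blast
 then show ?thesis by blast
qed blast

lemma closure_AE_eq_UNIV: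
 fixes P :: "'a::euclidean_space => bool"
 assumes "AE x in lborel. P x"
 shows "closure {x. P x} = UNIV"
proof (rule ccontr)
 assume "closure {x. P x} ~= UNIV"
 then have "- closure {x. P x} ~= {}" by auto
 then have "~ negligible (- closure {x. P x})" by (intro open_not_negligible) auto
 moreover have "negligible (- closure {x. P x})"
 proof -
  obtain N where N: "N \<in> null_sets lborel" "{x. ~ P x} \<subseteq> N" by (rule AE_E3[OF assms]) auto
  have "negligible N" using N(1) by (simp add: negligible_iff_null_sets null_sets_completionI)
  moreover have "- closure {x. P x} \<subseteq> N" using N(2) closure_subset[of "{x. P x}"] by auto
  ultimately show ?thesis by (rule negligible_subset)
 qed
 ultimately show False by simp
qed

locale pos_weight =
 fixes w :: "real^'n::finite => real"
 assumes w_meas[measurable]: "borel_fun w" and w_pos: "!!y. 0 < w y"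
begin

text \<open>Values in \<open>ennreal\<close> keep divergence visible, whereas the Bochner integral
  in \<open>heat_sg\<close> would replace it by 0.\<close>

definition heat_nn :: "real \<times> (real^'n) => ennreal" where
 "heat_nn p = (\<integral>\<^sup>+y. ennreal (w y * hk (fst p) (snd p) y) \<partial>lborel)"

text \<open>A Laplace transform in \<open>\<theta>\<close>: up to a positive factor it is the heat
  integral at x = s \<open>\<theta>\<close>, so finiteness in space for fixed \<open>s\<close> is a
  convex condition.\<close>

definition lap :: "real => real^'n => ennreal" where
 "lap s \<theta> = (\<integral>\<^sup>+y. ennreal (exp (\<theta> \<bullet> y) * (exp (- (norm y)\<^sup>2 / (2 * s)) * w y)) \<partial>lborel)"

lemma heat_nn_measurable[measurable]: "borel_fun heat_nn"
proof -
 have "heat_nn \<in> borel_measurable (borel \<Otimes>\<^sub>M borel)" unfolding heat_nn_def[abs_def] by measurable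
 then show ?thesis by (simp only: borel_prod)
qed

lemma heat_sg_eq_heat_nn: "heat_sg s w x = enn2real (heat_nn (s, x))"
 unfolding heat_sg_def heat_nn_def using w_pos by (subst integral_eq_nn_integral) (auto simp: less_imp_le heat_kernel_nonneg)

lemma heat_nn_lap:
 assumes s: "s ~= 0"
 obtains c where "0 < c" "heat_nn (s, x) = ennreal c * lap s ((1 / s) *\<^sub>R x)"
proof
 let ?c = "(2 * pi * s) powr (- real CARD('n) / 2) * exp (- (norm x)\<^sup>2 / (2 * s))"
 show c: "0 < ?c" using s by simp
 have "w y * hk s x y = ?c * (exp (((1 / s) *\<^sub>R x) \<bullet> y) * (exp (- (norm y)\<^sup>2 / (2 * s)) * w y))" for y
  by (subst heat_kernel_split[OF s]) (simp only: ac_simps)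
 moreover have "0 <= exp (((1 / s) *\<^sub>R x) \<bullet> y) * (exp (- (norm y)\<^sup>2 / (2 * s)) * w y)" for y using w_pos[of y] by simp
 ultimately show "heat_nn (s, x) = ennreal ?c * lap s ((1 / s) *\<^sub>R x)"
  unfolding heat_nn_def lap_def fst_conv snd_conv using c
  by (simp only: ennreal_mult less_imp_le) (rule nn_integral_cmult, measurable)
qed

lemma heat_nn_finite_iff: "s ~= 0 ==> heat_nn (s, x) < \<infinity> \<longleftrightarrow> lap s ((1 / s) *\<^sub>R x) < \<infinity>"
 by (rule heat_nn_lap[of s x]) (auto simp: ennreal_mult_less_top)

lemma heat_nn_pos:
 assumes s: "s ~= 0"
 shows "0 < heat_nn (s, x)"
proof (rule ccontr)
 assume "~ ?thesis"
 then have "(\<integral>\<^sup>+y. ennreal (w y * hk s x y) \<partial>lborel) = 0" by (simp add: heat_nn_def)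
 then have "AE y in lborel. ennreal (w y * hk s x y) = 0"
  by (subst (asm) nn_integral_0_iff_AE) measurable
 then have "AE y in (lborel :: (real^'n) measure). False"
 proof (rule eventually_mono)
  fix y assume "ennreal (w y * hk s x y) = 0"
  moreover have "0 < w y * hk s x y" by (intro mult_pos_pos w_pos heat_kernel_pos s)
  ultimately show False by auto
 qed
 then have "closure {x :: real^'n. False} = UNIV" by (rule closure_AE_eq_UNIV)
 then show False by simp
qed

lemma heat_nn_liminf:
 assumes X: "X ----> p" and p: "fst p ~= 0"
 shows "heat_nn p <= liminf (%n. heat_nn (X n))"
proof -
 have "heat_nn p = (\<integral>\<^sup>+y. liminf (%n. ennreal (w y * hk (fst (X n)) (snd (X n)) y)) \<partial>lborel)"
  unfolding heat_nn_def
 proof (rule nn_integral_cong)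
  fix y
  have "(%n. ennreal (w y * hk (fst (X n)) (snd (X n)) y)) ----> ennreal (w y * hk (fst p) (snd p) y)"
   by (intro tendsto_ennrealI tendsto_mult tendsto_const heat_kernel_tendsto tendsto_fst tendsto_snd X p)
  then show "ennreal (w y * hk (fst p) (snd p) y) = liminf (%n. ennreal (w y * hk (fst (X n)) (snd (X n)) y))"
   by (intro lim_imp_Liminf[symmetric]) auto
 qed
 also have "... <= liminf (%n. heat_nn (X n))" unfolding heat_nn_def by (rule nn_integral_liminf) measurable
 finally show ?thesis .
qed

text \<open>Fatou's lemma makes the heat integral lower semicontinuous where the variance is
  nonzero, so strict superlevel sets are open, even with a continuously varying level.\<close>

lemma open_heat_nn_greater:
 fixes \<pi> :: "'x::metric_space => real \<times> (real^'n)" and c :: "'x => real"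
 assumes \<pi>: "contU \<pi>" and c: "contU c"
 shows "open {q. fst (\<pi> q) ~= 0 & ennreal (c q) < heat_nn (\<pi> q)}" (is "open ?S")
proof (subst open_subopen, intro ballI)
 fix q assume q: "q \<in> ?S"
 have "eventually (%q. fst (\<pi> q) ~= 0 & ennreal (c q) < heat_nn (\<pi> q)) (inf (nhds q) (principal UNIV))"
 proof (rule sequentially_imp_eventually_nhds_within, intro allI impI)
  fix X assume "(\<forall>n::nat. X n \<in> UNIV) & X ----> q"
  then have X: "X ----> q" by simp
  have pX: "(%n. \<pi> (X n)) ----> \<pi> q" and cX: "(%n. c (X n)) ----> c q"
   using \<pi> c X by (auto intro: continuous_on_tendsto_compose[where s = UNIV])
  have "ennreal (c q) < liminf (%n. heat_nn (\<pi> (X n)))" using q heat_nn_liminf[OF pX] by (auto intro: less_le_trans)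
  then obtain d where d: "ennreal (c q) < d" "d < liminf (%n. heat_nn (\<pi> (X n)))" using dense by blast
  have "eventually (%n. fst (\<pi> (X n)) ~= 0) sequentially"
   using tendsto_imp_eventually_ne[OF tendsto_fst[OF pX], of 0] q by auto
  moreover have "eventually (%n. ennreal (c (X n)) < d) sequentially"
   using order_tendstoD(2)[OF tendsto_ennrealI[OF cX] d(1)] .
  moreover have "eventually (%n. d < heat_nn (\<pi> (X n))) sequentially" using less_LiminfD[OF d(2)] .
  ultimately show "eventually (%n. fst (\<pi> (X n)) ~= 0 & ennreal (c (X n)) < heat_nn (\<pi> (X n))) sequentially"
   by eventually_elim auto
 qed
 then show "\<exists>T. open T & q \<in> T & T \<subseteq> ?S" by (auto simp: eventually_nhds)
qed

lemma convex_heat_nn_finite: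
 assumes s: "s ~= 0"
 shows "convex {x. heat_nn (s, x) < \<infinity>}"
proof (rule convexI)
 fix x y :: "real^'n" and u v :: real
 assume xy: "x \<in> {x. heat_nn (s, x) < \<infinity>}" "y \<in> {x. heat_nn (s, x) < \<infinity>}" and uv: "0 <= u" "0 <= v" "u + v = 1"
 have u: "u = 1 - v" using uv(3) by linarith
 let ?e = "%z y. exp (((1 / s) *\<^sub>R z) \<bullet> y) * (exp (- (norm y)\<^sup>2 / (2 * s)) * w y)"
 have "lap s ((1 / s) *\<^sub>R (u *\<^sub>R x + v *\<^sub>R y)) <= (\<integral>\<^sup>+z. ennreal u * ennreal (?e x z) + ennreal v * ennreal (?e y z) \<partial>lborel)"
  unfolding lap_def
 proof (rule nn_integral_mono)
  fix z
  have "exp (((1 / s) *\<^sub>R (u *\<^sub>R x + v *\<^sub>R y)) \<bullet> z) = exp (u *\<^sub>R (((1 / s) *\<^sub>R x) \<bullet> z) + v *\<^sub>R (((1 / s) *\<^sub>R y) \<bullet> z))"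
   by (simp add: inner_add_left algebra_simps add_divide_distrib)
  also have "... <= u * exp (((1 / s) *\<^sub>R x) \<bullet> z) + v * exp (((1 / s) *\<^sub>R y) \<bullet> z)"
   unfolding u by (rule convex_onD[OF exp_convex]) (use uv in auto)
  finally have "?e (u *\<^sub>R x + v *\<^sub>R y) z <= (u * exp (((1 / s) *\<^sub>R x) \<bullet> z) + v * exp (((1 / s) *\<^sub>R y) \<bullet> z)) * (exp (- (norm z)\<^sup>2 / (2 * s)) * w z)"
   using w_pos[of z] by (intro mult_right_mono) auto
  also have "... = u * ?e x z + v * ?e y z" by (simp add: algebra_simps)
  finally show "ennreal (?e (u *\<^sub>R x + v *\<^sub>R y) z) <= ennreal u * ennreal (?e x z) + ennreal v * ennreal (?e y z)"
   using uv w_pos[of z] by (simp add: ennreal_mult[symmetric] ennreal_plus[symmetric] ennreal_leI del: ennreal_plus)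
 qed
 also have "... = ennreal u * lap s ((1 / s) *\<^sub>R x) + ennreal v * lap s ((1 / s) *\<^sub>R y)"
  unfolding lap_def by (simp add: nn_integral_add nn_integral_cmult)
 also have "... < \<infinity>" using xy unfolding mem_Collect_eq heat_nn_finite_iff[OF s] by (simp add: ennreal_mult_less_top)
 finally show "u *\<^sub>R x + v *\<^sub>R y \<in> {x. heat_nn (s, x) < \<infinity>}" unfolding mem_Collect_eq heat_nn_finite_iff[OF s] .
qed

text \<open>Finiteness at the points x + d e_i and x - d e_i gives exponential slack in every
  direction: some coordinate satisfies |y| <= n |y_i|, which explains the rate
  \<open>d / (\<bar>s\<bar> * n)\<close>. Differentiation of the exponential family then
  applies.\<close>

lemma heat_sg_differentiable_interior:
 assumes s: "s ~= 0" and d: "0 < d"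
  and fin: "!!i. heat_nn (s, x + d *\<^sub>R axis i 1) < \<infinity>" "!!i. heat_nn (s, x - d *\<^sub>R axis i 1) < \<infinity>"
 shows "heat_sg s w differentiable (at x)" "0 < heat_sg s w x"
proof -
 let ?w = "%y. exp (- (norm y)\<^sup>2 / (2 * s)) * w y"
 have wp: "0 <= ?w y" for y using w_pos[of y] by simp
 have [measurable]: "?w \<in> borel_measurable borel" by measurable
 define n where "n = real CARD('n)"
 have n: "0 < n" by (simp add: n_def)
 define r where "r = d / (\<bar>s\<bar> * n)"
 have r: "0 < r" using s d n by (simp add: r_def)
 let ?p = "%i. (1 / s) *\<^sub>R (x + d *\<^sub>R axis i 1)" and ?q = "%i. (1 / s) *\<^sub>R (x - d *\<^sub>R axis i 1)"
 have int: "integrable lborel (%y. exp (((1 / s) *\<^sub>R z) \<bullet> y) * ?w y)" if "heat_nn (s, z) < \<infinity>" for z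
  using that wp unfolding heat_nn_finite_iff[OF s] lap_def by (intro integrableI_nonneg) auto
 have E: "integrable lborel (%y. exp (((1 / s) *\<^sub>R x) \<bullet> y + r * norm y) * ?w y)"
 proof (rule integrable_boundI)
  show "integrable lborel (%y. (\<Sum>i\<in>UNIV. exp (?p i \<bullet> y) * ?w y + exp (?q i \<bullet> y) * ?w y))"
   by (intro Bochner_Integration.integrable_sum Bochner_Integration.integrable_add int fin)
  have "exp (((1 / s) *\<^sub>R x) \<bullet> y + r * norm y) <= (\<Sum>i\<in>UNIV. exp (?p i \<bullet> y) + exp (?q i \<bullet> y))" for y
  proof -
   have "\<exists>i. norm y <= n * \<bar>y $ i\<bar>"
   proof (rule ccontr)
    assume "~ ?thesis"
    then have "(\<Sum>i\<in>UNIV. \<bar>y $ i\<bar>) < (\<Sum>i\<in>(UNIV::'n set). norm y / n)"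
     using n by (intro sum_strict_mono) (auto simp: field_simps not_le)
    also have "... = norm y" using n by (simp add: n_def)
    finally show False using norm_le_l1_cart[of y] by linarith
   qed
   then obtain i where i: "norm y <= n * \<bar>y $ i\<bar>" by blast
   have "r * norm y <= r * (n * \<bar>y $ i\<bar>)" using i r by (intro mult_left_mono) auto
   also have "... = \<bar>(d / s) * y $ i\<bar>" using n d s by (simp add: r_def abs_mult field_simps)
   finally have "exp (((1 / s) *\<^sub>R x) \<bullet> y + r * norm y) <= exp (((1 / s) *\<^sub>R x) \<bullet> y + \<bar>(d / s) * y $ i\<bar>)" by simp
   also have "... <= exp (((1 / s) *\<^sub>R x) \<bullet> y + (d / s) * y $ i) + exp (((1 / s) *\<^sub>R x) \<bullet> y - (d / s) * y $ i)"
    by (cases "0 <= (d / s) * y $ i") (simp_all add: abs_if less_imp_le)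
   also have "... = exp (?p i \<bullet> y) + exp (?q i \<bullet> y)"
    by (simp add: inner_axis' inner_add_left inner_diff_left add_divide_distrib diff_divide_distrib)
   also have "... <= (\<Sum>i\<in>UNIV. exp (?p i \<bullet> y) + exp (?q i \<bullet> y))"
    by (rule member_le_sum) (auto intro: add_nonneg_nonneg)
   finally show ?thesis .
  qed
  then have *: "exp (((1 / s) *\<^sub>R x) \<bullet> y + r * norm y) * ?w y <= (\<Sum>i\<in>UNIV. exp (?p i \<bullet> y) * ?w y + exp (?q i \<bullet> y) * ?w y)" for y
   using mult_right_mono[OF _ wp[of y]] unfolding distrib_right[symmetric] sum_distrib_right[symmetric] by blast
  then show "AE y in lborel. norm (exp (((1 / s) *\<^sub>R x) \<bullet> y + r * norm y) * ?w y)
   <= norm (\<Sum>i\<in>UNIV. exp (?p i \<bullet> y) * ?w y + exp (?q i \<bullet> y) * ?w y)"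
  proof (intro AE_I2)
   fix y
   have "norm (exp (((1 / s) *\<^sub>R x) \<bullet> y + r * norm y) * ?w y) = exp (((1 / s) *\<^sub>R x) \<bullet> y + r * norm y) * ?w y"
    unfolding real_norm_def by (intro abs_of_nonneg mult_nonneg_nonneg wp exp_ge_zero)
   also have "... <= norm (\<Sum>i\<in>UNIV. exp (?p i \<bullet> y) * ?w y + exp (?q i \<bullet> y) * ?w y)"
    unfolding real_norm_def by (rule order_trans[OF * abs_ge_self])
   finally show "norm (exp (((1 / s) *\<^sub>R x) \<bullet> y + r * norm y) * ?w y) <= norm (\<Sum>i\<in>UNIV. exp (?p i \<bullet> y) * ?w y + exp (?q i \<bullet> y) * ?w y)" .
  qed
 qed measurable
 let ?\<Lambda> = "%\<theta>. \<integral>y. exp (\<theta> \<bullet> y) * ?w y \<partial>lborel"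
 have "?\<Lambda> differentiable (at ((1 / s) *\<^sub>R x))"
  unfolding differentiable_def by (rule exI, rule has_derivative_exp_family(1)[OF _ _ r E]) measurable
 moreover have "(%x. (1 / s) *\<^sub>R x) differentiable (at x)" by simp
 ultimately have D: "(%x. ?\<Lambda> ((1 / s) *\<^sub>R x)) differentiable (at x)" by (rule differentiable_chain_at[unfolded o_def, rotated])
 have eq: "heat_sg s w = (%x. ((2 * pi * s) powr (- real CARD('n) / 2) * exp (- (norm x)\<^sup>2 / (2 * s))) * ?\<Lambda> ((1 / s) *\<^sub>R x))"
 proof
  fix z
  have "w y * hk s z y = ((2 * pi * s) powr (- real CARD('n) / 2) * exp (- (norm z)\<^sup>2 / (2 * s)))
    * (exp (((1 / s) *\<^sub>R z) \<bullet> y) * ?w y)" for y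
   by (subst heat_kernel_split[OF s]) (simp only: ac_simps)
  then show "heat_sg s w z = ((2 * pi * s) powr (- real CARD('n) / 2) * exp (- (norm z)\<^sup>2 / (2 * s))) * ?\<Lambda> ((1 / s) *\<^sub>R z)"
   unfolding heat_sg_def by (simp only: integral_mult_right_zero)
 qed
 have N: "(%x :: real^'n. exp (- (norm x)\<^sup>2 / (2 * s))) differentiable (at x)"
  unfolding power2_norm_eq_inner differentiable_def by (rule exI) (auto intro!: derivative_eq_intros simp: s)
 show "heat_sg s w differentiable (at x)"
  unfolding eq by (intro differentiable_mult D N differentiable_const)
 have "convex {x. heat_nn (s, x) < \<infinity>}" by (rule convex_heat_nn_finite[OF s])
 then have "(1 / 2) *\<^sub>R (x + d *\<^sub>R axis undefined 1) + (1 / 2) *\<^sub>R (x - d *\<^sub>R axis undefined 1) \<in> {x. heat_nn (s, x) < \<infinity>}"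
  using fin by (intro convexD) auto
 also have "(1 / 2) *\<^sub>R (x + d *\<^sub>R axis undefined 1) + (1 / 2) *\<^sub>R (x - d *\<^sub>R axis undefined 1) = x"
  by (simp add: scaleR_right_distrib scaleR_right_diff_distrib scaleR_left_distrib[symmetric])
 finally show "0 < heat_sg s w x" using heat_nn_pos[OF s, of x] by (simp add: heat_sg_eq_heat_nn enn2real_positive_iff)
qed

end

context pos_weight
begin

definition lnpot :: "real => real \<times> (real^'n) => real" where
 "lnpot e p = e * ln (enn2real (heat_nn p))"

text \<open>By convexity of the finiteness domain, finiteness at these finitely many points for some
  \<open>k\<close> expresses that \<open>x\<close> is interior to it; in this form the condition is
  visibly Borel.\<close>

definition inner_set :: "(real \<times> (real^'n)) set" where
 "inner_set = {p. \<exists>k. \<forall>i. heat_nn (fst p, snd p + (1 / real (Suc k)) *\<^sub>R axis i 1) < \<infinity>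
   & heat_nn (fst p, snd p - (1 / real (Suc k)) *\<^sub>R axis i 1) < \<infinity>}"

text \<open>Pairs of a point and a nearby witness \<open>y\<close> violating the criterion of
  \<open>zero_on_halfspace_differentiable_iff\<close>. Requiring a finite heat integral at
  \<open>y\<close> loses nothing, because elsewhere the potential is 0 and cannot violate
  it.\<close>

definition bad_set :: "real => nat => nat => ((real \<times> (real^'n)) \<times> (real^'n)) set" where
 "bad_set e m k = {q. fst (fst q) ~= 0 & norm (snd q - snd (fst q)) < 1 / real (Suc k)
   & heat_nn (fst (fst q), snd q) < \<infinity> & norm (snd q - snd (fst q)) / real (Suc m) < \<bar>lnpot e (fst (fst q), snd q)\<bar>}"

lemma heat_nn_slice_measurable[measurable]:
 assumes [measurable]: "f \<in> borel_measurable M" "g \<in> borel_measurable M"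
 shows "(%q. heat_nn (f q, g q)) \<in> borel_measurable M"
proof -
 have "(%q. (f q, g q)) \<in> M \<rightarrow>\<^sub>M borel \<Otimes>\<^sub>M borel" by measurable
 then have "(%q. (f q, g q)) \<in> M \<rightarrow>\<^sub>M borel" by (simp only: borel_prod)
 then show ?thesis by (rule measurable_compose) (rule heat_nn_measurable)
qed

lemma measurable_borel_fst_snd[measurable]:
 "borel_fun (fst :: real \<times> (real^'n) => real)" "borel_fun (snd :: real \<times> (real^'n) => real^'n)"
 unfolding borel_prod[symmetric] by measurable

lemma inner_set_borel[measurable]: "inner_set \<in> sets borel"
 unfolding inner_set_def by measurable

text \<open>With z the heat integral, |ln z| > r means z > exp r, which is open by lower
  semicontinuity, or z < exp(-r), which is a union over rational c of an open condition c < exp(-r)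
  and a sublevel condition z <= c. Finiteness is the union of z <= j over integers j.\<close>

lemma fsigma_bad_set:
 assumes e: "0 < e"
 shows "fsigma_in euclidean (bad_set e m k)"
proof -
 let ?\<pi> = "%q :: (real \<times> (real^'n)) \<times> (real^'n). (fst (fst q), snd q)"
 define r where "r = (%q :: (real \<times> (real^'n)) \<times> (real^'n). norm (snd q - snd (fst q)) / real (Suc m) / e)"
 have \<pi>c: "contU ?\<pi>" by (intro continuous_intros)
 have rc: "contU r" unfolding r_def using e by (intro continuous_intros) auto
 define A where "A = {q :: (real \<times> (real^'n)) \<times> (real^'n). fst (fst q) ~= 0 & norm (snd q - snd (fst q)) < 1 / real (Suc k)}"
 define U where "U = (%c. {q. fst (?\<pi> q) ~= 0 & ennreal (c q) < heat_nn (?\<pi> q)})"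
 have Uo: "fsigma_in euclidean (U c)" "open (U c)" if "contU c" for c
  unfolding U_def using open_heat_nn_greater[OF \<pi>c that] by (auto intro: open_fsigma_in_euclidean)
 have Ao: "open A" unfolding A_def
  by (intro open_Collect_conj open_Collect_less open_Collect_neq continuous_intros)
 have AU: "fsigma_in euclidean (A - U c)" if "contU c" for c
 proof -
  have "fsigma_in euclidean (A \<inter> (- U c))"
   using Ao Uo(2)[OF that] by (intro fsigma_in_Int open_fsigma_in_euclidean closed_imp_fsigma_in) auto
  then show ?thesis by (simp add: Diff_eq)
 qed
 have Lq: "fsigma_in euclidean (\<Union>c\<in>\<rat>. {q. c < exp (- r q)} \<inter> (A - U (%_. c)))"
 proof (intro fsigma_in_Union)
  show "fsigma_in euclidean S" if SS: "S \<in> (%c. {q. c < exp (- r q)} \<inter> (A - U (%_. c))) ` \<rat>" for S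
  proof -
   obtain c where S: "S = {q. c < exp (- r q)} \<inter> (A - U (%_. c))" using SS by blast
   show ?thesis unfolding S
    by (intro fsigma_in_Int AU open_fsigma_in_euclidean open_Collect_less continuous_intros rc)
  qed
 qed (simp add: countable_rat)
 have "fsigma_in euclidean ((\<Union>j::nat. A - U (%_. real j)) \<inter> (U (%q. exp (r q)) \<union> (\<Union>c\<in>\<rat>. {q. c < exp (- r q)} \<inter> (A - U (%_. c)))))"
  by (intro fsigma_in_Int fsigma_in_Un Lq Uo(1) fsigma_in_Union) (auto intro!: AU continuous_intros rc)
 also have "(\<Union>j::nat. A - U (%_. real j)) \<inter> (U (%q. exp (r q)) \<union> (\<Union>c\<in>\<rat>. {q. c < exp (- r q)} \<inter> (A - U (%_. c)))) = bad_set e m k"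
 proof (rule set_eqI)
  fix q :: "(real \<times> (real^'n)) \<times> (real^'n)"
  show "q \<in> (\<Union>j::nat. A - U (%_. real j)) \<inter> (U (%q. exp (r q)) \<union> (\<Union>c\<in>\<rat>. {q. c < exp (- r q)} \<inter> (A - U (%_. c)))) \<longleftrightarrow> q \<in> bad_set e m k"
  proof (cases "q \<in> A & heat_nn (?\<pi> q) < \<infinity>")
   case False
   have "heat_nn (?\<pi> q) < \<infinity>" if "q \<in> A" "q \<notin> U (%_. real j)" for j
   proof -
    have "heat_nn (?\<pi> q) <= ennreal (real j)" using that by (auto simp: U_def A_def)
    then show ?thesis by (auto intro: order_le_less_trans)
   qed
   then show ?thesis using False by (auto simp: bad_set_def A_def)
  next
   case True
   then have qA: "q \<in> A" and s0: "fst (fst q) ~= 0" by (auto simp: A_def)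
   define z where "z = enn2real (heat_nn (?\<pi> q))"
   have hz: "heat_nn (?\<pi> q) = ennreal z" using True by (simp add: z_def)
   have z: "0 < z" using heat_nn_pos[OF s0, of "snd q"] hz by (simp add: ennreal_less_zero_iff)
   have U: "q \<in> U c \<longleftrightarrow> c q < z" if "0 <= c q" for c using s0 that by (simp add: U_def hz ennreal_less_iff)
   have Uneg: "q \<in> U c" if "c q < 0" for c using s0 that z by (simp add: U_def hz ennreal_neg)
   obtain j :: nat where "z <= real j" using real_arch_simple by blast
   then have j: "q \<in> A - U (%_. real j)" using qA U[of "%_. real j"] by simp
   have low: "q \<in> (\<Union>c\<in>\<rat>. {q. c < exp (- r q)} \<inter> (A - U (%_. c))) \<longleftrightarrow> z < exp (- r q)"
   proof
    assume "q \<in> (\<Union>c\<in>\<rat>. {q. c < exp (- r q)} \<inter> (A - U (%_. c)))"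
    then obtain c where c: "c < exp (- r q)" "q \<notin> U (%_. c)" by blast
    have "0 <= c" using Uneg[of "%_. c"] c(2) by (rule_tac ccontr) auto
    then show "z < exp (- r q)" using c U[of "%_. c"] by auto
   next
    assume "z < exp (- r q)"
    then obtain c where c: "c \<in> \<rat>" "z < c" "c < exp (- r q)" using Rats_dense_in_real by blast
    then have "q \<notin> U (%_. c)" using U[of "%_. c"] z by auto
    then show "q \<in> (\<Union>c\<in>\<rat>. {q. c < exp (- r q)} \<inter> (A - U (%_. c)))" using c qA by blast
   qed
   have "q \<in> bad_set e m k \<longleftrightarrow> e * r q < \<bar>e * ln z\<bar>"
    using True e by (simp add: bad_set_def A_def r_def lnpot_def z_def)
   also have "... \<longleftrightarrow> r q < \<bar>ln z\<bar>" using e by (simp add: abs_mult)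
   also have "... \<longleftrightarrow> r q < ln z \<or> ln z < - r q" by linarith
   also have "... \<longleftrightarrow> exp (r q) < z \<or> z < exp (- r q)"
    using z by (metis exp_ln exp_less_cancel_iff)
   finally show ?thesis using j low U[of "%q. exp (r q)"] by auto
  qed
 qed
 finally show ?thesis .
qed

lemma inner_set_differentiable:
 assumes s: "s ~= 0" and p: "(s, x) \<in> inner_set"
 shows "(%x. lnpot e (s, x)) differentiable (at x)"
proof -
 obtain k where k: "!!i. heat_nn (s, x + (1 / real (Suc k)) *\<^sub>R axis i 1) < \<infinity>" "!!i. heat_nn (s, x - (1 / real (Suc k)) *\<^sub>R axis i 1) < \<infinity>"
  using p unfolding inner_set_def by auto
 have d: "0 < 1 / real (Suc k)" by simp
 note h = heat_sg_differentiable_interior[OF s d k]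
 obtain L where "(heat_sg s w has_derivative L) (at x)" using h(1) by (auto simp: differentiable_def)
 then have "((%x. e * ln (heat_sg s w x)) has_derivative (%d. e * (L d * inverse (heat_sg s w x)))) (at x)"
  using h(2) by (auto intro!: derivative_eq_intros)
 then show ?thesis unfolding lnpot_def heat_sg_eq_heat_nn[symmetric] by (auto simp: differentiable_def)
qed

text \<open>Where the integral diverges the potential is 0, because \<open>enn2real\<close> of
  infinity and \<open>ln 0\<close> are both 0. A point outside the interior of the convex finiteness
  domain sees a whole open half-space of such points.\<close>

lemma outer_halfspace:
 assumes s: "s ~= 0" and p: "(s, x) \<notin> inner_set"
 obtains a where "a ~= 0" "{y. a \<bullet> y > a \<bullet> x} \<subseteq> closure {y. lnpot e (s, y) = 0}"
proof -
 let ?D = "{y. heat_nn (s, y) < \<infinity>}"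
 have "x \<notin> interior ?D"
 proof
  assume "x \<in> interior ?D"
  then obtain \<delta> where d: "0 < \<delta>" "ball x \<delta> \<subseteq> ?D" by (auto simp: mem_interior)
  obtain k :: nat where k: "1 / real (Suc k) < \<delta>" using nat_approx_posE[OF d(1)] by (auto simp: inverse_eq_divide)
  have P: "x + (1 / real (Suc k)) *\<^sub>R axis i 1 \<in> ball x \<delta>" "x - (1 / real (Suc k)) *\<^sub>R axis i 1 \<in> ball x \<delta>" for i
   using k by (auto simp: dist_norm norm_axis_1)
  have "(s, x) \<in> inner_set"
   unfolding inner_set_def mem_Collect_eq fst_conv snd_conv
   using subsetD[OF d(2) P(1)] subsetD[OF d(2) P(2)] by (intro exI[of _ k]) blast
  with p show False ..
 qed
 then obtain a where a: "a ~= 0" "{y. a \<bullet> y > a \<bullet> x} \<inter> ?D = {}"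
  by (rule convex_not_interior_halfspace[OF convex_heat_nn_finite[OF s]])
 have "{y. a \<bullet> y > a \<bullet> x} \<subseteq> {y. lnpot e (s, y) = 0}"
 proof
  fix y assume "y \<in> {y. a \<bullet> y > a \<bullet> x}"
  then have "heat_nn (s, y) = \<infinity>" using a(2) by (auto simp: less_top[symmetric] disjoint_iff)
  then show "y \<in> {y. lnpot e (s, y) = 0}" by (simp add: lnpot_def)
 qed
 then show ?thesis using a(1) closure_subset by (intro that[of a]) auto
qed

text \<open>Three regimes at nonzero variance: inside the finiteness domain the gradient is a limit
  of difference quotients; outside its interior it is 0 where the potential is differentiable, and
  the default constant elsewhere. The set \<open>N\<close> separating the last two is Borel by
  projection.\<close>

lemma grad_lnpot_measurable:
 assumes e: "0 < e"
 obtains R where "borel_fun R" "!!s x. s ~= 0 ==> grad (%x. lnpot e (s, x)) x = R (s, x)"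
proof -
 obtain c0 where c0: "!!(h :: real^'n => real) x. ~ h differentiable (at x) ==> grad h x = c0"
  using grad_not_differentiable_const by blast
 define N where "N = (\<Union>m. \<Inter>k. fst ` bad_set e m k)"
 have N[measurable]: "N \<in> sets borel"
  unfolding N_def by (intro sets.countable_UN sets.countable_INT image_subsetI fsigma_in_fst_image_borel fsigma_bad_set e) auto
 define H where "H = (%p. \<chi> i. lim (%n. (lnpot e (fst p, snd p + (1 / real (Suc n)) *\<^sub>R axis i 1) - lnpot e (fst p, snd p)) / (1 / real (Suc n))))"
 have H[measurable]: "borel_fun H"
  unfolding H_def lnpot_def by (intro borel_measurable_vecI) (simp only: vec_lambda_beta, measurable)
 show ?thesis
 proof (rule that)
  show "borel_fun (%p. if p \<in> inner_set then H p else if p \<in> N then c0 else 0)" by measurable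
  fix s :: real and x :: "real^'n" assume s: "s ~= 0"
  show "grad (%x. lnpot e (s, x)) x = (if (s, x) \<in> inner_set then H (s, x) else if (s, x) \<in> N then c0 else 0)"
  proof (cases "(s, x) \<in> inner_set")
   case True
   have D: "((%x. lnpot e (s, x)) has_derivative (%d. grad (%x. lnpot e (s, x)) x \<bullet> d)) (at x)"
    by (rule has_derivative_grad[OF inner_set_differentiable[OF s True]])
   have "H (s, x) $ i = grad (%x. lnpot e (s, x)) x $ i" for i
   proof -
    have "((%t :: real. lnpot e (s, x + t *\<^sub>R axis i 1)) has_derivative (%t. grad (%x. lnpot e (s, x)) x \<bullet> (t *\<^sub>R axis i 1))) (at 0)"
     by (rule has_derivative_compose[where f = "%t. x + t *\<^sub>R axis i 1" and g = "%x. lnpot e (s, x)"])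
      (use D in \<open>auto intro!: derivative_eq_intros\<close>)
    then have "DERIV (%t. lnpot e (s, x + t *\<^sub>R axis i 1)) 0 :> grad (%x. lnpot e (s, x)) x $ i"
     by (simp add: has_field_derivative_def inner_axis mult_commute_abs)
    then have "((%h. (lnpot e (s, x + h *\<^sub>R axis i 1) - lnpot e (s, x)) / h) \<longlongrightarrow> grad (%x. lnpot e (s, x)) x $ i) (at 0)"
     by (simp add: DERIV_def)
    moreover have "filterlim (%n. 1 / real (Suc n)) (at 0) sequentially"
     unfolding filterlim_at using LIMSEQ_Suc[OF lim_const_over_n[of 1]] by auto
    ultimately have "(%n. (lnpot e (s, x + (1 / real (Suc n)) *\<^sub>R axis i 1) - lnpot e (s, x)) / (1 / real (Suc n))) ----> grad (%x. lnpot e (s, x)) x $ i"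
     by (rule filterlim_compose)
    from limI[OF this] show ?thesis by (simp only: H_def vec_lambda_beta fst_conv snd_conv)
   qed
   then show ?thesis using True by (simp add: vec_eq_iff)
  next
   case False
   obtain a where a: "a ~= 0" "{y. a \<bullet> y > a \<bullet> x} \<subseteq> closure {y. lnpot e (s, y) = 0}" by (rule outer_halfspace[OF s False])
   have inf: "lnpot e (s, y) = 0" if "~ heat_nn (s, y) < \<infinity>" for y using that by (simp add: lnpot_def not_less top_unique)
   have "(s, x) \<in> fst ` bad_set e m k \<longleftrightarrow> (\<exists>y. norm (y - x) < 1 / real (Suc k) & ~ \<bar>lnpot e (s, y)\<bar> <= norm (y - x) / real (Suc m))" for m k
   proof -
    have "(s, x) \<in> fst ` bad_set e m k \<longleftrightarrow> (\<exists>y. ((s, x), y) \<in> bad_set e m k)" by (force simp: image_iff)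
    also have "... \<longleftrightarrow> (\<exists>y. norm (y - x) < 1 / real (Suc k) & ~ \<bar>lnpot e (s, y)\<bar> <= norm (y - x) / real (Suc m))"
    proof (rule ex_cong1)
     fix y
     have "0 <= norm (y - x) / real (Suc m)" by simp
     then show "((s, x), y) \<in> bad_set e m k \<longleftrightarrow> norm (y - x) < 1 / real (Suc k) & ~ \<bar>lnpot e (s, y)\<bar> <= norm (y - x) / real (Suc m)"
      using inf[of y] s by (cases "heat_nn (s, y) < \<infinity>") (simp_all add: bad_set_def not_le)
    qed
    finally show ?thesis .
   qed
   then have "(s, x) \<in> N \<longleftrightarrow> ~ (%x. lnpot e (s, x)) differentiable (at x)"
    unfolding zero_on_halfspace_differentiable_iff[OF a] N_def by auto
   moreover have "grad (%x. lnpot e (s, x)) x = 0" if "(%x. lnpot e (s, x)) differentiable (at x)"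
   proof -
    have "(%d. grad (%x. lnpot e (s, x)) x \<bullet> d) = (%h. 0)"
     by (rule zero_on_halfspace_derivative(2)[OF has_derivative_grad[OF that] a])
    then show ?thesis by (metis inner_eq_zero_iff)
   qed
   ultimately show ?thesis using False c0 by auto
  qed
 qed
qed

end

text \<open>The difference of the two logarithmic potentials vanishes on a dense set. Where it is
  differentiable its derivative is 0 and the gradient is \<open>W\<close>; elsewhere the version
  with \<open>g\<close> cannot be differentiable and the default constant appears. The set
  \<open>A\<close> of differentiability is a countable intersection of countable unions of closed
  sets.\<close>

lemma grad_ln_AE_eq:
 fixes g w :: "real^'n::finite => real" and e :: real
 assumes eq: "AE x in lborel. g x = w x"
  and D: "!!x. ((%x. e * ln (w x)) has_derivative (%h. W x \<bullet> h)) (at x)" and W[measurable]: "borel_fun W"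
 shows "grad (%x. e * ln (g x)) \<in> borel_measurable borel"
  and "\<exists>c. \<forall>x. grad (%x. e * ln (g x)) x = W x \<or> grad (%x. e * ln (g x)) x = c"
proof -
 obtain c0 where c0: "!!(h :: real^'n => real) x. ~ h differentiable (at x) ==> grad h x = c0"
  using grad_not_differentiable_const by blast
 let ?h = "%x. e * ln (g x)"
 define d where "d = (%x. e * ln (g x) - e * ln (w x))"
 have "closure {x. g x = w x} = UNIV" by (rule closure_AE_eq_UNIV[OF eq])
 moreover have "closure {x. g x = w x} \<subseteq> closure {x. d x = 0}" by (intro closure_mono) (auto simp: d_def)
 ultimately have cl: "closure {x. d x = 0} = UNIV" by auto
 define a :: "real^'n" where "a = axis undefined 1"
 have a: "a ~= 0" "{y. a \<bullet> y > a \<bullet> x} \<subseteq> closure {y. d y = 0}" for x unfolding cl by (auto simp: a_def axis_eq_0_iff)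
 define A where "A = (\<Inter>m::nat. \<Union>k::nat. {x. \<forall>y. norm (y - x) < 1 / real (Suc k) --> \<bar>d y\<bar> <= norm (y - x) / real (Suc m)})"
 have AA: "x \<in> A \<longleftrightarrow> d differentiable (at x)" for x
  unfolding zero_on_halfspace_differentiable_iff[OF a] A_def by auto
 have "closed {x. \<forall>y. norm (y - x) < 1 / real (Suc k) --> \<bar>d y\<bar> <= norm (y - x) / real (Suc m)}" for m k :: nat
  unfolding imp_conv_disj not_less
  by (intro closed_Collect_all closed_Collect_disj closed_Collect_le continuous_intros) auto
 then have [measurable]: "A \<in> sets borel" unfolding A_def by (intro sets.countable_UN sets.countable_INT image_subsetI borel_closed) auto
 have gr: "grad ?h x = (if x \<in> A then W x else c0)" for x
 proof (cases "x \<in> A")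
  case True
  then have dd: "(d has_derivative (%h. grad d x \<bullet> h)) (at x)" using AA by (intro has_derivative_grad) auto
  then have "(%h. grad d x \<bullet> h) = (%h. 0)" by (rule zero_on_halfspace_derivative(2)[OF _ a])
  with dd have "(d has_derivative (%h. 0)) (at x)" by simp
  from has_derivative_add[OF this D[of x]] have "(?h has_derivative (%h. W x \<bullet> h)) (at x)" by (simp add: d_def)
  then show ?thesis using True by (simp add: grad_eqI)
 next
  case False
  have "~ ?h differentiable (at x)"
  proof
   assume "?h differentiable (at x)"
   moreover have "(%x. e * ln (w x)) differentiable (at x)" using D by (auto simp: differentiable_def)
   ultimately have "d differentiable (at x)" unfolding d_def by (rule differentiable_diff)
   then show False using False AA by simp
  qed
  then show ?thesis using False c0 by simp
 qed
 have "grad ?h = (%x. if x \<in> A then W x else c0)" using gr by auto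
 moreover have "borel_fun (%x. if x \<in> A then W x else c0)" by measurable
 ultimately show "grad ?h \<in> borel_measurable borel" by simp
 show "\<exists>c. \<forall>x. grad ?h x = W x \<or> grad ?h x = c" using gr by (intro exI[of _ c0]) auto
qed

lemma gpot_AE_cong:
 assumes g: "borel_fun g" "!!y. 0 <= g y" and w: "borel_fun w" and eq: "AE y in lborel. g y = w y" and t: "t ~= 1"
 shows "gpot eps g t = heat_sg (eps * (1 - t)) w"
proof
 fix x
 note [measurable] = g(1)
 have "gpot eps g t x = heat_sg (eps * (1 - t)) g x"
  unfolding gpot_def heat_sg_def using t g(2) by (subst integral_eq_nn_integral) (auto simp: heat_kernel_nonneg)
 then show "gpot eps g t x = heat_sg (eps * (1 - t)) w x" using heat_sg_cong_AE[OF eq g(1) w] by simp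
qed

text \<open>Time 1 carries the given version of \<open>g\<close> and is treated as a separate slice.
  At every other time, including those outside [0,1], the heat integral depends only on the class of
  \<open>g\<close>, and the variance eps (1 - t) is nonzero.\<close>

lemma grad_ent_psi_measurable:
 fixes g w :: "real^'n::finite => real"
 assumes eps: "0 < eps" and g: "borel_fun g" "!!y. 0 <= g y" and w: "borel_fun w" "!!y. 0 < w y"
  and eq: "AE x in lborel. g x = w x"
  and D: "!!x. ((%x. eps * ln (w x)) has_derivative (%h. W x \<bullet> h)) (at x)" and W: "borel_fun W"
 shows "borel_fun (%(t, x). grad (ent_psi eps g t) x)"
proof -
 interpret pos_weight w by unfold_locales (rule w)+
 obtain R where R[measurable]: "borel_fun R" and Rg: "!!s x. s ~= 0 ==> grad (%x. lnpot eps (s, x)) x = R (s, x)"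
  by (rule grad_lnpot_measurable[OF eps]) blast
 note [measurable] = grad_ln_AE_eq(1)[OF eq D W]
 have 1: "ent_psi eps g 1 = (%x. eps * ln (g x))" by (auto simp: ent_psi_def gpot_def)
 have 2: "ent_psi eps g t = (%x. lnpot eps (eps * (1 - t), x))" if "t ~= 1" for t
  using gpot_AE_cong[OF g w(1) eq that] by (auto simp: ent_psi_def lnpot_def heat_sg_eq_heat_nn)
 have "(%(t, x). grad (ent_psi eps g t) x) = (%p. if fst p = 1 then grad (%x. eps * ln (g x)) (snd p) else R (eps * (1 - fst p), snd p))"
  using eps by (auto simp: fun_eq_iff 1 2 Rg)
 also have "... \<in> borel_measurable borel"
 proof -
  have "(%p :: real \<times> (real^'n). (eps * (1 - fst p), snd p)) \<in> borel \<rightarrow>\<^sub>M borel" by (intro borel_contI continuous_intros)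
  from measurable_compose[OF this R] have [measurable]: "borel_fun (%p. R (eps * (1 - fst p), snd p))" .
  show ?thesis by measurable
 qed
 finally show ?thesis .
qed

section \<open>Regularity of the Schroedinger potentials\<close>

lemma hessian_taylor:
 fixes V :: "real^'n::finite => real"
 assumes D: "!!x. (V has_derivative (%h. DV x \<bullet> h)) (at x)" and DD: "!!x. (DV has_derivative (%h. H x *v h)) (at x)"
 obtains \<theta> where "V (x + h) = V x + DV x \<bullet> h + (h \<bullet> (H \<theta> *v h)) / 2"
proof -
 let ?p = "%t. x + t *\<^sub>R h"
 define df where "df = (%m :: nat. if m = 0 then (%t. V (?p t)) else if m = 1 then (%t. DV (?p t) \<bullet> h) else (%t. (H (?p t) *v h) \<bullet> h))"
 have p: "(?p has_derivative (%s. s *\<^sub>R h)) (at t)" for t by (auto intro!: derivative_eq_intros)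
 have 0: "((%t. V (?p t)) has_real_derivative DV (?p t) \<bullet> h) (at t)" for t
  using has_derivative_compose[OF p D, of t] by (simp add: has_field_derivative_def mult_commute_abs)
 have 1: "((%t. DV (?p t) \<bullet> h) has_real_derivative (H (?p t) *v h) \<bullet> h) (at t)" for t
  using has_derivative_inner_left[OF has_derivative_compose[OF p DD, of t], of h]
  by (simp add: has_field_derivative_def mult_commute_abs matrix_vector_mult_scaleR)
 have "\<exists>t>0. t < 1 & V (?p 1) = (\<Sum>m<2. df m 0 / fact m * 1 ^ m) + df 2 t / fact 2 * 1 ^ 2"
 proof (rule Maclaurin)
  show "\<forall>m t. m < 2 & 0 <= t & t <= 1 --> (df m has_real_derivative df (Suc m) t) (at t)"
  proof (intro allI impI, elim conjE)
   fix m :: nat and t :: real assume "m < 2"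
   then consider "m = 0" | "m = 1" by linarith
   then show "(df m has_real_derivative df (Suc m) t) (at t)" by cases (simp_all add: df_def 0 1)
  qed
 qed (simp_all add: df_def)
 then obtain t where "V (x + h) = V x + DV x \<bullet> h + ((H (?p t) *v h) \<bullet> h) / 2"
  by (auto simp: df_def numeral_2_eq_2)
 then show ?thesis by (intro that) (simp add: inner_commute)
qed

text \<open>Distills what is used of the Hessian bounds: a quadratic lower bound with coefficient 1
  / (2 C), and quadratic growth of \<open>V\<close> and \<open>DV\<close>, which finite second
  moments turn into integrability.\<close>

lemma hessian_bounds:
 fixes V :: "real^'n::finite => real"
 assumes C: "0 < C" and V: "\<exists>H. C2_hessian V H &
   (\<forall>x \<xi>. (1 / C) * (norm \<xi>)^2 <= \<xi> \<bullet> (H x *v \<xi>) & \<xi> \<bullet> (H x *v \<xi>) <= C * (norm \<xi>)^2)"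
 obtains DV a b A where "!!x. (V has_derivative (%h. DV x \<bullet> h)) (at x)" "contU DV"
  "!!x. a + b \<bullet> x + (norm x)^2 / (2 * C) <= V x" "0 <= A" "!!x. \<bar>V x\<bar> <= A * (1 + (norm x)^2)"
  "!!x. norm (DV x) <= A * (1 + (norm x)^2)"
proof -
 obtain H DV where D: "!!x. (V has_derivative (%h. DV x \<bullet> h)) (at x)" and DD: "!!x. (DV has_derivative (%h. H x *v h)) (at x)"
  and H: "!!x \<xi>. (1 / C) * (norm \<xi>)^2 <= \<xi> \<bullet> (H x *v \<xi>)" "!!x \<xi>. \<xi> \<bullet> (H x *v \<xi>) <= C * (norm \<xi>)^2"
  using V unfolding C2_hessian_def by blast
 have lo: "V x + DV x \<bullet> h + (norm h)^2 / (2 * C) <= V (x + h)" and up: "V (x + h) <= V x + DV x \<bullet> h + C / 2 * (norm h)^2" for x h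
 proof -
  obtain \<theta> where t: "V (x + h) = V x + DV x \<bullet> h + (h \<bullet> (H \<theta> *v h)) / 2" by (rule hessian_taylor[OF D DD])
  define q where "q = (1 / C) * (norm h)^2"
  have q: "(norm h)^2 / (2 * C) = q / 2" by (simp add: q_def)
  show "V x + DV x \<bullet> h + (norm h)^2 / (2 * C) <= V (x + h)" using t H(1)[where x = \<theta> and \<xi> = h] unfolding q q_def[symmetric] by linarith
  show "V (x + h) <= V x + DV x \<bullet> h + C / 2 * (norm h)^2" using t H(2)[where x = \<theta> and \<xi> = h] by linarith
 qed
 define A where "A = \<bar>V 0\<bar> + norm (DV 0) + C / 2"
 have A0: "0 <= A" using C by (simp add: A_def)
 have n1: "norm x <= 1 + (norm x)^2" for x :: "real^'n"
 proof -
  have "2 * norm x <= 1 + (norm x)^2" using zero_le_power2[of "norm x - 1"] by (simp add: power2_diff)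
  then show ?thesis using norm_ge_zero[of x] by linarith
 qed
 have VA: "\<bar>V x\<bar> <= A * (1 + (norm x)^2)" for x
 proof -
  have ip: "\<bar>DV 0 \<bullet> x\<bar> <= norm (DV 0) * (1 + (norm x)^2)"
   using Cauchy_Schwarz_ineq2[of "DV 0" x] mult_left_mono[OF n1, of "norm (DV 0)" x] by simp
  have "0 <= (norm x)^2 / (2 * C)" using C by simp
  moreover have "\<bar>V 0\<bar> <= \<bar>V 0\<bar> * (1 + (norm x)^2)" by (simp add: mult_le_cancel_left1)
  moreover have "0 <= C / 2 * (norm x)^2" "C / 2 * (norm x)^2 <= C / 2 * (1 + (norm x)^2)" using C by simp_all
  moreover have "A * (1 + (norm x)^2) = \<bar>V 0\<bar> * (1 + (norm x)^2) + norm (DV 0) * (1 + (norm x)^2) + C / 2 * (1 + (norm x)^2)"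
   by (simp add: A_def distrib_right)
  ultimately show ?thesis using lo[of 0 x] up[of 0 x] ip unfolding add_0 by linarith
 qed
 have DA: "norm (DV x) <= 14 * A * (1 + (norm x)^2)" for x
 proof (cases "DV x = 0")
  case True then show ?thesis using A0 by simp
 next
  case False
  \<comment> \<open>Moving along the gradient by 1 + |x| and using convexity bounds (1 + |x|) |DV x|
    by an increment of \<open>V\<close>, which grows quadratically.\<close>
  define h where "h = ((1 + norm x) / norm (DV x)) *\<^sub>R DV x"
  have nh: "norm h = 1 + norm x" using False by (simp add: h_def)
  have "DV x \<bullet> h = (1 + norm x) * norm (DV x)" using False by (simp add: h_def power2_norm_eq_inner[symmetric] power2_eq_square)
  then have "(1 + norm x) * norm (DV x) <= V (x + h) - V x" using lo[of x h] zero_le_power2[of "norm h"] C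
   by (smt (verit) divide_nonneg_pos)
  also have "... <= A * (1 + (norm (x + h))^2) + A * (1 + (norm x)^2)" using VA[of "x + h"] VA[of x] by linarith
  also have "... <= A * (1 + (1 + 2 * norm x)\<^sup>2) + A * (1 + (norm x)^2)"
   using norm_triangle_ineq[of x h] nh A0 by (intro add_mono mult_left_mono order_refl power_mono) auto
  also have "... = A * (3 + 4 * norm x + 5 * (norm x)^2)" by (simp add: power2_eq_square algebra_simps)
  also have "... <= A * (14 * (1 + (norm x)^2))" 
  proof (rule mult_left_mono[OF _ A0])
   have "4 * norm x <= 4 * (1 + (norm x)^2)" using n1[of x] by simp
   then show "3 + 4 * norm x + 5 * (norm x)^2 <= 14 * (1 + (norm x)^2)"
    using zero_le_power2[of "norm x"] unfolding distrib_left mult_1_right by (linarith | argo | smt (verit))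
  qed
  finally have "(1 + norm x) * norm (DV x) <= 14 * A * (1 + (norm x)^2)" by (simp add: algebra_simps)
  moreover have "norm (DV x) <= (1 + norm x) * norm (DV x)" by (simp add: mult_le_cancel_right1)
  ultimately show ?thesis by linarith
 qed
 have cD: "contU DV" using DD by (auto intro!: continuous_at_imp_continuous_on has_derivative_continuous)
 have "A * (1 + (norm x)^2) <= 14 * A * (1 + (norm x)^2)" for x :: "real^'n" using A0 by (intro mult_right_mono) auto
 then show ?thesis
  using that[OF D cD, of "V 0" "DV 0" "14 * A"] lo[of 0] A0 order_trans[OF VA] DA by auto
qed

text \<open>Half of |x|^2 / (2 C) absorbs all linear terms by Young's inequality; the other half
  remains as the gain 1 / (2 C) in the rate.\<close>

lemma gaussian_exponent_bound:
 fixes b :: "real^'n::finite"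
 assumes C: "0 < C" and s: "0 < s" and kap: "1 / s - 1 / (2 * C) <= kap"
 obtains K where "!!x :: real^'n. - (a + b \<bullet> x + (norm x)^2 / (2 * C)) + (norm x + 1)^2 / (2 * s) <= K + kap / 2 * (norm x)^2"
proof
 fix x :: "real^'n"
 define B where "B = norm b + 1 / s"
 define n where "n = norm x"
 have ip: "- (b \<bullet> x) <= norm b * n" using Cauchy_Schwarz_ineq2[of b x] by (simp add: n_def abs_le_iff)
 define P where "P = n\<^sup>2 / (4 * C)"
 define S where "S = (1 / s) / 2 * n\<^sup>2"
 define T where "T = 1 / s * n"
 have 1: "B * n <= P + C * B\<^sup>2"
 proof -
  have "4 * C * (B * n) <= n\<^sup>2 + 4 * C\<^sup>2 * B\<^sup>2" using zero_le_power2[of "n - 2 * C * B"] by (simp add: power2_eq_square algebra_simps)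
  also have "... = 4 * C * (P + C * B\<^sup>2)" using C by (simp add: P_def power2_eq_square field_simps)
  finally show ?thesis using C by simp
 qed
 have 2: "(n + 1)\<^sup>2 / (2 * s) = S + T + 1 / (2 * s)" using s by (simp add: S_def T_def power2_eq_square field_simps)
 have "(1 / s - 1 / (2 * C)) / 2 * n\<^sup>2 <= kap / 2 * n\<^sup>2" using kap by (intro mult_right_mono divide_right_mono) auto
 moreover have "(1 / s - 1 / (2 * C)) / 2 * n\<^sup>2 = S - P" using C s by (simp add: S_def P_def field_simps)
 ultimately have 3: "S - P <= kap / 2 * n\<^sup>2" by simp
 have 4: "n\<^sup>2 / (2 * C) = 2 * P" by (simp add: P_def)
 have 5: "B * n = norm b * n + T" by (simp add: B_def T_def distrib_right)
 show "- (a + b \<bullet> x + (norm x)^2 / (2 * C)) + (norm x + 1)^2 / (2 * s) <= (- a + C * (norm b + 1 / s)^2 + 1 / (2 * s)) + kap / 2 * (norm x)^2"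
  using ip 1 3 5 unfolding n_def[symmetric] B_def[symmetric] 2 4 by linarith
qed

text \<open>The analogue of \<open>heat_sg_lower\<close> for a factor known only to be measurable
  and positive almost everywhere: the minimum over the ball is replaced by the integral of
  \<open>min 1 (h y)\<close> there, which is finite and positive.\<close>

lemma nn_heat_lower:
 fixes h :: "real^'n::finite => real"
 assumes [measurable]: "borel_fun h" and h0: "!!y. 0 <= h y" and hp: "AE y in lborel. 0 < h y" and s: "0 < s"
 obtains c where "0 < c" "!!x. ennreal (c * exp (- (norm x + 1)\<^sup>2 / (2 * s))) <= (\<integral>\<^sup>+y. ennreal (h y * hk s x y) \<partial>lborel)"
proof -
 have [measurable]: "cball (0::real^'n) 1 \<in> sets borel" by simp
 define m where "m = (\<integral>\<^sup>+y. ennreal (min 1 (h y) * indicator (cball 0 1) y) \<partial>lborel)"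
 have "m <= (\<integral>\<^sup>+y. indicator (cball (0::real^'n) 1) y \<partial>lborel)"
  unfolding m_def by (intro nn_integral_mono) (auto split: split_indicator)
 also have "... < \<infinity>" using emeasure_bounded_finite[of "cball (0::real^'n) 1"] by simp
 finally have mfin: "m < \<infinity>" .
 have mpos: "m ~= 0"
 proof
  assume "m = 0"
  then have "AE y in lborel. ennreal (min 1 (h y) * indicator (cball 0 1) y) = 0"
   unfolding m_def by (subst (asm) nn_integral_0_iff_AE) measurable
  then have "AE y in lborel. y \<in> - cball (0::real^'n) 1"
   using hp by eventually_elim (auto split: split_indicator_asm simp: min_def split: if_splits)
  then have "closure {y. y \<in> - cball (0::real^'n) 1} = UNIV" by (rule closure_AE_eq_UNIV)
  then have "- interior (cball (0::real^'n) 1) = UNIV" by (simp only: Collect_mem_eq closure_complement)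
  then have "(0::real^'n) \<in> - ball 0 1" by (simp only: interior_cball UNIV_I)
  then show False by simp
 qed
 define p where "p = (2 * pi * s) powr (- real CARD('n) / 2)"
 have p: "0 < p" using s by (simp add: p_def)
 have mr: "ennreal (enn2real m) = m" "0 < enn2real m" using mfin mpos by (auto simp: enn2real_positive_iff zero_less_iff_neq_zero)
 show ?thesis
 proof (rule that)
  show "0 < enn2real m * p" using mr p by simp
  fix x :: "real^'n"
  let ?e = "exp (- (norm x + 1)\<^sup>2 / (2 * s))"
  have "ennreal (enn2real m * p * ?e) = m * ennreal (p * ?e)" using mr p by (simp add: ennreal_mult mult.assoc)
  also have "... = (\<integral>\<^sup>+y. ennreal (min 1 (h y) * indicator (cball 0 1) y) * ennreal (p * ?e) \<partial>lborel)"
   unfolding m_def by (rule nn_integral_multc[symmetric]) measurable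
  also have "... <= (\<integral>\<^sup>+y. ennreal (h y * hk s x y) \<partial>lborel)"
  proof (rule nn_integral_mono)
   fix y :: "real^'n"
   show "ennreal (min 1 (h y) * indicator (cball 0 1) y) * ennreal (p * ?e) <= ennreal (h y * hk s x y)"
   proof (cases "y \<in> cball 0 1")
    case True
    have "norm (x - y) <= norm x + 1" using norm_triangle_ineq4[of x y] True by auto
    then have "(norm (x - y))^2 <= (norm x + 1)^2" by (intro power_mono) auto
    then have "?e <= exp (- (norm (x - y))\<^sup>2 / (2 * s))" using s by (simp add: divide_right_mono)
    then have "p * ?e <= hk s x y" unfolding heat_kernel_def p_def by (intro mult_left_mono) auto
    then have "min 1 (h y) * (p * ?e) <= h y * hk s x y" using h0[of y] p by (intro mult_mono) auto
    then show ?thesis using True h0[of y] p by (simp add: ennreal_mult[symmetric] ennreal_leI)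
   qed simp
  qed
  finally show "ennreal (enn2real m * p * ?e) <= (\<integral>\<^sup>+y. ennreal (h y * hk s x y) \<partial>lborel)" .
 qed
qed

text \<open>Solving one equation of the system for its factor yields a continuous quotient. The
  lower heat bound controls its growth, and bounds from both sides control its logarithm.\<close>

lemma schroedinger_factor_regular:
 fixes V h :: "real^'n::finite => real"
 assumes s: "0 < s" and C: "0 < C" and V: "contU V" and lo: "!!x. a + b \<bullet> x + (norm x)^2 / (2 * C) <= V x"
  and VA: "0 <= A" "!!x. \<bar>V x\<bar> <= A * (1 + (norm x)^2)"
  and hm[measurable]: "borel_fun h" and h0: "!!y. 0 <= h y" and hp: "AE y in lborel. 0 < h y"
  and kap: "0 <= kap" "kap * s < 1" "1 / s - 1 / (2 * C) <= kap" and hb: "!!y. h y <= M * exp (kap / 2 * (norm y)^2)"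
 obtains M' A' where "!!x. 0 < heat_sg s h x" "h \<in> gauss_class kap" "contU (%x. exp (- V x) / heat_sg s h x)"
  "!!x. exp (- V x) / heat_sg s h x <= M' * exp (kap / 2 * (norm x)^2)" "0 <= A'"
  "!!x. \<bar>ln (exp (- V x) / heat_sg s h x)\<bar> <= A' * (1 + (norm x)^2)"
proof -
 have hb': "\<bar>h y\<bar> <= M * exp (kap / 2 * (norm y)^2)" for y using hb[of y] h0[of y] by simp
 have gc: "h \<in> gauss_class kap" by (rule gauss_classI_bounded[OF hm hb'])
 have nnh: "0 <= heat_sg s h x" for x unfolding heat_sg_def using h0 by (intro integral_nonneg_AE AE_I2) (auto simp: heat_kernel_nonneg)
 obtain c where c: "0 < c" "!!x. ennreal (c * exp (- (norm x + 1)\<^sup>2 / (2 * s))) <= (\<integral>\<^sup>+y. ennreal (h y * hk s x y) \<partial>lborel)"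
  by (rule nn_heat_lower[OF hm h0 hp s]) blast
 have low: "c * exp (- (norm x + 1)\<^sup>2 / (2 * s)) <= heat_sg s h x" for x
  using c(2)[of x] unfolding ennreal_heat_sg[OF gc s kap(2) h0, symmetric] by (simp add: nnh)
 have pos: "0 < heat_sg s h x" for x using low[of x] c(1) by (smt (verit) exp_gt_zero mult_pos_pos)
 obtain d where d: "0 < d" "!!x. \<bar>heat_sg s h x\<bar> <= d * exp (kap / (1 - kap * s) / 2 * (norm x)^2)"
  by (rule heat_sg_upper[OF hm s kap(2,1) hb']) blast
 obtain K where K: "!!x :: real^'n. - (a + b \<bullet> x + (norm x)^2 / (2 * C)) + (norm x + 1)^2 / (2 * s) <= K + kap / 2 * (norm x)^2"
  by (rule gaussian_exponent_bound[OF C s kap(3)]) blast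
 show ?thesis
 proof (rule that[OF pos gc])
  have "contU (heat_sg s h)" by (rule smooth_k_continuous[OF smooth_k_heat_sg[OF s kap(2) gc]])
  then show "contU (%x. exp (- V x) / heat_sg s h x)"
   using V pos by (intro continuous_intros) (auto simp: less_imp_neq[THEN not_sym])
  show "exp (- V x) / heat_sg s h x <= (exp K / c) * exp (kap / 2 * (norm x)^2)" for x
  proof -
   have "exp (- V x) / heat_sg s h x <= exp (- V x) / (c * exp (- (norm x + 1)\<^sup>2 / (2 * s)))"
    using low[of x] c(1) by (intro divide_left_mono) (auto intro: mult_pos_pos pos)
   also have "... = exp (- V x + (norm x + 1)^2 / (2 * s)) / c" by (simp add: exp_add exp_diff exp_minus field_simps)
   also have "... <= exp (K + kap / 2 * (norm x)^2) / c"
    using K[of x] lo[of x] c(1) by (intro divide_right_mono) auto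
   finally show ?thesis by (simp add: exp_add)
  qed
  let ?q = "kap / (1 - kap * s) / 2"
  have q: "0 <= ?q" using kap by simp
  show "0 <= A + \<bar>ln c\<bar> + 1 / s + \<bar>ln d\<bar> + ?q" using VA q s by simp
  show "\<bar>ln (exp (- V x) / heat_sg s h x)\<bar> <= (A + \<bar>ln c\<bar> + 1 / s + \<bar>ln d\<bar> + ?q) * (1 + (norm x)^2)" for x
  proof -
   have "ln (c * exp (- (norm x + 1)\<^sup>2 / (2 * s))) <= ln (heat_sg s h x)" using low[of x] c(1) by (intro ln_mono) auto
   then have l1: "ln c - (norm x + 1)\<^sup>2 / (2 * s) <= ln (heat_sg s h x)" using c(1) by (simp add: ln_mult)
   have "ln (heat_sg s h x) <= ln (d * exp (?q * (norm x)^2))" using d(2)[of x] pos[of x] by (intro ln_mono) auto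
   then have l2: "ln (heat_sg s h x) <= ln d + ?q * (norm x)^2" using d(1) by (simp add: ln_mult)
   have "(norm x + 1)^2 <= 2 * (1 + (norm x)^2)" using zero_le_power2[of "norm x - 1"] by (simp add: power2_eq_square algebra_simps)
   then have l3: "(norm x + 1)^2 / (2 * s) <= 1 / s * (1 + (norm x)^2)" using s by (simp add: field_simps)
   have l4: "u <= u * (1 + (norm x)^2)" "0 <= u * (norm x)^2" if "0 <= u" for u using that by (simp_all add: mult_le_cancel_left1)
   have e: "(A + \<bar>ln c\<bar> + 1 / s + \<bar>ln d\<bar> + ?q) * (1 + (norm x)^2) = A * (1 + (norm x)^2) + \<bar>ln c\<bar> * (1 + (norm x)^2)
    + 1 / s * (1 + (norm x)^2) + \<bar>ln d\<bar> * (1 + (norm x)^2) + (?q + ?q * (norm x)^2)" by (simp only: distrib_right distrib_left mult_1_right)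
   have "\<bar>ln (exp (- V x) / heat_sg s h x)\<bar> <= \<bar>V x\<bar> + \<bar>ln (heat_sg s h x)\<bar>" using pos[of x] by (simp add: ln_div)
   moreover have "0 <= (norm x + 1)^2 / (2 * s)" using s by simp
   ultimately show ?thesis unfolding e using l1 l2 l3 l4(1)[of "\<bar>ln c\<bar>"] l4(1)[of "\<bar>ln d\<bar>"] l4(2)[OF q] q VA(2)[of x] by linarith
  qed
 qed
qed

lemma schroedinger_factor_AE_bound:
 fixes V f h :: "real^'n::finite => real"
 assumes s: "0 < s" and C: "0 < C" and lo: "!!x. a + b \<bullet> x + (norm x)^2 / (2 * C) <= V x"
  and h: "borel_fun h" "!!y. 0 <= h y" "AE y in lborel. 0 < h y"
  and kap: "1 / s - 1 / (2 * C) <= kap" and f0: "!!x. 0 <= f x"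
  and sys: "AE x in lborel. ennreal (f x) * (\<integral>\<^sup>+y. ennreal (h y * hk s x y) \<partial>lborel) = ennreal (exp (- V x))"
 obtains M where "0 <= M" "AE x in lborel. f x <= M * exp (kap / 2 * (norm x)^2)"
proof -
 obtain c where c: "0 < c" "!!x. ennreal (c * exp (- (norm x + 1)\<^sup>2 / (2 * s))) <= (\<integral>\<^sup>+y. ennreal (h y * hk s x y) \<partial>lborel)"
  by (rule nn_heat_lower[OF h s]) blast
 obtain K where K: "!!x :: real^'n. - (a + b \<bullet> x + (norm x)^2 / (2 * C)) + (norm x + 1)^2 / (2 * s) <= K + kap / 2 * (norm x)^2"
  by (rule gaussian_exponent_bound[OF C s kap]) blast
 show ?thesis
 proof (rule that)
  show "0 <= exp K / c" using c by simp
  show "AE x in lborel. f x <= exp K / c * exp (kap / 2 * (norm x)^2)"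
   using sys
  proof eventually_elim
   fix x :: "real^'n"
   let ?e = "exp (- (norm x + 1)\<^sup>2 / (2 * s))"
   assume x: "ennreal (f x) * (\<integral>\<^sup>+y. ennreal (h y * hk s x y) \<partial>lborel) = ennreal (exp (- V x))"
   have "ennreal (f x) * ennreal (c * ?e) <= ennreal (exp (- V x))" unfolding x[symmetric] by (intro mult_left_mono c(2)) simp
   then have "f x * (c * ?e) <= exp (- V x)" using f0[of x] c(1) by (simp add: ennreal_mult[symmetric])
   then have "f x <= exp (- V x) / (c * ?e)" using c(1) by (simp add: pos_le_divide_eq)
   also have "... = exp (- V x + (norm x + 1)^2 / (2 * s)) / c" by (simp add: exp_add exp_diff exp_minus field_simps)
   also have "... <= exp (K + kap / 2 * (norm x)^2) / c" using K[of x] lo[of x] c(1) by (intro divide_right_mono) auto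
   finally show "f x <= exp K / c * exp (kap / 2 * (norm x)^2)" by (simp add: exp_add)
  qed
 qed
qed

text \<open>The bootstrap alternates: the first equation bounds \<open>f\<close> almost everywhere,
  the second then defines a continuous \<open>g'\<close>, and the first again a continuous
  \<open>f'\<close>. Heat flows ignore null sets, so both equations end up valid everywhere.\<close>

lemma schroedinger_regularise:
 fixes V0 V1 f g :: "real^'n::finite => real"
 assumes C: "0 < C" and eps: "0 < eps"
  and V0: "contU V0" "!!x. a0 + b0 \<bullet> x + (norm x)^2 / (2 * C) <= V0 x" "0 <= A" "!!x. \<bar>V0 x\<bar> <= A * (1 + (norm x)^2)"
  and V1: "contU V1" "!!x. a1 + b1 \<bullet> x + (norm x)^2 / (2 * C) <= V1 x" "!!x. \<bar>V1 x\<bar> <= A * (1 + (norm x)^2)"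
  and f[measurable]: "borel_fun f" and g[measurable]: "borel_fun g" and f0: "!!x. 0 <= f x" and g0: "!!x. 0 <= g x"
  and sys0: "AE x in lborel. ennreal (f x) * (\<integral>\<^sup>+ y. ennreal (g y * hk eps x y) \<partial>lborel) = ennreal (exp (- V0 x))"
  and sys1: "AE y in lborel. ennreal (g y) * (\<integral>\<^sup>+ x. ennreal (f x * hk eps x y) \<partial>lborel) = ennreal (exp (- V1 y))"
  and prob0: "(\<integral>\<^sup>+x. ennreal (exp (- V0 x)) \<partial>lborel) = 1"
  and mom0: "(\<integral>\<^sup>+x. ennreal ((norm x)^2 * exp (- V0 x)) \<partial>lborel) < \<infinity>"
  and mom1: "(\<integral>\<^sup>+x. ennreal ((norm x)^2 * exp (- V1 x)) \<partial>lborel) < \<infinity>"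
 obtains f' g' kap M A0 where "schroedinger f' g' eps kap M A0" "AE x in lborel. f x = f' x" "AE x in lborel. g x = g' x"
  "!!x. f' x * heat_sg eps g' x = exp (- V0 x)" "!!x. g' x * heat_sg eps f' x = exp (- V1 x)"
proof -
 define kap where "kap = max 0 (1 / eps - 1 / (2 * C))"
 have kap: "0 <= kap" "kap * eps < 1" "1 / eps - 1 / (2 * C) <= kap"
  using eps C by (auto simp: kap_def max_def field_simps)
 have fp: "AE x in lborel. 0 < f x" using sys0
 proof eventually_elim
  fix x assume "ennreal (f x) * (\<integral>\<^sup>+ y. ennreal (g y * hk eps x y) \<partial>lborel) = ennreal (exp (- V0 x))"
  then have "f x ~= 0" by (metis ennreal_0 mult_zero_left ennreal_eq_0_iff exp_gt_zero not_le)
  then show "0 < f x" using f0[of x] by simp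
 qed
 have gp: "AE x in lborel. 0 < g x" using sys1
 proof eventually_elim
  fix x assume "ennreal (g x) * (\<integral>\<^sup>+ y. ennreal (f y * hk eps y x) \<partial>lborel) = ennreal (exp (- V1 x))"
  then have "g x ~= 0" by (metis ennreal_0 mult_zero_left ennreal_eq_0_iff exp_gt_zero not_le)
  then show "0 < g x" using g0[of x] by simp
 qed
 obtain Mf where Mf: "0 <= Mf" "AE x in lborel. f x <= Mf * exp (kap / 2 * (norm x)^2)"
  by (rule schroedinger_factor_AE_bound[OF eps C V0(2) g g0 gp kap(3) f0 sys0]) blast
 \<comment> \<open>The minimum changes \<open>f\<close> only on a null set but turns the
   almost-everywhere bound into one valid everywhere, as the growth class requires.\<close>
 define fh where "fh = (%x. min (f x) (Mf * exp (kap / 2 * (norm x)^2)))"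
 have fh[measurable]: "borel_fun fh" unfolding fh_def by measurable
 have ffh: "AE x in lborel. f x = fh x" using Mf(2) by eventually_elim (simp add: fh_def)
 have fh0: "0 <= fh x" "fh x <= Mf * exp (kap / 2 * (norm x)^2)" for x using f0[of x] Mf(1) by (auto simp: fh_def)
 have fhp: "AE x in lborel. 0 < fh x" using fp ffh by eventually_elim simp
 obtain M1 A1 where G: "!!x. 0 < heat_sg eps fh x" "fh \<in> gauss_class kap" "contU (%x. exp (- V1 x) / heat_sg eps fh x)"
  "!!x. exp (- V1 x) / heat_sg eps fh x <= M1 * exp (kap / 2 * (norm x)^2)" "0 <= A1"
  "!!x. \<bar>ln (exp (- V1 x) / heat_sg eps fh x)\<bar> <= A1 * (1 + (norm x)^2)"
  by (rule schroedinger_factor_regular[OF eps C V1(1,2) V0(3) V1(3) fh fh0(1) fhp kap fh0(2)]) blast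
 define g' where "g' = (%x. exp (- V1 x) / heat_sg eps fh x)"
 have g'p: "0 < g' x" for x using G(1)[of x] by (simp add: g'_def)
 have g'b: "g' x <= M1 * exp (kap / 2 * (norm x)^2)" for x using G(4)[of x] by (simp add: g'_def)
 have g'ae: "AE y in lborel. 0 < g' y" using g'p by simp
 have g'm[measurable]: "borel_fun g'" unfolding g'_def by (rule borel_contI[OF G(3)])
 have gg: "AE x in lborel. g x = g' x"
  using sys1
 proof eventually_elim
  fix x assume *: "ennreal (g x) * (\<integral>\<^sup>+ y. ennreal (f y * hk eps y x) \<partial>lborel) = ennreal (exp (- V1 x))"
  have "(\<integral>\<^sup>+ y. ennreal (f y * hk eps y x) \<partial>lborel) = (\<integral>\<^sup>+ y. ennreal (fh y * hk eps x y) \<partial>lborel)"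
   using ffh by (intro nn_integral_cong_AE) (auto elim!: eventually_mono simp: heat_kernel_commute[of eps _ x])
  with * have "ennreal (g x * heat_sg eps fh x) = ennreal (exp (- V1 x))"
   using g0[of x] G(1)[of x] by (simp add: ennreal_heat_sg[OF G(2) eps kap(2) fh0(1), symmetric] ennreal_mult)
  then have "g x * heat_sg eps fh x = exp (- V1 x)" using g0[of x] G(1)[of x] by simp
  then show "g x = g' x" using G(1)[of x] by (simp add: g'_def field_simps)
 qed
 obtain M0 A2 where F: "!!x. 0 < heat_sg eps g' x" "g' \<in> gauss_class kap" "contU (%x. exp (- V0 x) / heat_sg eps g' x)"
  "!!x. exp (- V0 x) / heat_sg eps g' x <= M0 * exp (kap / 2 * (norm x)^2)" "0 <= A2"
  "!!x. \<bar>ln (exp (- V0 x) / heat_sg eps g' x)\<bar> <= A2 * (1 + (norm x)^2)"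
  by (rule schroedinger_factor_regular[OF eps C V0 g'm less_imp_le[OF g'p] g'ae kap g'b]) blast
 define f' where "f' = (%x. exp (- V0 x) / heat_sg eps g' x)"
 have f'p: "0 < f' x" for x using F(1)[of x] by (simp add: f'_def)
 have f'm[measurable]: "borel_fun f'" unfolding f'_def by (rule borel_contI[OF F(3)])
 have ff: "AE x in lborel. f x = f' x"
  using sys0
 proof eventually_elim
  fix x assume *: "ennreal (f x) * (\<integral>\<^sup>+ y. ennreal (g y * hk eps x y) \<partial>lborel) = ennreal (exp (- V0 x))"
  have "(\<integral>\<^sup>+ y. ennreal (g y * hk eps x y) \<partial>lborel) = (\<integral>\<^sup>+ y. ennreal (g' y * hk eps x y) \<partial>lborel)"
   using gg by (intro nn_integral_cong_AE) (auto elim!: eventually_mono)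
  with * have "ennreal (f x * heat_sg eps g' x) = ennreal (exp (- V0 x))"
   using f0[of x] F(1)[of x] by (simp add: ennreal_heat_sg[OF F(2) eps kap(2) less_imp_le[OF g'p], symmetric] ennreal_mult)
  then have "f x * heat_sg eps g' x = exp (- V0 x)" using f0[of x] F(1)[of x] by simp
  then show "f x = f' x" using F(1)[of x] by (simp add: f'_def field_simps)
 qed
 \<comment> \<open>\<open>g'\<close> was built from the flow of \<open>fh\<close>; equality almost
   everywhere allows replacing it by the flow of \<open>f'\<close>, so both equations hold with the
   final pair.\<close>
 have hs: "heat_sg eps f' = heat_sg eps fh"
  using ff ffh by (intro heat_sg_cong_AE f'm fh) (auto elim: eventually_elim2)
 have e0: "f' x * heat_sg eps g' x = exp (- V0 x)" for x using F(1)[of x] by (simp add: f'_def)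
 have e1: "g' x * heat_sg eps f' x = exp (- V1 x)" for x using G(1)[of x] by (simp add: g'_def hs)
 have "schroedinger f' g' eps kap (max M0 M1) (max A1 A2)"
 proof
  show "contU f'" "contU g'" using F(3) G(3) by (simp_all add: f'_def g'_def)
  show "f' x <= max M0 M1 * exp (kap / 2 * (norm x)^2)" for x
   using F(4)[of x] unfolding f'_def by (rule order_trans) (intro mult_right_mono, auto)
  show "g' x <= max M0 M1 * exp (kap / 2 * (norm x)^2)" for x
   using G(4)[of x] unfolding g'_def by (rule order_trans) (intro mult_right_mono, auto)
  show "\<bar>ln (f' x)\<bar> <= max A1 A2 * (1 + (norm x)^2)" for x
   using F(6)[of x] unfolding f'_def by (rule order_trans) (intro mult_right_mono, auto)
  show "\<bar>ln (g' x)\<bar> <= max A1 A2 * (1 + (norm x)^2)" for x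
   using G(6)[of x] unfolding g'_def by (rule order_trans) (intro mult_right_mono, auto)
 qed (use eps kap G(5) f'p g'p prob0 mom0 mom1 in \<open>auto simp: e0 e1\<close>)
 then show ?thesis using ff gg e0 e1 by (rule that)
qed

section \<open>The value of the dynamic problem and uniqueness\<close>

lemma fp_pair_cong:
 fixes nu nu' :: "real => (real^'n::finite) measure"
 assumes "fp_pair eps nu v" and eq: "!!t. t \<in> {0..1} ==> nu t = nu' t"
 shows "fp_pair eps nu' v"
proof -
 have e01: "nu' 0 = nu 0" "nu' 1 = nu 1" using eq by auto
 have c: "prob_curve nu'"
 proof -
  have "continuous_on {0..1} (%t. \<integral>x. h x \<partial>nu' t) \<longleftrightarrow> continuous_on {0..1} (%t. \<integral>x. h x \<partial>nu t)" for h :: "real^'n => real"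
   by (rule continuous_on_cong) (simp_all add: eq)
  then show ?thesis using assms(1) eq unfolding fp_pair_def prob_curve_def by simp
 qed
 have s: "set_integrable lborel {0..1} (%t. \<integral>x. norm (v t x) \<partial>nu' t) \<longleftrightarrow> set_integrable lborel {0..1} (%t. \<integral>x. norm (v t x) \<partial>nu t)"
  by (rule set_integrable_cong) (simp_all add: eq)
 have l: "(LINT t:{0..1}|lborel. (LINT x|(nu' t). q t x)) = (LINT t:{0..1}|lborel. (LINT x|(nu t). q t x))" for q :: "real => real^'n => real"
  by (rule set_lebesgue_integral_cong) (simp_all add: eq)
 show ?thesis using assms(1) c s eq unfolding fp_pair_def l e01 by simp
qed

lemma borel_measurable_pair_combination:
 fixes v w :: "real => real^'n::finite => real^'n"
 assumes [measurable]: "borel_fun (%(t, x). v t x)" "borel_fun (%(t, x). w t x)"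
 shows "borel_fun (%(t, x). c *\<^sub>R (v t x + w t x))" "borel_fun (%(t, x). c *\<^sub>R (v t x - w t x))"
  "borel_fun (%(t, x). norm (v t x))" "borel_fun (%(t, x). ennreal ((norm (v t x))^2 / 2))"
proof -
 have "borel_fun (%z. c *\<^sub>R ((%(t, x). v t x) z + (%(t, x). w t x) z))" by measurable
 then show "borel_fun (%(t, x). c *\<^sub>R (v t x + w t x))" by (simp only: split_beta')
 have "borel_fun (%z. c *\<^sub>R ((%(t, x). v t x) z - (%(t, x). w t x) z))" by measurable
 then show "borel_fun (%(t, x). c *\<^sub>R (v t x - w t x))" by (simp only: split_beta')
 have "borel_fun (%z. norm ((%(t, x). v t x) z))" by measurable
 then show "borel_fun (%(t, x). norm (v t x))" by (simp only: split_beta')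
 have "(%z. ennreal ((norm ((%(t, x). v t x) z))\<^sup>2 / 2)) \<in> borel_measurable borel" by measurable
 then show "borel_fun (%(t, x). ennreal ((norm (v t x))^2 / 2))" by (simp only: split_beta')
qed

text \<open>For a fixed curve the equation is affine in the velocity, and the integrability
  requirements pass to averages by the triangle inequality.\<close>

lemma fp_pair_midpoint:
 fixes v w :: "real => real^'n::finite => real^'n"
 assumes v: "fp_pair eps nu v" and w: "fp_pair eps nu w"
 shows "fp_pair eps nu (%t x. (1 / 2) *\<^sub>R (v t x + w t x))"
proof -
 note V = fp_pairD[OF v] and W = fp_pairD[OF w]
 let ?m = "%t x. (1 / 2) *\<^sub>R (v t x + w t x)"
 have mB: "borel_fun (%(t, x). ?m t x)" by (rule borel_measurable_pair_combination(1)[OF V(2) W(2)])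
 have vs: "borel_fun (v t)" "borel_fun (w t)" for t by (rule borel_slice[OF V(2)] borel_slice[OF W(2)])+
 have bd: "norm (?m t x) <= norm (v t x) + norm (w t x)" for t x
 proof -
  have "norm (?m t x) = (1 / 2) * norm (v t x + w t x)" by simp
  then show ?thesis using norm_triangle_ineq[of "v t x" "w t x"] norm_ge_zero[of "v t x"] norm_ge_zero[of "w t x"] by linarith
 qed
 have mi: "integrable (nu t) (%x. norm (?m t x))" if t: "t \<in> {0..1}" for t
 proof (rule integrable_boundI)
  note [measurable] = vs
  have [measurable_cong]: "sets (nu t) = sets borel" by (rule V(4)[OF t])
  show "integrable (nu t) (%x. norm (v t x) + norm (w t x))" using V(5)[OF t] W(5)[OF t] by simp
  show "AE x in nu t. norm (norm (?m t x)) <= norm (norm (v t x) + norm (w t x))" using bd by (intro AE_I2) auto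
  show "(%x. norm (?m t x)) \<in> borel_measurable (nu t)" by measurable
 qed
 have mS: "set_integrable lborel {0..1} (%t. \<integral>x. norm (?m t x) \<partial>nu t)"
  unfolding set_integrable_def
 proof (rule integrable_boundI[OF set_integral_add(1)[OF V(6) W(6), unfolded set_integrable_def]])
  from prob_curve_integral_measurable[OF V(1) borel_measurable_pair_combination(3)[OF mB mB]]
  have m[measurable]: "borel_fun (%t. \<integral>x. norm (?m t x) \<partial>nu (clamp01 t))" .
  have e: "(%t. indicator {0..1} t *\<^sub>R (LINT x|(nu t). norm (?m t x))) = (%t. indicator {0..1} t *\<^sub>R (LINT x|(nu (clamp01 t)). norm (?m t x)))"
   by (auto simp: indicator_def clamp01_def)
  show "(%t. indicator {0..1} t *\<^sub>R (LINT x|(nu t). norm (?m t x))) \<in> borel_measurable lborel" unfolding e by measurable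
  show "AE t in lborel. norm (indicator {0..1} t *\<^sub>R (LINT x|(nu t). norm (?m t x)))
   <= norm (indicator {0..1} t *\<^sub>R ((LINT x|(nu t). norm (v t x)) + (LINT x|(nu t). norm (w t x))))"
  proof (intro AE_I2)
   fix t :: real
   have "(LINT x|(nu t). norm (?m t x)) <= (LINT x|(nu t). norm (v t x)) + (LINT x|(nu t). norm (w t x))" if t: "t \<in> {0..1}"
   proof -
    have "(LINT x|(nu t). norm (?m t x)) <= (LINT x|(nu t). norm (v t x) + norm (w t x))"
     by (rule integral_mono[OF mi[OF t] _ bd]) (use V(5)[OF t] W(5)[OF t] in simp)
    then show ?thesis using V(5)[OF t] W(5)[OF t] by simp
   qed
   moreover have "0 <= (LINT x|(nu t). norm (?m t x))" by (intro integral_nonneg_AE AE_I2 norm_ge_zero)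
   moreover have "a <= b ==> 0 <= a ==> norm (indicator {0..1} t *\<^sub>R a) <= norm (indicator {0..1} t *\<^sub>R b)" for a b :: real
    by (simp add: mult_left_mono)
   ultimately show "norm (indicator {0..1} t *\<^sub>R (LINT x|(nu t). norm (?m t x)))
    <= norm (indicator {0..1} t *\<^sub>R ((LINT x|(nu t). norm (v t x)) + (LINT x|(nu t). norm (w t x))))"
    by (cases "t \<in> {0..1}") (blast, simp only: indicator_simps scaleR_zero_left norm_zero order_refl not_False_eq_True)
  qed
 qed
 have id: "(LINT t:{0..1}|lborel. (LINT x|(nu t). pht t x + eps / 2 * laplacian (ph t) x + ?m t x \<bullet> grad (ph t) x))
  = (LINT x|(nu 1). ph 1 x) - (LINT x|(nu 0). ph 0 x)" if test: "test_fun ph pht" for ph pht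
 proof -
  have t: "test_on 0 1 ph pht" using test by (simp add: test_fun_eq_test_on)
  have iv: "!!t. t \<in> {0..1} ==> integrable (nu t) (fpgen eps ph pht v t)" "set_integrable lborel {0..1} (%t. \<integral>x. fpgen eps ph pht v t x \<partial>nu t)"
   by (rule fpgen_integrable[OF V(1,2) _ V(6) order_refl zero_less_one order_refl t]; use V(5) in simp)+
  have iw: "!!t. t \<in> {0..1} ==> integrable (nu t) (fpgen eps ph pht w t)" "set_integrable lborel {0..1} (%t. \<integral>x. fpgen eps ph pht w t x \<partial>nu t)"
   by (rule fpgen_integrable[OF W(1,2) _ W(6) order_refl zero_less_one order_refl t]; use W(5) in simp)+
  have "(LINT t:{0..1}|lborel. (LINT x|(nu t). pht t x + eps / 2 * laplacian (ph t) x + ?m t x \<bullet> grad (ph t) x))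
   = (LINT t:{0..1}|lborel. (1 / 2) * (LINT x|(nu t). fpgen eps ph pht v t x) + (1 / 2) * (LINT x|(nu t). fpgen eps ph pht w t x))"
  proof (rule set_lebesgue_integral_cong)
   show "\<forall>t. t \<in> {0..1} --> (LINT x|(nu t). pht t x + eps / 2 * laplacian (ph t) x + ?m t x \<bullet> grad (ph t) x)
    = (1 / 2) * (LINT x|(nu t). fpgen eps ph pht v t x) + (1 / 2) * (LINT x|(nu t). fpgen eps ph pht w t x)"
   proof (intro allI impI)
    fix t :: real assume t: "t \<in> {0..1}"
    have "(LINT x|(nu t). pht t x + eps / 2 * laplacian (ph t) x + ?m t x \<bullet> grad (ph t) x)
     = (LINT x|(nu t). (1 / 2) * fpgen eps ph pht v t x + (1 / 2) * fpgen eps ph pht w t x)"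
     by (rule LINT_cong[OF refl]) (simp add: fpgen_def inner_add_left field_simps)
    also have "... = (1 / 2) * (LINT x|(nu t). fpgen eps ph pht v t x) + (1 / 2) * (LINT x|(nu t). fpgen eps ph pht w t x)"
     using iv(1)[OF t] iw(1)[OF t] by simp
    finally show "(LINT x|(nu t). pht t x + eps / 2 * laplacian (ph t) x + ?m t x \<bullet> grad (ph t) x)
     = (1 / 2) * (LINT x|(nu t). fpgen eps ph pht v t x) + (1 / 2) * (LINT x|(nu t). fpgen eps ph pht w t x)" .
   qed
  qed simp
  also have "... = (1 / 2) * (LINT t:{0..1}|lborel. (LINT x|(nu t). fpgen eps ph pht v t x)) + (1 / 2) * (LINT t:{0..1}|lborel. (LINT x|(nu t). fpgen eps ph pht w t x))"
   by (subst set_integral_add(2)) (intro set_integrable_mult_right impI iv(2) iw(2), intro set_integrable_mult_right impI iv(2) iw(2), simp)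
  also have "... = (LINT x|(nu 1). ph 1 x) - (LINT x|(nu 0). ph 0 x)" unfolding V(7)[OF t] W(7)[OF t] by simp
  finally show ?thesis .
 qed
 show ?thesis unfolding fp_pair_def using V(1) mB mi mS id by blast
qed

lemma ennreal_add_eq_cancel_zero:
 fixes a b c :: ennreal
 assumes "a + b = c" "c <= a" "a < \<infinity>"
 shows "b = 0"
proof -
 have "a + b <= a + 0" using assms by simp
 then show ?thesis using assms(3) by (auto simp: ennreal_add_left_cancel_le)
qed

lemma curve_energy_measurable:
 fixes v :: "real => real^'n::finite => real^'n"
 assumes c: "prob_curve nu" and v: "borel_fun (%(t, x). v t x)"
 shows "(%t. (\<integral>\<^sup>+x. ennreal ((norm (v t x))^2 / 2) \<partial>nu t) * indicator {0..1} t) \<in> borel_measurable borel"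
proof -
 from prob_curve_nn_integral_measurable[OF c borel_measurable_pair_combination(4)[OF v v]]
 have [measurable]: "borel_fun (%t. \<integral>\<^sup>+x. ennreal ((norm (v t x))^2 / 2) \<partial>nu (clamp01 t))" .
 have "(%t. (\<integral>\<^sup>+x. ennreal ((norm (v t x))^2 / 2) \<partial>nu (clamp01 t)) * indicator {0..1} t) \<in> borel_measurable borel" by measurable
 also have "(%t. (\<integral>\<^sup>+x. ennreal ((norm (v t x))^2 / 2) \<partial>nu (clamp01 t)) * indicator {0..1} t)
  = (%t. (\<integral>\<^sup>+x. ennreal ((norm (v t x))^2 / 2) \<partial>nu t) * indicator {0..1} t)"
  by (intro ext) (auto simp: indicator_def clamp01_def)
 finally show ?thesis .
qed

context schroedinger
begin

lemma energy_cong: "(!!t. t \<in> {0..1} ==> nu t = nu' t) ==> energy nu v 0 1 = energy nu' v 0 1"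
 by (intro nn_integral_cong) (auto simp: indicator_def)

lemma energy_parallelogram:
 assumes v: "fp_pair eps nu v" and w: "fp_pair eps nu w"
 shows "energy nu (%t x. (1 / 2) *\<^sub>R (v t x + w t x)) 0 1 + energy nu (%t x. (1 / 2) *\<^sub>R (v t x - w t x)) 0 1
  = ennreal (1 / 2) * energy nu v 0 1 + ennreal (1 / 2) * energy nu w 0 1"
proof -
 note V = fp_pairD[OF v] and W = fp_pairD[OF w]
 let ?m = "%t x. (1 / 2) *\<^sub>R (v t x + w t x)" and ?d = "%t x. (1 / 2) *\<^sub>R (v t x - w t x)"
 have mB: "borel_fun (%(t, x). ?m t x)" "borel_fun (%(t, x). ?d t x)"
  by (rule borel_measurable_pair_combination[OF V(2) W(2)])+
 note meas = curve_energy_measurable[OF V(1)]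
 have pt: "(\<integral>\<^sup>+x. ennreal ((norm (?m t x))^2 / 2) \<partial>nu t) + (\<integral>\<^sup>+x. ennreal ((norm (?d t x))^2 / 2) \<partial>nu t)
  = ennreal (1 / 2) * (\<integral>\<^sup>+x. ennreal ((norm (v t x))^2 / 2) \<partial>nu t) + ennreal (1 / 2) * (\<integral>\<^sup>+x. ennreal ((norm (w t x))^2 / 2) \<partial>nu t)"
  if t: "t \<in> {0..1}" for t
 proof -
  have [measurable_cong]: "sets (nu t) = sets borel" by (rule V(4)[OF t])
  have [measurable]: "borel_fun (v t)" "borel_fun (w t)" by (rule borel_slice[OF V(2)] borel_slice[OF W(2)])+
  have e: "ennreal ((norm (?m t x))^2 / 2) + ennreal ((norm (?d t x))^2 / 2)
   = ennreal (1 / 2) * ennreal ((norm (v t x))^2 / 2) + ennreal (1 / 2) * ennreal ((norm (w t x))^2 / 2)" for x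
  proof -
   have "(norm (?m t x))^2 / 2 + (norm (?d t x))^2 / 2 = 1 / 2 * ((norm (v t x))^2 / 2) + 1 / 2 * ((norm (w t x))^2 / 2)"
    by (simp add: power2_norm_eq_inner inner_add_left inner_add_right inner_diff_left inner_diff_right inner_commute field_simps)
   then show ?thesis by (simp only: ennreal_mult[symmetric] ennreal_plus[symmetric] zero_le_power2 divide_nonneg_nonneg zero_le_numeral zero_le_one mult_nonneg_nonneg)
  qed
  have "(\<integral>\<^sup>+x. ennreal ((norm (?m t x))^2 / 2) \<partial>nu t) + (\<integral>\<^sup>+x. ennreal ((norm (?d t x))^2 / 2) \<partial>nu t)
   = (\<integral>\<^sup>+x. ennreal ((norm (?m t x))^2 / 2) + ennreal ((norm (?d t x))^2 / 2) \<partial>nu t)"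
   by (rule nn_integral_add[symmetric]) measurable
  also have "... = (\<integral>\<^sup>+x. ennreal (1 / 2) * ennreal ((norm (v t x))^2 / 2) \<partial>nu t) + (\<integral>\<^sup>+x. ennreal (1 / 2) * ennreal ((norm (w t x))^2 / 2) \<partial>nu t)"
   unfolding e by (rule nn_integral_add) measurable
  also have "(\<integral>\<^sup>+x. ennreal (1 / 2) * ennreal ((norm (v t x))^2 / 2) \<partial>nu t) = ennreal (1 / 2) * (\<integral>\<^sup>+x. ennreal ((norm (v t x))^2 / 2) \<partial>nu t)"
   by (rule nn_integral_cmult) measurable
  also have "(\<integral>\<^sup>+x. ennreal (1 / 2) * ennreal ((norm (w t x))^2 / 2) \<partial>nu t) = ennreal (1 / 2) * (\<integral>\<^sup>+x. ennreal ((norm (w t x))^2 / 2) \<partial>nu t)"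
   by (rule nn_integral_cmult) measurable
  finally show ?thesis .
 qed
 have "energy nu ?m 0 1 + energy nu ?d 0 1 = (\<integral>\<^sup>+t. (\<integral>\<^sup>+x. ennreal ((norm (?m t x))^2 / 2) \<partial>nu t) * indicator {0..1} t
   + (\<integral>\<^sup>+x. ennreal ((norm (?d t x))^2 / 2) \<partial>nu t) * indicator {0..1} t \<partial>lborel)"
  using meas[OF mB(1)] meas[OF mB(2)] by (intro nn_integral_add[symmetric]) simp_all
 also have "... = (\<integral>\<^sup>+t. ennreal (1 / 2) * ((\<integral>\<^sup>+x. ennreal ((norm (v t x))^2 / 2) \<partial>nu t) * indicator {0..1} t)
   + ennreal (1 / 2) * ((\<integral>\<^sup>+x. ennreal ((norm (w t x))^2 / 2) \<partial>nu t) * indicator {0..1} t) \<partial>lborel)"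
 proof (rule nn_integral_cong)
  fix t :: real
  show "(\<integral>\<^sup>+x. ennreal ((norm (?m t x))^2 / 2) \<partial>nu t) * indicator {0..1} t + (\<integral>\<^sup>+x. ennreal ((norm (?d t x))^2 / 2) \<partial>nu t) * indicator {0..1} t
   = ennreal (1 / 2) * ((\<integral>\<^sup>+x. ennreal ((norm (v t x))^2 / 2) \<partial>nu t) * indicator {0..1} t)
   + ennreal (1 / 2) * ((\<integral>\<^sup>+x. ennreal ((norm (w t x))^2 / 2) \<partial>nu t) * indicator {0..1} t)"
  proof (cases "t \<in> {0..1}")
   case True
   then have i: "indicator {0..1} t = (1 :: ennreal)" by simp
   show ?thesis unfolding i mult_1_right by (rule pt[OF True])
  next
   case False
   then have i: "indicator {0..1} t = (0 :: ennreal)" by simp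
   show ?thesis unfolding i mult_zero_right add_0 ..
  qed
 qed
 also have "... = ennreal (1 / 2) * energy nu v 0 1 + ennreal (1 / 2) * energy nu w 0 1"
  using meas[OF V(2)] meas[OF W(2)] by (subst nn_integral_add) (simp_all add: nn_integral_cmult)
 finally show ?thesis .
qed

text \<open>Once the curves coincide, the midpoint velocity is admissible and costs at least the
  minimum. The parallelogram identity then leaves zero energy for half the difference; finiteness
  permits the cancellation in \<open>ennreal\<close>.\<close>

lemma dynamic_minimizer_unique:
 assumes nu: "fp_pair eps nu v" "nu 0 = mu 0" "nu 1 = mu 1" "energy nu v 0 1 = ennreal (ent 1 - ent 0)"
  and w: "fp_pair eps mu w" "energy mu w 0 1 = ennreal (ent 1 - ent 0)"
 shows "!!t. t \<in> {0..1} ==> nu t = mu t" "AE t in lborel. t \<in> {0..1} --> (AE x in mu t. v t x = w t x)"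
proof -
 have nn: "0 <= ent 1 - ent 0" using ent_mono by simp
 show eq: "nu t = mu t" if "t \<in> {0..1}" for t
  by (rule minimizer_marginals[OF nu(1-3) _ _ that]) (use nn in \<open>simp_all add: nu(4)\<close>)
 have v: "fp_pair eps mu v" by (rule fp_pair_cong[OF nu(1) eq])
 have ev: "energy mu v 0 1 = ennreal (ent 1 - ent 0)" using energy_cong[of nu mu v] eq nu(4) by simp
 let ?m = "%t x. (1 / 2) *\<^sub>R (v t x + w t x)" and ?d = "%t x. (1 / 2) *\<^sub>R (v t x - w t x)"
 have "energy mu ?m 0 1 + energy mu ?d 0 1 = ennreal (1 / 2) * ennreal (ent 1 - ent 0) + ennreal (1 / 2) * ennreal (ent 1 - ent 0)"
  unfolding energy_parallelogram[OF v w(1)] ev w(2) ..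
 also have "... = ennreal (1 / 2 * (ent 1 - ent 0) + 1 / 2 * (ent 1 - ent 0))"
  using nn by (simp only: ennreal_mult[symmetric] ennreal_plus[symmetric] divide_nonneg_nonneg zero_le_numeral zero_le_one mult_nonneg_nonneg)
 finally have sum: "energy mu ?m 0 1 + energy mu ?d 0 1 = ennreal (ent 1 - ent 0)" by simp
 have "energy mu ?m 0 1 <= energy mu ?m 0 1 + energy mu ?d 0 1" by (rule add_increasing2[OF zero_le order_refl])
 also have "... < \<infinity>" unfolding sum by simp
 finally have fin: "energy mu ?m 0 1 < \<infinity>" .
 have "ent 1 - ent 0 <= enn2real (energy mu ?m 0 1)" by (rule energy_ge[OF fp_pair_midpoint[OF v w(1)] refl refl fin])
 from ennreal_leI[OF this] have ge: "ennreal (ent 1 - ent 0) <= energy mu ?m 0 1"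
  unfolding ennreal_enn2real[OF fin[unfolded infinity_ennreal_def]] .
 have z: "energy mu ?d 0 1 = 0"
  by (rule ennreal_add_eq_cancel_zero[OF sum ge fin])
 have dB: "borel_fun (%(t, x). ?d t x)" by (rule borel_measurable_pair_combination(2)[OF fp_pairD(2)[OF v] fp_pairD(2)[OF w(1)]])
 have "AE t in lborel. (\<integral>\<^sup>+x. ennreal ((norm (?d t x))^2 / 2) \<partial>mu t) * indicator {0..1} t = 0"
  using z curve_energy_measurable[OF mu_curve dB] by (subst (asm) nn_integral_0_iff_AE) simp_all
 then show "AE t in lborel. t \<in> {0..1} --> (AE x in mu t. v t x = w t x)"
 proof (rule eventually_mono, intro impI)
  fix t assume t: "(\<integral>\<^sup>+x. ennreal ((norm (?d t x))^2 / 2) \<partial>mu t) * indicator {0..1} t = 0" "t \<in> {0..1}"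
  have [measurable]: "?d t \<in> borel_measurable borel" by (rule borel_slice[OF dB])
  have "(\<integral>\<^sup>+x. ennreal ((norm (?d t x))^2 / 2) \<partial>mu t) = 0" using t by simp
  then have "AE x in mu t. ennreal ((norm (?d t x))^2 / 2) = 0" by (subst (asm) nn_integral_0_iff_AE) measurable
  then show "AE x in mu t. v t x = w t x" by eventually_elim (simp add: ennreal_eq_0_iff)
 qed
qed

end

text \<open>The function \<open>u\<close> is any integrable version of the logarithmic density under
  \<open>Q\<close>. Its integrability excludes the undefined difference of infinities, and almost
  sure uniqueness identifies the chosen \<open>RN_deriv\<close>.\<close>

lemma rel_entropy_density_eq:
 fixes h u :: "'a => real"
 assumes P: "sigma_finite_measure P" and h[measurable]: "h \<in> borel_measurable P" "!!x. 0 <= h x" and Q: "Q = density P (%x. ennreal (h x))"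
  and u: "AE x in Q. ln (h x) = u x" "integrable Q u"
 shows "rel_entropy Q P = ereal (LINT x|Q. u x)"
proof -
 interpret sigma_finite_measure P by (rule P)
 have ac: "absolutely_continuous P Q" unfolding Q by (rule absolutely_continuousI_density) measurable
 have sets: "sets Q = sets P" by (simp add: Q)
 have "AE x in P. ennreal (h x) = RN_deriv P Q x" by (rule RN_deriv_unique) (auto simp: Q)
 then have "AE x in Q. ennreal (h x) = RN_deriv P Q x" by (rule absolutely_continuous_AE[OF sets ac])
 with u(1) have R: "AE x in Q. ln (enn2real (RN_deriv P Q x)) = u x"
 proof eventually_elim
  fix x assume "ln (h x) = u x" "ennreal (h x) = RN_deriv P Q x"
  then show "ln (enn2real (RN_deriv P Q x)) = u x" using h(2)[of x] by (metis enn2real_ennreal)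
 qed
 let ?p = "\<integral>\<^sup>+x. ennreal (u x) \<partial>Q" and ?n = "\<integral>\<^sup>+x. ennreal (- u x) \<partial>Q"
 have m: "ennreal (max 0 r) = ennreal r" for r by (cases "0 <= r") (auto simp: max_def ennreal_neg)
 have p: "(\<integral>\<^sup>+x. ennreal (max 0 (ln (enn2real (RN_deriv P Q x)))) \<partial>Q) = ?p" and n: "(\<integral>\<^sup>+x. ennreal (max 0 (- ln (enn2real (RN_deriv P Q x)))) \<partial>Q) = ?n"
  unfolding m using R by (auto intro!: nn_integral_cong_AE elim!: eventually_mono)
 have fin: "?p ~= \<infinity>" "?n ~= \<infinity>" using u(2) by (auto simp: real_integrable_def)
 have "rel_entropy Q P = enn2ereal ?p - enn2ereal ?n" unfolding rel_entropy_def p n using ac sets by simp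
 also have "... = ereal (enn2real ?p) - ereal (enn2real ?n)" using fin by (cases ?p; cases ?n) (auto simp: enn2ereal_ennreal)
 also have "... = ereal (LINT x|Q. u x)" using real_lebesgue_integral_def[OF u(2)] by simp
 finally show ?thesis .
qed

lemma has_derivative_cmult_ln:
 fixes h :: "real^'n::finite => real"
 assumes "(h has_derivative (%d. L \<bullet> d)) (at x)" "0 < h x"
 shows "((%x. e * ln (h x)) has_derivative (%d. ((e / h x) *\<^sub>R L) \<bullet> d)) (at x)"
proof -
 have "((%x. e * ln (h x)) has_derivative (%d. e * ((L \<bullet> d) * inverse (h x)))) (at x)"
  using assms by (intro has_derivative_mult_right has_derivative_ln) 
 then show ?thesis by (rule has_derivative_eq_rhs) (simp add: fun_eq_iff divide_inverse)
qed

lemma kin_cost_eq_energy: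
 fixes \<eta> :: "real => real^'n::finite => real"
 assumes \<eta>: "!!t. t \<in> {0..1} ==> \<eta> t \<in> borel_measurable borel" "!!t x. t \<in> {0..1} ==> 0 <= \<eta> t x"
  and v: "borel_fun (%(t, x). v t x)"
 shows "kin_cost (\<eta>, v) = (\<integral>\<^sup>+t\<in>{0..1}. (\<integral>\<^sup>+x. ennreal ((norm (v t x))^2 / 2) \<partial>density lborel (%x. ennreal (\<eta> t x))) \<partial>lborel)"
 unfolding kin_cost_def fst_conv snd_conv
proof (rule nn_integral_cong)
 fix t :: real
 show "(\<integral>\<^sup>+x. ennreal ((norm (v t x))^2 / 2 * \<eta> t x) \<partial>lborel) * indicator {0..1} t
  = (\<integral>\<^sup>+x. ennreal ((norm (v t x))^2 / 2) \<partial>density lborel (%x. ennreal (\<eta> t x))) * indicator {0..1} t"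
 proof (cases "t \<in> {0..1}")
  case True
  have [measurable]: "borel_fun (v t)" "\<eta> t \<in> borel_measurable borel" by (rule borel_slice[OF v] \<eta>(1)[OF True])+
  have "(\<integral>\<^sup>+x. ennreal ((norm (v t x))^2 / 2) \<partial>density lborel (%x. ennreal (\<eta> t x)))
   = (\<integral>\<^sup>+x. ennreal (\<eta> t x) * ennreal ((norm (v t x))^2 / 2) \<partial>lborel)" by (rule nn_integral_density) measurable
  also have "... = (\<integral>\<^sup>+x. ennreal ((norm (v t x))^2 / 2 * \<eta> t x) \<partial>lborel)"
   using \<eta>(2)[OF True] by (intro nn_integral_cong) (simp add: ennreal_mult[symmetric] mult.commute)
  finally show ?thesis by (rule arg_cong[where f = "%a. a * _", OF sym])
 qed simp
qed

lemma fpot_eq_gpot: "fpot eps f t = gpot eps f (1 - t)"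
 by (simp add: fun_eq_iff fpot_def gpot_def)

theorem theorem3p6:
  fixes V0 V1 :: "real^'n::finite \<Rightarrow> real"
    and C eps :: real
    and f g :: "real^'n \<Rightarrow> real"
  defines "\<rho>0 \<equiv> (\<lambda>x. exp (- V0 x))" and "\<rho>1 \<equiv> (\<lambda>x. exp (- V1 x))"
  defines "\<mu>0 \<equiv> density lborel (\<lambda>x. ennreal (\<rho>0 x))"
      and "\<mu>1 \<equiv> density lborel (\<lambda>x. ennreal (\<rho>1 x))"
  assumes prob0: "prob_space \<mu>0" and prob1: "prob_space \<mu>1"
    and mom0: "(\<integral>\<^sup>+ x. ennreal ((norm x)\<^sup>2) \<partial>\<mu>0) < \<infinity>"
    and mom1: "(\<integral>\<^sup>+ x. ennreal ((norm x)\<^sup>2) \<partial>\<mu>1) < \<infinity>"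
    and C_pos: "C > 0"
    and V0_C2: "\<exists>H. C2_hessian V0 H \<and>
                  (\<forall>x \<xi>. (1 / C) * (norm \<xi>)\<^sup>2 \<le> \<xi> \<bullet> (H x *v \<xi>) \<and> \<xi> \<bullet> (H x *v \<xi>) \<le> C * (norm \<xi>)\<^sup>2)"
    and V1_C2: "\<exists>H. C2_hessian V1 H \<and>
                  (\<forall>x \<xi>. (1 / C) * (norm \<xi>)\<^sup>2 \<le> \<xi> \<bullet> (H x *v \<xi>) \<and> \<xi> \<bullet> (H x *v \<xi>) \<le> C * (norm \<xi>)\<^sup>2)"
    and eps_pos: "eps > 0"
    \<comment> \<open>f, g: the Borel nonnegative Schroedinger potentials of the minimizer gamma^eps = (f x g) R_eps\<close>
    and f_meas: "f \<in> borel_measurable borel" and g_meas: "g \<in> borel_measurable borel"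
    and f_nonneg: "\<forall>x. 0 \<le> f x" and g_nonneg: "\<forall>y. 0 \<le> g y"
    and sys0: "AE x in lborel. ennreal (f x) * (\<integral>\<^sup>+ y. ennreal (g y * heat_kernel eps x y) \<partial>lborel) = ennreal (\<rho>0 x)"
    and sys1: "AE y in lborel. ennreal (g y) * (\<integral>\<^sup>+ x. ennreal (f x * heat_kernel eps x y) \<partial>lborel) = ennreal (\<rho>1 y)"
    and gamma_min: "density lborel (\<lambda>(x, y). ennreal (f x * g y * heat_kernel eps x y)) \<in> couplings \<mu>0 \<mu>1"
                   "\<forall>\<gamma>\<in>couplings \<mu>0 \<mu>1.
                      rel_entropy (density lborel (\<lambda>(x, y). ennreal (f x * g y * heat_kernel eps x y))) (ref_meas eps)
                      \<le> rel_entropy \<gamma> (ref_meas eps)"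
  shows "(\<exists>\<gamma>\<in>couplings \<mu>0 \<mu>1. rel_entropy \<gamma> (ref_meas eps) = (INF \<gamma>'\<in>couplings \<mu>0 \<mu>1. rel_entropy \<gamma>' (ref_meas eps)))
       \<and> ereal eps * (INF \<gamma>\<in>couplings \<mu>0 \<mu>1. rel_entropy \<gamma> (ref_meas eps))
           = ereal eps * rel_entropy \<mu>0 lborel + enn2ereal (INF p\<in>fp_admissible eps \<rho>0 \<rho>1. kin_cost p)
       \<and> (ent_density eps f g, \<lambda>t. grad (ent_psi eps g t)) \<in> fp_admissible eps \<rho>0 \<rho>1
       \<and> kin_cost (ent_density eps f g, \<lambda>t. grad (ent_psi eps g t)) = (INF p\<in>fp_admissible eps \<rho>0 \<rho>1. kin_cost p)
       \<and> (\<forall>\<eta> v. (\<eta>, v) \<in> fp_admissible eps \<rho>0 \<rho>1 \<and>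
                 kin_cost (\<eta>, v) = (INF p\<in>fp_admissible eps \<rho>0 \<rho>1. kin_cost p) \<longrightarrow>
                 (\<forall>t\<in>{0..1}. density lborel (\<lambda>x. ennreal (\<eta> t x))
                              = density lborel (\<lambda>x. ennreal (ent_density eps f g t x))) \<and>
                 (AE t in lborel. t \<in> {0..1} \<longrightarrow>
                    (AE x in density lborel (\<lambda>x. ennreal (ent_density eps f g t x)).
                       v t x = grad (ent_psi eps g t) x)))"
proof -
 obtain DV0 a0 b0 B0 where V0: "!!x. (V0 has_derivative (%h. DV0 x \<bullet> h)) (at x)" "!!x. a0 + b0 \<bullet> x + (norm x)^2 / (2 * C) <= V0 x"
  "0 <= B0" "!!x. \<bar>V0 x\<bar> <= B0 * (1 + (norm x)^2)"
  by (rule hessian_bounds[OF C_pos V0_C2]) blast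
 obtain DV1 a1 b1 B1 where V1: "!!x. (V1 has_derivative (%h. DV1 x \<bullet> h)) (at x)" "contU DV1" "!!x. a1 + b1 \<bullet> x + (norm x)^2 / (2 * C) <= V1 x"
  "0 <= B1" "!!x. \<bar>V1 x\<bar> <= B1 * (1 + (norm x)^2)" "!!x. norm (DV1 x) <= B1 * (1 + (norm x)^2)"
  by (rule hessian_bounds[OF C_pos V1_C2]) blast
 have V0c: "contU V0" and V1c: "contU V1"
  using V0(1) V1(1) by (auto intro!: continuous_at_imp_continuous_on has_derivative_continuous)
 have [measurable]: "borel_fun V0" "borel_fun V1" "borel_fun DV1"
  by (rule borel_contI[OF V0c] borel_contI[OF V1c] borel_contI[OF V1(2)])+
 have [measurable]: "\<rho>0 \<in> borel_measurable borel" "\<rho>1 \<in> borel_measurable borel" unfolding \<rho>0_def \<rho>1_def by measurable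
 note [measurable] = f_meas g_meas
 have mom: "(\<integral>\<^sup>+x. ennreal ((norm x)^2 * exp (- V x)) \<partial>lborel) = (\<integral>\<^sup>+x. ennreal ((norm x)^2) \<partial>density lborel (%x. ennreal (exp (- V x))))"
  if [measurable]: "borel_fun V" for V :: "real^'n => real"
  by (subst nn_integral_density) (auto simp: ennreal_mult[symmetric] mult.commute)
 have p0: "(\<integral>\<^sup>+x. ennreal (exp (- V0 x)) \<partial>lborel) = 1"
  using prob_space.emeasure_space_1[OF prob0] unfolding \<mu>0_def \<rho>0_def by (simp add: emeasure_density)
 have B: "\<bar>V0 x\<bar> <= max B0 B1 * (1 + (norm x)^2)" "\<bar>V1 x\<bar> <= max B0 B1 * (1 + (norm x)^2)" for x
  using order_trans[OF V0(4)[of x] mult_right_mono[OF max.cobounded1[of B0 B1], of "1 + (norm x)^2"]]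
   order_trans[OF V1(5)[of x] mult_right_mono[OF max.cobounded2[of B1 B0], of "1 + (norm x)^2"]] by simp_all
 have Bnn: "0 <= max B0 B1" using V0(3) by simp
 obtain f' g' kap M A where S: "schroedinger f' g' eps kap M A" and ff: "AE x in lborel. f x = f' x" and gg: "AE x in lborel. g x = g' x"
  and e0: "!!x. f' x * heat_sg eps g' x = exp (- V0 x)" and e1: "!!x. g' x * heat_sg eps f' x = exp (- V1 x)"
  by (rule schroedinger_regularise[OF C_pos eps_pos V0c V0(2) Bnn B(1) V1c V1(3) B(2) f_meas g_meas spec[OF f_nonneg] spec[OF g_nonneg]
   sys0[unfolded \<rho>0_def] sys1[unfolded \<rho>1_def] p0]) (use mom mom0 mom1 in \<open>simp_all add: \<mu>0_def \<mu>1_def \<rho>0_def \<rho>1_def\<close>)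
 interpret S: schroedinger f' g' eps kap M A by (rule S)
 interpret R: schroedinger g' f' eps kap M A by (rule S.rev)
 have z01: "(0::real) \<in> {0..1}" "(1::real) \<in> {0..1}" by auto
 have r0: "S.rho 0 = \<rho>0" and r1: "S.rho 1 = \<rho>1" and rR: "R.rho 0 = \<rho>1"
  using e0 e1 by (auto simp: fun_eq_iff S.rho_def R.rho_def S.F_def S.G_def R.F_def R.G_def \<rho>0_def \<rho>1_def mult.commute)
 have m0: "S.mu 0 = \<mu>0" and m1: "S.mu 1 = \<mu>1" and mR: "R.mu 0 = S.mu 1"
  by (simp_all add: S.mu_def R.mu_def r0 r1 rR \<mu>0_def \<mu>1_def)
 have F: "fpot eps f t = S.F t" if "t ~= 0" for t
  using gpot_AE_cong[OF f_meas spec[OF f_nonneg] S.f_meas ff, of "1 - t" eps] that by (simp add: fpot_eq_gpot S.F_def)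
 have G: "gpot eps g t = S.G t" if "t ~= 1" for t
  using gpot_AE_cong[OF g_meas spec[OF g_nonneg] S.g_meas gg, of t eps] that by (simp add: S.G_def)
 have F0: "fpot eps f 0 = f" and G1: "gpot eps g 1 = g" by (auto simp: fpot_def gpot_def)
 have Fm: "borel_fun (fpot eps f t)" "!!x. 0 <= fpot eps f t x" "AE x in lborel. fpot eps f t x = S.F t x" if "t \<in> {0..1}" for t
  using S.F_meas[OF that] S.F_pos[OF that] F[of t] f_nonneg ff by (cases "t = 0"; auto simp: F0 S.F_def less_imp_le)+
 have Gm: "borel_fun (gpot eps g t)" "!!x. 0 <= gpot eps g t x" "AE x in lborel. gpot eps g t x = S.G t x" if "t \<in> {0..1}" for t
  using S.G_meas[OF that] S.G_pos[OF that] G[of t] g_nonneg gg by (cases "t = 1"; auto simp: G1 S.G_def less_imp_le)+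
 have em: "borel_fun (ent_density eps f g t)" and enn: "!!x. 0 <= ent_density eps f g t x" if "t \<in> {0..1}" for t
  using Fm(1,2)[OF that] Gm(1,2)[OF that] unfolding ent_density_def[abs_def] by (auto intro!: borel_measurable_times)
 have dens: "density lborel (%x. ennreal (ent_density eps f g t x)) = S.mu t" if t: "t \<in> {0..1}" for t
  unfolding S.mu_def
 proof (rule density_cong)
  show "AE x in lborel. ennreal (ent_density eps f g t x) = ennreal (S.rho t x)"
   using Fm(3)[OF t] Gm(3)[OF t] by eventually_elim (simp add: ent_density_def S.rho_def)
 qed (use em[OF t] S.rho_meas[OF t] in simp_all)
 let ?v = "%t. grad (ent_psi eps g t)"
 have vel: "?v t x = S.vel t x" if t: "0 <= t" "t < 1" for t x
 proof -
  have t': "t \<in> {0..1}" "t ~= 1" using t by auto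
  have e: "ent_psi eps g t = (%x. eps * ln (S.G t x))" using G[OF t'(2)] by (auto simp: ent_psi_def)
  have "(S.G t has_derivative (%d. hgrad (eps * (1 - t)) g' x \<bullet> d)) (at x)"
   using heat_sg_has_derivative_space[OF S.g_gc] S.time_G[OF t'] t'(2) by (simp add: S.G_def)
  then show ?thesis unfolding e S.vel_def by (intro grad_eqI has_derivative_cmult_ln S.G_pos[OF t'(1)])
 qed
 \<comment> \<open>At time 1 the equation g' P_eps f' = exp(-V1) gives eps ln g' = -eps V1 - eps ln
   (P_eps f'); the last gradient is the initial velocity of the reversed interpolation.\<close>
 define W where "W = (%x. (- eps) *\<^sub>R DV1 x - R.vel 0 x)"
 have [measurable]: "R.vel 0 \<in> borel_measurable borel" by (rule R.vel_meas) auto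
 have Wm[measurable]: "borel_fun W" unfolding W_def by measurable
 have WD: "((%x. eps * ln (g' x)) has_derivative (%h. W x \<bullet> h)) (at x)" for x
 proof -
  have "(R.G 0 has_derivative (%d. hgrad (eps * (1 - 0)) f' x \<bullet> d)) (at x)"
   using heat_sg_has_derivative_space[OF R.g_gc, of "eps * (1 - 0)"] R.time_G[OF z01(1)] by (simp add: R.G_def)
  from has_derivative_cmult_ln[OF this R.G_pos[OF z01(1)], of eps]
  have D: "((%x. eps * ln (R.G 0 x)) has_derivative (%d. R.vel 0 x \<bullet> d)) (at x)" by (simp add: R.vel_def)
  have "((%x. (- eps) * V1 x - eps * ln (R.G 0 x)) has_derivative (%d. (- eps) * (DV1 x \<bullet> d) - R.vel 0 x \<bullet> d)) (at x)"
   by (intro has_derivative_diff has_derivative_mult_right V1(1) D)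
  moreover have "(- eps) * V1 y - eps * ln (R.G 0 y) = eps * ln (g' y)" for y
  proof -
   have "ln (g' y) + ln (R.G 0 y) = ln (g' y * R.G 0 y)" using S.g_pos[of y] R.G_pos[OF z01(1), of y] by (simp add: ln_mult)
   also have "... = - V1 y" using e1[of y] by (simp add: R.G_def)
   finally have V: "V1 y = - ln (g' y) - ln (R.G 0 y)" by linarith
   show ?thesis unfolding V by (simp add: algebra_simps)
  qed
  moreover have "(%d. (- eps) * (DV1 x \<bullet> d) - R.vel 0 x \<bullet> d) = (%h. W x \<bullet> h)" by (simp add: fun_eq_iff W_def inner_diff_left)
  ultimately show ?thesis by simp
 qed
 have vB: "borel_fun (%(t, x). ?v t x)"
  by (rule grad_ent_psi_measurable[OF eps_pos g_meas spec[OF g_nonneg] S.g_meas S.g_pos gg WD Wm])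
 have v1: "integrable (S.mu 1) (%x. norm (?v 1 x))"
 proof -
  interpret P1: prob_space "S.mu 1" by (rule S.mu_prob[OF z01(2)])
  have "ent_psi eps g 1 = (%x. eps * ln (g x))" by (auto simp: ent_psi_def G1)
  then obtain c where c: "!!x. ?v 1 x = W x \<or> ?v 1 x = c" using grad_ln_AE_eq(2)[OF gg WD Wm] by auto
  have [measurable]: "?v 1 \<in> borel_measurable borel" by (rule borel_slice[OF vB])
  have "integrable (S.mu 1) (%x. norm (DV1 x))"
   by (rule S.mu_integrable_quadratic[OF z01(2), of _ B1]) (use V1(6) in auto)
  moreover have "integrable (S.mu 1) (%x. norm (R.vel 0 x))" using R.vel_integrable(2)[of 0] by (simp add: mR)
  ultimately have i: "integrable (S.mu 1) (%x. eps * norm (DV1 x) + norm (R.vel 0 x) + norm c)" by simp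
  show ?thesis
  proof (rule integrable_boundI[OF i])
   have "norm (?v 1 x) <= eps * norm (DV1 x) + norm (R.vel 0 x) + norm c" for x
   proof -
    have "norm (W x) <= eps * norm (DV1 x) + norm (R.vel 0 x)"
     using norm_triangle_ineq4[of "(- eps) *\<^sub>R DV1 x" "R.vel 0 x"] eps_pos by (simp add: W_def)
    then have "norm (W x) <= eps * norm (DV1 x) + norm (R.vel 0 x) + norm c" by (simp add: add_increasing2)
    moreover have "norm c <= eps * norm (DV1 x) + norm (R.vel 0 x) + norm c" using eps_pos by simp
    ultimately show ?thesis using c[of x] by (elim disjE) (simp_all only:)
   qed
   then show "AE x in S.mu 1. norm (norm (?v 1 x)) <= norm (eps * norm (DV1 x) + norm (R.vel 0 x) + norm c)"
    by (intro AE_I2) (auto intro: order_trans[OF _ abs_ge_self])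
  qed measurable
 qed
 have fpS: "fp_pair eps S.mu ?v" "(\<integral>\<^sup>+t\<in>{0..1}. (\<integral>\<^sup>+x. ennreal ((norm (?v t x))^2 / 2) \<partial>S.mu t) \<partial>lborel) <= ennreal (S.ent 1 - S.ent 0)"
  using S.fp_mu[OF vB _ v1] vel by blast+
 define J where "J = S.ent 1 - S.ent 0"
 have J0: "0 <= J" using S.ent_mono by (simp add: J_def)
 let ?Adm = "fp_admissible eps \<rho>0 \<rho>1" and ?e = "(ent_density eps f g, ?v)"
 have eAdm: "?e \<in> ?Adm"
  unfolding fp_admissible_def using em enn dens[OF z01(1)] dens[OF z01(2)] fp_pair_cong[OF fpS(1) dens[symmetric]]
  by (simp add: m0 m1 \<mu>0_def \<mu>1_def)
 have kin: "kin_cost (\<eta>, v) = (\<integral>\<^sup>+t\<in>{0..1}. (\<integral>\<^sup>+x. ennreal ((norm (v t x))^2 / 2) \<partial>density lborel (%x. ennreal (\<eta> t x))) \<partial>lborel)"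
  if "(\<eta>, v) \<in> ?Adm" for \<eta> v
  using that fp_pairD(2) by (intro kin_cost_eq_energy) (auto simp: fp_admissible_def)
 have admD: "fp_pair eps (%t. density lborel (%x. ennreal (\<eta> t x))) v" "density lborel (%x. ennreal (\<eta> 0 x)) = S.mu 0" "density lborel (%x. ennreal (\<eta> 1 x)) = S.mu 1"
  if "(\<eta>, v) \<in> ?Adm" for \<eta> v
  using that by (auto simp: fp_admissible_def m0 m1 \<mu>0_def \<mu>1_def)
 have lower: "ennreal J <= kin_cost p" if p: "p \<in> ?Adm" for p
 proof (cases p)
  case (Pair \<eta> v)
  note a = p[unfolded Pair]
  show ?thesis
  proof (cases "kin_cost (\<eta>, v) < \<infinity>")
   case True
   have "J <= enn2real (kin_cost (\<eta>, v))" unfolding J_def kin[OF a] by (rule S.energy_ge[OF admD[OF a]]) (use True kin[OF a] in simp)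
   from ennreal_leI[OF this] show ?thesis unfolding Pair ennreal_enn2real[OF True[unfolded infinity_ennreal_def]] .
  next
   case False then show ?thesis by (simp add: Pair not_less top_unique)
  qed
 qed
 have kinS: "kin_cost ?e = (\<integral>\<^sup>+t\<in>{0..1}. (\<integral>\<^sup>+x. ennreal ((norm (?v t x))^2 / 2) \<partial>S.mu t) \<partial>lborel)"
  unfolding kin[OF eAdm] by (rule S.energy_cong) (rule dens)
 have kinJ: "kin_cost ?e = ennreal J"
  using lower[OF eAdm] fpS(2) unfolding kinS J_def by (rule antisym[rotated])
 have INFk: "(INF p\<in>?Adm. kin_cost p) = ennreal J"
  by (rule antisym) (use INF_lower[OF eAdm, of kin_cost] kinJ lower in \<open>auto intro: INF_greatest\<close>)
 define \<gamma> where "\<gamma> = density lborel (%(x, y). ennreal (f x * g y * hk eps x y))"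
 have \<gamma>c: "\<gamma> \<in> couplings \<mu>0 \<mu>1" using gamma_min(1) by (simp add: \<gamma>_def)
 have INF\<gamma>: "(INF \<gamma>\<in>couplings \<mu>0 \<mu>1. rel_entropy \<gamma> (ref_meas eps)) = rel_entropy \<gamma> (ref_meas eps)"
  by (rule antisym[OF INF_lower[OF \<gamma>c] INF_greatest]) (use gamma_min(2) in \<open>simp add: \<gamma>_def\<close>)
 have lnf: "integrable (S.mu 0) (%x. ln (f' x))" by (rule S.mu_integrable_quadratic[OF z01(1) _ S.f_ln]) measurable
 have lng: "integrable (S.mu 1) (%x. ln (g' x))" by (rule S.mu_integrable_quadratic[OF z01(2) _ S.g_ln]) measurable
 have iV: "integrable (S.mu 0) (%x. - V0 x)" by (rule S.mu_integrable_quadratic[OF z01(1), of _ B0]) (use V0(4) in auto)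
 have H0: "rel_entropy \<mu>0 lborel = ereal (LINT x|\<mu>0. - V0 x)"
  by (rule rel_entropy_density_eq[of lborel "%x. exp (- V0 x)"])
   (use iV m0 in \<open>auto simp: \<mu>0_def \<rho>0_def intro: lborel.sigma_finite_measure_axioms\<close>)
 have H\<gamma>: "rel_entropy \<gamma> (ref_meas eps) = ereal ((LINT x|(S.mu 0). ln (f' x)) + (LINT y|(S.mu 1). ln (g' y)))"
 proof -
  have fst_m[measurable]: "fst \<in> (borel :: ((real^'n) \<times> (real^'n)) measure) \<rightarrow>\<^sub>M borel" and snd_m[measurable]: "snd \<in> (borel :: ((real^'n) \<times> (real^'n)) measure) \<rightarrow>\<^sub>M borel"
   by (intro borel_contI continuous_intros)+
  have s\<gamma>[measurable_cong]: "sets \<gamma> = sets borel" by (simp add: \<gamma>_def)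
  have d0: "distr \<gamma> borel fst = S.mu 0" and d1: "distr \<gamma> borel snd = S.mu 1" using \<gamma>c by (simp_all add: couplings_def m0 m1)
  have fm: "fst \<in> \<gamma> \<rightarrow>\<^sub>M borel" "snd \<in> \<gamma> \<rightarrow>\<^sub>M borel" by measurable
  have km[measurable]: "borel_fun (%z :: (real^'n) \<times> (real^'n). ennreal (hk eps (fst z) (snd z)))" by measurable
  have rm: "ref_meas eps = density lborel (%z :: (real^'n) \<times> (real^'n). ennreal (hk eps (fst z) (snd z)))"
   by (simp add: ref_meas_def split_beta')
  have sf: "sigma_finite_measure (ref_meas eps :: ((real^'n) \<times> (real^'n)) measure)"
   unfolding rm by (subst sigma_finite_measure.sigma_finite_iff_density_finite[OF lborel.sigma_finite_measure_axioms]) auto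
  have Q: "\<gamma> = density (ref_meas eps) (%z. ennreal (f (fst z) * g (snd z)))"
   unfolding rm \<gamma>_def using f_nonneg g_nonneg
   by (subst density_density_eq) (auto simp: split_beta' ennreal_mult[symmetric] heat_kernel_nonneg mult.commute mult.left_commute mult.assoc)
  have a0: "AE x in S.mu 0. f x = f' x" and a1: "AE x in S.mu 1. g x = g' x"
   unfolding S.mu_def using S.rho_meas[OF z01(1)] S.rho_meas[OF z01(2)]
   by (simp_all add: AE_density eventually_mono[OF ff] eventually_mono[OF gg])
  have b0: "AE z in \<gamma>. f (fst z) = f' (fst z)" by (rule AE_distrD[OF fm(1)]) (unfold d0, rule a0)
  have b1: "AE z in \<gamma>. g (snd z) = g' (snd z)" by (rule AE_distrD[OF fm(2)]) (unfold d1, rule a1)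
  have i0: "integrable \<gamma> (%z. ln (f' (fst z)))" by (rule integrable_distr[OF fm(1)]) (unfold d0, rule lnf)
  have i1: "integrable \<gamma> (%z. ln (g' (snd z)))" by (rule integrable_distr[OF fm(2)]) (unfold d1, rule lng)
  have "rel_entropy \<gamma> (ref_meas eps) = ereal (LINT z|\<gamma>. ln (f' (fst z)) + ln (g' (snd z)))"
  proof (rule rel_entropy_density_eq[OF sf _ _ Q])
   show "(%z. f (fst z) * g (snd z)) \<in> borel_measurable (ref_meas eps)" unfolding rm by simp
   show "0 <= f (fst z) * g (snd z)" for z using f_nonneg g_nonneg by simp
   show "AE z in \<gamma>. ln (f (fst z) * g (snd z)) = ln (f' (fst z)) + ln (g' (snd z))"
    using b0 b1
   proof eventually_elim
    fix z assume "f (fst z) = f' (fst z)" "g (snd z) = g' (snd z)"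
    then show "ln (f (fst z) * g (snd z)) = ln (f' (fst z)) + ln (g' (snd z))"
     using S.f_pos[of "fst z"] S.g_pos[of "snd z"] by (simp add: ln_mult)
   qed
   show "integrable \<gamma> (%z. ln (f' (fst z)) + ln (g' (snd z)))" using i0 i1 by simp
  qed
  also have "(LINT z|\<gamma>. ln (f' (fst z)) + ln (g' (snd z))) = (LINT x|(distr \<gamma> borel fst). ln (f' x)) + (LINT y|(distr \<gamma> borel snd). ln (g' y))"
   using i0 i1 fm by (simp add: integral_distr)
  finally show ?thesis unfolding d0 d1 .
 qed
 \<comment> \<open>Substituting ln f' = - V0 - ln G_0 from the first equation turns the static cost
   into the entropy of the initial marginal plus the increment of \<open>ent\<close>, which is the
   dynamic value.\<close>
 have bal: "eps * ((LINT x|(S.mu 0). ln (f' x)) + (LINT y|(S.mu 1). ln (g' y))) = eps * (LINT x|\<mu>0. - V0 x) + J"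
 proof -
  have iG: "integrable (S.mu 0) (%x. ln (S.G 0 x))" by (rule S.psi_integrable(2)[OF z01(1)])
  have "ln (f' x) = - V0 x - ln (S.G 0 x)" for x
  proof -
   have "ln (f' x) + ln (S.G 0 x) = ln (f' x * S.G 0 x)" using S.f_pos[of x] S.G_pos[OF z01(1), of x] by (simp add: ln_mult)
   also have "... = - V0 x" using e0[of x] by (simp add: S.G_def)
   finally show ?thesis by linarith
  qed
  then have 1: "(LINT x|(S.mu 0). ln (f' x)) = (LINT x|(S.mu 0). - V0 x) - (LINT x|(S.mu 0). ln (S.G 0 x))"
   using Bochner_Integration.integral_diff[OF iV iG] by simp
  have 2: "J = eps * (LINT x|(S.mu 1). ln (g' x)) - eps * (LINT x|(S.mu 0). ln (S.G 0 x))"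
   unfolding J_def S.ent_def S.psi_def by (simp add: S.G_def)
  show ?thesis unfolding 1 2 m0[symmetric] by algebra
 qed
 have uniq: "(\<forall>t\<in>{0..1}. density lborel (%x. ennreal (\<eta> t x)) = density lborel (%x. ennreal (ent_density eps f g t x)))
   & (AE t in lborel. t \<in> {0..1} --> (AE x in density lborel (%x. ennreal (ent_density eps f g t x)). v t x = grad (ent_psi eps g t) x))"
  if a: "(\<eta>, v) \<in> ?Adm" and k: "kin_cost (\<eta>, v) = (INF p\<in>?Adm. kin_cost p)" for \<eta> v
 proof -
  note U = S.dynamic_minimizer_unique[OF admD[OF a] k[unfolded INFk kin[OF a] J_def] fpS(1) kinJ[unfolded kinS J_def]]
  show ?thesis
  proof
   show "\<forall>t\<in>{0..1}. density lborel (%x. ennreal (\<eta> t x)) = density lborel (%x. ennreal (ent_density eps f g t x))"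
    using U(1) dens by simp
   show "AE t in lborel. t \<in> {0..1} --> (AE x in density lborel (%x. ennreal (ent_density eps f g t x)). v t x = grad (ent_psi eps g t) x)"
    using U(2)
   proof (rule eventually_mono, intro impI)
    fix t :: real assume h: "t \<in> {0..1} --> (AE x in S.mu t. v t x = grad (ent_psi eps g t) x)" and t: "t \<in> {0..1}"
    show "AE x in density lborel (%x. ennreal (ent_density eps f g t x)). v t x = grad (ent_psi eps g t) x"
     unfolding dens[OF t] by (rule mp[OF h t])
   qed
  qed
 qed
 have "ereal eps * rel_entropy \<gamma> (ref_meas eps) = ereal eps * rel_entropy \<mu>0 lborel + enn2ereal (ennreal J)"
  unfolding H\<gamma> H0 using bal J0 by (simp add: enn2ereal_ennreal)
 then show ?thesis unfolding INF\<gamma> INFk using \<gamma>c eAdm kinJ uniq[unfolded INFk] by blast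
qed

end
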